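(* Let $p$ be a prime, $n\ge1$, and let $f(x)=\sum_\alpha f_\alpha x^\alpha$ be a nonzero power series in $x=(x_1,\dots,x_n)$ with integer coefficients that converges on a neighborhood of the origin when viewed as a power series on $\mathbb{Q}_p^n$, with $f(0)=0$. For $a=(a_1,\dots,a_n)$ with each $a_i$ an integer, let $f_a(x_1,\dots,x_n)=f(p^{a_1}x_1,\dots,p^{a_n}x_n)$. With $N(f)$, $d(f)$, the central face of $N(f)$, $f_F$ and $o(F)$ as defined in the context (for the field $K=\mathbb{Q}_p$), let $h$ be the dimension of the central face of $N(f)$. There exists a constant $M>0$ depending on $f$ such that if $a_i>M$ for all $i$, then there are constants $C,C'>0$ depending on $a$, $f$ and $p$ such that the following hold for every positive integer $l$. (a) If $o(F)\le d(f)$ for all compact faces $F$ of $N(f)$, with $o(F)<d(f)$ whenever $F$ is a subset of the central face of $N(f)$, then $$C\,l^{n-h-1}p^{-\frac{l}{d(f)}}\le \frac{1}{p^{ln}}\,\#\{x\in\{0,\dots,p^l-1\}^n: p^l \text{ divides } f_a(x)\}\le C'\,l^{n-h-1}p^{-\frac{l}{d(f)}}.$$ (b) If $o(F)\le d(f)$ for all compact faces $F$ of $N(f)$, with $o(F)=d(f)$ for at least one compact face $F$ contained in the central face of $N(f)$, then $$C\,l^{n-h-1}p^{-\frac{l}{d(f)}}\le \frac{1}{p^{ln}}\,\#\{x\in\{0,\dots,p^l-1\}^n: p^l \text{ divides } f_a(x)\}\le C'\,l^{n-h}p^{-\frac{l}{d(f)}}.$$ (c) If $o(F)>d(f)$ for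 at least one compact face $F$ of $N(f)$, let $s(f)=\sup_F o(F)$ over all compact faces $F$ of $N(f)$. Then $$C\,l^{n-h-1}p^{-\frac{l}{d(f)}}\le \frac{1}{p^{ln}}\,\#\{x\in\{0,\dots,p^l-1\}^n: p^l \text{ divides } f_a(x)\}\le C'\,p^{-\frac{l}{s(f)}}.$$
   Context: Newton polyhedron: for each multi-index $\alpha$ with $f_\alpha\neq 0$ let $Q_\alpha=\{t\in\mathbb{R}^n: t_i\ge\alpha_i \text{ for all } i\}$. The Newton polyhedron $N(f)$ is the convex hull of the union of all these $Q_\alpha$. Its faces have various dimensions and may be compact or unbounded; a vertex is considered a compact face of dimension $0$. For a compact face $F$ of $N(f)$, $f_F(x)=\sum_{\alpha\in F} f_\alpha x^\alpha$ (a polynomial). $o(F)$ denotes the maximum order of any zero of $f_F$ in $(\mathbb{Q}_p\setminus\{0\})^n$ (the order of a zero is the smallest order of a partial derivative of $f_F$ that does not vanish at that point; $o(F)=0$ if $f_F$ has no zero there). Newton distance: $d(f)=\inf\{t: (t,t,\dots,t)\in N(f)\}$. Central face: the face of $N(f)$ of minimal dimension intersecting the line $t_1=t_2=\dots=t_n$ (it is the intersection of all faces of $N(f)$ meeting this line). For integer $x$, the value $f_a(x)$ is the sum of the series in $\mathbb{Q}_p$, which is an element of $\mathbb{Z}_p$; "$p^l$ divides $f_a(x)$" means $f_a(x)\in p^l\mathbb{Z}_p$ (ordinary divisibility when $f$ is a polynomial). *)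

theory Defs
  imports "HOL-Analysis.Analysis" "HOL-Computational_Algebra.Primes"
    "Berlekamp_Zassenhaus.Finite_Field"
begin

definition padic_abs :: "nat \<Rightarrow> rat \<Rightarrow> real" where
  "padic_abs p x = (if x = 0 then 0 else
     (case quotient_of x of (a, b) \<Rightarrow>
        real p powi (int (multiplicity (int p) b) - int (multiplicity (int p) a))))"

lemma padic_abs_0 [simp]: "padic_abs p 0 = 0"
  by (simp add: padic_abs_def)

lemma padic_abs_of_int_div:
  assumes "prime p" "a \<noteq> 0" "b \<noteq> 0"
  shows "padic_abs p (of_int a / of_int b) =
    real p powi (int (multiplicity (int p) b) - int (multiplicity (int p) a))"
proof -
  obtain c d where cd: "quotient_of (of_int a / of_int b :: rat) = (c, d)"
    by (cases "quotient_of (of_int a / of_int b :: rat)")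
  have d: "d > 0" using quotient_of_denom_pos[OF cd] .
  have eq: "(of_int a / of_int b :: rat) = of_int c / of_int d"
    using quotient_of_div[OF cd] .
  have "(of_int a * of_int d :: rat) = of_int c * of_int b"
    using eq assms d by (simp add: field_simps)
  then have ad: "a * d = c * b" by (metis of_int_eq_iff of_int_mult)
  then have c: "c \<noteq> 0" using assms d by auto
  have pe: "prime_elem (int p)" using assms by (simp add: prime_imp_prime_elem)
  have "multiplicity (int p) (a * d) = multiplicity (int p) (c * b)" using ad by simp
  then have "multiplicity (int p) a + multiplicity (int p) d =
      multiplicity (int p) c + multiplicity (int p) b"
    using assms c d by (simp add: prime_elem_multiplicity_mult_distrib[OF pe])
  then have "int (multiplicity (int p) d) - int (multiplicity (int p) c) =
      int (multiplicity (int p) b) - int (multiplicity (int p) a)" by linarith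
  then show ?thesis using cd assms by (simp add: padic_abs_def)
qed

lemma rat_cases_frac:
  obtains a b :: int where "b \<noteq> 0" "(x :: rat) = of_int a / of_int b"
proof (cases x)
  case (Fract a b)
  then show ?thesis using that[of b a] by (simp add: Fract_of_int_quotient)
qed

lemma padic_abs_eq_0_iff [simp]: "prime p \<Longrightarrow> padic_abs p x = 0 \<longleftrightarrow> x = 0"
  by (auto simp: padic_abs_def prime_gt_0_nat split: prod.splits)

lemma padic_abs_nonneg [simp]: "padic_abs p x \<ge> 0"
  by (auto simp: padic_abs_def split: prod.splits)

lemma padic_abs_1 [simp]: "padic_abs p 1 = 1"
  by (simp add: padic_abs_def)

lemma padic_abs_minus [simp]: "padic_abs p (- x) = padic_abs p x"
proof -
  have "multiplicity (int p) (- a) = multiplicity (int p) a" for a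
    by (rule multiplicity_cong) simp
  then show ?thesis by (cases "quotient_of x") (auto simp: padic_abs_def rat_uminus_code)
qed

lemma padic_abs_mult:
  assumes "prime p"
  shows "padic_abs p (x * y) = padic_abs p x * padic_abs p y"
proof (cases "x = 0 \<or> y = 0")
  case False
  obtain a b where x: "b \<noteq> 0" "x = of_int a / of_int b" by (rule rat_cases_frac)
  obtain c d where y: "d \<noteq> 0" "y = of_int c / of_int d" by (rule rat_cases_frac)
  have nz: "a \<noteq> 0" "c \<noteq> 0" using False x y by auto
  have pe: "prime_elem (int p)" using assms by (simp add: prime_imp_prime_elem)
  have xy: "x * y = of_int (a * c) / of_int (b * d)" using x y by simp
  show ?thesis
    unfolding xy unfolding x y using assms x y nz prime_gt_0_nat[OF assms]
    by (simp add: padic_abs_of_int_div prime_elem_multiplicity_mult_distrib[OF pe]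
        add_diff_add flip: of_int_mult power_int_add)
qed auto

lemma padic_abs_add_le_max:
  assumes "prime p"
  shows "padic_abs p (x + y) \<le> max (padic_abs p x) (padic_abs p y)"
proof (cases "x = 0 \<or> y = 0 \<or> x + y = 0")
  case False
  obtain a b where x: "b \<noteq> 0" "x = of_int a / of_int b" by (rule rat_cases_frac)
  obtain c d where y: "d \<noteq> 0" "y = of_int c / of_int d" by (rule rat_cases_frac)
  let ?m = "multiplicity (int p)"
  have x': "x = of_int (a * d) / of_int (b * d)" and y': "y = of_int (c * b) / of_int (b * d)"
    using x y by simp_all
  have xy': "x + y = of_int (a * d + c * b) / of_int (b * d)"
    unfolding x' y' by (simp add: add_divide_distrib)
  have bd: "b * d \<noteq> 0" using x y by simp
  have nz: "a * d \<noteq> 0" "c * b \<noteq> 0" "a * d + c * b \<noteq> 0"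
    using False x y xy' by (auto simp del: of_int_add of_int_mult)
  have p1: "real p \<ge> 1" using prime_gt_1_nat[OF assms] by simp
  have nu: "\<not> is_unit (int p)" using prime_gt_1_nat[OF assms] by simp
  have "min (?m (a * d)) (?m (c * b)) \<le> ?m (a * d + c * b)"
    by (rule multiplicity_geI[OF nz(3) nu])
      (meson dvd_add multiplicity_dvd' min.cobounded1 min.cobounded2)
  then consider "?m (a * d) \<le> ?m (a * d + c * b)" | "?m (c * b) \<le> ?m (a * d + c * b)"
    by linarith
  then show ?thesis
  proof cases
    case 1
    then have "padic_abs p (x + y) \<le> padic_abs p x"
      unfolding xy' unfolding x' padic_abs_of_int_div[OF assms nz(3) bd]
        padic_abs_of_int_div[OF assms nz(1) bd]
      by (intro power_int_increasing) (use p1 in auto)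
    then show ?thesis by simp
  next
    case 2
    then have "padic_abs p (x + y) \<le> padic_abs p y"
      unfolding xy' unfolding y' padic_abs_of_int_div[OF assms nz(3) bd]
        padic_abs_of_int_div[OF assms nz(2) bd]
      by (intro power_int_increasing) (use p1 in auto)
    then show ?thesis by simp
  qed
qed (auto simp: max_def)

lemma padic_abs_add_le:
  assumes "prime p"
  shows "padic_abs p (x + y) \<le> padic_abs p x + padic_abs p y"
  using padic_abs_add_le_max[OF assms, of x y] by (auto simp: max_def split: if_splits
      intro: order_trans)

lemma padic_abs_minus_commute: "padic_abs p (x - y) = padic_abs p (y - x)"
  using padic_abs_minus[of p "x - y"] by simp

lemma padic_abs_diff_triangle:
  "prime p \<Longrightarrow> padic_abs p (x - z) \<le> padic_abs p (x - y) + padic_abs p (y - z)"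
  using padic_abs_add_le[of p "x - y" "y - z"] by simp

lemma padic_abs_abs_diff_le:
  assumes "prime p"
  shows "\<bar>padic_abs p x - padic_abs p y\<bar> \<le> padic_abs p (x - y)"
  using padic_abs_add_le[OF assms, of "x - y" y] padic_abs_add_le[OF assms, of "y - x" x]
  by (simp add: padic_abs_minus_commute[of p y x])

lemma padic_abs_inverse:
  assumes "prime p"
  shows "padic_abs p (inverse x) = inverse (padic_abs p x)"
proof (cases "x = 0")
  case False
  then have "padic_abs p x * padic_abs p (inverse x) = 1"
    using padic_abs_mult[OF assms, of x "inverse x"] by simp
  then show ?thesis by (metis inverse_unique)
qed auto

definition padic_cauchy :: "nat \<Rightarrow> (nat \<Rightarrow> rat) \<Rightarrow> bool" where
  "padic_cauchy p X \<longleftrightarrow> (\<forall>e>0. \<exists>k. \<forall>m\<ge>k. \<forall>n\<ge>k. padic_abs p (X m - X n) < e)"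

definition padic_null :: "nat \<Rightarrow> (nat \<Rightarrow> rat) \<Rightarrow> bool" where
  "padic_null p X \<longleftrightarrow> (\<lambda>n. padic_abs p (X n)) \<longlonglongrightarrow> 0"

definition padic_rel :: "nat \<Rightarrow> (nat \<Rightarrow> rat) \<Rightarrow> (nat \<Rightarrow> rat) \<Rightarrow> bool" where
  "padic_rel p X Y \<longleftrightarrow> padic_cauchy p X \<and> padic_cauchy p Y \<and> padic_null p (\<lambda>n. X n - Y n)"

lemma padic_cauchyD:
  "padic_cauchy p X \<Longrightarrow> e > 0 \<Longrightarrow> \<exists>k. \<forall>m\<ge>k. \<forall>n\<ge>k. padic_abs p (X m - X n) < e"
  by (simp add: padic_cauchy_def)

lemma padic_cauchy_const [simp]: "padic_cauchy p (\<lambda>n. c)"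
  by (simp add: padic_cauchy_def)

lemma padic_null_0 [simp]: "padic_null p (\<lambda>n. 0)"
  by (simp add: padic_null_def)

lemma padic_null_bound:
  assumes "padic_null p Y" "\<And>n. padic_abs p (X n) \<le> B * padic_abs p (Y n)"
  shows "padic_null p X"
proof -
  have "(\<lambda>n. B * padic_abs p (Y n)) \<longlonglongrightarrow> B * 0"
    using assms(1) unfolding padic_null_def by (intro tendsto_intros)
  then have "(\<lambda>n. B * padic_abs p (Y n)) \<longlonglongrightarrow> 0" by simp
  from tendsto_sandwich[OF _ _ tendsto_const this, of "\<lambda>n. padic_abs p (X n)"]
  show ?thesis using assms(2) by (simp add: padic_null_def)
qed

lemma padic_null_minus: "padic_null p X \<Longrightarrow> padic_null p (\<lambda>n. - X n)"
  by (simp add: padic_null_def)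

lemma padic_null_add:
  assumes "prime p" "padic_null p X" "padic_null p Y"
  shows "padic_null p (\<lambda>n. X n + Y n)"
proof -
  have "(\<lambda>n. padic_abs p (X n) + padic_abs p (Y n)) \<longlonglongrightarrow> 0 + 0"
    using assms(2,3) unfolding padic_null_def by (intro tendsto_intros)
  then have "(\<lambda>n. padic_abs p (X n) + padic_abs p (Y n)) \<longlonglongrightarrow> 0" by simp
  from tendsto_sandwich[OF _ _ tendsto_const this, of "\<lambda>n. padic_abs p (X n + Y n)"]
  show ?thesis using padic_abs_add_le[OF assms(1)] by (simp add: padic_null_def)
qed

lemma padic_cauchy_add:
  assumes "prime p" "padic_cauchy p X" "padic_cauchy p Y"
  shows "padic_cauchy p (\<lambda>n. X n + Y n)"
  unfolding padic_cauchy_def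
proof (intro allI impI)
  fix e :: real assume e: "e > 0"
  obtain k where k: "\<forall>m\<ge>k. \<forall>n\<ge>k. padic_abs p (X m - X n) < e / 2"
    using padic_cauchyD[OF assms(2), of "e / 2"] e by auto
  obtain l where l: "\<forall>m\<ge>l. \<forall>n\<ge>l. padic_abs p (Y m - Y n) < e / 2"
    using padic_cauchyD[OF assms(3), of "e / 2"] e by auto
  have "padic_abs p (X m + Y m - (X n + Y n)) < e" if "m \<ge> max k l" "n \<ge> max k l" for m n
  proof -
    have "padic_abs p (X m - X n) < e / 2" "padic_abs p (Y m - Y n) < e / 2"
      using k l that by auto
    then show ?thesis
      using padic_abs_add_le[OF assms(1), of "X m - X n" "Y m - Y n"]
      by (simp add: algebra_simps)
  qed
  then show "\<exists>k. \<forall>m\<ge>k. \<forall>n\<ge>k. padic_abs p (X m + Y m - (X n + Y n)) < e" by blast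
qed

lemma padic_cauchy_minus:
  assumes "padic_cauchy p X" shows "padic_cauchy p (\<lambda>n. - X n)"
proof -
  have "padic_abs p (- X m - - X n) = padic_abs p (X m - X n)" for m n
    using padic_abs_minus[of p "X m - X n"] by simp
  then show ?thesis using assms unfolding padic_cauchy_def by simp
qed

lemma padic_cauchy_tendsto:
  assumes "prime p" "padic_cauchy p X"
  shows "(\<lambda>n. padic_abs p (X n)) \<longlonglongrightarrow> lim (\<lambda>n. padic_abs p (X n))"
proof -
  have "Cauchy (\<lambda>n. padic_abs p (X n))"
  proof (rule metric_CauchyI)
    fix e :: real assume "e > 0"
    then obtain k where "\<forall>m\<ge>k. \<forall>n\<ge>k. padic_abs p (X m - X n) < e"
      using padic_cauchyD[OF assms(2)] by blast
    then show "\<exists>M. \<forall>m\<ge>M. \<forall>n\<ge>M. dist (padic_abs p (X m)) (padic_abs p (X n)) < e"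
      using padic_abs_abs_diff_le[OF assms(1)] order_le_less_trans unfolding dist_real_def by blast
  qed
  then show ?thesis by (simp add: Cauchy_convergent_iff convergent_LIMSEQ_iff)
qed

lemma padic_cauchy_bounded:
  assumes "prime p" "padic_cauchy p X"
  obtains B where "B > 0" "\<And>n. padic_abs p (X n) \<le> B"
proof -
  have "Bseq (\<lambda>n. padic_abs p (X n))"
    using padic_cauchy_tendsto[OF assms] convergentI convergent_imp_Bseq by blast
  then show ?thesis using that unfolding Bseq_def by auto
qed

lemma padic_cauchy_mult:
  assumes "prime p" "padic_cauchy p X" "padic_cauchy p Y"
  shows "padic_cauchy p (\<lambda>n. X n * Y n)"
  unfolding padic_cauchy_def
proof (intro allI impI)
  fix e :: real assume e: "e > 0"
  obtain A where A: "A > 0" "\<And>n. padic_abs p (X n) \<le> A"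
    by (rule padic_cauchy_bounded[OF assms(1,2)]) blast
  obtain B where B: "B > 0" "\<And>n. padic_abs p (Y n) \<le> B"
    by (rule padic_cauchy_bounded[OF assms(1,3)]) blast
  obtain k where k: "\<forall>m\<ge>k. \<forall>n\<ge>k. padic_abs p (X m - X n) < e / (2 * B)"
    using padic_cauchyD[OF assms(2), of "e / (2 * B)"] e B by auto
  obtain l where l: "\<forall>m\<ge>l. \<forall>n\<ge>l. padic_abs p (Y m - Y n) < e / (2 * A)"
    using padic_cauchyD[OF assms(3), of "e / (2 * A)"] e A by auto
  have "padic_abs p (X m * Y m - X n * Y n) < e" if "m \<ge> max k l" "n \<ge> max k l" for m n
  proof -
    have 1: "padic_abs p (X m - X n) < e / (2 * B)" "padic_abs p (Y m - Y n) < e / (2 * A)"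
      using k l that by auto
    have "X m * Y m - X n * Y n = X m * (Y m - Y n) + (X m - X n) * Y n"
      by (simp add: algebra_simps)
    then have "padic_abs p (X m * Y m - X n * Y n) \<le>
        padic_abs p (X m) * padic_abs p (Y m - Y n) + padic_abs p (X m - X n) * padic_abs p (Y n)"
      using padic_abs_add_le[OF assms(1)] by (simp flip: padic_abs_mult[OF assms(1)])
    also have "\<dots> \<le> A * padic_abs p (Y m - Y n) + padic_abs p (X m - X n) * B"
      using A B by (intro add_mono mult_mono) auto
    also have "\<dots> < A * (e / (2 * A)) + e / (2 * B) * B"
      using 1 A B by (intro add_strict_mono mult_strict_left_mono mult_strict_right_mono) auto
    also have "\<dots> = e" using A B by simp
    finally show ?thesis .
  qed
  then show "\<exists>k. \<forall>m\<ge>k. \<forall>n\<ge>k. padic_abs p (X m * Y m - X n * Y n) < e" by blast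
qed

lemma padic_cauchy_away:
  assumes "prime p" "padic_cauchy p X" "\<not> padic_null p X"
  obtains L k where "L > 0" "\<And>n. n \<ge> k \<Longrightarrow> padic_abs p (X n) > L"
proof -
  let ?L = "lim (\<lambda>n. padic_abs p (X n))"
  note lim = padic_cauchy_tendsto[OF assms(1,2)]
  have "?L \<ge> 0" by (rule LIMSEQ_le_const[OF lim]) auto
  moreover have "?L \<noteq> 0" using lim assms(3) by (auto simp: padic_null_def)
  ultimately have "?L > 0" by simp
  then have "eventually (\<lambda>n. padic_abs p (X n) > ?L / 2) sequentially"
    by (intro order_tendstoD(1)[OF lim]) auto
  then show ?thesis using that[of "?L / 2"] \<open>?L > 0\<close> by (auto simp: eventually_sequentially)
qed

lemma padic_cauchy_inverse:
  assumes "prime p" "padic_cauchy p X" "\<not> padic_null p X"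
  shows "padic_cauchy p (\<lambda>n. inverse (X n))"
  unfolding padic_cauchy_def
proof (intro allI impI)
  fix e :: real assume e: "e > 0"
  obtain L k where L: "L > 0" "\<And>n. n \<ge> k \<Longrightarrow> padic_abs p (X n) > L"
    by (rule padic_cauchy_away[OF assms]) blast
  obtain l where l: "\<forall>m\<ge>l. \<forall>n\<ge>l. padic_abs p (X m - X n) < e * L\<^sup>2"
    using padic_cauchyD[OF assms(2), of "e * L\<^sup>2"] e L by auto
  have "padic_abs p (inverse (X m) - inverse (X n)) < e" if "m \<ge> max k l" "n \<ge> max k l" for m n
  proof -
    have mn: "padic_abs p (X m) > L" "padic_abs p (X n) > L" using L that by auto
    then have nz: "X m \<noteq> 0" "X n \<noteq> 0" using L by auto
    have "inverse (X m) - inverse (X n) = (X n - X m) * (inverse (X m) * inverse (X n))"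
      using nz by (simp add: field_simps)
    then have "padic_abs p (inverse (X m) - inverse (X n)) =
        padic_abs p (X n - X m) / (padic_abs p (X m) * padic_abs p (X n))"
      using assms(1) by (simp add: padic_abs_mult padic_abs_inverse divide_inverse)
    also have "\<dots> \<le> padic_abs p (X n - X m) / (L * L)"
      using mn L by (intro divide_left_mono mult_mono mult_pos_pos) auto
    also have "\<dots> < e" using l that L by (simp add: field_simps power2_eq_square)
    finally show ?thesis .
  qed
  then show "\<exists>k. \<forall>m\<ge>k. \<forall>n\<ge>k. padic_abs p (inverse (X m) - inverse (X n)) < e" by blast
qed

lemma padic_rel_cong:
  assumes "prime p" "padic_rel p X Y"
  shows "padic_rel p X = padic_rel p Y"
proof
  fix Z
  have 1: "padic_cauchy p X" "padic_cauchy p Y" "padic_null p (\<lambda>n. X n - Y n)"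
    using assms(2) by (simp_all add: padic_rel_def)
  have 2: "padic_null p (\<lambda>n. Y n - X n)" using padic_null_minus[OF 1(3)] by simp
  have "padic_null p (\<lambda>n. X n - Z n) \<longleftrightarrow> padic_null p (\<lambda>n. Y n - Z n)"
    using padic_null_add[OF assms(1) 2, of "\<lambda>n. X n - Z n"]
      padic_null_add[OF assms(1) 1(3), of "\<lambda>n. Y n - Z n"] by fastforce
  then show "padic_rel p X Z = padic_rel p Y Z" using 1 by (simp add: padic_rel_def)
qed

text \<open>
  The field of p-adic numbers is the completion of the rationals with respect to
  \<^const>\<open>padic_abs\<close>: classes of Cauchy sequences modulo null sequences. The prime is carried by
  the type, as the cardinality of \<open>'p\<close>.
\<close>

typedef (overloaded) 'p padic =
  "{C. \<exists>X. padic_cauchy CARD('p::prime_card) X \<and> C = {Y. padic_rel CARD('p) X Y}}"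
  by (rule exI[of _ "{Y. padic_rel CARD('p) (\<lambda>_. 0) Y}"]) (auto intro: exI[of _ "\<lambda>_. 0"])

definition padic_of_seq :: "(nat \<Rightarrow> rat) \<Rightarrow> 'p::prime_card padic" where
  "padic_of_seq X = Abs_padic {Y. padic_rel CARD('p) X Y}"

definition seq_of_padic :: "'p::prime_card padic \<Rightarrow> nat \<Rightarrow> rat" where
  "seq_of_padic x = (SOME X. X \<in> Rep_padic x)"

lemma seq_of_padic_props:
  fixes x :: "'p::prime_card padic"
  shows "padic_cauchy CARD('p) (seq_of_padic x)" "padic_of_seq (seq_of_padic x) = x"
proof -
  obtain X where X: "padic_cauchy CARD('p) X" "Rep_padic x = {Y. padic_rel CARD('p) X Y}"
    using Rep_padic[of x] by auto
  have "X \<in> Rep_padic x" using X by (simp add: padic_rel_def)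
  then have "seq_of_padic x \<in> Rep_padic x" unfolding seq_of_padic_def by (rule someI[of "\<lambda>X. X \<in> Rep_padic x"])
  then have r: "padic_rel CARD('p) X (seq_of_padic x)" using X by simp
  then show "padic_cauchy CARD('p) (seq_of_padic x)" by (simp add: padic_rel_def)
  show "padic_of_seq (seq_of_padic x) = x"
    unfolding padic_of_seq_def padic_rel_cong[OF prime_card r, symmetric] X(2)[symmetric]
    by (rule Rep_padic_inverse)
qed

lemma padic_of_seq_eq_iff:
  assumes "padic_cauchy CARD('p) X" "padic_cauchy CARD('p) Y"
  shows "(padic_of_seq X :: 'p::prime_card padic) = padic_of_seq Y
    \<longleftrightarrow> padic_null CARD('p) (\<lambda>n. X n - Y n)"
proof -
  have "(padic_of_seq X :: 'p padic) = padic_of_seq Y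
    \<longleftrightarrow> {Z. padic_rel CARD('p) X Z} = {Z. padic_rel CARD('p) Y Z}"
    unfolding padic_of_seq_def using assms by (intro Abs_padic_inject) auto
  also have "\<dots> \<longleftrightarrow> padic_rel CARD('p) X Y"
  proof
    have "Y \<in> {Z. padic_rel CARD('p) Y Z}" using assms by (simp add: padic_rel_def)
    moreover assume "{Z. padic_rel CARD('p) X Z} = {Z. padic_rel CARD('p) Y Z}"
    ultimately show "padic_rel CARD('p) X Y" by blast
  next
    assume "padic_rel CARD('p) X Y"
    from padic_rel_cong[OF prime_card this]
    show "{Z. padic_rel CARD('p) X Z} = {Z. padic_rel CARD('p) Y Z}" by (rule arg_cong)
  qed
  finally show ?thesis using assms by (simp add: padic_rel_def)
qed

lemma padic_cases [cases type: padic]: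
  obtains X where "padic_cauchy CARD('p) X" "(x :: 'p::prime_card padic) = padic_of_seq X"
  using seq_of_padic_props by metis

lemma seq_of_padic_of_seq:
  assumes "padic_cauchy CARD('p) X"
  shows "padic_null CARD('p) (\<lambda>n. seq_of_padic (padic_of_seq X :: 'p::prime_card padic) n - X n)"
  using padic_of_seq_eq_iff[OF seq_of_padic_props(1) assms] seq_of_padic_props(2) by metis

instantiation padic :: (prime_card) field
begin

definition "0 = padic_of_seq (\<lambda>_. 0)"
definition "1 = padic_of_seq (\<lambda>_. 1)"
definition "x + y = padic_of_seq (\<lambda>n. seq_of_padic x n + seq_of_padic y n)"
definition "- x = padic_of_seq (\<lambda>n. - seq_of_padic x n)"
definition "x - y = (x + - y :: 'a padic)"
definition "x * y = padic_of_seq (\<lambda>n. seq_of_padic x n * seq_of_padic y n)"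
definition "inverse x = (if x = 0 then 0 else padic_of_seq (\<lambda>n. inverse (seq_of_padic x n)))"
definition "x div y = (x * inverse y :: 'a padic)"

lemma padic_of_seq_add:
  assumes "padic_cauchy CARD('a) X" "padic_cauchy CARD('a) Y"
  shows "padic_of_seq X + padic_of_seq Y = (padic_of_seq (\<lambda>n. X n + Y n) :: 'a padic)"
  unfolding plus_padic_def using assms
  by (subst padic_of_seq_eq_iff)
    (auto intro!: padic_cauchy_add prime_card seq_of_padic_props
      simp: add_diff_add intro: padic_null_add seq_of_padic_of_seq)

lemma padic_of_seq_minus:
  assumes "padic_cauchy CARD('a) X"
  shows "- padic_of_seq X = (padic_of_seq (\<lambda>n. - X n) :: 'a padic)"
  unfolding uminus_padic_def using assms
    padic_null_minus[OF seq_of_padic_of_seq[OF assms]]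
  by (subst padic_of_seq_eq_iff) (auto intro!: padic_cauchy_minus seq_of_padic_props)

lemma padic_null_mult:
  assumes "padic_null CARD('a) X" "padic_cauchy CARD('a) Y"
  shows "padic_null CARD('a) (\<lambda>n. X n * Y n)"
proof -
  obtain B where "B > 0" "\<And>n. padic_abs CARD('a) (Y n) \<le> B"
    by (rule padic_cauchy_bounded[OF prime_card assms(2)]) blast
  then show ?thesis
    by (intro padic_null_bound[OF assms(1), of _ B])
      (simp add: padic_abs_mult[OF prime_card] mult.commute[of B] mult_left_mono)
qed

lemma padic_of_seq_mult:
  assumes "padic_cauchy CARD('a) X" "padic_cauchy CARD('a) Y"
  shows "padic_of_seq X * padic_of_seq Y = (padic_of_seq (\<lambda>n. X n * Y n) :: 'a padic)"
proof -
  let ?X = "seq_of_padic (padic_of_seq X :: 'a padic)"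
  let ?Y = "seq_of_padic (padic_of_seq Y :: 'a padic)"
  have "padic_null CARD('a) (\<lambda>n. (?X n - X n) * ?Y n + (?Y n - Y n) * X n)"
    by (intro padic_null_add padic_null_mult seq_of_padic_of_seq assms prime_card seq_of_padic_props)
  then have "padic_null CARD('a) (\<lambda>n. ?X n * ?Y n - X n * Y n)"
    by (simp add: algebra_simps)
  then show ?thesis
    unfolding times_padic_def using assms
    by (subst padic_of_seq_eq_iff) (auto intro!: padic_cauchy_mult prime_card seq_of_padic_props)
qed

lemma padic_of_seq_eq_0_iff:
  "padic_cauchy CARD('a) X \<Longrightarrow> (padic_of_seq X :: 'a padic) = 0 \<longleftrightarrow> padic_null CARD('a) X"
  unfolding zero_padic_def by (simp add: padic_of_seq_eq_iff)

lemma padic_inverse_left: "x \<noteq> 0 \<Longrightarrow> inverse x * x = (1 :: 'a padic)"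
proof -
  assume x: "x \<noteq> 0"
  let ?X = "seq_of_padic x"
  have X: "padic_cauchy CARD('a) ?X" "\<not> padic_null CARD('a) ?X"
    using x padic_of_seq_eq_0_iff[of ?X] by (auto simp: seq_of_padic_props)
  have iX: "padic_cauchy CARD('a) (\<lambda>n. inverse (?X n))"
    by (rule padic_cauchy_inverse[OF prime_card X])
  obtain L k where L: "L > 0" "\<And>n. n \<ge> k \<Longrightarrow> padic_abs CARD('a) (?X n) > L"
    by (rule padic_cauchy_away[OF prime_card X]) blast
  have "inverse x * x = padic_of_seq (\<lambda>n. inverse (?X n)) * padic_of_seq ?X"
    using x by (simp add: inverse_padic_def seq_of_padic_props)
  also have "\<dots> = padic_of_seq (\<lambda>n. inverse (?X n) * ?X n)"
    by (rule padic_of_seq_mult[OF iX X(1)])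
  also have "\<dots> = 1"
  proof -
    have "?X n \<noteq> 0" if "n \<ge> k" for n using L(1) L(2)[OF that] by auto
    then have "padic_abs CARD('a) (inverse (?X n) * ?X n - 1) = 0" if "n \<ge> k" for n
      using that by simp
    then have "eventually (\<lambda>n. padic_abs CARD('a) (inverse (?X n) * ?X n - 1) = 0) sequentially"
      unfolding eventually_sequentially by blast
    then have "padic_null CARD('a) (\<lambda>n. inverse (?X n) * ?X n - 1)"
      unfolding padic_null_def by (rule tendsto_eventually)
    then show ?thesis unfolding one_padic_def
      by (subst padic_of_seq_eq_iff)
        (auto intro!: padic_cauchy_mult iX X prime_card)
  qed
  finally show ?thesis .
qed

instance
proof
  fix x y z :: "'a padic"
  note [simp] = padic_of_seq_add padic_of_seq_mult padic_of_seq_minus zero_padic_def one_padic_def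
    padic_cauchy_add[OF prime_card] padic_cauchy_mult[OF prime_card] padic_cauchy_minus
    algebra_simps
  show "x + y + z = x + (y + z)" by (cases x; cases y; cases z) simp
  show "x + y = y + x" by (cases x; cases y) simp
  show "0 + x = x" by (cases x) simp
  show "- x + x = 0" by (cases x) simp
  show "x * y * z = x * (y * z)" by (cases x; cases y; cases z) simp
  show "x * y = y * x" by (cases x; cases y) simp
  show "1 * x = x" by (cases x) simp
  show "(x + y) * z = x * z + y * z" by (cases x; cases y; cases z) simp
  show "x - y = x + - y" by (simp only: minus_padic_def)
  show "x div y = x * inverse y" by (simp only: divide_padic_def)
  show "inverse (0 :: 'a padic) = 0" by (simp only: inverse_padic_def refl if_True)
  show "x \<noteq> 0 \<Longrightarrow> inverse x * x = 1" by (rule padic_inverse_left)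
  show "(0 :: 'a padic) \<noteq> 1"
    using padic_of_seq_eq_0_iff[of "\<lambda>_. 1 :: rat"]
    by (simp add: padic_null_def LIMSEQ_const_iff)
qed

end

text \<open>
  A separate constant, because \<^const>\<open>norm\<close> is reserved for real normed vector spaces.
\<close>

definition padic_norm :: "'p::prime_card padic \<Rightarrow> real" where
  "padic_norm x = lim (\<lambda>n. padic_abs CARD('p) (seq_of_padic x n))"

lemma padic_norm_lim:
  assumes "padic_cauchy CARD('p) X"
  shows "(\<lambda>n. padic_abs CARD('p) (X n)) \<longlonglongrightarrow> padic_norm (padic_of_seq X :: 'p::prime_card padic)"
proof -
  let ?Y = "seq_of_padic (padic_of_seq X :: 'p padic)"
  have 1: "(\<lambda>n. padic_abs CARD('p) (?Y n)) \<longlonglongrightarrow> padic_norm (padic_of_seq X :: 'p padic)"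
    unfolding padic_norm_def by (rule padic_cauchy_tendsto[OF prime_card seq_of_padic_props(1)])
  have "(\<lambda>n. padic_abs CARD('p) (X n) - padic_abs CARD('p) (?Y n)) \<longlonglongrightarrow> 0"
  proof (rule Lim_null_comparison)
    show "eventually (\<lambda>n. norm (padic_abs CARD('p) (X n) - padic_abs CARD('p) (?Y n))
        \<le> padic_abs CARD('p) (?Y n - X n)) sequentially"
      using padic_abs_abs_diff_le[OF prime_card]
      by (intro always_eventually allI) (simp add: padic_abs_minus_commute[of _ "?Y _"])
    show "(\<lambda>n. padic_abs CARD('p) (?Y n - X n)) \<longlonglongrightarrow> 0"
      using seq_of_padic_of_seq[OF assms] by (simp add: padic_null_def)
  qed
  from tendsto_add[OF this 1] show ?thesis by simp
qed

lemma padic_norm_eq_0 [simp]: "padic_norm x = 0 \<longleftrightarrow> x = (0 :: 'p::prime_card padic)"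
proof (cases x)
  case (1 X)
  show ?thesis
    unfolding 1(2) padic_of_seq_eq_0_iff[OF 1(1)] padic_null_def
    using padic_norm_lim[OF 1(1)] LIMSEQ_unique by metis
qed

lemma padic_norm_nonneg [simp]: "padic_norm x \<ge> 0" for x :: "'p::prime_card padic"
proof (cases x)
  case (1 X)
  show ?thesis unfolding 1(2) by (rule LIMSEQ_le_const[OF padic_norm_lim[OF 1(1)]]) auto
qed

lemma padic_norm_ultrametric: "padic_norm (x + y) \<le> max (padic_norm x) (padic_norm y)" for x y :: "'p::prime_card padic"
proof (cases x; cases y)
  fix X Y assume X: "padic_cauchy CARD('p) X" "x = padic_of_seq X"
    and Y: "padic_cauchy CARD('p) Y" "y = padic_of_seq Y"
  show ?thesis unfolding X(2) Y(2) padic_of_seq_add[OF X(1) Y(1)]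
    by (rule LIMSEQ_le[OF padic_norm_lim[OF padic_cauchy_add[OF prime_card X(1) Y(1)]]
          tendsto_max[OF padic_norm_lim[OF X(1)] padic_norm_lim[OF Y(1)]]])
      (auto simp: padic_abs_add_le_max[OF prime_card])
qed

lemma padic_norm_minus [simp]: "padic_norm (- x) = padic_norm x" for x :: "'p::prime_card padic"
proof (cases x)
  case (1 X)
  have "(\<lambda>n. padic_abs CARD('p) (- X n)) \<longlonglongrightarrow> padic_norm (- x)"
    unfolding 1(2) padic_of_seq_minus[OF 1(1)] by (rule padic_norm_lim[OF padic_cauchy_minus[OF 1(1)]])
  moreover have "(\<lambda>n. padic_abs CARD('p) (- X n)) \<longlonglongrightarrow> padic_norm x"
    unfolding 1(2) using padic_norm_lim[OF 1(1)] by simp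
  ultimately show ?thesis using LIMSEQ_unique by blast
qed

instantiation padic :: (prime_card) metric_space
begin

definition dist_padic :: "'a padic \<Rightarrow> 'a padic \<Rightarrow> real" where
  "dist x y = padic_norm (x - y)"

definition uniformity_padic :: "('a padic \<times> 'a padic) filter" where
  "uniformity_padic = (INF e\<in>{0<..}. principal {(x, y). dist x y < e})"

definition open_padic :: "'a padic set \<Rightarrow> bool" where
  "open_padic U = (\<forall>x\<in>U. eventually (\<lambda>(x', y). x' = x \<longrightarrow> y \<in> U) uniformity)"

instance
proof
  fix x y z :: "'a padic"
  show "dist x y = 0 \<longleftrightarrow> x = y" by (simp add: dist_padic_def)
  have "padic_norm (x - y) \<le> max (padic_norm (x - z)) (padic_norm (- (y - z)))"
    using padic_norm_ultrametric[of "x - z" "- (y - z)"] by simp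
  also have "\<dots> \<le> padic_norm (x - z) + padic_norm (y - z)"
    unfolding padic_norm_minus by simp
  finally show "dist x y \<le> dist x z + dist y z" by (simp add: dist_padic_def)
qed (simp_all only: uniformity_padic_def open_padic_def)

end

lemma padic_norm_mult: "padic_norm (x * y) = padic_norm x * padic_norm y" for x y :: "'p::prime_card padic"
proof (cases x; cases y)
  fix X Y assume X: "padic_cauchy CARD('p) X" "x = padic_of_seq X"
    and Y: "padic_cauchy CARD('p) Y" "y = padic_of_seq Y"
  have "(\<lambda>n. padic_abs CARD('p) (X n * Y n)) \<longlonglongrightarrow> padic_norm (x * y)"
    unfolding X(2) Y(2) padic_of_seq_mult[OF X(1) Y(1)]
    by (rule padic_norm_lim[OF padic_cauchy_mult[OF prime_card X(1) Y(1)]])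
  moreover have "(\<lambda>n. padic_abs CARD('p) (X n * Y n)) \<longlonglongrightarrow> padic_norm x * padic_norm y"
    unfolding X(2) Y(2) padic_abs_mult[OF prime_card]
    by (intro tendsto_mult padic_norm_lim X Y)
  ultimately show ?thesis by (rule LIMSEQ_unique)
qed

lemma padic_of_nat: "of_nat k = (padic_of_seq (\<lambda>_. of_nat k) :: 'p::prime_card padic)"
  by (induction k) (simp_all add: zero_padic_def one_padic_def padic_of_seq_add)

instance padic :: (prime_card) field_char_0
proof
  show "inj (of_nat :: nat \<Rightarrow> 'a padic)"
    by (rule injI) (simp add: padic_of_nat padic_of_seq_eq_iff padic_null_def LIMSEQ_const_iff
        prime_card)
qed

lemma padic_of_int: "of_int k = (padic_of_seq (\<lambda>_. of_int k) :: 'p::prime_card padic)"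
  by (cases k rule: int_cases2) (simp_all add: padic_of_nat padic_of_seq_minus)

lemma padic_of_rat: "of_rat r = (padic_of_seq (\<lambda>_. r) :: 'p::prime_card padic)"
proof -
  obtain a b where r: "b \<noteq> 0" "r = of_int a / of_int b" by (rule rat_cases_frac)
  have "(padic_of_seq (\<lambda>_. r) :: 'p padic) * of_int b = of_int a"
    using r by (simp add: padic_of_int padic_of_seq_mult)
  then show ?thesis using r(1) unfolding r(2) of_rat_divide by (simp add: divide_eq_eq)
qed

lemma padic_norm_of_rat: "padic_norm (of_rat r :: 'p::prime_card padic) = padic_abs CARD('p) r"
  using padic_norm_lim[where 'p = 'p, of "\<lambda>_. r"] by (simp add: padic_of_rat LIMSEQ_const_iff)

lemma padic_seq_approx:
  assumes "padic_cauchy CARD('p) X" "e > 0"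
  shows "\<exists>k. \<forall>n\<ge>k. dist (padic_of_seq X :: 'p::prime_card padic) (of_rat (X n)) < e"
proof -
  obtain k where k: "\<forall>m\<ge>k. \<forall>n\<ge>k. padic_abs CARD('p) (X m - X n) < e / 2"
    using padic_cauchyD[OF assms(1), of "e / 2"] assms(2) by auto
  have "dist (padic_of_seq X :: 'p padic) (of_rat (X n)) < e" if n: "n \<ge> k" for n
  proof -
    have c: "padic_cauchy CARD('p) (\<lambda>m. X m + - X n)"
      by (intro padic_cauchy_add prime_card assms padic_cauchy_const)
    have eq: "padic_of_seq X - of_rat (X n) = (padic_of_seq (\<lambda>m. X m + - X n) :: 'p padic)"
      using assms(1) unfolding minus_padic_def
      by (simp add: padic_of_rat padic_of_seq_minus padic_of_seq_add)
    have "dist (padic_of_seq X :: 'p padic) (of_rat (X n)) \<le> e / 2"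
      unfolding dist_padic_def eq
      by (rule LIMSEQ_le_const2[OF padic_norm_lim[OF c]])
        (use k n in \<open>auto intro!: exI[of _ k] less_imp_le\<close>)
    then show ?thesis using assms(2) by simp
  qed
  then show ?thesis by blast
qed

instance padic :: (prime_card) complete_space
proof
  fix S :: "nat \<Rightarrow> 'a padic"
  assume S: "Cauchy S"
  have "\<exists>q. dist (S n) (of_rat q) < inverse (real (Suc n))" for n
  proof (cases "S n")
    case (1 X)
    show ?thesis unfolding 1(2)
      using padic_seq_approx[OF 1(1), of "inverse (real (Suc n))"] by auto
  qed
  then obtain q where q: "\<And>n. dist (S n) (of_rat (q n)) < inverse (real (Suc n))" by metis
  have dq: "dist (of_rat x) (of_rat y :: 'a padic) = padic_abs CARD('a) (x - y)" for x y
    by (simp add: dist_padic_def padic_norm_of_rat flip: of_rat_diff)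
  have lim0: "(\<lambda>n. dist (S n) (of_rat (q n))) \<longlonglongrightarrow> 0"
    by (rule tendsto_sandwich[OF _ _ tendsto_const LIMSEQ_inverse_real_of_nat])
      (use q in \<open>auto intro!: always_eventually less_imp_le simp del: of_nat_Suc\<close>)
  have cq: "padic_cauchy CARD('a) q"
    unfolding padic_cauchy_def
  proof (intro allI impI)
    fix e :: real assume e: "e > 0"
    obtain k where k: "\<And>m n. m \<ge> k \<Longrightarrow> n \<ge> k \<Longrightarrow> dist (S m) (S n) < e / 3"
      using metric_CauchyD[OF S, of "e / 3"] e by auto
    obtain l where l: "\<And>n. n \<ge> l \<Longrightarrow> dist (S n) (of_rat (q n)) < e / 3"
      using order_tendstoD(2)[OF lim0, of "e / 3"] e by (auto simp: eventually_sequentially)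
    have "padic_abs CARD('a) (q m - q n) < e" if "m \<ge> max k l" "n \<ge> max k l" for m n
    proof -
      have "dist (of_rat (q m) :: 'a padic) (of_rat (q n)) \<le>
          dist (S m) (of_rat (q m)) + dist (S m) (S n) + dist (S n) (of_rat (q n))"
        using dist_triangle[of "of_rat (q m)" "of_rat (q n)" "S m"]
          dist_triangle[of "S m" "of_rat (q n)" "S n"] by (simp add: dist_commute)
      also have "\<dots> < e" using k[of m n] l[of m] l[of n] that by simp
      finally show ?thesis by (simp add: dq)
    qed
    then show "\<exists>k. \<forall>m\<ge>k. \<forall>n\<ge>k. padic_abs CARD('a) (q m - q n) < e" by blast
  qed
  have "S \<longlonglongrightarrow> padic_of_seq q"
    unfolding lim_sequentially
  proof (intro allI impI)
    fix e :: real assume e: "e > 0"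
    obtain k where k: "\<forall>n\<ge>k. dist (padic_of_seq q :: 'a padic) (of_rat (q n)) < e / 2"
      using padic_seq_approx[OF cq, of "e / 2"] e by auto
    obtain l where l: "\<And>n. n \<ge> l \<Longrightarrow> dist (S n) (of_rat (q n)) < e / 2"
      using order_tendstoD(2)[OF lim0, of "e / 2"] e by (auto simp: eventually_sequentially)
    have "dist (S n) (padic_of_seq q) < e" if "n \<ge> max k l" for n
    proof -
      have "dist (padic_of_seq q :: 'a padic) (of_rat (q n)) < e / 2" "dist (S n) (of_rat (q n)) < e / 2"
        using k l that by auto
      then show ?thesis
        using dist_triangle2[of "S n" "padic_of_seq q" "of_rat (q n)"] by simp
    qed
    then show "\<exists>no. \<forall>n\<ge>no. dist (S n) (padic_of_seq q) < e" by blast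
  qed
  then show "convergent S" by (rule convergentI)
qed

definition padic_integers :: "'p::prime_card padic set" where
  "padic_integers = {x. padic_norm x \<le> 1}"

text \<open>
  Multi-indices are elements of \<^typ>\<open>nat ^ 'n\<close>, and a power series is the family of its
  coefficients. Polynomials are the power series with finitely many nonzero coefficients. Series
  are summed unconditionally; over a non-archimedean field this is no restriction, since
  a series converges as soon as its terms tend to \<open>0\<close>.
\<close>

definition monomial_at :: "'a::comm_semiring_1 ^ 'n \<Rightarrow> nat ^ 'n \<Rightarrow> 'a" where
  "monomial_at x \<alpha> = (\<Prod>i\<in>UNIV. (x $ i) ^ (\<alpha> $ i))"

definition series_at ::
    "(nat ^ 'n \<Rightarrow> 'a) \<Rightarrow> 'a::{comm_semiring_1,t2_space} ^ 'n \<Rightarrow> 'a" where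
  "series_at c x = (\<Sum>\<^sub>\<infinity>\<alpha>. c \<alpha> * monomial_at x \<alpha>)"

definition converges_near_0 ::
    "(nat ^ 'n \<Rightarrow> 'a::{comm_semiring_1,topological_space}) \<Rightarrow> bool" where
  "converges_near_0 c \<longleftrightarrow>
     (\<exists>U :: ('a ^ 'n) set. open U \<and> 0 \<in> U \<and>
        (\<forall>x\<in>U. (\<lambda>\<alpha>. c \<alpha> * monomial_at x \<alpha>) summable_on UNIV))"

definition coeff_pderiv ::
    "'n::finite \<Rightarrow> (nat ^ 'n \<Rightarrow> 'a::comm_semiring_1) \<Rightarrow> nat ^ 'n \<Rightarrow> 'a" where
  "coeff_pderiv i c = (\<lambda>\<alpha>. of_nat (\<alpha> $ i + 1) * c (\<alpha> + axis i 1))"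

text \<open>
  A list \<open>js\<close> of variables stands for the iterated partial derivative of order
  \<open>length js\<close> with respect to these variables.
\<close>

definition zero_order ::
    "(nat ^ 'n \<Rightarrow> 'a) \<Rightarrow> 'a::{comm_semiring_1,t2_space} ^ 'n \<Rightarrow> nat" where
  "zero_order c x =
     (LEAST k. \<exists>js :: 'n list. length js = k \<and> series_at (foldr coeff_pderiv js c) x \<noteq> 0)"

definition newton_polyhedron :: "(nat ^ 'n \<Rightarrow> int) \<Rightarrow> (real ^ 'n) set" where
  "newton_polyhedron f =
     convex hull (\<Union>\<alpha>\<in>{\<alpha>. f \<alpha> \<noteq> 0}. {t. \<forall>i. t $ i \<ge> real (\<alpha> $ i)})"

definition newton_distance :: "(nat ^ 'n \<Rightarrow> int) \<Rightarrow> real" where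
  "newton_distance f = Inf {t. (\<chi> i. t) \<in> newton_polyhedron f}"

text \<open>In contrast to \<^const>\<open>face_of\<close>, the empty set is not a face.\<close>

definition newton_face :: "(nat ^ 'n \<Rightarrow> int) \<Rightarrow> (real ^ 'n) set \<Rightarrow> bool" where
  "newton_face f F \<longleftrightarrow> F face_of newton_polyhedron f \<and> F \<noteq> {}"

definition compact_newton_faces :: "(nat ^ 'n \<Rightarrow> int) \<Rightarrow> (real ^ 'n) set set" where
  "compact_newton_faces f = {F. newton_face f F \<and> compact F}"

definition diagonal :: "(real ^ 'n) set" where
  "diagonal = range (\<lambda>t. \<chi> i. t)"

definition central_face :: "(nat ^ 'n \<Rightarrow> int) \<Rightarrow> (real ^ 'n) set \<Rightarrow> bool" where
  "central_face f F \<longleftrightarrow> newton_face f F \<and> F \<inter> diagonal \<noteq> {} \<and>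
     (\<forall>G. newton_face f G \<and> G \<inter> diagonal \<noteq> {} \<longrightarrow> aff_dim F \<le> aff_dim G)"

definition face_part :: "(nat ^ 'n \<Rightarrow> int) \<Rightarrow> (real ^ 'n) set \<Rightarrow> nat ^ 'n \<Rightarrow> int" where
  "face_part f F = (\<lambda>\<alpha>. if (\<chi> i. real (\<alpha> $ i)) \<in> F then f \<alpha> else 0)"

definition padic_coeffs :: "(nat ^ 'n \<Rightarrow> int) \<Rightarrow> nat ^ 'n \<Rightarrow> 'p::prime_card padic" where
  "padic_coeffs f = (\<lambda>\<alpha>. of_int (f \<alpha>))"

definition torus_zeros :: "(nat ^ 'n \<Rightarrow> int) \<Rightarrow> ('p::prime_card padic ^ 'n) set" where
  "torus_zeros g = {x. (\<forall>i. x $ i \<noteq> 0) \<and> series_at (padic_coeffs g) x = 0}"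

text \<open>
  For a compact face \<open>F\<close> the polynomial \<open>face_part f F\<close> is nonzero and the orders
  of its zeros are bounded by its degree, so the maximum is over a finite set.
\<close>

definition face_order ::
    "'p::prime_card itself \<Rightarrow> (nat ^ 'n \<Rightarrow> int) \<Rightarrow> (real ^ 'n) set \<Rightarrow> nat" where
  "face_order T f F =
     (let Z = (torus_zeros (face_part f F) :: ('p padic ^ 'n) set)
      in if Z = {} then 0 else Max (zero_order (padic_coeffs (face_part f F)) ` Z))"

text \<open>
  The infinite sum is \<open>0\<close> by convention where it does not converge. This does not occur
  when all \<open>a $ i\<close> are positive and \<open>x\<close> has coordinates in \<^const>\<open>padic_integers\<close>, because the
  coefficients are integers.
\<close>

definition dilated_series_at ::
    "(nat ^ 'n \<Rightarrow> int) \<Rightarrow> int ^ 'n \<Rightarrow> 'p::prime_card padic ^ 'n \<Rightarrow> 'p padic" where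
  "dilated_series_at f a x =
     series_at (padic_coeffs f) (\<chi> i. of_nat CARD('p) powi (a $ i) * x $ i)"

definition solutions ::
    "'p::prime_card itself \<Rightarrow> (nat ^ 'n \<Rightarrow> int) \<Rightarrow> int ^ 'n \<Rightarrow> nat \<Rightarrow> (int ^ 'n) set" where
  "solutions T f a l =
     {x. (\<forall>i. x $ i \<in> {0..int CARD('p) ^ l - 1}) \<and>
         (\<exists>z \<in> padic_integers. dilated_series_at f a (\<chi> i. of_int (x $ i)) =
            (of_nat CARD('p) ^ l * z :: 'p padic))}"

end

theory Submission
  imports Defs
begin

text \<open>
  Split the box according to the valuations \<open>e\<close> of the coordinates and write \<open>k = a + e\<close>, so that
  \<open>x\<^sub>i = p ^ e\<^sub>i * u\<^sub>i\<close> with units \<open>u\<^sub>i\<close>. The monomials of \<open>f\<^sub>a(x)\<close> then carry the powers \<open>p ^ (k \<cdot> \<alpha>)\<close>;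
  those within a bounded distance of the minimum \<open>m(k)\<close> lie on a compact face \<open>F\<close> once all \<open>k\<^sub>i\<close>
  are large. By compactness of the unit torus some directional divided difference of \<open>f\<^sub>F\<close> of order at
  most \<open>o(F)\<close> is bounded below, whence the proportion of \<open>u\<close> for which \<open>p ^ l\<close> divides \<open>f\<^sub>a(x)\<close> is at
  most \<open>O(p powr (- (l - m(k)) / o(F)))\<close>. Multiplying by the measure \<open>p powr (- |e|)\<close> of the stratum leaves a
  sum over lattice points, in which \<open>d|k| - m(k)\<close> measures the distance of \<open>k\<close> to the normal cone of
  the central face. This cone has dimension \<open>n - h\<close>, and requiring \<open>m(k) \<approx> l\<close> leaves \<open>l\<^sup>n\<^sup>-\<^sup>h\<^sup>-\<^sup>1\<close> strata of
  weight \<open>p powr (- l / d)\<close>. Conversely the strata with \<open>k\<close> in the normal cone and \<open>m(k) \<ge> l\<close> consist of solutions,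
  which gives the lower bound.
\<close>

hide_const (open) Module.smult up_ring.coeff up_ring.monom

section \<open>p-adic evaluation\<close>

text \<open>The obstacle is uniformity in the valuations. The exactly minimal monomials do not
  suffice: near a wall of the normal fan, a monomial slightly above the minimum still perturbs the
  leading polynomial. The tolerance for calling a generator active is therefore adaptive but
  bounded. Only finitely many rescaled polynomials with coefficients
  \<open>f \<alpha> * p ^ \<delta> \<alpha>\<close> then arise, so one constant serves all of them;
  every other monomial is negligible once all k_i exceed a fixed bound, which is the origin of M.
  Divided differences replace derivatives because coefficients of restrictions to lines stay
  integral, whereas k! may be divisible by p. In case (a) one power of l is saved. On faces inside
  the central face the strict inequality gives a rate above 1 / d, which pins m(k) to l; on any
  other face a nearly minimal generator outside the central face gives one more linear form
  confining k. In case (c) the rate 1 / s is so slow that the weights decay in |k| itself.\<close>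

lemma padic_abs_of_int:
  assumes "prime p" "z \<noteq> 0"
  shows "padic_abs p (of_int z) = real p powi (- int (multiplicity (int p) z))"
  using padic_abs_of_int_div[OF assms, of 1] by simp

lemma padic_norm_of_int:
  "padic_norm (of_int z :: 'p::prime_card padic) =
    (if z = 0 then 0 else real CARD('p) powi (- int (multiplicity (int CARD('p)) z)))"
  using padic_norm_of_rat[where 'p = 'p, of "of_int z"] padic_abs_of_int[OF prime_card, of z]
  by auto

lemma card_prime_gt_1: "real CARD('p::prime_card) > 1"
  using prime_gt_1_nat[OF prime_card[where 'a = 'p]] by simp

lemma padic_norm_0 [simp]: "padic_norm (0 :: 'p::prime_card padic) = 0"
  by simp

lemma padic_norm_of_int_le_iff:
  "padic_norm (of_int z :: 'p::prime_card padic) \<le> real CARD('p) powi (- int l)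
    \<longleftrightarrow> int CARD('p) ^ l dvd z"
proof (cases "z = 0")
  case False
  have nu: "\<not> is_unit (int CARD('p))" using card_prime_gt_1[where 'p = 'p] by simp
  have "int CARD('p) ^ l dvd z \<longleftrightarrow> l \<le> multiplicity (int CARD('p)) z"
    using power_dvd_iff_le_multiplicity[OF False nu] by simp
  moreover have "real CARD('p) powi (- int (multiplicity (int CARD('p)) z)) \<le> real CARD('p) powi (- int l)
      \<longleftrightarrow> l \<le> multiplicity (int CARD('p)) z"
    using card_prime_gt_1[where 'p = 'p] by (simp add: power_int_minus)
  ultimately show ?thesis using False by (simp add: padic_norm_of_int)
qed (simp add: padic_norm_of_int)

lemma padic_norm_of_int_le_1: "padic_norm (of_int z :: 'p::prime_card padic) \<le> 1"
  using padic_norm_of_int_le_iff[where 'p = 'p, of z 0] by simp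

lemma padic_norm_1 [simp]: "padic_norm (1 :: 'p::prime_card padic) = 1"
  using padic_norm_of_int[where 'p = 'p, of 1] by simp

lemma padic_norm_power: "padic_norm (x ^ k) = padic_norm (x :: 'p::prime_card padic) ^ k"
  by (induction k) (simp_all add: padic_norm_mult)

lemma padic_norm_p: "padic_norm (of_nat CARD('p) :: 'p::prime_card padic) = 1 / real CARD('p)"
proof -
  have "multiplicity (int CARD('p)) (int CARD('p)) = 1"
    using card_prime_gt_1[where 'p = 'p] by (intro multiplicity_self) auto
  moreover have "(of_nat CARD('p) :: 'p padic) = of_int (int CARD('p))" by simp
  ultimately show ?thesis
    using card_prime_gt_1[where 'p = 'p] unfolding \<open>(of_nat CARD('p) :: 'p padic) = _\<close> padic_norm_of_int
    by (simp add: field_simps)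
qed

lemma padic_norm_p_power:
  "padic_norm (of_nat CARD('p) ^ l :: 'p::prime_card padic) = real CARD('p) powi (- int l)"
  by (simp add: padic_norm_power padic_norm_p power_int_minus power_one_over divide_inverse power_inverse)

lemma padic_norm_sum_le:
  assumes "\<And>i. i \<in> A \<Longrightarrow> padic_norm (f i :: 'p::prime_card padic) \<le> e" "e \<ge> 0"
  shows "padic_norm (sum f A) \<le> e"
  using assms(1)
proof (induction A rule: infinite_finite_induct)
  case (insert x F)
  then show ?case using padic_norm_ultrametric[of "f x" "sum f F"] by fastforce
qed (use assms(2) in \<open>simp_all add: padic_norm_eq_0[THEN iffD2]\<close>)

lemma padic_norm_diff_le:
  "padic_norm (x - y) \<le> max (padic_norm x) (padic_norm (y :: 'p::prime_card padic))"
  using padic_norm_ultrametric[of x "- y"] by simp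

text \<open>The ultrametric inequality in the form used most: moving a point by at most e does not
  affect membership in the ball of radius e.\<close>

lemma padic_norm_le_iff:
  assumes "padic_norm (x - y :: 'p::prime_card padic) \<le> e"
  shows "padic_norm x \<le> e \<longleftrightarrow> padic_norm y \<le> e"
proof
  assume "padic_norm x \<le> e"
  then have "max (padic_norm x) (padic_norm (x - y)) \<le> e" using assms by simp
  moreover have "padic_norm y \<le> max (padic_norm x) (padic_norm (x - y))"
    using padic_norm_diff_le[of x "x - y"] by simp
  ultimately show "padic_norm y \<le> e" by (rule order_trans[rotated])
next
  assume "padic_norm y \<le> e"
  then have "max (padic_norm (x - y)) (padic_norm y) \<le> e" using assms by simp
  moreover have "padic_norm x \<le> max (padic_norm (x - y)) (padic_norm y)"
    using padic_norm_ultrametric[of "x - y" y] by simp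
  ultimately show "padic_norm x \<le> e" by (rule order_trans[rotated])
qed

lemma mult_p_power_integer_iff:
  "(\<exists>z\<in>padic_integers. x = (of_nat CARD('p) ^ l * z :: 'p::prime_card padic)) \<longleftrightarrow>
    padic_norm x \<le> real CARD('p) powi (- int l)"
proof
  assume "\<exists>z\<in>padic_integers. x = (of_nat CARD('p) ^ l * z :: 'p padic)"
  then show "padic_norm x \<le> real CARD('p) powi (- int l)"
    by (auto simp: padic_integers_def padic_norm_mult padic_norm_p_power mult_left_le)
next
  assume *: "padic_norm x \<le> real CARD('p) powi (- int l)"
  have nz: "(of_nat CARD('p) ^ l :: 'p padic) \<noteq> 0" by simp
  define z where "z = x / of_nat CARD('p) ^ l"
  have x: "x = of_nat CARD('p) ^ l * z" using nz by (simp add: z_def)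
  have "real CARD('p) powi (- int l) * padic_norm z \<le> real CARD('p) powi (- int l) * 1"
    using * unfolding x padic_norm_mult padic_norm_p_power by simp
  then have "padic_norm z \<le> 1"
    using card_prime_gt_1[where 'p = 'p] by (subst (asm) mult_le_cancel_left_pos) (auto simp: zero_less_power_int)
  then show "\<exists>z\<in>padic_integers. x = of_nat CARD('p) ^ l * z" using x by (auto simp: padic_integers_def)
qed

lemma p_powi_eventually_less:
  assumes "e > 0" shows "\<exists>l. real CARD('p::prime_card) powi (- int l) < e"
proof -
  obtain l where "(1 / real CARD('p)) ^ l < e"
    using real_arch_pow_inv[OF assms, of "1 / real CARD('p)"] card_prime_gt_1[where 'p = 'p] by auto
  then show ?thesis by (intro exI[of _ l]) (simp add: power_int_minus power_one_over divide_inverse power_inverse)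
qed

text \<open>The finite sets \<open>A l\<close> of terms not divisible by p^l contain all that
  matters modulo p^l, so the partial sums \<open>s l\<close> form a Cauchy sequence. The second
  conjunct is the error bound that later replaces divisibility of an infinite sum by a congruence
  for a finite one.\<close>

lemma padic_int_series:
  fixes c :: "'i \<Rightarrow> int"
  assumes fin: "\<And>l. finite {i. \<not> int CARD('p) ^ l dvd c i}"
  shows "\<exists>S :: 'p::prime_card padic. ((\<lambda>i. of_int (c i)) has_sum S) UNIV \<and>
    (\<forall>l T. finite T \<longrightarrow> {i. \<not> int CARD('p) ^ l dvd c i} \<subseteq> T \<longrightarrow>
      padic_norm (S - of_int (sum c T)) \<le> real CARD('p) powi (- int l))"
proof -
  define A where "A l = {i. \<not> int CARD('p) ^ l dvd c i}" for l
  define s :: "nat \<Rightarrow> 'p padic" where "s l = of_int (sum c (A l))" for l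
  have diff: "padic_norm (of_int (sum c T) - of_int (sum c T') :: 'p padic) \<le> real CARD('p) powi (- int l)"
    if "finite T" "finite T'" "A l \<subseteq> T" "A l \<subseteq> T'" for l T T'
  proof -
    have "int CARD('p) ^ l dvd sum c (X - A l)" for X by (rule dvd_sum) (auto simp: A_def)
    moreover have "sum c T = sum c (A l) + sum c (T - A l)" "sum c T' = sum c (A l) + sum c (T' - A l)"
      using that by (metis add.commute sum.subset_diff)+
    ultimately have "int CARD('p) ^ l dvd sum c T - sum c T'" by simp
    then show ?thesis by (metis of_int_diff padic_norm_of_int_le_iff)
  qed
  have mono: "A l \<subseteq> A m" if "l \<le> m" for l m using that by (auto simp: A_def intro: power_le_dvd)
  have sd: "padic_norm (s m - s n) \<le> real CARD('p) powi (- int l)" if "l \<le> m" "l \<le> n" for l m n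
    unfolding s_def using that mono fin by (intro diff) (auto simp: A_def[symmetric])
  have "Cauchy s"
  proof (rule metric_CauchyI)
    fix e :: real assume "e > 0"
    then obtain l where "real CARD('p) powi (- int l) < e" using p_powi_eventually_less by blast
    then show "\<exists>M. \<forall>m\<ge>M. \<forall>n\<ge>M. dist (s m) (s n) < e"
      using sd by (intro exI[of _ l]) (force simp: dist_padic_def)
  qed
  then obtain S where S: "s \<longlonglongrightarrow> S" using Cauchy_convergent_iff convergent_def by blast
  have Ss: "padic_norm (S - s l) \<le> real CARD('p) powi (- int l)" for l
  proof -
    have "(\<lambda>m. dist (s m) (s l)) \<longlonglongrightarrow> dist S (s l)" by (intro tendsto_dist S tendsto_const)
    then have "dist S (s l) \<le> real CARD('p) powi (- int l)"
      by (rule LIMSEQ_le_const2) (use sd[of l _ l] in \<open>auto simp: dist_padic_def intro!: exI[of _ l]\<close>)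
    then show ?thesis by (simp add: dist_padic_def)
  qed
  have main: "padic_norm (S - of_int (sum c T)) \<le> real CARD('p) powi (- int l)"
    if T: "finite T" "A l \<subseteq> T" for l T
  proof -
    have "padic_norm (s l - of_int (sum c T)) \<le> real CARD('p) powi (- int l)"
      unfolding s_def using that fin by (intro diff) (auto simp: A_def[symmetric])
    then show ?thesis using Ss[of l] padic_norm_ultrametric[of "S - s l" "s l - of_int (sum c T)"] by simp
  qed
  have "((\<lambda>i. of_int (c i)) has_sum S) UNIV"
    unfolding has_sum_def
  proof (rule tendstoI)
    fix e :: real assume "e > 0"
    then obtain l where l: "real CARD('p) powi (- int l) < e" using p_powi_eventually_less by blast
    show "eventually (\<lambda>T. dist (\<Sum>i\<in>T. of_int (c i)) S < e) (finite_subsets_at_top UNIV)"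
      unfolding eventually_finite_subsets_at_top
    proof (intro exI[of _ "A l"] conjI allI impI)
      show "finite (A l)" using fin by (simp add: A_def)
      fix T assume "finite T \<and> A l \<subseteq> T \<and> T \<subseteq> UNIV"
      then have "dist S (of_int (sum c T)) \<le> real CARD('p) powi (- int l)"
        using main[of T l] by (simp add: dist_padic_def)
      then show "dist (\<Sum>i\<in>T. of_int (c i)) S < e" using l by (simp add: dist_commute)
    qed auto
  qed
  then show ?thesis using main unfolding A_def by blast
qed

text \<open>The pairing k . alpha: substituting \<open>p ^ (k $ i) * u $ i\<close> for the variables
  multiplies the monomial alpha by p to this power.\<close>

definition dotn :: "nat ^ 'n \<Rightarrow> nat ^ 'n \<Rightarrow> nat" where
  "dotn k \<alpha> = (\<Sum>i\<in>UNIV. k $ i * \<alpha> $ i)"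

lemma monomial_at_of_int:
  "monomial_at (\<chi> i. of_int (x $ i)) \<alpha> = (of_int :: int \<Rightarrow> 'a::comm_ring_1) (monomial_at x \<alpha>)"
  by (simp add: monomial_at_def)

lemma monomial_at_mult: "monomial_at (\<chi> i. x $ i * y $ i) \<alpha> = monomial_at x \<alpha> * monomial_at y \<alpha>"
  by (simp add: monomial_at_def power_mult_distrib prod.distrib)

lemma monomial_at_powers: "monomial_at (\<chi> i. q ^ (k $ i)) \<alpha> = q ^ dotn k \<alpha>"
  by (simp add: monomial_at_def dotn_def power_sum flip: power_mult)

lemma finite_bounded_vec: "finite {\<alpha> :: nat ^ 'n. \<forall>i. \<alpha> $ i \<le> N}"
proof (rule finite_surj)
  show "finite (Pi\<^sub>E (UNIV :: 'n set) (\<lambda>_. {..N}))" by (intro finite_PiE) auto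
  show "{\<alpha> :: nat ^ 'n. \<forall>i. \<alpha> $ i \<le> N} \<subseteq> vec_lambda ` Pi\<^sub>E UNIV (\<lambda>_. {..N})"
  proof
    fix \<alpha> :: "nat ^ 'n" assume "\<alpha> \<in> {\<alpha>. \<forall>i. \<alpha> $ i \<le> N}"
    then show "\<alpha> \<in> vec_lambda ` Pi\<^sub>E UNIV (\<lambda>_. {..N})"
      by (intro image_eqI[of _ _ "vec_nth \<alpha>"]) auto
  qed
qed

lemma dotn_ge_component: "k $ i \<ge> 1 \<Longrightarrow> \<alpha> $ i \<le> dotn k \<alpha>"
proof -
  assume "k $ i \<ge> 1"
  then have "\<alpha> $ i \<le> k $ i * \<alpha> $ i" by simp
  also have "\<dots> \<le> dotn k \<alpha>" unfolding dotn_def by (rule member_le_sum) auto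
  finally show ?thesis .
qed

lemma finite_dotn_less: "(\<And>i. k $ i \<ge> 1) \<Longrightarrow> finite {\<alpha>. dotn k \<alpha> < l}"
proof (rule finite_subset[OF _ finite_bounded_vec[of l]])
  assume k: "\<And>i. k $ i \<ge> 1"
  show "{\<alpha>. dotn k \<alpha> < l} \<subseteq> {\<alpha>. \<forall>i. \<alpha> $ i \<le> l}"
  proof clarify
    fix \<alpha> :: "nat ^ 'a" and i assume "dotn k \<alpha> < l"
    then show "\<alpha> $ i \<le> l" using dotn_ge_component[of k i \<alpha>] k by simp
  qed
qed

text \<open>Monomials with \<open>dotn k \<alpha> \<ge> l\<close> vanish modulo p^l.
  \<open>U\<close> may be any finite set containing the remaining ones, because the upper bound has
  to add the generators to it.\<close>

lemma solutions_eq: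
  fixes f :: "nat ^ 'n \<Rightarrow> int" and a :: "int ^ 'n" and k :: "nat ^ 'n"
  assumes a: "\<And>i. a $ i = int (k $ i)" and k: "\<And>i. k $ i \<ge> 1"
    and U: "finite U" "\<And>\<alpha>. f \<alpha> \<noteq> 0 \<Longrightarrow> dotn k \<alpha> < l \<Longrightarrow> \<alpha> \<in> U"
  shows "solutions TYPE('p::prime_card) f a l =
    {x. (\<forall>i. x $ i \<in> {0..<int CARD('p) ^ l}) \<and>
      int CARD('p) ^ l dvd (\<Sum>\<alpha>\<in>U. f \<alpha> * int CARD('p) ^ dotn k \<alpha> * monomial_at x \<alpha>)}"
proof -
  have "(\<exists>z \<in> padic_integers. dilated_series_at f a (\<chi> i. of_int (x $ i)) = (of_nat CARD('p) ^ l * z :: 'p padic))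
    \<longleftrightarrow> int CARD('p) ^ l dvd (\<Sum>\<alpha>\<in>U. f \<alpha> * int CARD('p) ^ dotn k \<alpha> * monomial_at x \<alpha>)"
    for x :: "int ^ 'n"
  proof -
    define c where "c \<alpha> = f \<alpha> * int CARD('p) ^ dotn k \<alpha> * monomial_at x \<alpha>" for \<alpha>
    have sub: "{\<alpha>. \<not> int CARD('p) ^ m dvd c \<alpha>} \<subseteq> {\<alpha>. f \<alpha> \<noteq> 0 \<and> dotn k \<alpha> < m}" for m
    proof
      fix \<alpha> assume "\<alpha> \<in> {\<alpha>. \<not> int CARD('p) ^ m dvd c \<alpha>}"
      then have *: "\<not> int CARD('p) ^ m dvd c \<alpha>" by simp
      then have "\<not> m \<le> dotn k \<alpha>"
        unfolding c_def by (meson dvd_mult dvd_mult2 le_imp_power_dvd)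
      moreover have "f \<alpha> \<noteq> 0" using * by (auto simp: c_def)
      ultimately show "\<alpha> \<in> {\<alpha>. f \<alpha> \<noteq> 0 \<and> dotn k \<alpha> < m}" by simp
    qed
    have fin: "finite {\<alpha>. \<not> int CARD('p) ^ m dvd c \<alpha>}" for m
      by (rule finite_subset[OF sub]) (use finite_dotn_less[of k m] k in auto)
    obtain S :: "'p padic" where S: "((\<lambda>i. of_int (c i)) has_sum S) UNIV"
      "\<forall>l T. finite T \<longrightarrow> {i. \<not> int CARD('p) ^ l dvd c i} \<subseteq> T \<longrightarrow>
        padic_norm (S - of_int (sum c T)) \<le> real CARD('p) powi (- int l)"
      using padic_int_series[where 'p = 'p and c = c, OF fin] by (elim exE conjE)
    have "padic_coeffs f \<alpha> * monomial_at (\<chi> i. of_nat CARD('p) powi (a $ i) * of_int (x $ i)) \<alpha>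
        = (of_int (c \<alpha>) :: 'p padic)" for \<alpha>
    proof -
      have eq: "(\<chi> i. of_nat CARD('p) powi (a $ i) * of_int (x $ i) :: 'p padic ^ 'n) =
        (\<chi> i. of_int ((\<chi> i. int CARD('p) ^ (k $ i) * x $ i) $ i))" by (simp add: a vec_eq_iff del: vec_lambda_unique)
      have "monomial_at (\<chi> i. int CARD('p) ^ (k $ i) * x $ i) \<alpha> = int CARD('p) ^ dotn k \<alpha> * monomial_at x \<alpha>"
        using monomial_at_mult[of "\<chi> i. int CARD('p) ^ (k $ i)" x \<alpha>] by (simp add: monomial_at_powers)
      then show ?thesis unfolding eq monomial_at_of_int by (simp add: padic_coeffs_def c_def)
    qed
    then have dil: "dilated_series_at f a (\<chi> i. of_int (x $ i)) = S"
      using infsumI[OF S(1)] by (simp add: dilated_series_at_def series_at_def)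
    have d: "padic_norm (S - of_int (sum c U)) \<le> real CARD('p) powi (- int l)"
    proof (rule S(2)[rule_format, OF U(1)])
      show "{i. \<not> int CARD('p) ^ l dvd c i} \<subseteq> U" using sub[of l] U(2) by blast
    qed
    have 1: "padic_norm S \<le> real CARD('p) powi (- int l) \<longleftrightarrow> int CARD('p) ^ l dvd sum c U"
      using padic_norm_le_iff[OF d] padic_norm_of_int_le_iff[where 'p = 'p, of "sum c U" l] by (rule trans)
    have 2: "sum c U = (\<Sum>\<alpha>\<in>U. f \<alpha> * int CARD('p) ^ dotn k \<alpha> * monomial_at x \<alpha>)"
      by (rule sum.cong[OF refl c_def])
    show ?thesis
      using trans[OF mult_p_power_integer_iff[of S l] 1] unfolding dil[symmetric] 2[symmetric] .
  qed
  moreover have "{0..int CARD('p) ^ l - 1} = {0..<int CARD('p) ^ l}" by auto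
  ultimately show ?thesis unfolding solutions_def by (intro Collect_cong) simp
qed

section \<open>Restrictions to lines\<close>

text \<open>The restriction of \<open>c\<close> to the line u + t v as a polynomial in t. Its
  coefficient of order k is a directional derivative already divided by k!, so integral data give
  integral coefficients.\<close>

definition line_poly :: "(nat ^ 'n \<Rightarrow> 'a::comm_ring_1) \<Rightarrow> 'a ^ 'n \<Rightarrow> 'a ^ 'n \<Rightarrow> 'a poly" where
  "line_poly c u v = (\<Sum>\<alpha> | c \<alpha> \<noteq> 0. smult (c \<alpha>) (\<Prod>i\<in>UNIV. [:u $ i, v $ i:] ^ (\<alpha> $ i)))"

lemma line_poly_superset:
  assumes "finite T" "\<And>\<alpha>. c \<alpha> \<noteq> 0 \<Longrightarrow> \<alpha> \<in> T"
  shows "line_poly c u v = (\<Sum>\<alpha>\<in>T. smult (c \<alpha>) (\<Prod>i\<in>UNIV. [:u $ i, v $ i:] ^ (\<alpha> $ i)))"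
  unfolding line_poly_def using assms by (intro sum.mono_neutral_left) auto

lemma poly_line_poly:
  assumes "finite T" "\<And>\<alpha>. c \<alpha> \<noteq> 0 \<Longrightarrow> \<alpha> \<in> T"
  shows "poly (line_poly c u v) t = (\<Sum>\<alpha>\<in>T. c \<alpha> * monomial_at (\<chi> i. u $ i + t * v $ i) \<alpha>)"
  by (simp add: line_poly_superset[OF assms] poly_sum poly_prod monomial_at_def)

text \<open>The binomial expansion in s of the only factor that involves coordinate i. The common
  summation bound \<open>B\<close> lets powers of s be collected over all alpha afterwards.\<close>

lemma line_factor_shift:
  fixes u w :: "'a::comm_ring_1 ^ 'n"
  assumes "\<alpha> $ i \<le> B"
  shows "(\<Prod>j\<in>UNIV. [:u $ j, (w + axis i s) $ j:] ^ (\<alpha> $ j)) =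
    (\<Sum>m\<le>B. smult (of_nat (\<alpha> $ i choose m) * s ^ m)
      (monom 1 m * ([:u $ i, w $ i:] ^ (\<alpha> $ i - m) * (\<Prod>j\<in>UNIV - {i}. [:u $ j, w $ j:] ^ (\<alpha> $ j)))))"
proof -
  let ?R = "\<Prod>j\<in>UNIV - {i}. [:u $ j, w $ j:] ^ (\<alpha> $ j)"
  have "(\<Prod>j\<in>UNIV. [:u $ j, (w + axis i s) $ j:] ^ (\<alpha> $ j)) =
      [:u $ i, w $ i + s:] ^ (\<alpha> $ i) * (\<Prod>j\<in>UNIV - {i}. [:u $ j, (w + axis i s) $ j:] ^ (\<alpha> $ j))"
    by (subst prod.remove[of _ i]) (simp_all add: axis_def)
  also have "(\<Prod>j\<in>UNIV - {i}. [:u $ j, (w + axis i s) $ j:] ^ (\<alpha> $ j)) = ?R"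
    by (rule prod.cong) (auto simp: axis_def)
  also have "[:u $ i, w $ i + s:] = monom s 1 + [:u $ i, w $ i:]" by (simp add: monom_altdef)
  also have "\<dots> ^ (\<alpha> $ i) = (\<Sum>m\<le>\<alpha> $ i. of_nat (\<alpha> $ i choose m) * monom s 1 ^ m * [:u $ i, w $ i:] ^ (\<alpha> $ i - m))"
    by (rule binomial_ring)
  also have "\<dots> = (\<Sum>m\<le>B. of_nat (\<alpha> $ i choose m) * monom s 1 ^ m * [:u $ i, w $ i:] ^ (\<alpha> $ i - m))"
    using assms by (intro sum.mono_neutral_left) (auto simp: binomial_eq_0)
  also have "\<dots> * ?R = (\<Sum>m\<le>B. smult (of_nat (\<alpha> $ i choose m) * s ^ m)
      (monom 1 m * ([:u $ i, w $ i:] ^ (\<alpha> $ i - m) * ?R)))"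
    unfolding sum_distrib_right
  proof (rule sum.cong[OF refl])
    fix m
    have "of_nat (\<alpha> $ i choose m) * monom s 1 ^ m = smult (of_nat (\<alpha> $ i choose m) * s ^ m) (monom 1 m)"
      by (simp add: monom_power of_nat_poly smult_monom)
    then show "of_nat (\<alpha> $ i choose m) * monom s 1 ^ m * [:u $ i, w $ i:] ^ (\<alpha> $ i - m) * ?R =
      smult (of_nat (\<alpha> $ i choose m) * s ^ m) (monom 1 m * ([:u $ i, w $ i:] ^ (\<alpha> $ i - m) * ?R))"
      by (simp add: mult.assoc)
  qed
  finally show ?thesis .
qed

lemma finite_support_coeff_pderiv:
  assumes "finite {\<alpha>. c \<alpha> \<noteq> 0}"
  shows "finite {\<alpha>. coeff_pderiv i c \<alpha> \<noteq> 0}"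
proof (rule finite_subset)
  show "{\<alpha>. coeff_pderiv i c \<alpha> \<noteq> 0} \<subseteq> (\<lambda>\<alpha>. \<alpha> + axis i 1) -` {\<alpha>. c \<alpha> \<noteq> 0}"
    by (auto simp: coeff_pderiv_def)
  show "finite ((\<lambda>\<alpha>. \<alpha> + axis i 1) -` {\<alpha>. c \<alpha> \<noteq> 0})"
    by (rule finite_vimageI[OF assms]) (auto simp: inj_on_def)
qed

text \<open>
  The coefficient of \<open>s\<close> in the restriction of \<open>c\<close> to the line through \<open>u\<close> with direction
  \<open>w + s e\<^sub>i\<close> is, up to a factor of the line variable, the restriction of the \<open>i\<close>-th derivative.
\<close>

lemma line_poly_coeff_pderiv:
  fixes u w :: "'a::{idom,ring_char_0} ^ 'n"
  assumes fin: "finite {\<alpha>. c \<alpha> \<noteq> 0}" and q: "q \<noteq> 0"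
    and van: "\<And>s::int. coeff (line_poly c u (w + axis i (q * of_int s))) (Suc k) = 0"
  shows "coeff (line_poly (coeff_pderiv i c) u w) k = 0"
proof -
  let ?T = "{\<alpha>. c \<alpha> \<noteq> 0}"
  \<comment> \<open>\<open>Suc\<close> guarantees 1 \<le> B, so that the power s^1, whose
    coefficient is wanted, occurs in the sum even if no monomial involves coordinate i.\<close>
  define B where "B = Suc (\<Sum>\<alpha>\<in>?T. \<alpha> $ i)"
  have B: "\<alpha> $ i \<le> B" if "\<alpha> \<in> ?T" for \<alpha>
    unfolding B_def using member_le_sum[OF that, of "\<lambda>\<alpha>. \<alpha> $ i"] fin by simp
  define R where "R \<alpha> = (\<Prod>j\<in>UNIV - {i}. [:u $ j, w $ j:] ^ (\<alpha> $ j))" for \<alpha>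
  define A where "A m = (\<Sum>\<alpha>\<in>?T. c \<alpha> * of_nat (\<alpha> $ i choose m) *
    coeff (monom 1 m * ([:u $ i, w $ i:] ^ (\<alpha> $ i - m) * R \<alpha>)) (Suc k))" for m
  have exp: "coeff (line_poly c u (w + axis i s)) (Suc k) = poly (\<Sum>m\<le>B. monom (A m) m) s" for s
  proof -
    have "coeff (line_poly c u (w + axis i s)) (Suc k) =
        (\<Sum>\<alpha>\<in>?T. c \<alpha> * coeff (\<Prod>j\<in>UNIV. [:u $ j, (w + axis i s) $ j:] ^ (\<alpha> $ j)) (Suc k))"
      by (simp add: line_poly_def coeff_sum)
    also have "\<dots> = (\<Sum>\<alpha>\<in>?T. \<Sum>m\<le>B. s ^ m * (c \<alpha> * of_nat (\<alpha> $ i choose m) *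
        coeff (monom 1 m * ([:u $ i, w $ i:] ^ (\<alpha> $ i - m) * R \<alpha>)) (Suc k)))"
    proof (rule sum.cong[OF refl])
      fix \<alpha> assume "\<alpha> \<in> ?T"
      from line_factor_shift[OF B[OF this], of u w s]
      show "c \<alpha> * coeff (\<Prod>j\<in>UNIV. [:u $ j, (w + axis i s) $ j:] ^ (\<alpha> $ j)) (Suc k) =
        (\<Sum>m\<le>B. s ^ m * (c \<alpha> * of_nat (\<alpha> $ i choose m) *
        coeff (monom 1 m * ([:u $ i, w $ i:] ^ (\<alpha> $ i - m) * R \<alpha>)) (Suc k)))"
        by (simp only: coeff_sum coeff_smult sum_distrib_left R_def) (simp add: mult_ac)
    qed
    also have "\<dots> = (\<Sum>m\<le>B. s ^ m * A m)"
      unfolding A_def sum_distrib_left by (rule sum.swap)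
    also have "\<dots> = poly (\<Sum>m\<le>B. monom (A m) m) s"
      by (simp add: poly_sum poly_monom mult.commute)
    finally show ?thesis .
  qed
  \<comment> \<open>As a polynomial in s it vanishes at all integer multiples of \<open>q\<close>,
    infinitely many points in characteristic 0.\<close>
  have "(\<Sum>m\<le>B. monom (A m) m) = 0"
  proof (rule ccontr)
    assume "(\<Sum>m\<le>B. monom (A m) m) \<noteq> 0"
    then have "finite {s. poly (\<Sum>m\<le>B. monom (A m) m) s = 0}" by (rule poly_roots_finite)
    moreover have "range (\<lambda>s::int. q * of_int s) \<subseteq> {s. poly (\<Sum>m\<le>B. monom (A m) m) s = 0}"
      using van exp by auto
    moreover have "infinite (range (\<lambda>s::int. q * of_int s))"
      using q finite_imageD[of "\<lambda>s::int. q * of_int s" UNIV] infinite_UNIV_int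
      by (auto simp: inj_on_def)
    ultimately show False using finite_subset by blast
  qed
  then have "coeff (\<Sum>m\<le>B. monom (A m) m) 1 = 0" by simp
  moreover have "coeff (\<Sum>m\<le>B. monom (A m) m) 1 = A 1"
    by (simp add: coeff_sum coeff_monom B_def if_distrib cong: if_cong)
  ultimately have A1: "A 1 = 0" by simp
  let ?h = "\<lambda>\<beta>. \<beta> + axis i 1 :: nat ^ 'n"
  have "line_poly (coeff_pderiv i c) u w =
      (\<Sum>\<beta> \<in> ?h -` ?T. smult (coeff_pderiv i c \<beta>) (\<Prod>j\<in>UNIV. [:u $ j, w $ j:] ^ (\<beta> $ j)))"
  proof (rule line_poly_superset)
    show "finite (?h -` ?T)" by (rule finite_vimageI[OF fin]) (auto simp: inj_on_def)
  qed (auto simp: coeff_pderiv_def)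
  then have "coeff (line_poly (coeff_pderiv i c) u w) k =
      (\<Sum>\<beta> \<in> ?h -` ?T. coeff_pderiv i c \<beta> * coeff (\<Prod>j\<in>UNIV. [:u $ j, w $ j:] ^ (\<beta> $ j)) k)"
    by (simp add: coeff_sum)
  also have "\<dots> = (\<Sum>\<beta> \<in> ?h -` ?T. c (?h \<beta>) * of_nat (?h \<beta> $ i choose 1) *
    coeff (monom 1 1 * ([:u $ i, w $ i:] ^ (?h \<beta> $ i - 1) * R (?h \<beta>))) (Suc k))"
  proof (rule sum.cong[OF refl])
    fix \<beta> :: "nat ^ 'n"
    have "(\<Prod>j\<in>UNIV. [:u $ j, w $ j:] ^ (\<beta> $ j)) = [:u $ i, w $ i:] ^ (\<beta> $ i) * R (?h \<beta>)"
      unfolding R_def by (subst prod.remove[of _ i]) (auto simp: axis_def intro!: prod.cong)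
    moreover have "coeff (monom 1 1 * P) (Suc k) = coeff P k" for P :: "'a poly"
      by (simp add: coeff_monom_mult)
    moreover have "?h \<beta> $ i = \<beta> $ i + 1" by (simp add: axis_def)
    ultimately show "coeff_pderiv i c \<beta> * coeff (\<Prod>j\<in>UNIV. [:u $ j, w $ j:] ^ (\<beta> $ j)) k =
       c (?h \<beta>) * of_nat (?h \<beta> $ i choose 1) *
       coeff (monom 1 1 * ([:u $ i, w $ i:] ^ (?h \<beta> $ i - 1) * R (?h \<beta>))) (Suc k)"
      by (simp only: coeff_pderiv_def choose_one add_diff_cancel_right' mult.commute[of "of_nat _"])
  qed
  also have "\<dots> = (\<Sum>\<alpha> \<in> ?h ` (?h -` ?T). c \<alpha> * of_nat (\<alpha> $ i choose 1) *
    coeff (monom 1 1 * ([:u $ i, w $ i:] ^ (\<alpha> $ i - 1) * R \<alpha>)) (Suc k))"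
    by (subst sum.reindex) (auto simp: inj_on_def)
  also have "\<dots> = A 1"
    unfolding A_def
  proof (rule sum.mono_neutral_left[OF fin])
    \<comment> \<open>Exponents not of the form \<open>\<beta> + axis i 1\<close> have i-th entry 0,
      where the binomial factor vanishes.\<close>
    show "\<forall>\<alpha>\<in>?T - ?h ` (?h -` ?T). c \<alpha> * of_nat (\<alpha> $ i choose 1) *
      coeff (monom 1 1 * ([:u $ i, w $ i:] ^ (\<alpha> $ i - 1) * R \<alpha>)) (Suc k) = 0"
    proof
      fix \<alpha> assume \<alpha>: "\<alpha> \<in> ?T - ?h ` (?h -` ?T)"
      have "\<alpha> $ i = 0"
      proof (rule ccontr)
        assume "\<alpha> $ i \<noteq> 0"
        then have *: "\<alpha> $ j = ?h (\<chi> j. \<alpha> $ j - axis i 1 $ j) $ j" for j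
          by (cases "j = i") (simp_all add: axis_def)
        have "\<alpha> = ?h (\<chi> j. \<alpha> $ j - axis i 1 $ j)"
          by (rule iffD2[OF vec_eq_iff], rule allI, rule *)
        then have "\<alpha> \<in> ?h ` (?h -` ?T)"
          using \<alpha> by (intro image_eqI[of _ _ "\<chi> j. \<alpha> $ j - axis i 1 $ j"]) simp_all
        then show False using \<alpha> by simp
      qed
      then show "c \<alpha> * of_nat (\<alpha> $ i choose 1) *
        coeff (monom 1 1 * ([:u $ i, w $ i:] ^ (\<alpha> $ i - 1) * R \<alpha>)) (Suc k) = 0" by simp
    qed
  qed auto
  finally show ?thesis using A1 by simp
qed

text \<open>Each derivative trades one order in the line variable. The induction runs over all
  \<open>v\<close> and \<open>k\<close> at once because the step for coordinate i also moves the
  direction by multiples of the i-th unit vector.\<close>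

lemma line_poly_foldr_pderiv:
  fixes u q :: "'a::{idom,ring_char_0} ^ 'n"
  assumes fin: "finite {\<alpha>. c \<alpha> \<noteq> 0}" and q: "\<And>i. q $ i \<noteq> 0"
    and van: "\<And>v :: int ^ 'n. \<And>k. k \<le> d \<Longrightarrow> coeff (line_poly c u (\<chi> i. q $ i * of_int (v $ i))) k = 0"
    and len: "length js + k \<le> d"
  shows "finite {\<alpha>. foldr coeff_pderiv js c \<alpha> \<noteq> 0} \<and>
    coeff (line_poly (foldr coeff_pderiv js c) u (\<chi> i. q $ i * of_int (v $ i))) k = 0"
  using len
proof (induction js arbitrary: k v)
  case Nil
  then show ?case using fin van by simp
next
  case (Cons i js)
  let ?c = "foldr coeff_pderiv js c"
  have fin': "finite {\<alpha>. ?c \<alpha> \<noteq> 0}" using Cons.IH[of k] Cons.prems by simp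
  have "coeff (line_poly (coeff_pderiv i ?c) u (\<chi> i. q $ i * of_int (v $ i))) k = 0"
  proof (rule line_poly_coeff_pderiv[OF fin' q[of i]])
    fix s :: int
    have "(\<chi> j. q $ j * of_int (v $ j)) + axis i (q $ i * of_int s) =
      (\<chi> j. q $ j * of_int ((v + axis i s) $ j))"
      by (auto simp: vec_eq_iff axis_def algebra_simps)
    then show "coeff (line_poly ?c u ((\<chi> j. q $ j * of_int (v $ j)) + axis i (q $ i * of_int s))) (Suc k) = 0"
      using Cons.IH[of "Suc k" "v + axis i s"] Cons.prems by simp
  qed
  then show ?case using finite_support_coeff_pderiv[OF fin'] by simp
qed

lemma series_at_finite:
  fixes c :: "nat ^ 'n \<Rightarrow> 'a::{comm_semiring_1,t2_space}"
  assumes "finite T" "\<And>\<alpha>. c \<alpha> \<noteq> 0 \<Longrightarrow> \<alpha> \<in> T"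
  shows "series_at c x = (\<Sum>\<alpha>\<in>T. c \<alpha> * monomial_at x \<alpha>)"
proof -
  have "series_at c x = infsum (\<lambda>\<alpha>. c \<alpha> * monomial_at x \<alpha>) T"
    unfolding series_at_def using assms(2) by (intro infsum_cong_neutral) force+
  then show ?thesis using assms(1) by simp
qed

text \<open>Used in contrapositive form: a nonzero partial derivative of order at most d produces a
  nonzero line coefficient of order at most d in some direction of the lattice with scales
  \<open>q\<close>, so integral directions suffice.\<close>

lemma derivatives_vanish:
  fixes u q :: "'a::{field_char_0,t2_space} ^ 'n"
  assumes fin: "finite {\<alpha>. c \<alpha> \<noteq> 0}" and q: "\<And>i. q $ i \<noteq> 0"
    and van: "\<And>v :: int ^ 'n. \<And>k. k \<le> d \<Longrightarrow> coeff (line_poly c u (\<chi> i. q $ i * of_int (v $ i))) k = 0"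
    and len: "length js \<le> d"
  shows "series_at (foldr coeff_pderiv js c) u = 0"
proof -
  let ?c = "foldr coeff_pderiv js c"
  have *: "finite {\<alpha>. ?c \<alpha> \<noteq> 0}" "coeff (line_poly ?c u (\<chi> i. q $ i * of_int ((0 :: int ^ 'n) $ i))) 0 = 0"
    using line_poly_foldr_pderiv[OF fin q van, where js = js and k = 0 and v = 0] len by auto
  have "series_at ?c u = poly (line_poly ?c u (\<chi> i. q $ i * of_int ((0 :: int ^ 'n) $ i))) 0"
    by (subst poly_line_poly[OF *(1)], simp, subst series_at_finite[OF *(1)]) simp_all
  also have "\<dots> = 0" using *(2) by (simp add: poly_0_coeff_0)
  finally show ?thesis .
qed

text \<open>\<open>K\<close> is a product of falling factorials; being positive, it is nonzero in
  characteristic 0.\<close>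

lemma foldr_coeff_pderiv:
  "\<exists>K>0. foldr coeff_pderiv js c \<beta> = of_nat K * c (\<beta> + (\<chi> i. count_list js i))"
proof (induction js arbitrary: \<beta>)
  case Nil
  have "\<beta> + (\<chi> i. count_list [] i) = \<beta>" by (simp add: vec_eq_iff)
  then show ?case by (intro exI[of _ 1]) simp
next
  case (Cons j js)
  obtain K where "K > 0" "foldr coeff_pderiv js c (\<beta> + axis j 1) =
      of_nat K * c (\<beta> + axis j 1 + (\<chi> i. count_list js i))"
    using Cons.IH by blast
  moreover have "\<beta> + axis j 1 + (\<chi> i. count_list js i) = \<beta> + (\<chi> i. count_list (j # js) i)"
    by (auto simp: vec_eq_iff axis_def)
  ultimately have "foldr coeff_pderiv (j # js) c \<beta> =
      of_nat (\<beta> $ j + 1) * (of_nat K * c (\<beta> + (\<chi> i. count_list (j # js) i)))"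
    by (simp only: foldr.simps o_apply) (simp only: coeff_pderiv_def)
  also have "\<dots> = of_nat ((\<beta> $ j + 1) * K) * c (\<beta> + (\<chi> i. count_list (j # js) i))"
    by (simp only: of_nat_mult mult.assoc)
  finally show ?case using \<open>K > 0\<close> by (intro exI[of _ "(\<beta> $ j + 1) * K"]) simp
qed

lemma ex_list_counts: "\<exists>js. length js = (\<Sum>i\<in>UNIV. \<alpha> $ i) \<and> (\<forall>i. count_list js i = (\<alpha> :: nat ^ 'n) $ i)"
proof -
  have "finite {i. 0 < \<alpha> $ i}" by simp
  then have M: "count (Abs_multiset (vec_nth \<alpha>)) = vec_nth \<alpha>" by (simp add: Abs_multiset_inverse)
  obtain js where js: "mset js = Abs_multiset (vec_nth \<alpha>)" using ex_mset by blast
  have *: "count_list js i = \<alpha> $ i" for i using M js by (metis count_mset)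
  have "length js = sum (count_list js) UNIV"
    using sum_count_set[of js UNIV] by simp
  then show ?thesis using * by auto
qed

text \<open>Differentiating by the exponent of a monomial of maximal total degree kills all other
  monomials and leaves a nonzero constant. Hence the \<open>LEAST\<close> in
  \<open>zero_order\<close> is over a nonempty set and is bounded by the degree.\<close>

lemma ex_nonvanishing_derivative:
  fixes c :: "nat ^ 'n \<Rightarrow> 'a::{field_char_0,t2_space}"
  assumes fin: "finite {\<alpha>. c \<alpha> \<noteq> 0}" and ne: "c \<alpha>\<^sub>0 \<noteq> 0"
    and deg: "\<And>\<alpha>. c \<alpha> \<noteq> 0 \<Longrightarrow> (\<Sum>i\<in>UNIV. \<alpha> $ i) \<le> D"
  shows "\<exists>js. length js \<le> D \<and> series_at (foldr coeff_pderiv js c) x \<noteq> 0"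
proof -
  let ?deg = "\<lambda>\<alpha> :: nat ^ 'n. \<Sum>i\<in>UNIV. \<alpha> $ i"
  obtain \<alpha> where \<alpha>: "c \<alpha> \<noteq> 0" "\<And>\<beta>. c \<beta> \<noteq> 0 \<Longrightarrow> ?deg \<beta> \<le> ?deg \<alpha>"
  proof -
    have "Max (?deg ` {\<alpha>. c \<alpha> \<noteq> 0}) \<in> ?deg ` {\<alpha>. c \<alpha> \<noteq> 0}"
      using fin ne by (intro Max_in) auto
    then obtain \<alpha> where "c \<alpha> \<noteq> 0" "Max (?deg ` {\<alpha>. c \<alpha> \<noteq> 0}) = ?deg \<alpha>" by blast
    moreover have "?deg \<beta> \<le> Max (?deg ` {\<alpha>. c \<alpha> \<noteq> 0})" if "c \<beta> \<noteq> 0" for \<beta>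
      using fin that by (intro Max_ge) auto
    ultimately show ?thesis by (intro that) auto
  qed
  obtain js where js: "length js = ?deg \<alpha>" "\<And>i. count_list js i = \<alpha> $ i"
    using ex_list_counts by metis
  have "(\<chi> i. count_list js i) = \<alpha>" using js by (simp add: vec_eq_iff)
  then have fo: "\<exists>K>0. foldr coeff_pderiv js c \<beta> = of_nat K * c (\<beta> + \<alpha>)" for \<beta>
    using foldr_coeff_pderiv[of js c \<beta>] by simp
  have "foldr coeff_pderiv js c \<beta> = 0" if "\<beta> \<noteq> 0" for \<beta>
  proof -
    have "\<exists>i. \<beta> $ i \<noteq> 0"
    proof (rule ccontr)
      assume "\<nexists>i. \<beta> $ i \<noteq> 0"
      then have "\<beta> = 0" by (simp add: vec_eq_iff)
      then show False using that by simp
    qed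
    then obtain i where "\<beta> $ i \<noteq> 0" ..
    then have "\<beta> $ i > 0" by simp
    then have "?deg \<beta> > 0" by (simp add: sum_pos2)
    then have "?deg (\<beta> + \<alpha>) > ?deg \<alpha>" by (simp add: sum.distrib)
    then have "c (\<beta> + \<alpha>) = 0" using \<alpha>(2)[of "\<beta> + \<alpha>"] by force
    then show ?thesis using fo[of \<beta>] by auto
  qed
  then have "series_at (foldr coeff_pderiv js c) x = foldr coeff_pderiv js c 0"
    by (subst series_at_finite[of "{0}"]) (auto simp: monomial_at_def)
  also have "\<dots> \<noteq> 0" using fo[of 0] \<alpha>(1) by auto
  finally show ?thesis using js(1) deg[OF \<alpha>(1)] by metis
qed

section \<open>Congruence of line restrictions, and compactness of the integral points\<close>

definition close_polys :: "real \<Rightarrow> 'p::prime_card padic poly \<Rightarrow> 'p padic poly \<Rightarrow> bool" where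
  "close_polys e P Q \<longleftrightarrow> (\<forall>k. padic_norm (coeff P k) \<le> 1 \<and> padic_norm (coeff Q k) \<le> 1 \<and>
     padic_norm (coeff P k - coeff Q k) \<le> e)"

text \<open>From P P' - Q Q' = (P - Q) P' + Q (P' - Q'); integrality of the coefficients is built
  into \<open>close_polys\<close> so that the relation survives products.\<close>

lemma close_polys_mult:
  fixes P Q P' Q' :: "'p::prime_card padic poly"
  assumes "close_polys e P Q" "close_polys e P' Q'" "e \<ge> 0"
  shows "close_polys e (P * P') (Q * Q')"
  unfolding close_polys_def
proof (intro allI conjI)
  fix k
  have 1: "padic_norm (coeff P i) \<le> 1" "padic_norm (coeff Q i) \<le> 1"
    "padic_norm (coeff P' i) \<le> 1" "padic_norm (coeff Q' i) \<le> 1"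
    "padic_norm (coeff P i - coeff Q i) \<le> e" "padic_norm (coeff P' i - coeff Q' i) \<le> e" for i
    using assms by (auto simp: close_polys_def)
  show "padic_norm (coeff (P * P') k) \<le> 1" "padic_norm (coeff (Q * Q') k) \<le> 1"
    unfolding coeff_mult using 1
    by (auto intro!: padic_norm_sum_le mult_le_one simp: padic_norm_mult)
  have "coeff (P * P') k - coeff (Q * Q') k =
      (\<Sum>i\<le>k. (coeff P i - coeff Q i) * coeff P' (k - i) + coeff Q i * (coeff P' (k - i) - coeff Q' (k - i)))"
    by (simp add: coeff_mult sum_subtractf[symmetric] algebra_simps)
  also have "padic_norm \<dots> \<le> e"
  proof (rule padic_norm_sum_le[OF _ assms(3)])
    fix i
    have "padic_norm ((coeff P i - coeff Q i) * coeff P' (k - i)) \<le> e * 1"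
      unfolding padic_norm_mult using 1 assms(3) by (intro mult_mono) auto
    moreover have "padic_norm (coeff Q i * (coeff P' (k - i) - coeff Q' (k - i))) \<le> 1 * e"
      unfolding padic_norm_mult using 1 assms(3) by (intro mult_mono) auto
    ultimately show "padic_norm ((coeff P i - coeff Q i) * coeff P' (k - i) +
        coeff Q i * (coeff P' (k - i) - coeff Q' (k - i))) \<le> e"
      by (intro order_trans[OF padic_norm_ultrametric]) simp
  qed
  finally show "padic_norm (coeff (P * P') k - coeff (Q * Q') k) \<le> e" .
qed

lemma close_polys_1: "e \<ge> 0 \<Longrightarrow> close_polys e 1 1"
  by (auto simp: close_polys_def coeff_1)

lemma close_polys_power:
  "close_polys e P Q \<Longrightarrow> e \<ge> 0 \<Longrightarrow> close_polys e (P ^ m) (Q ^ m)"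
  by (induction m) (auto intro: close_polys_mult close_polys_1)

lemma close_polys_prod:
  "(\<And>i. i \<in> A \<Longrightarrow> close_polys e (f i) (g i)) \<Longrightarrow> e \<ge> 0 \<Longrightarrow> close_polys e (prod f A) (prod g A)"
  by (induction A rule: infinite_finite_induct) (auto intro: close_polys_mult close_polys_1)

lemma close_polys_sum:
  assumes "\<And>i. i \<in> A \<Longrightarrow> close_polys e (f i) (g i)" "e \<ge> 0"
  shows "close_polys e (sum f A) (sum g A)"
  unfolding close_polys_def coeff_sum sum_subtractf[symmetric]
  using assms by (auto intro!: padic_norm_sum_le simp: close_polys_def)

text \<open>Line coefficients are polynomials with integer coefficients in the point and the
  direction, hence do not expand distances between integral points.\<close>

lemma close_polys_line:
  fixes c :: "nat ^ 'n \<Rightarrow> int" and u u' v :: "'p::prime_card padic ^ 'n"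
  assumes "\<And>i. padic_norm (u $ i) \<le> 1" "\<And>i. padic_norm (u' $ i) \<le> 1" "\<And>i. padic_norm (v $ i) \<le> 1"
    "\<And>i. padic_norm (u $ i - u' $ i) \<le> e" "e \<ge> 0"
  shows "close_polys e (line_poly (padic_coeffs c) u v) (line_poly (padic_coeffs c) u' v)"
  unfolding line_poly_def
proof (intro close_polys_sum assms(5))
  fix \<alpha> :: "nat ^ 'n"
  have "close_polys e [:u $ i, v $ i:] [:u' $ i, v $ i:]" for i
    using assms by (auto simp: close_polys_def coeff_pCons split: nat.splits)
  moreover have "close_polys e [:padic_coeffs c \<alpha> :: 'p padic:] [:padic_coeffs c \<alpha>:]"
    using assms(5) by (auto simp: close_polys_def coeff_pCons padic_coeffs_def padic_norm_of_int_le_1 split: nat.splits)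
  ultimately have "close_polys e ([:padic_coeffs c \<alpha>:] * (\<Prod>i\<in>UNIV. [:u $ i, v $ i:] ^ (\<alpha> $ i)))
      ([:padic_coeffs c \<alpha>:] * (\<Prod>i\<in>UNIV. [:u' $ i, v $ i:] ^ (\<alpha> $ i)))"
    by (intro close_polys_mult close_polys_prod close_polys_power assms(5))
  then show "close_polys e (smult (padic_coeffs c \<alpha>) (\<Prod>i\<in>UNIV. [:u $ i, v $ i:] ^ (\<alpha> $ i)))
      (smult (padic_coeffs c \<alpha>) (\<Prod>i\<in>UNIV. [:u' $ i, v $ i:] ^ (\<alpha> $ i)))"
    by simp
qed

lemma line_poly_of_int:
  "line_poly (padic_coeffs c :: nat ^ 'n \<Rightarrow> 'p::prime_card padic) (\<chi> i. of_int (u $ i)) (\<chi> i. of_int (v $ i)) =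
    of_int_poly (line_poly c u v)"
  by (simp add: line_poly_def padic_coeffs_def of_int_poly_hom.hom_sum of_int_poly_hom.hom_prod
      of_int_poly_hom.hom_power of_int_hom.map_poly_hom_smult of_int_hom.map_poly_pCons_hom)

lemma coeff_line_poly_of_int:
  "coeff (line_poly (padic_coeffs c :: nat ^ 'n \<Rightarrow> 'p::prime_card padic) (\<chi> i. of_int (u $ i)) (\<chi> i. of_int (v $ i))) k =
    of_int (coeff (line_poly c u v) k)"
  by (simp add: line_poly_of_int)

text \<open>Deduced from the p-adic version by reading integers as p-adic numbers, where
  divisibility by p^R is a bound on the norm.\<close>

lemma line_poly_cong:
  fixes c :: "nat ^ 'n \<Rightarrow> int" and u u' v :: "int ^ 'n"
  assumes "\<And>i. int CARD('p::prime_card) ^ R dvd u $ i - u' $ i"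
  shows "int CARD('p) ^ R dvd coeff (line_poly c u v) k - coeff (line_poly c u' v) k"
proof -
  let ?e = "real CARD('p) powi (- int R)"
  have "close_polys ?e
      (line_poly (padic_coeffs c) (\<chi> i. of_int (u $ i) :: 'p padic ^ 'n) (\<chi> i. of_int (v $ i)))
      (line_poly (padic_coeffs c) (\<chi> i. of_int (u' $ i)) (\<chi> i. of_int (v $ i)))"
  proof (rule close_polys_line)
    fix i
    have "padic_norm (of_int (u $ i - u' $ i) :: 'p padic) \<le> ?e"
      using assms[of i] by (simp only: padic_norm_of_int_le_iff)
    then show "padic_norm ((\<chi> i. of_int (u $ i) :: 'p padic ^ 'n) $ i - (\<chi> i. of_int (u' $ i)) $ i) \<le> ?e"
      by simp
  qed (simp_all add: padic_norm_of_int_le_1)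
  then have "padic_norm (of_int (coeff (line_poly c u v) k) - of_int (coeff (line_poly c u' v) k) :: 'p padic) \<le> ?e"
    unfolding close_polys_def coeff_line_poly_of_int by blast
  then have "padic_norm (of_int (coeff (line_poly c u v) k - coeff (line_poly c u' v) k) :: 'p padic) \<le> ?e"
    by simp
  then show ?thesis by (simp only: padic_norm_of_int_le_iff)
qed

text \<open>The closure of Z^n in Q_p^n, that is, the product of n copies of the ring of p-adic
  integers. Defining it as a closure makes integer vectors dense by construction.\<close>

definition int_points :: "('p::prime_card padic ^ 'n) set" where
  "int_points = closure (range (\<lambda>u. \<chi> i. of_int (u $ i)))"

lemma dist_vec_le_card:
  fixes x y :: "'p::prime_card padic ^ 'n"
  assumes "\<And>i. padic_norm (x $ i - y $ i) \<le> e"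
  shows "dist x y \<le> real CARD('n) * e"
proof -
  have "dist x y \<le> (\<Sum>i\<in>UNIV. dist (x $ i) (y $ i))"
    unfolding dist_vec_def by (rule L2_set_le_sum) auto
  also have "\<dots> \<le> real CARD('n) * e"
    using assms by (intro sum_bounded_above) (simp add: dist_padic_def)
  finally show ?thesis .
qed

lemma finite_int_box: "finite {u :: int ^ 'n. \<forall>i. u $ i \<in> {0..<N}}"
proof (rule finite_surj)
  show "finite (Pi\<^sub>E (UNIV :: 'n set) (\<lambda>_. {0..<N}))" by (intro finite_PiE) auto
  show "{u :: int ^ 'n. \<forall>i. u $ i \<in> {0..<N}} \<subseteq> vec_lambda ` Pi\<^sub>E UNIV (\<lambda>_. {0..<N})"
  proof
    fix u :: "int ^ 'n" assume "u \<in> {u. \<forall>i. u $ i \<in> {0..<N}}"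
    then show "u \<in> vec_lambda ` Pi\<^sub>E UNIV (\<lambda>_. {0..<N})"
      by (intro image_eqI[of _ _ "vec_nth u"]) auto
  qed
qed

text \<open>Closed in a complete space, and the residue vectors modulo p^l form a finite
  net.\<close>

lemma compact_int_points: "compact (int_points :: ('p::prime_card padic ^ 'n) set)"
  unfolding compact_eq_totally_bounded
proof (intro conjI allI impI)
  show "complete (int_points :: ('p padic ^ 'n) set)"
    unfolding complete_eq_closed int_points_def by simp
  fix e :: real assume e: "e > 0"
  define f where "f = (\<lambda>u :: int ^ 'n. \<chi> i. of_int (u $ i) :: 'p padic ^ 'n)"
  \<comment> \<open>One half of e is spent on approximating by an integer vector, the other on
    reducing it modulo p^l; the factor \<open>CARD('n)\<close> compares the Euclidean distance with
    the maximum norm.\<close>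
  have *: "e / (2 * real CARD('n)) > 0" using e by simp
  obtain l where l: "real CARD('p) powi (- int l) < e / (2 * real CARD('n))"
    by (rule exE[OF p_powi_eventually_less[where 'p = 'p, OF *]])
  define K where "K = f ` {u. \<forall>i. u $ i \<in> {0..<int CARD('p) ^ l}}"
  have "int_points \<subseteq> (\<Union>x\<in>K. ball x e)"
  proof
    fix x :: "'p padic ^ 'n" assume "x \<in> int_points"
    then have "\<forall>e>0. \<exists>y\<in>range f. dist y x < e"
      unfolding int_points_def closure_approachable f_def .
    then have "\<exists>y\<in>range f. dist y x < e / 2" using e by (elim allE[of _ "e / 2"]) simp
    then obtain u where u: "dist (f u) x < e / 2" by (elim bexE imageE) simp
    define w where "w = (\<chi> i. u $ i mod int CARD('p) ^ l)"
    have "dist (f w) (f u) \<le> real CARD('n) * real CARD('p) powi (- int l)"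
    proof (rule dist_vec_le_card)
      fix i
      have "int CARD('p) ^ l dvd w $ i - u $ i" by (simp add: w_def mod_eq_dvd_iff[symmetric])
      then have "padic_norm (of_int (w $ i - u $ i) :: 'p padic) \<le> real CARD('p) powi (- int l)"
        by (simp only: padic_norm_of_int_le_iff)
      then show "padic_norm (f w $ i - f u $ i) \<le> real CARD('p) powi (- int l)" by (simp add: f_def)
    qed
    also have "\<dots> < e / 2" using l by (simp add: field_simps)
    finally have "dist (f w) x < e" using u dist_triangle[of "f w" x "f u"] by simp
    moreover have "f w \<in> K" unfolding K_def by (intro imageI) (simp add: w_def)
    ultimately show "x \<in> (\<Union>x\<in>K. ball x e)" by auto
  qed
  moreover have "finite K" unfolding K_def by (intro finite_imageI finite_int_box)
  ultimately show "\<exists>k. finite k \<and> int_points \<subseteq> (\<Union>x\<in>k. ball x e :: ('p padic ^ 'n) set)" by blast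
qed

lemma int_points_cluster:
  fixes u :: "nat \<Rightarrow> int ^ 'n"
  obtains U :: "'p::prime_card padic ^ 'n" where
    "\<And>l N. \<exists>j\<ge>N. \<forall>i. padic_norm (U $ i - of_int (u j $ i)) \<le> real CARD('p) powi (- int l)"
proof -
  let ?f = "\<lambda>u :: int ^ 'n. \<chi> i. of_int (u $ i) :: 'p padic ^ 'n"
  have sc: "seq_compact (int_points :: ('p padic ^ 'n) set)"
    using compact_int_points compact_imp_seq_compact by blast
  have "\<forall>j. ?f (u j) \<in> int_points"
    unfolding int_points_def by (intro allI subsetD[OF closure_subset] rangeI)
  then have "\<exists>U\<in>int_points. \<exists>r :: nat \<Rightarrow> nat. strict_mono r \<and> ((\<lambda>j. ?f (u j)) \<circ> r) \<longlonglongrightarrow> U"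
    using sc unfolding seq_compact_def by (elim allE[of _ "\<lambda>j. ?f (u j)"]) simp
  then obtain U r where r: "strict_mono r" "((\<lambda>j. ?f (u j)) \<circ> r) \<longlonglongrightarrow> U"
    by (elim bexE exE conjE)
  show ?thesis
  proof (rule that)
    fix l N
    have "real CARD('p) powi (- int l) > 0" using card_prime_gt_1[where 'p = 'p] by (simp add: zero_less_power_int)
    from metric_LIMSEQ_D[OF r(2) this]
    obtain M where "\<forall>j\<ge>M. dist (((\<lambda>j. ?f (u j)) \<circ> r) j) U < real CARD('p) powi (- int l)"
      by (elim exE)
    then have M: "dist (?f (u (r j))) U < real CARD('p) powi (- int l)" if "j \<ge> M" for j
      using that by (simp only: o_apply)
    let ?j = "max M N"
    have "padic_norm (U $ i - of_int (u (r ?j) $ i)) \<le> real CARD('p) powi (- int l)" for i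
    proof -
      have "dist (U $ i) (?f (u (r ?j)) $ i) \<le> dist U (?f (u (r ?j)))" by (rule dist_vec_nth_le)
      also have "\<dots> < real CARD('p) powi (- int l)" using M[of ?j] by (simp add: dist_commute)
      finally show ?thesis by (simp add: dist_padic_def)
    qed
    moreover have "r ?j \<ge> N" using seq_suble[OF r(1), of ?j] by simp
    ultimately show "\<exists>j\<ge>N. \<forall>i. padic_norm (U $ i - of_int (u j $ i)) \<le> real CARD('p) powi (- int l)" by blast
  qed
qed

lemma padic_norm_of_int_unit:
  assumes "\<not> int CARD('p) dvd z" shows "padic_norm (of_int z :: 'p::prime_card padic) = 1"
proof -
  have "multiplicity (int CARD('p)) z = 0" using assms by (rule not_dvd_imp_multiplicity_0)
  moreover have "z \<noteq> 0" using assms by auto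
  ultimately show ?thesis by (simp add: padic_norm_of_int)
qed

text \<open>Compactness of the unit torus makes the nonvanishing of the directional derivatives uniform.\<close>

lemma uniform_nonvanishing:
  fixes c :: "nat ^ 'n \<Rightarrow> int"
  assumes H: "\<And>U :: 'p::prime_card padic ^ 'n. (\<And>i. padic_norm (U $ i) = 1) \<Longrightarrow>
    \<exists>v :: int ^ 'n. \<exists>k\<le>d. coeff (line_poly (padic_coeffs c) U (\<chi> i. of_int (v $ i))) k \<noteq> 0"
  shows "\<exists>R. \<forall>u :: int ^ 'n. (\<forall>i. \<not> int CARD('p) dvd u $ i) \<longrightarrow>
    (\<exists>v. \<exists>k\<le>d. \<not> int CARD('p) ^ R dvd coeff (line_poly c u v) k)"
proof (rule ccontr)
  assume "\<not> ?thesis"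
  then have "\<forall>R. \<exists>u :: int ^ 'n. (\<forall>i. \<not> int CARD('p) dvd u $ i) \<and>
    (\<forall>v. \<forall>k\<le>d. int CARD('p) ^ R dvd coeff (line_poly c u v) k)" by simp
  then obtain u :: "nat \<Rightarrow> int ^ 'n" where u: "\<And>R i. \<not> int CARD('p) dvd u R $ i"
    "\<And>R v k. k \<le> d \<Longrightarrow> int CARD('p) ^ R dvd coeff (line_poly c (u R) v) k" by metis
  \<comment> \<open>The points \<open>u R\<close> are counterexamples of increasing precision; at a
    cluster point, which is again a unit vector, every line coefficient of order at most d would
    have to vanish exactly.\<close>
  obtain U :: "'p padic ^ 'n" where U:
    "\<And>l N. \<exists>j\<ge>N. \<forall>i. padic_norm (U $ i - of_int (u j $ i)) \<le> real CARD('p) powi (- int l)"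
    using int_points_cluster[where 'p = 'p and u = u] by blast
  have n1: "padic_norm (U $ i) = 1" for i
  proof -
    obtain j where "padic_norm (U $ i - of_int (u j $ i)) \<le> real CARD('p) powi (- int 1)"
      using U[of 0 1] by blast
    moreover have "real CARD('p) powi (- int 1) < 1"
      using card_prime_gt_1[where 'p = 'p] by (simp add: field_simps)
    ultimately have lt: "padic_norm (U $ i - of_int (u j $ i)) < 1" by linarith
    have un: "padic_norm (of_int (u j $ i) :: 'p padic) = 1" by (rule padic_norm_of_int_unit[OF u(1)])
    have "padic_norm (U $ i) \<le> 1"
      using padic_norm_ultrametric[of "U $ i - of_int (u j $ i)" "of_int (u j $ i)"] lt un by simp
    moreover have "1 \<le> max (padic_norm (U $ i)) (padic_norm (U $ i - of_int (u j $ i)))"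
      using padic_norm_diff_le[of "U $ i" "U $ i - of_int (u j $ i)"] un by simp
    ultimately show ?thesis using lt by (simp add: le_max_iff_disj)
  qed
  obtain v :: "int ^ 'n" and k where k: "k \<le> d"
    and nz: "coeff (line_poly (padic_coeffs c) U (\<chi> i. of_int (v $ i))) k \<noteq> 0"
    using H[OF n1] by blast
  let ?C = "coeff (line_poly (padic_coeffs c) U (\<chi> i. of_int (v $ i))) k"
  have "padic_norm ?C > 0" using nz padic_norm_nonneg[of ?C] padic_norm_eq_0[of ?C] by linarith
  then obtain l where l: "real CARD('p) powi (- int l) < padic_norm ?C"
    using p_powi_eventually_less by blast
  \<comment> \<open>\<open>j \<ge> l\<close> is needed as well as closeness: the coefficients at
    \<open>u j\<close> are known to be divisible only by p^j.\<close>
  obtain j where j: "j \<ge> l" "\<And>i. padic_norm (U $ i - of_int (u j $ i)) \<le> real CARD('p) powi (- int l)"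
    using U[of l l] by blast
  have "close_polys (real CARD('p) powi (- int l)) (line_poly (padic_coeffs c) U (\<chi> i. of_int (v $ i)))
      (line_poly (padic_coeffs c) (\<chi> i. of_int (u j $ i)) (\<chi> i. of_int (v $ i)))"
    by (rule close_polys_line) (simp_all add: n1 j padic_norm_of_int_le_1)
  then have "padic_norm (?C - of_int (coeff (line_poly c (u j) v) k)) \<le> real CARD('p) powi (- int l)"
    unfolding close_polys_def coeff_line_poly_of_int by blast
  moreover have "padic_norm (of_int (coeff (line_poly c (u j) v) k) :: 'p padic) \<le> real CARD('p) powi (- int l)"
    unfolding padic_norm_of_int_le_iff using u(2)[OF k, of j v] j(1) by (rule power_le_dvd)
  ultimately have "padic_norm ?C \<le> real CARD('p) powi (- int l)"
    by (simp only: padic_norm_le_iff)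
  then show False using l by simp
qed

section \<open>Sublevel sets on the unit torus\<close>

lemma coeff_synthetic_div:
  "coeff (synthetic_div P t) k = coeff P (Suc k) + t * coeff (synthetic_div P t) (Suc k)"
proof -
  have "coeff (P + smult t (synthetic_div P t)) (Suc k) = coeff (pCons (poly P t) (synthetic_div P t)) (Suc k)"
    by (simp only: synthetic_div_correct)
  then show ?thesis by simp
qed

text \<open>The quotient is determined from the top downwards by b_k = c_(k+1) + t b_(k+1), so b_k
  involves only those coefficients c_m of \<open>P\<close> with m > k.\<close>

lemma synthetic_div_dvd:
  fixes P :: "int poly"
  assumes "\<And>m. m > k \<Longrightarrow> q dvd coeff P m" "m \<ge> k"
  shows "q dvd coeff (synthetic_div P t) m"
  using assms(2)
proof (induction "degree (synthetic_div P t) + 1 - m" arbitrary: m)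
  case 0
  then show ?case by (simp add: coeff_eq_0)
next
  case (Suc n)
  from Suc.hyps(1)[of "Suc m"] Suc.hyps(2) Suc.prems have "q dvd coeff (synthetic_div P t) (Suc m)" by simp
  then show ?case using assms(1)[of "Suc m"] Suc.prems by (subst coeff_synthetic_div) simp
qed

lemma prime_power_dvd_mult_cancel:
  fixes p :: int
  assumes "prime p" "p ^ j dvd x * y" "\<not> p ^ s dvd x"
  shows "p ^ (j - s) dvd y"
proof (cases "y = 0")
  case False
  have x: "x \<noteq> 0" using assms(3) by auto
  have nu: "\<not> is_unit p" using assms(1) by (simp add: prime_int_iff)
  have "j \<le> multiplicity p (x * y)"
    using assms(2) x False power_dvd_iff_le_multiplicity[OF _ nu, of "x * y" j] by simp
  moreover have "multiplicity p (x * y) = multiplicity p x + multiplicity p y"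
    using prime_elem_multiplicity_mult_distrib[OF prime_imp_prime_elem[OF assms(1)] x False] .
  moreover have "multiplicity p x < s"
    using assms(3) power_dvd_iff_le_multiplicity[OF x nu, of s] by simp
  ultimately have "j - s \<le> multiplicity p y" by simp
  then show ?thesis using power_dvd_iff_le_multiplicity[OF False nu, of "j - s"] by simp
qed simp

lemma dvd_poly_of_dvd_coeffs:
  fixes P :: "int poly"
  assumes "\<And>m. q dvd coeff P m"
  shows "q dvd poly P t"
  unfolding poly_altdef by (intro dvd_sum dvd_mult2 assms)

text \<open>
  A Newton divided difference of order \<open>k\<close> of \<open>P\<close> is congruent to the coefficient of
  order \<open>k\<close>; dividing off one point at a time replaces it by synthetic division.
\<close>

lemma separated_roots_bound:
  fixes P :: "int poly" and p :: int
  assumes "prime p"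
    and "\<not> p ^ b dvd coeff P k" "\<And>m. m > k \<Longrightarrow> p ^ b dvd coeff P m"
    and "finite T" "card T = Suc k" "\<And>t. t \<in> T \<Longrightarrow> p ^ j dvd poly P t"
    and "\<And>t t'. t \<in> T \<Longrightarrow> t' \<in> T \<Longrightarrow> t \<noteq> t' \<Longrightarrow> \<not> p ^ s dvd t - t'"
  shows "j < b + k * s"
  using assms(2-)
proof (induction k arbitrary: P T j)
  case 0
  then obtain t where t: "t \<in> T" by fastforce
  show ?case
  proof (rule ccontr)
    assume "\<not> j < b + 0 * s"
    then have 1: "p ^ b dvd poly P t" using power_le_dvd[OF 0(5)[OF t], of b] by simp
    obtain a Q where P: "P = pCons a Q" by (rule pCons_cases)
    have "p ^ b dvd poly Q t"
      by (rule dvd_poly_of_dvd_coeffs) (use 0(2)[of "Suc _"] P in simp)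
    then have "p ^ b dvd a" using 1 unfolding P by (simp add: dvd_add_left_iff)
    then show False using 0(1) by (simp add: P)
  qed
next
  case (Suc k)
  then obtain t\<^sub>0 where t0: "t\<^sub>0 \<in> T" by fastforce
  let ?Q = "synthetic_div P t\<^sub>0"
  have "j - s < b + k * s"
  proof (rule Suc.IH)
    \<comment> \<open>The coefficient of order k of the quotient is that of order
      \<open>Suc k\<close> of \<open>P\<close> plus a multiple of p^b, so it stays dominant.\<close>
    have "p ^ b dvd coeff ?Q (Suc k)" by (rule synthetic_div_dvd[of "Suc k"]) (use Suc.prems(2) in auto)
    then show "\<not> p ^ b dvd coeff ?Q k"
      using Suc.prems(1) by (subst coeff_synthetic_div) (simp add: dvd_add_left_iff)
    show "p ^ b dvd coeff ?Q m" if "m > k" for m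
      by (rule synthetic_div_dvd[of "Suc k"]) (use Suc.prems(2) that in auto)
    show "finite (T - {t\<^sub>0})" "card (T - {t\<^sub>0}) = Suc k" using Suc.prems(3,4) t0 by auto
    \<comment> \<open>Dividing by \<open>t - t\<^sub>0\<close>, which p^s does not divide, costs
      fewer than s of the j digits.\<close>
    show "p ^ (j - s) dvd poly ?Q t" if "t \<in> T - {t\<^sub>0}" for t
    proof (rule prime_power_dvd_mult_cancel[OF assms(1)])
      show "\<not> p ^ s dvd t - t\<^sub>0" using Suc.prems(6) that t0 by blast
      have "poly P t = poly ([:- t\<^sub>0, 1:] * ?Q + [:poly P t\<^sub>0:]) t" by (simp only: synthetic_div_correct')
      then have "(t - t\<^sub>0) * poly ?Q t = poly P t - poly P t\<^sub>0" by (simp add: algebra_simps)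
      moreover have "p ^ j dvd poly P t - poly P t\<^sub>0" using Suc.prems(5) that t0 by (intro dvd_diff) auto
      ultimately show "p ^ j dvd (t - t\<^sub>0) * poly ?Q t" by simp
    qed
    show "\<not> p ^ s dvd t - t'" if "t \<in> T - {t\<^sub>0}" "t' \<in> T - {t\<^sub>0}" "t \<noteq> t'" for t t'
      using Suc.prems(6) that by blast
  qed
  then show ?case by simp
qed

text \<open>By \<open>separated_roots_bound\<close>, k + 1 near roots cannot be pairwise incongruent
  modulo p^s. They therefore fill at most k residue classes, each with p^(L - s) members.\<close>

lemma card_near_roots:
  fixes P :: "int poly" and p :: nat
  assumes p: "prime p"
    and P: "\<not> int p ^ b dvd coeff P k" "\<And>m. m > k \<Longrightarrow> int p ^ b dvd coeff P m"
    and s: "b + k * s \<le> j" "s \<le> L"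
  shows "card {t \<in> {0..<int p ^ L}. int p ^ j dvd poly P t} \<le> k * p ^ (L - s)"
proof -
  let ?E = "{t \<in> {0..<int p ^ L}. int p ^ j dvd poly P t}"
  let ?r = "\<lambda>t. t mod int p ^ s"
  have p0: "int p > 0" using p by (simp add: prime_gt_0_nat)
  have fin: "finite ?E" by (rule finite_subset[of _ "{0..<int p ^ L}"]) auto
  have card_r: "card (?r ` ?E) \<le> k"
  proof (rule ccontr)
    assume "\<not> card (?r ` ?E) \<le> k"
    then have "Suc k \<le> card (?r ` ?E)" by simp
    then obtain X where X: "X \<subseteq> ?r ` ?E" "card X = Suc k" "finite X"
      by (rule obtain_subset_with_card_n)
    obtain T where T: "T \<subseteq> ?E" "inj_on ?r T" "X = ?r ` T"
      using X(1) unfolding subset_image_inj by (elim exE conjE)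
    have "j < b + k * s"
    proof (rule separated_roots_bound[of "int p" b P k T])
      show "prime (int p)" using p by simp
      show "finite T" using T(1) fin by (rule finite_subset)
      show "card T = Suc k" using card_image[OF T(2)] T(3) X(2) by simp
      show "int p ^ j dvd poly P t" if "t \<in> T" for t using T(1) that by blast
      show "\<not> int p ^ s dvd t - t'" if "t \<in> T" "t' \<in> T" "t \<noteq> t'" for t t'
        using T(2) that by (auto simp: inj_on_def mod_eq_dvd_iff[symmetric])
    qed (use P in auto)
    then show False using s by simp
  qed
  have "?E \<subseteq> (\<Union>r\<in>?r ` ?E. (\<lambda>i. r + int p ^ s * i) ` {0..<int p ^ (L - s)})"
  proof
    fix t assume t: "t \<in> ?E"
    have "t div int p ^ s < int p ^ (L - s)"
    proof (rule ccontr)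
      assume "\<not> t div int p ^ s < int p ^ (L - s)"
      then have "int p ^ s * int p ^ (L - s) \<le> int p ^ s * (t div int p ^ s)"
        using p0 by (intro mult_left_mono) auto
      also have "\<dots> \<le> int p ^ s * (t div int p ^ s) + t mod int p ^ s"
        using p0 by (intro le_add_same_cancel1[THEN iffD2] pos_mod_sign) simp
      also have "\<dots> = t" by (rule mult_div_mod_eq)
      finally show False using t s(2) by (simp flip: power_add)
    qed
    moreover have "t div int p ^ s \<ge> 0" using t p0 by (simp add: pos_imp_zdiv_nonneg_iff)
    moreover have "t = ?r t + int p ^ s * (t div int p ^ s)" by simp
    ultimately show "t \<in> (\<Union>r\<in>?r ` ?E. (\<lambda>i. r + int p ^ s * i) ` {0..<int p ^ (L - s)})"
      using t by (intro UN_I[of "?r t"] imageI image_eqI[of t _ "t div int p ^ s"]) auto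
  qed
  then have "card ?E \<le> card (\<Union>r\<in>?r ` ?E. (\<lambda>i. r + int p ^ s * i) ` {0..<int p ^ (L - s)})"
    using fin by (intro card_mono) auto
  also have "\<dots> \<le> (\<Sum>r\<in>?r ` ?E. card ((\<lambda>i. r + int p ^ s * i) ` {0..<int p ^ (L - s)}))"
    using fin by (intro card_UN_le) auto
  also have "\<dots> \<le> (\<Sum>r\<in>?r ` ?E. p ^ (L - s))"
  proof (rule sum_mono)
    fix r
    show "card ((\<lambda>i. r + int p ^ s * i) ` {0..<int p ^ (L - s)}) \<le> p ^ (L - s)"
      using card_image_le[of "{0..<int p ^ (L - s)}" "\<lambda>i. r + int p ^ s * i"]
      by (simp add: nat_power_eq)
  qed
  also have "\<dots> = card (?r ` ?E) * p ^ (L - s)" by simp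
  also have "\<dots> \<le> k * p ^ (L - s)" using card_r by (rule mult_le_mono1)
  finally show ?thesis .
qed

text \<open>A p-adic van der Corput estimate in a form uniform in k and b. The factor p pays for
  rounding s to an integer, d + 1 bounds the number k of classes, and p powr (\<gamma> b') makes the
  bound trivial when j < b. For k = 0 and b \<le> j there are no near roots at all.\<close>

lemma card_near_roots_powr:
  fixes P :: "int poly" and p :: nat
  assumes p: "prime p"
    and P: "\<not> int p ^ b dvd coeff P k" "\<And>m. m > k \<Longrightarrow> int p ^ b dvd coeff P m"
    and k: "k \<le> d" and \<gamma>: "\<gamma> \<ge> 0" "\<gamma> * real d \<le> 1" and b: "b \<le> b'" and j: "j \<le> L"
  shows "real (card {t \<in> {0..<int p ^ L}. int p ^ j dvd poly P t}) \<le>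
    real (d + 1) * real p * real p powr (\<gamma> * real b') * real p ^ L * real p powr (- \<gamma> * real j)"
proof -
  let ?E = "{t \<in> {0..<int p ^ L}. int p ^ j dvd poly P t}"
  have p1: "real p > 1" using prime_gt_1_nat[OF p] by simp
  have dp: "real (d + 1) * real p \<ge> 1"
    using mult_mono[of 1 "real (d + 1)" 1 "real p"] p1 by simp
  have eq: "real p powr (\<gamma> * real b') * real p ^ L * real p powr (- \<gamma> * real j)
      = real p ^ L * real p powr (\<gamma> * (real b' - real j))"
    by (simp add: powr_add[symmetric] right_diff_distrib mult.commute mult.left_commute)
  have "card ?E \<le> card {0..<int p ^ L}" by (rule card_mono) auto
  then have triv: "card ?E \<le> p ^ L" by (simp add: nat_power_eq)
  consider "j < b" | "k = 0" "b \<le> j" | "k > 0" "b \<le> j" by linarith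
  then have "real (card ?E) \<le> (real (d + 1) * real p) * (real p ^ L * real p powr (\<gamma> * (real b' - real j)))"
  proof cases
    case 1
    then have "1 \<le> real p powr (\<gamma> * (real b' - real j))"
      using p1 b \<gamma> by (intro ge_one_powr_ge_zero mult_nonneg_nonneg) auto
    then have "real p ^ L * 1 \<le> real p ^ L * real p powr (\<gamma> * (real b' - real j))"
      using p1 by (intro mult_left_mono) auto
    then have "real (card ?E) \<le> real p ^ L * real p powr (\<gamma> * (real b' - real j))"
      using of_nat_mono[OF triv, where 'a = real] by (simp only: of_nat_power mult_1_right)
    also have "\<dots> \<le> (real (d + 1) * real p) * (real p ^ L * real p powr (\<gamma> * (real b' - real j)))"
      using mult_right_mono[OF dp, of "real p ^ L * real p powr (\<gamma> * (real b' - real j))"] p1 by simp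
    finally show ?thesis .
  next
    case 2
    then have "card ?E \<le> 0 * p ^ (L - 0)" using P j by (intro card_near_roots[OF p]) auto
    then show ?thesis using p1 by simp
  next
    case 3
    \<comment> \<open>The largest separation allowed by b + k s \<le> j.\<close>
    define s where "s = (j - b) div k"
    have "k * s \<le> j - b" by (simp add: s_def)
    then have "b + k * s \<le> j" using 3 by linarith
    moreover have "s \<le> j" unfolding s_def using div_le_dividend[of "j - b" k] by linarith
    ultimately have s: "b + k * s \<le> j" "s \<le> L" using j by linarith+
    have "real (j - b) < real k * (real s + 1)"
    proof -
      have "j - b < k * (s + 1)" using 3 unfolding s_def by (simp add: dividend_less_times_div)
      then show ?thesis by (metis of_nat_1 of_nat_add of_nat_less_iff of_nat_mult)
    qed
    have "\<gamma> * (real j - real b') \<le> real s + 1"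
    proof (cases "real j \<le> real b'")
      case True
      then have "\<gamma> * (real j - real b') \<le> 0" using \<gamma> by (intro mult_nonneg_nonpos) auto
      then show ?thesis by simp
    next
      case False
      have "\<gamma> * (real j - real b') \<le> \<gamma> * (real j - real b)" using b \<gamma> by (intro mult_left_mono) auto
      also have "\<dots> \<le> \<gamma> * (real k * (real s + 1))"
        using \<gamma> \<open>real (j - b) < _\<close> 3 by (intro mult_left_mono) (auto simp: of_nat_diff)
      also have "\<dots> \<le> \<gamma> * (real d * (real s + 1))" using \<gamma> k by (intro mult_left_mono mult_right_mono) auto
      also have "\<dots> \<le> 1 * (real s + 1)" unfolding mult.assoc[symmetric] using \<gamma> by (intro mult_right_mono) auto
      finally show ?thesis by simp
    qed
    then have "real p powr (- (real s + 1)) \<le> real p powr (\<gamma> * (real b' - real j))"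
      using p1 by (intro powr_mono) (auto simp: algebra_simps)
    then have "real p * real p powr (- (real s + 1)) \<le> real p * real p powr (\<gamma> * (real b' - real j))"
      using p1 by (intro mult_left_mono) auto
    moreover have "real p * real p powr (- (real s + 1)) = real p powr (- real s)"
      using p1 by (simp add: powr_mult_base)
    ultimately have ps: "real p powr (- real s) \<le> real p * real p powr (\<gamma> * (real b' - real j))" by simp
    have "real (card ?E) \<le> real (k * p ^ (L - s))"
      using card_near_roots[OF p P s] by (simp only: of_nat_le_iff)
    also have "\<dots> = real k * (real p ^ L * real p powr (- real s))"
    proof -
      have "real p ^ (L - s) = real p ^ L / real p ^ s" using p1 s(2) by (intro power_diff) auto
      moreover have "real p powr (- real s) = inverse (real p ^ s)" using p1 by (simp add: powr_minus powr_realpow)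
      ultimately show ?thesis by (simp add: divide_inverse)
    qed
    also have "\<dots> \<le> real (d + 1) * (real p ^ L * (real p * real p powr (\<gamma> * (real b' - real j))))"
      using ps k p1 by (intro mult_mono) auto
    finally show ?thesis by (simp add: mult_ac)
  qed
  then show ?thesis using eq by (simp only: mult.assoc)
qed

section \<open>Slicing boxes by translated lines\<close>

lemma card_int_box: "card {u :: int ^ 'n. \<forall>i. u $ i \<in> {0..<int N}} = N ^ CARD('n)"
proof -
  have "bij_betw vec_lambda (Pi\<^sub>E (UNIV :: 'n set) (\<lambda>_. {0..<int N})) {u. \<forall>i. u $ i \<in> {0..<int N}}"
    by (rule bij_betwI[of _ _ _ vec_nth]) auto
  then have "card {u :: int ^ 'n. \<forall>i. u $ i \<in> {0..<int N}} = card (Pi\<^sub>E (UNIV :: 'n set) (\<lambda>_. {0..<int N}))"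
    by (metis bij_betw_same_card)
  then show ?thesis by (simp add: card_PiE)
qed

text \<open>Translation followed by reduction into the box is injective on the box, and periodicity
  carries the predicate along.\<close>

lemma card_shift_le:
  fixes Pr :: "int ^ 'n \<Rightarrow> bool" and N :: nat
  assumes N: "N > 0" and per: "\<And>x y. (\<And>i. int N dvd x $ i - y $ i) \<Longrightarrow> Pr x = Pr y"
  shows "card {u. (\<forall>i. u $ i \<in> {0..<int N}) \<and> Pr u} \<le> card {u. (\<forall>i. u $ i \<in> {0..<int N}) \<and> Pr (u + z)}"
proof (rule card_inj_on_le)
  let ?g = "\<lambda>u :: int ^ 'n. \<chi> i. (u $ i - z $ i) mod int N"
  show "inj_on ?g {u. (\<forall>i. u $ i \<in> {0..<int N}) \<and> Pr u}"
  proof (rule inj_onI)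
    fix x y assume x: "x \<in> {u. (\<forall>i. u $ i \<in> {0..<int N}) \<and> Pr u}"
      and y: "y \<in> {u. (\<forall>i. u $ i \<in> {0..<int N}) \<and> Pr u}" and eq: "?g x = ?g y"
    have "x $ i = y $ i" for i
    proof -
      have "(x $ i - z $ i) mod int N = (y $ i - z $ i) mod int N"
        using arg_cong[OF eq, of "\<lambda>w. w $ i"] by simp
      then have "int N dvd (x $ i - z $ i) - (y $ i - z $ i)" by (simp add: mod_eq_dvd_iff)
      then have "x $ i mod int N = y $ i mod int N" by (simp add: mod_eq_dvd_iff)
      then show ?thesis using x y by simp
    qed
    then show "x = y" by (simp add: vec_eq_iff)
  qed
  show "?g ` {u. (\<forall>i. u $ i \<in> {0..<int N}) \<and> Pr u} \<subseteq> {u. (\<forall>i. u $ i \<in> {0..<int N}) \<and> Pr (u + z)}"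
  proof (intro subsetI, elim imageE)
    fix w u assume u: "u \<in> {u. (\<forall>i. u $ i \<in> {0..<int N}) \<and> Pr u}" and w: "w = ?g u"
    have "int N dvd (w + z) $ i - u $ i" for i
    proof -
      have "int N dvd (u $ i - z $ i) mod int N - (u $ i - z $ i)" by (simp add: mod_eq_dvd_iff[symmetric])
      then show ?thesis by (simp add: w algebra_simps)
    qed
    then have "Pr (w + z)" using per u by blast
    then show "w \<in> {u. (\<forall>i. u $ i \<in> {0..<int N}) \<and> Pr (u + z)}" using N by (simp add: w)
  qed
  show "finite {u. (\<forall>i. u $ i \<in> {0..<int N}) \<and> Pr (u + z)}"
    by (rule finite_subset[OF _ finite_int_box[of "int N"]]) auto
qed

lemma sum_card_swap:
  assumes "finite A" "finite B"
  shows "(\<Sum>a\<in>A. card {b\<in>B. Q a b}) = (\<Sum>b\<in>B. card {a\<in>A. Q a b})"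
proof -
  have c: "card {b\<in>B. Q a b} = (\<Sum>b\<in>B. if Q a b then 1 else 0)" for a
    using assms by (simp add: sum.If_cases Int_def)
  have d: "card {a\<in>A. Q a b} = (\<Sum>a\<in>A. if Q a b then 1 else 0)" for b
    using assms by (simp add: sum.If_cases Int_def)
  show ?thesis unfolding c d by (rule sum.swap)
qed

text \<open>Averaging over the translates by \<open>t *s w\<close> replaces a decomposition of the
  box into lines, so \<open>w\<close> may be any vector; it will be a multiple of p^R.\<close>

lemma card_le_line_sections:
  fixes Pr :: "int ^ 'n \<Rightarrow> bool" and N :: nat
  assumes N: "N > 0" and per: "\<And>x y. (\<And>i. int N dvd x $ i - y $ i) \<Longrightarrow> Pr x = Pr y"
    and K: "\<And>u. real (card {t \<in> {0..<int N}. Pr (u + t *s w)}) \<le> K"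
  shows "real N * real (card {u. (\<forall>i. u $ i \<in> {0..<int N}) \<and> Pr u}) \<le> real N ^ CARD('n) * K"
proof -
  let ?B = "{u :: int ^ 'n. \<forall>i. u $ i \<in> {0..<int N}}"
  have fB: "finite ?B" by (rule finite_int_box)
  have "N * card {u. (\<forall>i. u $ i \<in> {0..<int N}) \<and> Pr u} = (\<Sum>t\<in>{0..<int N}. card {u. (\<forall>i. u $ i \<in> {0..<int N}) \<and> Pr u})"
    by simp
  also have "\<dots> \<le> (\<Sum>t\<in>{0..<int N}. card {u\<in>?B. Pr (u + t *s w)})"
  proof (rule sum_mono)
    fix t
    show "card {u. (\<forall>i. u $ i \<in> {0..<int N}) \<and> Pr u} \<le> card {u\<in>?B. Pr (u + t *s w)}"
      using card_shift_le[OF N, of Pr "t *s w"] per by simp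
  qed
  also have "\<dots> = (\<Sum>u\<in>?B. card {t \<in> {0..<int N}. Pr (u + t *s w)})"
    by (rule sum_card_swap) (simp, rule fB)
  finally have "real (N * card {u. (\<forall>i. u $ i \<in> {0..<int N}) \<and> Pr u}) \<le>
      real (\<Sum>u\<in>?B. card {t \<in> {0..<int N}. Pr (u + t *s w)})" by (simp only: of_nat_le_iff)
  also have "\<dots> = (\<Sum>u\<in>?B. real (card {t \<in> {0..<int N}. Pr (u + t *s w)}))" by simp
  also have "\<dots> \<le> (\<Sum>u\<in>?B. K)" by (rule sum_mono) (rule K)
  also have "\<dots> = real N ^ CARD('n) * K" by (simp only: sum_constant card_int_box of_nat_power)
  finally show ?thesis by simp
qed

lemma coeff_line_poly_scale:
  fixes c :: "nat ^ 'n \<Rightarrow> 'a::comm_ring_1"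
  shows "coeff (line_poly c u (\<chi> i. q * v $ i)) m = q ^ m * coeff (line_poly c u v) m"
proof -
  have pw: "pcompose (P ^ n) R = pcompose P R ^ n" for P R :: "'a poly" and n
    by (induction n) (simp_all add: pcompose_mult pcompose_1)
  have "line_poly c u (\<chi> i. q * v $ i) = pcompose (line_poly c u v) [:0, q:]"
    by (simp add: line_poly_def pcompose_sum pcompose_smult pcompose_prod pw pcompose_pCons mult.commute)
  then show ?thesis by (simp add: coeff_pcompose_linear)
qed

lemma coeff_line_poly_diff_dvd:
  fixes c c' :: "nat ^ 'n \<Rightarrow> int"
  assumes "finite {\<alpha>. c \<alpha> \<noteq> 0}" "finite {\<alpha>. c' \<alpha> \<noteq> 0}" "\<And>\<alpha>. q dvd c' \<alpha> - c \<alpha>"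
  shows "q dvd coeff (line_poly c' u v) m - coeff (line_poly c u v) m"
proof -
  let ?T = "{\<alpha>. c \<alpha> \<noteq> 0} \<union> {\<alpha>. c' \<alpha> \<noteq> 0}"
  have fin: "finite ?T" using assms by simp
  have 1: "line_poly c' u v = (\<Sum>\<alpha>\<in>?T. smult (c' \<alpha>) (\<Prod>i\<in>UNIV. [:u $ i, v $ i:] ^ (\<alpha> $ i)))"
    by (rule line_poly_superset[OF fin]) simp
  have 2: "line_poly c u v = (\<Sum>\<alpha>\<in>?T. smult (c \<alpha>) (\<Prod>i\<in>UNIV. [:u $ i, v $ i:] ^ (\<alpha> $ i)))"
    by (rule line_poly_superset[OF fin]) simp
  have "coeff (line_poly c' u v) m - coeff (line_poly c u v) m =
      (\<Sum>\<alpha>\<in>?T. (c' \<alpha> - c \<alpha>) * coeff (\<Prod>i\<in>UNIV. [:u $ i, v $ i:] ^ (\<alpha> $ i)) m)"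
    unfolding 1 2 by (simp add: coeff_sum sum_subtractf left_diff_distrib)
  then show ?thesis using assms(3) by (simp add: dvd_sum)
qed

lemma monomial_at_diff_dvd:
  fixes x y :: "int ^ 'n"
  assumes "\<And>i. N dvd x $ i - y $ i"
  shows "N dvd monomial_at x \<alpha> - monomial_at y \<alpha>"
proof -
  have "[monomial_at x \<alpha> = monomial_at y \<alpha>] (mod N)"
    unfolding monomial_at_def using assms by (intro cong_prod cong_pow) (simp add: cong_iff_dvd_diff)
  then show ?thesis by (simp add: cong_iff_dvd_diff)
qed

lemma eval_diff_dvd:
  fixes x y :: "int ^ 'n"
  assumes "\<And>i. N dvd x $ i - y $ i"
  shows "N dvd (\<Sum>\<alpha>\<in>T. c \<alpha> * monomial_at x \<alpha>) - (\<Sum>\<alpha>\<in>T. c \<alpha> * monomial_at y \<alpha>)"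
  unfolding sum_subtractf[symmetric] right_diff_distrib[symmetric]
  by (intro dvd_sum dvd_mult monomial_at_diff_dvd assms)

text \<open>Stretching the direction by p^R multiplies the coefficient of order m by p^(R m). The
  exponent R (k + 1) then separates order k from all higher orders, as
  \<open>separated_roots_bound\<close> demands, and this persists for u congruent to
  \<open>u0\<close> and for c' congruent to c.\<close>

lemma power_line_coeff_not_dvd:
  fixes c c' :: "nat ^ 'n \<Rightarrow> int"
  assumes fin: "finite {\<alpha>. c \<alpha> \<noteq> 0}" "finite {\<alpha>. c' \<alpha> \<noteq> 0}"
    and cc': "\<And>\<alpha>. int CARD('p::prime_card) ^ (R * (d + 1)) dvd c' \<alpha> - c \<alpha>" and k: "k \<le> d"
    and nd: "\<not> int CARD('p) ^ R dvd coeff (line_poly c u0 v) k"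
    and u: "\<And>i. int CARD('p) ^ R dvd u $ i - u0 $ i"
  shows "\<not> int CARD('p) ^ (R * (k + 1)) dvd coeff (line_poly c' u (\<chi> i. int CARD('p) ^ R * v $ i)) k"
    and "m > k \<Longrightarrow> int CARD('p) ^ (R * (k + 1)) dvd coeff (line_poly c' u (\<chi> i. int CARD('p) ^ R * v $ i)) m"
proof -
  let ?p = "int CARD('p)"
  have p0: "?p \<noteq> 0" using prime_gt_0_nat[OF prime_card[where 'a = 'p]] by simp
  have "?p ^ R dvd coeff (line_poly c' u v) k - coeff (line_poly c u0 v) k"
  proof -
    have "?p ^ R dvd coeff (line_poly c' u v) k - coeff (line_poly c' u0 v) k"
      by (rule line_poly_cong[OF u])
    moreover have "?p ^ R dvd coeff (line_poly c' u0 v) k - coeff (line_poly c u0 v) k"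
      by (rule coeff_line_poly_diff_dvd[OF fin power_le_dvd[OF cc']]) simp
    ultimately have "?p ^ R dvd (coeff (line_poly c' u v) k - coeff (line_poly c' u0 v) k) +
        (coeff (line_poly c' u0 v) k - coeff (line_poly c u0 v) k)" by (rule dvd_add)
    then show ?thesis by simp
  qed
  then have "\<not> ?p ^ R dvd coeff (line_poly c' u v) k"
    using nd dvd_diff_right_iff by blast
  then show "\<not> ?p ^ (R * (k + 1)) dvd coeff (line_poly c' u (\<chi> i. ?p ^ R * v $ i)) k"
    unfolding coeff_line_poly_scale using p0 by (simp add: power_add power_mult[symmetric])
  assume "m > k"
  then have "R * (k + 1) \<le> R * m" by (intro mult_le_mono2) simp
  then have "?p ^ (R * (k + 1)) dvd (?p ^ R) ^ m"
    unfolding power_mult[symmetric] by (rule le_imp_power_dvd)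
  then show "?p ^ (R * (k + 1)) dvd coeff (line_poly c' u (\<chi> i. ?p ^ R * v $ i)) m"
    unfolding coeff_line_poly_scale by (rule dvd_mult2)
qed

text \<open>On a residue class modulo p^R a single direction and order work for all points and all
  perturbations c'. Lines in direction p^R v stay in the class, so slicing applies class by class;
  the constant depends neither on c' nor on j and L.\<close>

lemma card_unit_sublevel:
  fixes c :: "nat ^ 'n \<Rightarrow> int"
  assumes fin: "finite {\<alpha>. c \<alpha> \<noteq> 0}"
    and R: "\<And>u :: int ^ 'n. (\<And>i. \<not> int CARD('p::prime_card) dvd u $ i) \<Longrightarrow>
      \<exists>v. \<exists>k\<le>d. \<not> int CARD('p) ^ R dvd coeff (line_poly c u v) k"
    and \<gamma>: "\<gamma> \<ge> 0" "\<gamma> * real d \<le> 1"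
  obtains C where "C > 0"
    "\<And>c' j L. finite {\<alpha>. c' \<alpha> \<noteq> 0} \<Longrightarrow> (\<And>\<alpha>. int CARD('p) ^ (R * (d + 1)) dvd c' \<alpha> - c \<alpha>) \<Longrightarrow> j \<le> L \<Longrightarrow>
      real (card {u. (\<forall>i. u $ i \<in> {0..<int CARD('p) ^ L}) \<and> (\<forall>i. \<not> int CARD('p) dvd u $ i) \<and>
        int CARD('p) ^ j dvd (\<Sum>\<alpha> | c' \<alpha> \<noteq> 0. c' \<alpha> * monomial_at u \<alpha>)})
      \<le> C * real CARD('p) ^ (L * CARD('n)) * real CARD('p) powr (- \<gamma> * real j)"
proof -
  let ?p = "CARD('p)"
  have p1: "real ?p > 1" by (rule card_prime_gt_1)
  have pn0: "?p > 0" by (rule prime_gt_0_nat[OF prime_card[where 'a = 'p]])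
  \<comment> \<open>\<open>D\<close> is the constant of \<open>card_near_roots_powr\<close> with b'
    = R (d + 1). In \<open>C\<close> the first entry covers L < R trivially, the second sums
    \<open>D\<close> over the residue vectors modulo p^R.\<close>
  define D where "D = real (d + 1) * real ?p * real ?p powr (\<gamma> * real (R * (d + 1)))"
  define C where "C = max (real ?p powr (\<gamma> * real R)) (real ((?p ^ R) ^ CARD('n)) * D)"
  have "C > 0" using p1 by (simp add: C_def less_max_iff_disj)
  moreover have "real (card {u. (\<forall>i. u $ i \<in> {0..<int ?p ^ L}) \<and> (\<forall>i. \<not> int ?p dvd u $ i) \<and>
        int ?p ^ j dvd (\<Sum>\<alpha> | c' \<alpha> \<noteq> 0. c' \<alpha> * monomial_at u \<alpha>)})
      \<le> C * real ?p ^ (L * CARD('n)) * real ?p powr (- \<gamma> * real j)"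
    if c': "finite {\<alpha>. c' \<alpha> \<noteq> 0}" "\<And>\<alpha>. int ?p ^ (R * (d + 1)) dvd c' \<alpha> - c \<alpha>" and j: "j \<le> L"
    for c' :: "nat ^ 'n \<Rightarrow> int" and j L
  proof -
    let ?ev = "\<lambda>u. \<Sum>\<alpha> | c' \<alpha> \<noteq> 0. c' \<alpha> * monomial_at u \<alpha>"
    define B where "B = {u :: int ^ 'n. \<forall>i. u $ i \<in> {0..<int (?p ^ L)}}"
    define E where "E = {u \<in> B. (\<forall>i. \<not> int ?p dvd u $ i) \<and> int ?p ^ j dvd ?ev u}"
    have fB: "finite B" unfolding B_def by (rule finite_int_box)
    have cB: "card B = (?p ^ L) ^ CARD('n)" unfolding B_def by (rule card_int_box)
    have Eeq: "{u. (\<forall>i. u $ i \<in> {0..<int ?p ^ L}) \<and> (\<forall>i. \<not> int ?p dvd u $ i) \<and> int ?p ^ j dvd ?ev u} = E"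
      by (simp add: E_def B_def)
    have pw0: "real ?p powr (- \<gamma> * real j) > 0" using p1 by simp
    have "real (card E) \<le> C * (real ?p ^ (L * CARD('n)) * real ?p powr (- \<gamma> * real j))"
    proof (cases "R \<le> L")
      case False
      have "card E \<le> card B" by (rule card_mono[OF fB]) (auto simp: E_def)
      then have "real (card E) \<le> real ?p ^ (L * CARD('n)) * 1"
        unfolding cB by (simp flip: power_mult of_nat_power)
      also have "\<dots> \<le> real ?p ^ (L * CARD('n)) * (real ?p powr (\<gamma> * real R) * real ?p powr (- \<gamma> * real j))"
      proof (rule mult_left_mono)
        have "\<gamma> * real j \<le> \<gamma> * real R" using False j \<gamma> by (intro mult_left_mono) auto
        then show "1 \<le> real ?p powr (\<gamma> * real R) * real ?p powr (- \<gamma> * real j)"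
          using p1 by (simp add: powr_add[symmetric] ge_one_powr_ge_zero)
      qed simp
      also have "\<dots> = real ?p powr (\<gamma> * real R) * (real ?p ^ (L * CARD('n)) * real ?p powr (- \<gamma> * real j))"
        by (simp only: mult_ac)
      also have "\<dots> \<le> C * (real ?p ^ (L * CARD('n)) * real ?p powr (- \<gamma> * real j))"
        by (rule mult_right_mono) (simp_all add: C_def)
      finally show ?thesis .
    next
      case True
      define B0 where "B0 = {u :: int ^ 'n. \<forall>i. u $ i \<in> {0..<int (?p ^ R)}}"
      have fB0: "finite B0" unfolding B0_def by (rule finite_int_box)
      \<comment> \<open>The class condition is part of the predicate, so that a line starting
        outside the class of \<open>u0\<close> contributes nothing.\<close>
      define Pr where "Pr u0 u \<longleftrightarrow> (\<forall>i. int ?p ^ R dvd u $ i - u0 $ i) \<and> int ?p ^ j dvd ?ev u" for u0 u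
      have per: "Pr u0 x = Pr u0 y" if "\<And>i. int (?p ^ L) dvd x $ i - y $ i" for u0 x y
      proof -
        have "int ?p ^ R dvd x $ i - y $ i" for i
          by (rule power_le_dvd[OF _ True]) (use that[of i] in simp)
        then have "int ?p ^ R dvd x $ i - u0 $ i \<longleftrightarrow> int ?p ^ R dvd y $ i - u0 $ i" for i
          using dvd_add_right_iff[of "int ?p ^ R" "x $ i - y $ i" "y $ i - u0 $ i"] by simp
        moreover have "int ?p ^ j dvd ?ev x - ?ev y"
          by (rule eval_diff_dvd, rule power_le_dvd[OF _ j]) (use that in simp)
        then have "int ?p ^ j dvd ?ev x \<longleftrightarrow> int ?p ^ j dvd ?ev y"
          using dvd_add_right_iff[of "int ?p ^ j" "?ev x - ?ev y" "?ev y"] by simp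
        ultimately show ?thesis unfolding Pr_def by blast
      qed
      have sec: "real (card {t \<in> {0..<int (?p ^ L)}. Pr u0 (u + t *s (\<chi> i. int ?p ^ R * v $ i))})
          \<le> D * real ?p ^ L * real ?p powr (- \<gamma> * real j)"
        if k: "k \<le> d" "\<not> int ?p ^ R dvd coeff (line_poly c u0 v) k" for u0 u v k
      proof (cases "\<forall>i. int ?p ^ R dvd u $ i - u0 $ i")
        case cl: True
        let ?w = "\<chi> i. int ?p ^ R * v $ i"
        let ?P = "line_poly c' u ?w"
        have "poly ?P t = ?ev (u + t *s ?w)" for t
        proof -
          have "poly ?P t = (\<Sum>\<alpha> | c' \<alpha> \<noteq> 0. c' \<alpha> * monomial_at (\<chi> i. u $ i + t * ?w $ i) \<alpha>)"
            by (rule poly_line_poly[OF c'(1)]) simp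
          moreover have "(\<chi> i. u $ i + t * ?w $ i) = u + t *s ?w" by (simp add: vec_eq_iff)
          ultimately show ?thesis by simp
        qed
        then have "{t \<in> {0..<int (?p ^ L)}. Pr u0 (u + t *s ?w)} \<subseteq> {t \<in> {0..<int ?p ^ L}. int ?p ^ j dvd poly ?P t}"
          by (auto simp: Pr_def)
        then have "card {t \<in> {0..<int (?p ^ L)}. Pr u0 (u + t *s ?w)} \<le> card {t \<in> {0..<int ?p ^ L}. int ?p ^ j dvd poly ?P t}"
          by (intro card_mono finite_subset[OF Collect_restrict finite_atLeastLessThan_int])
        then have "real (card {t \<in> {0..<int (?p ^ L)}. Pr u0 (u + t *s ?w)}) \<le>
            real (card {t \<in> {0..<int ?p ^ L}. int ?p ^ j dvd poly ?P t})" by simp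
        also have "\<dots> \<le> D * real ?p ^ L * real ?p powr (- \<gamma> * real j)"
          unfolding D_def
        proof (rule card_near_roots_powr[OF prime_card _ _ k(1) \<gamma> _ j])
          show "\<not> int ?p ^ (R * (k + 1)) dvd coeff ?P k"
            using power_line_coeff_not_dvd(1)[OF fin c'(1) c'(2) k] cl by blast
          show "int ?p ^ (R * (k + 1)) dvd coeff ?P m" if "m > k" for m
            using power_line_coeff_not_dvd(2)[OF fin c'(1) c'(2) k _ that] cl by blast
          show "R * (k + 1) \<le> R * (d + 1)" using k by (intro mult_le_mono2) simp
        qed
        finally show ?thesis .
      next
        case False
        have "\<not> Pr u0 (u + t *s (\<chi> i. int ?p ^ R * v $ i))" for t
        proof -
          obtain i where i: "\<not> int ?p ^ R dvd u $ i - u0 $ i" using False by blast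
          have "(u + t *s (\<chi> i. int ?p ^ R * v $ i)) $ i - u0 $ i = int ?p ^ R * (t * v $ i) + (u $ i - u0 $ i)"
            by simp
          then have "\<not> int ?p ^ R dvd (u + t *s (\<chi> i. int ?p ^ R * v $ i)) $ i - u0 $ i"
            using i by (simp only: dvd_add_right_iff[OF dvd_triv_left]) simp
          then show ?thesis unfolding Pr_def by blast
        qed
        then show ?thesis using p1 by (simp add: D_def)
      qed
      have cls: "real (card {u \<in> B. Pr u0 u}) \<le> D * (real ?p ^ (L * CARD('n)) * real ?p powr (- \<gamma> * real j))"
        if u0: "\<And>i. \<not> int ?p dvd u0 $ i" for u0
      proof -
        obtain v k where k: "k \<le> d" "\<not> int ?p ^ R dvd coeff (line_poly c u0 v) k" using R[OF u0] by blast
        have "real (?p ^ L) * real (card {u. (\<forall>i. u $ i \<in> {0..<int (?p ^ L)}) \<and> Pr u0 u}) \<le>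
            real (?p ^ L) ^ CARD('n) * (D * real ?p ^ L * real ?p powr (- \<gamma> * real j))"
          by (rule card_le_line_sections[OF _ per sec[OF k]]) (use pn0 in auto)
        also have "\<dots> = real (?p ^ L) * (D * (real ?p ^ (L * CARD('n)) * real ?p powr (- \<gamma> * real j)))"
          by (simp add: power_mult[symmetric])
        finally have "real (card {u. (\<forall>i. u $ i \<in> {0..<int (?p ^ L)}) \<and> Pr u0 u}) \<le>
            D * (real ?p ^ (L * CARD('n)) * real ?p powr (- \<gamma> * real j))"
          using pn0 by (subst (asm) mult_le_cancel_left_pos) auto
        then show ?thesis by (simp add: B_def)
      qed
      have "E \<subseteq> (\<Union>u0 \<in> {u0 \<in> B0. \<forall>i. \<not> int ?p dvd u0 $ i}. {u \<in> B. Pr u0 u})"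
      proof
        fix u assume u: "u \<in> E"
        show "u \<in> (\<Union>u0 \<in> {u0 \<in> B0. \<forall>i. \<not> int ?p dvd u0 $ i}. {u \<in> B. Pr u0 u})"
        \<comment> \<open>For R = 0 the hypothesis fails at every unit vector, because 1 divides
          every coefficient, so there is no such u. Otherwise p divides p^R, and reduction modulo
          p^R preserves units.\<close>
        proof (cases "R = 0")
          case True
          have False using R[of u] u True by (simp add: E_def)
          then show ?thesis ..
        next
          case False
          let ?u0 = "\<chi> i. u $ i mod int ?p ^ R"
          have "int ?p dvd int ?p ^ R" using False by (simp add: dvd_power)
          then have "\<not> int ?p dvd ?u0 $ i" for i using u by (simp add: E_def dvd_mod_iff)
          moreover have "?u0 \<in> B0" using pn0 by (simp add: B0_def)
          moreover have "int ?p ^ R dvd u $ i - ?u0 $ i" for i by (simp add: minus_mod_eq_mult_div)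
          ultimately show ?thesis using u by (intro UN_I[of ?u0]) (simp_all add: E_def Pr_def)
        qed
      qed
      then have "card E \<le> card (\<Union>u0 \<in> {u0 \<in> B0. \<forall>i. \<not> int ?p dvd u0 $ i}. {u \<in> B. Pr u0 u})"
        using fB0 fB by (intro card_mono) auto
      also have "\<dots> \<le> (\<Sum>u0 \<in> {u0 \<in> B0. \<forall>i. \<not> int ?p dvd u0 $ i}. card {u \<in> B. Pr u0 u})"
        using fB0 by (intro card_UN_le) auto
      finally have "real (card E) \<le> (\<Sum>u0 \<in> {u0 \<in> B0. \<forall>i. \<not> int ?p dvd u0 $ i}. real (card {u \<in> B. Pr u0 u}))"
        by (simp only: of_nat_sum[symmetric] of_nat_le_iff)
      also have "\<dots> \<le> (\<Sum>u0 \<in> {u0 \<in> B0. \<forall>i. \<not> int ?p dvd u0 $ i}.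
          D * (real ?p ^ (L * CARD('n)) * real ?p powr (- \<gamma> * real j)))"
        by (rule sum_mono) (use cls in simp)
      also have "\<dots> \<le> (\<Sum>u0 \<in> B0. D * (real ?p ^ (L * CARD('n)) * real ?p powr (- \<gamma> * real j)))"
        using fB0 p1 by (intro sum_mono2) (auto simp: D_def)
      also have "\<dots> = (real ((?p ^ R) ^ CARD('n)) * D) * (real ?p ^ (L * CARD('n)) * real ?p powr (- \<gamma> * real j))"
        using card_int_box[of "?p ^ R", where 'n = 'n] by (simp add: B0_def)
      also have "\<dots> \<le> C * (real ?p ^ (L * CARD('n)) * real ?p powr (- \<gamma> * real j))"
        by (rule mult_right_mono) (simp_all add: C_def)
      finally show ?thesis .
    qed
    then show ?thesis unfolding Eeq by (simp only: mult.assoc)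
  qed
  ultimately show ?thesis by (rule that)
qed

section \<open>The Newton polyhedron and its compact faces\<close>

definition real_vec :: "nat ^ 'n \<Rightarrow> real ^ 'n" where
  "real_vec \<alpha> = (\<chi> i. real (\<alpha> $ i))"

lemma real_vec_nth [simp]: "real_vec \<alpha> $ i = real (\<alpha> $ i)"
  by (simp add: real_vec_def)

lemma inner_real_vec: "real_vec k \<bullet> real_vec \<alpha> = real (dotn k \<alpha>)"
  by (simp add: inner_vec_def dotn_def)

text \<open>Dickson's lemma, by induction on the set \<open>J\<close> of compared coordinates. If
  x_j exceeds the j-th entries of all vectors found for \<open>J\<close>, these also dominate in
  coordinate j; the finitely many remaining values of x_j are treated one by one.\<close>

lemma finite_dominating_subset:
  fixes X :: "(nat ^ 'n) set"
  shows "\<exists>S. finite S \<and> S \<subseteq> X \<and> (\<forall>x\<in>X. \<exists>s\<in>S. \<forall>i. s $ i \<le> x $ i)"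
proof -
  have "\<exists>S. finite S \<and> S \<subseteq> X \<and> (\<forall>x\<in>X. \<exists>s\<in>S. \<forall>i\<in>J. s $ i \<le> x $ i)" if "finite J" for J :: "'n set" and X :: "(nat ^ 'n) set"
    using that
  proof (induction J arbitrary: X rule: finite_induct)
    case empty
    show ?case
    proof (cases "X = {}")
      case False
      then obtain x where "x \<in> X" by blast
      then show ?thesis by (intro exI[of _ "{x}"]) auto
    qed auto
  next
    case (insert j J)
    obtain S where S: "finite S" "S \<subseteq> X" "\<forall>x\<in>X. \<exists>s\<in>S. \<forall>i\<in>J. s $ i \<le> x $ i"
      using insert.IH[of X] by blast
    define B where "B = (\<Sum>s\<in>S. s $ j)"
    have B: "s $ j \<le> B" if "s \<in> S" for s
      unfolding B_def using S(1) that by (intro member_le_sum) auto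
    have "\<forall>b. \<exists>T. finite T \<and> T \<subseteq> {x\<in>X. x $ j = b} \<and>
        (\<forall>x\<in>{x\<in>X. x $ j = b}. \<exists>s\<in>T. \<forall>i\<in>J. s $ i \<le> x $ i)"
    proof
      fix b
      show "\<exists>T. finite T \<and> T \<subseteq> {x\<in>X. x $ j = b} \<and>
        (\<forall>x\<in>{x\<in>X. x $ j = b}. \<exists>s\<in>T. \<forall>i\<in>J. s $ i \<le> x $ i)"
        by (rule insert.IH)
    qed
    from choice[OF this] obtain T where T0: "\<forall>b. finite (T b) \<and> T b \<subseteq> {x\<in>X. x $ j = b} \<and>
        (\<forall>x\<in>{x\<in>X. x $ j = b}. \<exists>s\<in>T b. \<forall>i\<in>J. s $ i \<le> x $ i)"
      by (elim exE)
    have T: "finite (T b)" "T b \<subseteq> {x\<in>X. x $ j = b}"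
      "\<forall>x\<in>{x\<in>X. x $ j = b}. \<exists>s\<in>T b. \<forall>i\<in>J. s $ i \<le> x $ i" for b
      using T0[rule_format, of b] by simp_all
    show ?case
    proof (intro exI[of _ "S \<union> (\<Union>b\<le>B. T b)"] conjI ballI)
      show "finite (S \<union> (\<Union>b\<le>B. T b))" using S(1) T(1) by simp
      show "S \<union> (\<Union>b\<le>B. T b) \<subseteq> X" using S(2) T(2) by blast
      fix x assume x: "x \<in> X"
      show "\<exists>s\<in>S \<union> (\<Union>b\<le>B. T b). \<forall>i\<in>insert j J. s $ i \<le> x $ i"
      proof (cases "x $ j \<le> B")
        case True
        obtain s where s: "s \<in> T (x $ j)" "\<forall>i\<in>J. s $ i \<le> x $ i" using T(3)[of "x $ j"] x by blast
        have "s $ j = x $ j" using T(2)[of "x $ j"] s(1) by blast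
        then show ?thesis using s True by (intro bexI[of _ s]) auto
      next
        case False
        obtain s where s: "s \<in> S" "\<forall>i\<in>J. s $ i \<le> x $ i" using S(3) x by blast
        then show ?thesis using B[OF s(1)] False by (intro bexI[of _ s]) auto
      qed
    qed
  qed
  from this[of UNIV X] show ?thesis by simp
qed

text \<open>
  The smallest face of a convex set \<open>N\<close> that contains the point \<open>w\<close>: the points \<open>t\<close> for which
  the segment from \<open>t\<close> to \<open>w\<close> can be prolonged beyond \<open>w\<close> inside \<open>N\<close>.
\<close>

definition minface :: "'a::real_vector set \<Rightarrow> 'a \<Rightarrow> 'a set" where
  "minface N w = {t \<in> N. \<exists>e>0. w - e *\<^sub>R (t - w) \<in> N}"

lemma minface_self: "w \<in> N \<Longrightarrow> w \<in> minface N w"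
  by (auto simp: minface_def intro: exI[of _ 1])

text \<open>\<open>w\<close> lies strictly between t and the prolongation of the segment, with
  weight e / (1 + e) at t, and a face contains both ends of such a segment.\<close>

lemma minface_subset_face:
  assumes "F face_of N" "w \<in> F"
  shows "minface N w \<subseteq> F"
proof
  fix t assume "t \<in> minface N w"
  then obtain e where t: "t \<in> N" and e: "e > 0" "w - e *\<^sub>R (t - w) \<in> N" by (auto simp: minface_def)
  show "t \<in> F"
  proof (cases "t = w")
    case False
    have eq: "w = (1 - e / (1 + e)) *\<^sub>R (w - e *\<^sub>R (t - w)) + (e / (1 + e)) *\<^sub>R t"
    proof -
      have "1 - e / (1 + e) = 1 / (1 + e)" using e by (simp add: field_simps)
      moreover have "(1 + e) *\<^sub>R w = (w - e *\<^sub>R (t - w)) + e *\<^sub>R t" by (simp add: algebra_simps)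
      then have "(1 / (1 + e)) *\<^sub>R (1 + e) *\<^sub>R w = (1 / (1 + e)) *\<^sub>R ((w - e *\<^sub>R (t - w)) + e *\<^sub>R t)" by simp
      ultimately show ?thesis using e by (simp add: scaleR_add_right)
    qed
    have "w \<in> open_segment (w - e *\<^sub>R (t - w)) t"
      unfolding in_segment(2)
    proof (intro conjI exI[of _ "e / (1 + e)"])
      have "(1 + e) *\<^sub>R (t - w) \<noteq> 0" using False e by simp
      then show "w - e *\<^sub>R (t - w) \<noteq> t" by (auto simp: algebra_simps)
    qed (use e eq in auto)
    then show ?thesis using assms e(2) t unfolding face_of_def by blast
  qed (use assms in simp)
qed

lemma minface_mono_e:
  assumes "convex N" "w \<in> N" "w - e *\<^sub>R z \<in> N" "0 \<le> e'" "e' \<le> e"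
  shows "w - e' *\<^sub>R z \<in> N"
proof (cases "e = 0")
  case False
  then have e: "e > 0" using assms by simp
  have "(1 - e' / e) *\<^sub>R w + (e' / e) *\<^sub>R (w - e *\<^sub>R z) \<in> N"
    using assms e by (intro convexD) (auto simp: divide_le_eq_1)
  moreover have "(1 - e' / e) *\<^sub>R w + (e' / e) *\<^sub>R (w - e *\<^sub>R z) = w - e' *\<^sub>R z"
    using e by (simp add: algebra_simps)
  ultimately show ?thesis by simp
qed (use assms in auto)

lemma minface_face_of:
  assumes N: "convex N" and w: "w \<in> N"
  shows "minface N w face_of N"
  unfolding face_of_def
proof (intro conjI ballI impI)
  show "minface N w \<subseteq> N" by (auto simp: minface_def)
  show "convex (minface N w)"
    unfolding convex_def
  proof (intro ballI allI impI)
    fix x y :: 'a and u v :: real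
    assume x: "x \<in> minface N w" and y: "y \<in> minface N w" and uv: "0 \<le> u" "0 \<le> v" "u + v = 1"
    obtain e1 where e1: "e1 > 0" "w - e1 *\<^sub>R (x - w) \<in> N" using x by (auto simp: minface_def)
    obtain e2 where e2: "e2 > 0" "w - e2 *\<^sub>R (y - w) \<in> N" using y by (auto simp: minface_def)
    let ?e = "min e1 e2"
    have "w - ?e *\<^sub>R (x - w) \<in> N" "w - ?e *\<^sub>R (y - w) \<in> N"
      by (rule minface_mono_e[OF N w e1(2)], use e1 e2 in auto)
         (rule minface_mono_e[OF N w e2(2)], use e1 e2 in auto)
    then have "u *\<^sub>R (w - ?e *\<^sub>R (x - w)) + v *\<^sub>R (w - ?e *\<^sub>R (y - w)) \<in> N"
      using N uv by (intro convexD) auto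
    moreover have "u *\<^sub>R (w - ?e *\<^sub>R (x - w)) + v *\<^sub>R (w - ?e *\<^sub>R (y - w)) =
        (u + v) *\<^sub>R w - ?e *\<^sub>R ((u *\<^sub>R x + v *\<^sub>R y) - (u + v) *\<^sub>R w)"
      by (simp add: algebra_simps)
    moreover have "u *\<^sub>R x + v *\<^sub>R y \<in> N" using N uv x y by (intro convexD) (auto simp: minface_def)
    ultimately show "u *\<^sub>R x + v *\<^sub>R y \<in> minface N w"
      using e1 e2 uv by (auto simp: minface_def intro!: exI[of _ ?e])
  qed
  have half: "x \<in> minface N w" if x: "x \<in> N" and y: "y \<in> N" and z: "z \<in> minface N w"
    and s: "0 < s" "s < 1" and zz: "z = (1 - s) *\<^sub>R x + s *\<^sub>R y" for x y z s
  proof -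
    obtain e where e: "e > 0" "w - e *\<^sub>R (z - w) \<in> N" using z by (auto simp: minface_def)
    \<comment> \<open>Chosen so that the component along y cancels: the convex combination of the
      prolongation of z with y is then a prolongation of x beyond \<open>w\<close>.\<close>
    define \<theta> where "\<theta> = e * s / (1 + e * s)"
    have pos: "1 + e * s > 0" using e s by (simp add: add_pos_pos)
    have \<theta>: "0 \<le> \<theta>" "\<theta> < 1" "1 - \<theta> = 1 / (1 + e * s)"
      using e s pos by (auto simp: \<theta>_def field_simps)
    have "(1 - \<theta>) *\<^sub>R (w - e *\<^sub>R (z - w)) + \<theta> *\<^sub>R y \<in> N"
      using N e(2) y \<theta> pos by (intro convexD) auto
    moreover have "(1 - \<theta>) *\<^sub>R (w - e *\<^sub>R (z - w)) + \<theta> *\<^sub>R y = w - ((1 - \<theta>) * e * (1 - s)) *\<^sub>R (x - w)"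
    proof -
      have t: "\<theta> = (1 - \<theta>) * e * s" unfolding \<theta>(3) by (simp add: \<theta>_def)
      have "(1 - \<theta>) *\<^sub>R (w - e *\<^sub>R (z - w)) + ((1 - \<theta>) * e * s) *\<^sub>R y =
          ((1 - \<theta>) + (1 - \<theta>) * e * s) *\<^sub>R w - ((1 - \<theta>) * e * (1 - s)) *\<^sub>R (x - w)"
        unfolding zz by (simp add: algebra_simps)
      moreover have "(1 - \<theta>) + (1 - \<theta>) * e * s = 1" using t by simp
      ultimately show ?thesis using t by simp
    qed
    moreover have "(1 - \<theta>) * e * (1 - s) > 0" using \<theta>(2) e(1) s by (intro mult_pos_pos) simp_all
    ultimately show ?thesis using x by (auto simp: minface_def)
  qed
  fix a b x assume "a \<in> N" "b \<in> N" "x \<in> minface N w" "x \<in> open_segment a b"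
  then obtain s where s: "0 < s" "s < 1" "x = (1 - s) *\<^sub>R a + s *\<^sub>R b" by (auto simp: in_segment)
  show "a \<in> minface N w" by (rule half[OF \<open>a \<in> N\<close> \<open>b \<in> N\<close> \<open>x \<in> minface N w\<close> s])
  show "b \<in> minface N w"
    by (rule half[OF \<open>b \<in> N\<close> \<open>a \<in> N\<close> \<open>x \<in> minface N w\<close>, of "1 - s"]) (use s in \<open>auto simp: add.commute\<close>)
qed

text \<open>\<open>S\<close> is to come from Dickson's lemma. Its finiteness makes N a polytope plus
  the orthant; \<open>zero_notin_gens\<close> carries the hypothesis f(0) = 0 and makes the Newton
  distance positive.\<close>

locale newton_series =
  fixes f :: "nat ^ 'n \<Rightarrow> int" and S :: "(nat ^ 'n) set"
  assumes finite_gens: "finite S" and gens_ne: "S \<noteq> {}"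
    and gens_support: "s \<in> S \<Longrightarrow> f s \<noteq> 0"
    and gens_dominate: "f \<alpha> \<noteq> 0 \<Longrightarrow> \<exists>s\<in>S. \<forall>i. s $ i \<le> \<alpha> $ i"
    and zero_notin_gens: "0 \<notin> S"
begin

abbreviation "N \<equiv> newton_polyhedron f"

text \<open>The minimum m(k) of the linear form k over N, that is, its support function. By
  \<open>gens_dominate\<close>, and since k has nonnegative entries, a minimum over \<open>S\<close>
  is enough.\<close>

definition order_along :: "nat ^ 'n \<Rightarrow> nat" where
  "order_along k = Min (dotn k ` S)"

lemma order_along_le: "s \<in> S \<Longrightarrow> order_along k \<le> dotn k s"
  unfolding order_along_def using finite_gens by (intro Min_le) auto

lemma order_along_attained: "\<exists>s\<in>S. dotn k s = order_along k"
proof -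
  have "order_along k \<in> dotn k ` S"
    unfolding order_along_def using finite_gens gens_ne by (intro Min_in) auto
  then show ?thesis by auto
qed

lemma convex_N: "convex N"
  unfolding newton_polyhedron_def by (rule convex_convex_hull)

lemma support_in_N:
  assumes "f \<alpha> \<noteq> 0" "\<And>i. real (\<alpha> $ i) \<le> t $ i"
  shows "t \<in> N"
  unfolding newton_polyhedron_def using assms by (intro hull_inc) auto

lemma gens_in_N: "s \<in> S \<Longrightarrow> real_vec s \<in> N"
  using gens_support by (intro support_in_N[of s]) auto

lemma N_subset_halfspace:
  assumes "\<And>i. \<kappa> $ i \<ge> 0" "\<And>s. s \<in> S \<Longrightarrow> b \<le> \<kappa> \<bullet> real_vec s" "t \<in> N"
  shows "b \<le> \<kappa> \<bullet> t"
proof -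
  have "N \<subseteq> {t. \<kappa> \<bullet> t \<ge> b}"
    unfolding newton_polyhedron_def
  proof (rule hull_minimal)
    show "(\<Union>\<alpha>\<in>{\<alpha>. f \<alpha> \<noteq> 0}. {t. \<forall>i. real (\<alpha> $ i) \<le> t $ i}) \<subseteq> {t. \<kappa> \<bullet> t \<ge> b}"
    proof clarify
      fix \<alpha> t assume \<alpha>: "f \<alpha> \<noteq> 0" and t: "\<forall>i. real (\<alpha> $ i) \<le> t $ i"
      obtain s where s: "s \<in> S" "\<forall>i. s $ i \<le> \<alpha> $ i" using gens_dominate[OF \<alpha>] by blast
      have le: "real_vec s $ i \<le> t $ i" for i
        using s(2)[rule_format, of i] t[rule_format, of i] by simp
      have "b \<le> \<kappa> \<bullet> real_vec s" by (rule assms(2)[OF s(1)])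
      also have "\<dots> \<le> \<kappa> \<bullet> t"
        unfolding inner_vec_def using assms(1) le by (intro sum_mono) (simp add: mult_left_mono)
      finally show "b \<le> \<kappa> \<bullet> t" .
    qed
    show "convex {t. \<kappa> \<bullet> t \<ge> b}" by (rule convex_halfspace_ge)
  qed
  then show ?thesis using assms(3) by blast
qed

lemma order_along_le_inner: "t \<in> N \<Longrightarrow> real (order_along k) \<le> real_vec k \<bullet> t"
  by (rule N_subset_halfspace) (use order_along_le in \<open>auto simp: inner_real_vec\<close>)

definition upper_hull :: "(real ^ 'n) set" where
  "upper_hull = {t. \<exists>y\<in>convex hull (real_vec ` S). \<forall>i. y $ i \<le> t $ i}"

lemma N_eq_upper_hull: "N = upper_hull"
proof
  show "N \<subseteq> upper_hull"
    unfolding newton_polyhedron_def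
  proof (rule hull_minimal)
    show "(\<Union>\<alpha>\<in>{\<alpha>. f \<alpha> \<noteq> 0}. {t. \<forall>i. real (\<alpha> $ i) \<le> t $ i}) \<subseteq> upper_hull"
    proof clarify
      fix \<alpha> t assume \<alpha>: "f \<alpha> \<noteq> 0" and t: "\<forall>i. real (\<alpha> $ i) \<le> t $ i"
      obtain s where s: "s \<in> S" "\<forall>i. s $ i \<le> \<alpha> $ i" using gens_dominate[OF \<alpha>] by blast
      have le: "real_vec s $ i \<le> t $ i" for i
        using s(2)[rule_format, of i] t[rule_format, of i] by simp
      have "real_vec s \<in> convex hull (real_vec ` S)" using s by (intro hull_inc) auto
      then show "t \<in> upper_hull" unfolding upper_hull_def using le by blast
    qed
    show "convex upper_hull"
      unfolding convex_def
    proof (intro ballI allI impI)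
      fix x y and u v :: real assume x: "x \<in> upper_hull" and y: "y \<in> upper_hull" and uv: "0 \<le> u" "0 \<le> v" "u + v = 1"
      obtain x' where x': "x' \<in> convex hull (real_vec ` S)" "\<forall>i. x' $ i \<le> x $ i"
        using x by (auto simp: upper_hull_def)
      obtain y' where y': "y' \<in> convex hull (real_vec ` S)" "\<forall>i. y' $ i \<le> y $ i"
        using y by (auto simp: upper_hull_def)
      have "u *\<^sub>R x' + v *\<^sub>R y' \<in> convex hull (real_vec ` S)"
        using x' y' uv by (intro convexD[OF convex_convex_hull]) auto
      moreover have "(u *\<^sub>R x' + v *\<^sub>R y') $ i \<le> (u *\<^sub>R x + v *\<^sub>R y) $ i" for i
        using x' y' uv by (simp add: add_mono mult_left_mono)
      ultimately show "u *\<^sub>R x + v *\<^sub>R y \<in> upper_hull" unfolding upper_hull_def by blast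
    qed
  qed
  show "upper_hull \<subseteq> N"
  proof
    fix t assume "t \<in> upper_hull"
    then obtain y where y: "y \<in> convex hull (real_vec ` S)" "\<forall>i. y $ i \<le> t $ i"
      by (auto simp: upper_hull_def)
    \<comment> \<open>N is stable under translation by the nonnegative vector t - y because the
      union of orthants that generates it is.\<close>
    have sub: "(+) (t - y) ` N \<subseteq> N"
    proof -
      have "(+) (t - y) ` (\<Union>\<alpha>\<in>{\<alpha>. f \<alpha> \<noteq> 0}. {t. \<forall>i. real (\<alpha> $ i) \<le> t $ i}) \<subseteq>
          (\<Union>\<alpha>\<in>{\<alpha>. f \<alpha> \<noteq> 0}. {t. \<forall>i. real (\<alpha> $ i) \<le> t $ i})"
      proof clarify
        fix \<alpha> x assume *: "f \<alpha> \<noteq> 0" "\<forall>i. real (\<alpha> $ i) \<le> x $ i"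
        have "real (\<alpha> $ i) \<le> (t - y + x) $ i" for i using *(2)[rule_format, of i] y(2)[rule_format, of i] by simp
        then show "t - y + x \<in> (\<Union>\<alpha>\<in>{\<alpha>. f \<alpha> \<noteq> 0}. {t. \<forall>i. real (\<alpha> $ i) \<le> t $ i})" using *(1) by blast
      qed
      then show ?thesis
        unfolding newton_polyhedron_def convex_hull_translation[symmetric] by (rule hull_mono)
    qed
    have "convex hull (real_vec ` S) \<subseteq> N"
      by (intro hull_minimal convex_N) (use gens_in_N in auto)
    then have "y \<in> N" using y(1) by (rule subsetD)
    then have "(t - y) + y \<in> N" by (rule subsetD[OF sub imageI])
    then show "t \<in> N" by simp
  qed
qed

lemma N_up:
  assumes "t \<in> N" "\<And>i. t $ i \<le> t' $ i"
  shows "t' \<in> N"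
proof -
  obtain y where y: "y \<in> convex hull (real_vec ` S)" "\<And>i. y $ i \<le> t $ i"
    using assms(1) unfolding N_eq_upper_hull upper_hull_def by blast
  have "y $ i \<le> t' $ i" for i using y(2)[of i] assms(2)[of i] by simp
  then show ?thesis using y(1) unfolding N_eq_upper_hull upper_hull_def by blast
qed

lemma closed_N: "closed N"
proof -
  have "N = (\<Union>x\<in>convex hull (real_vec ` S). \<Union>y\<in>{r. \<forall>i. 0 \<le> r $ i}. {x + y})"
    unfolding N_eq_upper_hull upper_hull_def
  proof (intro subset_antisym subsetI)
    fix t assume "t \<in> {t. \<exists>y\<in>convex hull (real_vec ` S). \<forall>i. y $ i \<le> t $ i}"
    then obtain y where y: "y \<in> convex hull (real_vec ` S)" "\<forall>i. y $ i \<le> t $ i" by blast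
    then show "t \<in> (\<Union>x\<in>convex hull (real_vec ` S). \<Union>y\<in>{r. \<forall>i. 0 \<le> r $ i}. {x + y})"
      by (intro UN_I[of y] UN_I[of "t - y"]) auto
  next
    fix t assume "t \<in> (\<Union>x\<in>convex hull (real_vec ` S). \<Union>y\<in>{r. \<forall>i. 0 \<le> r $ i}. {x + y})"
    then obtain x y where x: "x \<in> convex hull (real_vec ` S)" "\<forall>i. 0 \<le> y $ i" "t = x + y" by blast
    have "x $ i \<le> t $ i" for i using x by simp
    then show "t \<in> {t. \<exists>y\<in>convex hull (real_vec ` S). \<forall>i. y $ i \<le> t $ i}" using x(1) by blast
  qed
  also have "closed \<dots>"
  proof (rule compact_closed_sums)
    show "compact (convex hull (real_vec ` S))"
      using finite_gens by (intro finite_imp_compact_convex_hull) simp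
    show "closed {r :: real ^ 'n. \<forall>i. 0 \<le> r $ i}" by (rule closed_positive_orthant)
  qed
  finally show ?thesis .
qed

end

text \<open>Monotonicity allows the maximum of the witnesses. Several constants below are kept as
  natural numbers so that this lemma makes them uniform over finite families of generator
  sets.\<close>

lemma uniform_nat_bound:
  assumes "finite D" "\<And>x. x \<in> D \<Longrightarrow> \<exists>N::nat. P x N"
    and "\<And>x N N'. P x N \<Longrightarrow> N \<le> N' \<Longrightarrow> P x N'"
  shows "\<exists>N. \<forall>x\<in>D. P x N"
  using assms(1,2)
proof (induction D rule: finite_induct)
  case (insert x D)
  obtain N where N: "\<forall>x\<in>D. P x N" using insert by blast
  obtain N' where N': "P x N'" using insert by blast
  have "P y (max N N')" if "y \<in> insert x D" for y
  proof (cases "y = x")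
    case True
    then show ?thesis using assms(3)[OF N', of "max N N'"] by simp
  next
    case False
    then show ?thesis using assms(3)[of y N "max N N'"] N that by simp
  qed
  then show ?case by blast
qed auto

section \<open>Generator sets of compact faces\<close>

context newton_series
begin

text \<open>A point whose smallest face in N is the smallest face containing all of
  \<open>A\<close>.\<close>

definition barycenter :: "(nat ^ 'n) set \<Rightarrow> real ^ 'n" where
  "barycenter A = (1 / real (card A)) *\<^sub>R (\<Sum>a\<in>A. real_vec a)"

text \<open>\<open>A\<close> consists of the generators on a compact face. The last clause encodes
  compactness: the barycenter cannot be lowered along any axis, which excludes unbounded faces. In
  this form a failure is witnessed by explicit points of N.\<close>

definition facial :: "(nat ^ 'n) set \<Rightarrow> bool" where
  "facial A \<longleftrightarrow> A \<subseteq> S \<and> A \<noteq> {} \<and>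
     (\<forall>b\<in>S - A. real_vec b \<notin> minface N (barycenter A)) \<and>
     (\<forall>i. \<forall>e>0. barycenter A - e *\<^sub>R axis i 1 \<notin> N)"

text \<open>The shifted point is a combination of \<open>A\<close> with total weight 1, and the
  bound on e keeps the weight of \<open>a\<close> nonnegative.\<close>

lemma barycenter_shift:
  assumes "A \<subseteq> S" "a \<in> A" "0 \<le> e" "e * real (card A) \<le> 1"
  shows "barycenter A - e *\<^sub>R (real_vec a - barycenter A) \<in> N"
proof -
  let ?n = "real (card A)"
  have fin: "finite A" using assms finite_gens finite_subset by blast
  have n: "?n > 0" using fin assms(2) by (simp add: card_gt_0_iff) blast
  define c where "c b = (1 + e) / ?n - (if b = a then e else 0)" for b
  have "(\<Sum>b\<in>A. c b *\<^sub>R real_vec b) \<in> N"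
  proof (rule convex_sum[OF fin convex_N])
    have "(\<Sum>b\<in>A. if b = a then e else 0) = e" using fin assms(2) by simp
    moreover have "sum c A = (\<Sum>b\<in>A. (1 + e) / ?n) - (\<Sum>b\<in>A. if b = a then e else 0)"
      unfolding c_def by (rule sum_subtractf)
    ultimately show "sum c A = 1" using n by simp
    fix b assume b: "b \<in> A"
    have "e \<le> 1 / ?n" using assms(4) n by (simp add: field_simps)
    also have "\<dots> \<le> (1 + e) / ?n" using assms(3) n by (intro divide_right_mono) auto
    finally show "0 \<le> c b" using assms(3) n by (simp add: c_def)
    show "real_vec b \<in> N" using b assms(1) gens_in_N by blast
  qed
  also have "(\<Sum>b\<in>A. c b *\<^sub>R real_vec b) =
      ((1 + e) / ?n) *\<^sub>R (\<Sum>b\<in>A. real_vec b) - (\<Sum>b\<in>A. (if b = a then e else 0) *\<^sub>R real_vec b)"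
    by (simp add: c_def scaleR_diff_left sum_subtractf scaleR_sum_right)
  also have "(\<Sum>b\<in>A. (if b = a then e else 0) *\<^sub>R real_vec b) = (\<Sum>b\<in>A. if b = a then e *\<^sub>R real_vec b else 0)"
    by (rule sum.cong) auto
  also have "\<dots> = e *\<^sub>R real_vec a" using fin assms(2) by simp
  also have "((1 + e) / ?n) *\<^sub>R (\<Sum>b\<in>A. real_vec b) - e *\<^sub>R real_vec a =
      barycenter A - e *\<^sub>R (real_vec a - barycenter A)"
    by (simp add: barycenter_def algebra_simps add_divide_distrib)
  finally show ?thesis .
qed

lemma barycenter_in_N:
  assumes "A \<subseteq> S" "A \<noteq> {}"
  shows "barycenter A \<in> N"
proof -
  obtain a where "a \<in> A" using assms by blast
  from barycenter_shift[OF assms(1) this, of 0] show ?thesis by simp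
qed

lemma gen_in_minface_barycenter:
  assumes "A \<subseteq> S" "a \<in> A"
  shows "real_vec a \<in> minface N (barycenter A)"
proof -
  have "finite A" using assms finite_gens finite_subset by blast
  then have n: "real (card A) > 0" using assms(2) by (simp add: card_gt_0_iff) blast
  then have "barycenter A - (1 / real (card A)) *\<^sub>R (real_vec a - barycenter A) \<in> N"
    by (intro barycenter_shift assms) auto
  moreover have "real_vec a \<in> N" using assms gens_in_N by blast
  moreover have "1 / real (card A) > 0" using n by simp
  ultimately show ?thesis unfolding minface_def by blast
qed

text \<open>
  If a point of the face could be lowered in direction \<open>i\<close> inside \<open>N\<close>, then so could the barycenter.
\<close>

lemma facial_lower:
  assumes A: "facial A" and t: "t \<in> minface N (barycenter A)" and \<delta>: "\<delta> > 0"
  shows "t - \<delta> *\<^sub>R axis i 1 \<notin> N"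
proof
  let ?w = "barycenter A"
  assume low: "t - \<delta> *\<^sub>R axis i 1 \<in> N"
  obtain e where e: "e > 0" "?w - e *\<^sub>R (t - ?w) \<in> N" using t by (auto simp: minface_def)
  let ?\<theta> = "e / (1 + e)"
  have "(1 - ?\<theta>) *\<^sub>R (?w - e *\<^sub>R (t - ?w)) + ?\<theta> *\<^sub>R (t - \<delta> *\<^sub>R axis i 1) \<in> N"
    using convex_N e low by (intro convexD) (auto simp: divide_le_eq_1)
  moreover have "(1 - ?\<theta>) *\<^sub>R (?w - e *\<^sub>R (t - ?w)) + ?\<theta> *\<^sub>R (t - \<delta> *\<^sub>R axis i 1) = ?w - (?\<theta> * \<delta>) *\<^sub>R axis i 1"
  proof -
    have \<theta>: "1 - ?\<theta> = 1 / (1 + e)" using e by (simp add: field_simps)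
    have eq: "?\<theta> = (1 - ?\<theta>) * e" unfolding \<theta> by simp
    have "(1 - ?\<theta>) *\<^sub>R (?w - e *\<^sub>R (t - ?w)) + ?\<theta> *\<^sub>R (t - \<delta> *\<^sub>R axis i 1) =
      ((1 - ?\<theta>) + (1 - ?\<theta>) * e) *\<^sub>R ?w + (?\<theta> - (1 - ?\<theta>) * e) *\<^sub>R t - (?\<theta> * \<delta>) *\<^sub>R axis i 1"
      by (simp only: scaleR_diff_right scaleR_add_right scaleR_add_left scaleR_diff_left scaleR_scaleR) simp
    also have "(1 - ?\<theta>) + (1 - ?\<theta>) * e = 1" using eq by simp
    also have "?\<theta> - (1 - ?\<theta>) * e = 0" using eq by simp
    finally show ?thesis by simp
  qed
  moreover have "?\<theta> * \<delta> > 0" using e \<delta> by simp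
  ultimately show False using A by (auto simp: facial_def)
qed

text \<open>A support point of the face that differs from the generator below it could be lowered by
  1 along some axis inside N, which \<open>facial_lower\<close> forbids. So such a face sees only
  generators, and its face polynomial is determined by \<open>A\<close>.\<close>

lemma facial_support:
  assumes A: "facial A" and \<alpha>: "f \<alpha> \<noteq> 0"
  shows "real_vec \<alpha> \<in> minface N (barycenter A) \<longleftrightarrow> \<alpha> \<in> A"
proof
  assume "\<alpha> \<in> A"
  then show "real_vec \<alpha> \<in> minface N (barycenter A)"
    using A by (intro gen_in_minface_barycenter) (auto simp: facial_def)
next
  assume in_face: "real_vec \<alpha> \<in> minface N (barycenter A)"
  obtain s where s: "s \<in> S" "\<And>i. s $ i \<le> \<alpha> $ i" using gens_dominate[OF \<alpha>] by blast
  have "s = \<alpha>"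
  proof (rule ccontr)
    assume "s \<noteq> \<alpha>"
    then have "\<exists>i. s $ i \<noteq> \<alpha> $ i" unfolding vec_eq_iff by simp
    then obtain i where i: "s $ i \<noteq> \<alpha> $ i" ..
    have le: "real_vec s $ j \<le> (real_vec \<alpha> - 1 *\<^sub>R axis i 1) $ j" for j
      using s(2)[of j] i by (cases "j = i") (auto simp: axis_def)
    have "real_vec \<alpha> - 1 *\<^sub>R axis i 1 \<in> N" by (rule N_up[OF gens_in_N[OF s(1)] le])
    then show False using facial_lower[OF A in_face, of 1] by simp
  qed
  then show "\<alpha> \<in> A" using s(1) in_face A by (auto simp: facial_def)
qed

text \<open>Each point of the face lies above a point of the convex hull of \<open>S\<close>; if the
  two differed, it could be lowered. The face is therefore contained in a polytope.\<close>

lemma facial_compact_face: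
  assumes A: "facial A"
  shows "minface N (barycenter A) \<in> compact_newton_faces f"
proof -
  let ?w = "barycenter A" and ?F = "minface N (barycenter A)"
  have w: "?w \<in> N" using A barycenter_in_N by (simp add: facial_def)
  have face: "?F face_of N" by (rule minface_face_of[OF convex_N w])
  have "?F \<subseteq> convex hull (real_vec ` S)"
  proof
    fix t assume t: "t \<in> ?F"
    then have "t \<in> N" by (simp add: minface_def)
    then obtain y where y: "y \<in> convex hull (real_vec ` S)" "\<And>i. y $ i \<le> t $ i"
      unfolding N_eq_upper_hull upper_hull_def by blast
    then have yN: "y \<in> N" unfolding N_eq_upper_hull upper_hull_def by blast
    have "y $ i = t $ i" for i
    proof (rule ccontr)
      assume "y $ i \<noteq> t $ i"
      then have pos: "t $ i - y $ i > 0" using y(2)[of i] by simp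
      have "y $ j \<le> (t - (t $ i - y $ i) *\<^sub>R axis i 1) $ j" for j
        using y(2)[of j] by (cases "j = i") (auto simp: axis_def)
      then have "t - (t $ i - y $ i) *\<^sub>R axis i 1 \<in> N" by (rule N_up[OF yN])
      then show False using facial_lower[OF A t pos] by simp
    qed
    then have "y = t" by (simp add: vec_eq_iff)
    then show "t \<in> convex hull (real_vec ` S)" using y(1) by simp
  qed
  moreover have "compact (convex hull (real_vec ` S))"
    using finite_gens by (intro finite_imp_compact_convex_hull) simp
  ultimately have "bounded ?F" using bounded_subset compact_imp_bounded by blast
  moreover have "closed ?F" by (rule face_of_imp_closed[OF convex_N closed_N face])
  ultimately have "compact ?F" by (simp add: compact_eq_bounded_closed)
  moreover have "?F \<noteq> {}" using minface_self[OF w] by blast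
  ultimately show ?thesis using face by (simp add: compact_newton_faces_def newton_face_def)
qed

lemma inner_barycenter_le:
  assumes "A \<subseteq> S" "A \<noteq> {}" "\<And>a. a \<in> A \<Longrightarrow> real (dotn k a) \<le> c"
  shows "real_vec k \<bullet> barycenter A \<le> c"
proof -
  have "finite A" using assms finite_gens finite_subset by blast
  then have n: "real (card A) > 0" using assms(2) by (simp add: card_gt_0_iff)
  have "(\<Sum>a\<in>A. real (dotn k a)) \<le> real (card A) * c"
    by (rule sum_bounded_above) (use assms(3) in auto)
  then have "(1 / real (card A)) * (\<Sum>a\<in>A. real (dotn k a)) \<le> (1 / real (card A)) * (real (card A) * c)"
    using n by (intro mult_left_mono) auto
  then show ?thesis using n by (simp add: barycenter_def inner_sum_right inner_real_vec)
qed

lemma inner_axis_real_vec: "real_vec k \<bullet> axis i 1 = real (k $ i)"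
  by (simp add: inner_axis)

text \<open>A failure of \<open>facial A\<close> is witnessed by a point of N beyond the barycenter,
  opposite an extra generator b, or below it along an axis i. The form k is at least
  \<open>order_along k\<close> at that point and at most \<open>order_along k + B\<close> at the
  barycenter, so the excess of b, or \<open>k $ i\<close>, is at most K * B with K determined by the
  witness. A larger gap rules out every failure.\<close>

lemma active_facial_bound:
  assumes A: "A \<subseteq> S" "A \<noteq> {}"
  shows "\<exists>K. \<forall>B k. (\<forall>a\<in>A. dotn k a \<le> order_along k + B) \<longrightarrow>
      (\<forall>b\<in>S - A. dotn k b > order_along k + K * B) \<longrightarrow> (\<forall>i. k $ i > K * B) \<longrightarrow> facial A"
proof -
  let ?w = "barycenter A"
  have wN: "?w \<in> N" by (rule barycenter_in_N[OF A])
  have low: "real_vec k \<bullet> ?w \<le> real (order_along k) + real B"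
    if "\<forall>a\<in>A. dotn k a \<le> order_along k + B" for k B
    by (rule inner_barycenter_le[OF A]) (use that in \<open>simp flip: of_nat_add\<close>)
  have "\<exists>K. \<forall>b\<in>S. real_vec b \<in> minface N ?w \<longrightarrow> (\<forall>B k. (\<forall>a\<in>A. dotn k a \<le> order_along k + B) \<longrightarrow>
      dotn k b \<le> order_along k + K * B)"
  proof (rule uniform_nat_bound[OF finite_gens])
    fix b assume b: "b \<in> S"
    show "\<exists>K. real_vec b \<in> minface N ?w \<longrightarrow> (\<forall>B k. (\<forall>a\<in>A. dotn k a \<le> order_along k + B) \<longrightarrow>
      dotn k b \<le> order_along k + K * B)"
    proof (cases "real_vec b \<in> minface N ?w")
      case True
      then obtain e where e: "e > 0" "?w - e *\<^sub>R (real_vec b - ?w) \<in> N" by (auto simp: minface_def)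
      obtain K :: nat where K: "(1 + e) / e \<le> real K" using real_arch_simple by blast
      have "dotn k b \<le> order_along k + K * B" if "\<forall>a\<in>A. dotn k a \<le> order_along k + B" for B k
      proof -
        let ?m = "real (order_along k)"
        have "?m \<le> real_vec k \<bullet> (?w - e *\<^sub>R (real_vec b - ?w))" by (rule order_along_le_inner[OF e(2)])
        then have "e * (real (dotn k b) - ?m) \<le> (1 + e) * (real_vec k \<bullet> ?w - ?m)"
          by (simp add: inner_diff_right inner_real_vec algebra_simps)
        also have "\<dots> \<le> (1 + e) * real B" using low[OF that] e by (intro mult_left_mono) auto
        finally have "real (dotn k b) - ?m \<le> (1 + e) / e * real B" using e by (simp add: field_simps)
        also have "\<dots> \<le> real K * real B" using K by (intro mult_right_mono) auto
        finally have "real (dotn k b) \<le> real (order_along k + K * B)" by simp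
        then show ?thesis by (simp only: of_nat_le_iff)
      qed
      then show ?thesis by blast
    qed auto
  next
    fix b :: "nat ^ 'n" and K K' :: nat
    assume *: "real_vec b \<in> minface N ?w \<longrightarrow> (\<forall>B k. (\<forall>a\<in>A. dotn k a \<le> order_along k + B) \<longrightarrow>
      dotn k b \<le> order_along k + K * B)" and "K \<le> K'"
    then have KK: "K * B \<le> K' * B" for B by simp
    show "real_vec b \<in> minface N ?w \<longrightarrow> (\<forall>B k. (\<forall>a\<in>A. dotn k a \<le> order_along k + B) \<longrightarrow>
      dotn k b \<le> order_along k + K' * B)"
    proof (intro impI allI)
      fix B k assume "real_vec b \<in> minface N ?w" "\<forall>a\<in>A. dotn k a \<le> order_along k + B"
      then have "dotn k b \<le> order_along k + K * B" using * by blast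
      then show "dotn k b \<le> order_along k + K' * B" using KK[of B] by linarith
    qed
  qed
  then obtain K1 where K1: "\<And>b B k. b \<in> S \<Longrightarrow> real_vec b \<in> minface N ?w \<Longrightarrow>
      \<forall>a\<in>A. dotn k a \<le> order_along k + B \<Longrightarrow> dotn k b \<le> order_along k + K1 * B" by blast
  have "\<exists>K. \<forall>i\<in>UNIV. (\<exists>e>0. ?w - e *\<^sub>R axis i 1 \<in> N) \<longrightarrow> (\<forall>B k. (\<forall>a\<in>A. dotn k a \<le> order_along k + B) \<longrightarrow>
      k $ i \<le> K * B)"
  proof (rule uniform_nat_bound[OF finite])
    fix i
    show "\<exists>K. (\<exists>e>0. ?w - e *\<^sub>R axis i 1 \<in> N) \<longrightarrow> (\<forall>B k. (\<forall>a\<in>A. dotn k a \<le> order_along k + B) \<longrightarrow>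
      k $ i \<le> K * B)"
    proof (cases "\<exists>e>0. ?w - e *\<^sub>R axis i 1 \<in> N")
      case True
      then obtain e where e: "e > 0" "?w - e *\<^sub>R axis i 1 \<in> N" by blast
      obtain K :: nat where K: "1 / e \<le> real K" using real_arch_simple by blast
      have "k $ i \<le> K * B" if "\<forall>a\<in>A. dotn k a \<le> order_along k + B" for B k
      proof -
        have "real (order_along k) \<le> real_vec k \<bullet> (?w - e *\<^sub>R axis i 1)" by (rule order_along_le_inner[OF e(2)])
        then have "e * real (k $ i) \<le> real B"
          using low[OF that] by (simp add: inner_diff_right inner_axis_real_vec)
        then have "real (k $ i) \<le> 1 / e * real B" using e by (simp add: field_simps)
        also have "\<dots> \<le> real K * real B" using K by (intro mult_right_mono) auto
        finally have "real (k $ i) \<le> real (K * B)" by simp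
        then show ?thesis by (simp only: of_nat_le_iff)
      qed
      then show ?thesis by blast
    qed auto
  next
    fix i :: 'n and K K' :: nat
    assume *: "(\<exists>e>0. ?w - e *\<^sub>R axis i 1 \<in> N) \<longrightarrow> (\<forall>B k. (\<forall>a\<in>A. dotn k a \<le> order_along k + B) \<longrightarrow>
      k $ i \<le> K * B)" and "K \<le> K'"
    then have KK: "K * B \<le> K' * B" for B by simp
    show "(\<exists>e>0. ?w - e *\<^sub>R axis i 1 \<in> N) \<longrightarrow> (\<forall>B k. (\<forall>a\<in>A. dotn k a \<le> order_along k + B) \<longrightarrow>
      k $ i \<le> K' * B)"
    proof (intro impI allI)
      fix B k assume "\<exists>e>0. ?w - e *\<^sub>R axis i 1 \<in> N" "\<forall>a\<in>A. dotn k a \<le> order_along k + B"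
      then have "k $ i \<le> K * B" using * by blast
      then show "k $ i \<le> K' * B" using KK[of B] by linarith
    qed
  qed
  then obtain K2 where K2: "\<And>i e B k. e > 0 \<Longrightarrow> ?w - e *\<^sub>R axis i 1 \<in> N \<Longrightarrow>
      \<forall>a\<in>A. dotn k a \<le> order_along k + B \<Longrightarrow> k $ i \<le> K2 * B" by blast
  show ?thesis
  proof (intro exI[of _ "max K1 K2"] allI impI)
    fix B k
    assume a: "\<forall>a\<in>A. dotn k a \<le> order_along k + B"
      and b: "\<forall>b\<in>S - A. dotn k b > order_along k + max K1 K2 * B" and c: "\<forall>i. k $ i > max K1 K2 * B"
    have le: "K1 * B \<le> max K1 K2 * B" "K2 * B \<le> max K1 K2 * B" by simp_all
    show "facial A"
      unfolding facial_def
    proof (intro conjI A ballI allI impI notI)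
      fix b' assume b': "b' \<in> S - A" "real_vec b' \<in> minface N ?w"
      have "dotn k b' \<le> order_along k + K1 * B" by (rule K1) (use b' a in auto)
      moreover have "dotn k b' > order_along k + max K1 K2 * B" using b b'(1) by blast
      ultimately show False using le(1) by linarith
    next
      fix i and e :: real assume "e > 0" "?w - e *\<^sub>R axis i 1 \<in> N"
      then have "k $ i \<le> K2 * B" by (rule K2[OF _ _ a])
      moreover have "k $ i > max K1 K2 * B" using c by blast
      ultimately show False using le(2) by linarith
    qed
  qed
qed

section \<open>Counting near a compact face\<close>

lemma face_part_facial:
  assumes "facial A"
  shows "face_part f (minface N (barycenter A)) = (\<lambda>\<alpha>. if \<alpha> \<in> A then f \<alpha> else 0)"
proof
  fix \<alpha>
  show "face_part f (minface N (barycenter A)) \<alpha> = (if \<alpha> \<in> A then f \<alpha> else 0)"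
    using facial_support[OF assms, of \<alpha>] gens_support[of \<alpha>] assms
    by (cases "f \<alpha> = 0") (auto simp: face_part_def real_vec_def)
qed

text \<open>The degree bound D makes the \<open>Max\<close> in \<open>face_order\<close> range over
  a finite set, so it really bounds the order at every torus zero; at other torus points the empty
  list of derivatives serves.\<close>

lemma face_order_spec:
  fixes A :: "(nat ^ 'n) set" and x :: "'p::prime_card padic ^ 'n"
  assumes A: "finite A" "A \<noteq> {}" and F: "\<And>\<alpha>. face_part f F \<alpha> \<noteq> 0 \<longleftrightarrow> \<alpha> \<in> A"
    and D: "\<And>\<alpha>. \<alpha> \<in> A \<Longrightarrow> (\<Sum>i\<in>UNIV. \<alpha> $ i) \<le> D"
  shows "face_order TYPE('p) f F \<le> D"
    and "(\<And>i. x $ i \<noteq> 0) \<Longrightarrow> \<exists>js. length js \<le> face_order TYPE('p) f F \<and>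
      series_at (foldr coeff_pderiv js (padic_coeffs (face_part f F))) x \<noteq> 0"
proof -
  let ?g = "padic_coeffs (face_part f F) :: nat ^ 'n \<Rightarrow> 'p padic"
  let ?Z = "torus_zeros (face_part f F) :: ('p padic ^ 'n) set"
  have g: "?g \<alpha> \<noteq> 0 \<longleftrightarrow> \<alpha> \<in> A" for \<alpha> using F[of \<alpha>] by (simp add: padic_coeffs_def)
  then have fin: "finite {\<alpha>. ?g \<alpha> \<noteq> 0}" using A by simp
  obtain \<alpha>\<^sub>0 where \<alpha>0: "?g \<alpha>\<^sub>0 \<noteq> 0" using A g by blast
  have ex: "\<exists>js. length js \<le> D \<and> series_at (foldr coeff_pderiv js ?g) y \<noteq> 0" for y
    by (rule ex_nonvanishing_derivative[OF fin \<alpha>0]) (use D g in blast)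
  have zo: "zero_order ?g y \<le> D" for y
  proof -
    obtain js where "length js \<le> D" "series_at (foldr coeff_pderiv js ?g) y \<noteq> 0" using ex by blast
    then have "zero_order ?g y \<le> length js" unfolding zero_order_def by (intro Least_le) blast
    then show ?thesis using \<open>length js \<le> D\<close> by simp
  qed
  have zs: "\<exists>js. length js = zero_order ?g y \<and> series_at (foldr coeff_pderiv js ?g) y \<noteq> 0" for y
    unfolding zero_order_def by (rule LeastI_ex) (use ex in blast)
  have finz: "finite (zero_order ?g ` ?Z)"
    by (rule finite_subset[of _ "{..D}"]) (use zo in auto)
  show "face_order TYPE('p) f F \<le> D"
    unfolding face_order_def Let_def using finz zo by auto
  assume x: "\<And>i. x $ i \<noteq> 0"
  show "\<exists>js. length js \<le> face_order TYPE('p) f F \<and> series_at (foldr coeff_pderiv js ?g) x \<noteq> 0"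
  proof (cases "x \<in> ?Z")
    case True
    then have "zero_order ?g x \<le> Max (zero_order ?g ` ?Z)" using finz by (intro Max_ge) auto
    then have "zero_order ?g x \<le> face_order TYPE('p) f F"
      unfolding face_order_def Let_def using True by auto
    then show ?thesis using zs[of x] by force
  next
    case False
    then have "series_at ?g x \<noteq> 0" using x by (simp add: torus_zeros_def)
    then show ?thesis by (intro exI[of _ "[]"]) simp
  qed
qed

definition face_of_gens :: "(nat ^ 'n) set \<Rightarrow> (real ^ 'n) set" where
  "face_of_gens A = minface N (barycenter A)"

text \<open>The substitution x_i = p^(k_i) U_i turns the face polynomial into p^m times the rescaled
  polynomial with offsets \<delta>. Since o(F) is a maximum over the whole torus, and not only over
  unit vectors, it bounds the order at U for every k.\<close>

lemma facial_nonvanishing: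
  fixes U :: "'p::prime_card padic ^ 'n"
  assumes A: "facial A" and \<delta>: "\<And>a. a \<in> A \<Longrightarrow> dotn k a = m + \<delta> a"
    and U: "\<And>i. padic_norm (U $ i) = 1"
  shows "\<exists>v :: int ^ 'n. \<exists>j\<le>face_order TYPE('p) f (face_of_gens A).
    coeff (line_poly (padic_coeffs (\<lambda>\<alpha>. if \<alpha> \<in> A then f \<alpha> * int CARD('p) ^ \<delta> \<alpha> else 0)) U (\<chi> i. of_int (v $ i))) j \<noteq> 0"
proof (rule ccontr)
  let ?F = "face_of_gens A"
  let ?o = "face_order TYPE('p) f ?F"
  define g :: "nat ^ 'n \<Rightarrow> int" where "g = (\<lambda>\<alpha>. if \<alpha> \<in> A then f \<alpha> * int CARD('p) ^ \<delta> \<alpha> else 0)"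
  assume "\<not> (\<exists>v :: int ^ 'n. \<exists>j\<le>?o.
    coeff (line_poly (padic_coeffs (\<lambda>\<alpha>. if \<alpha> \<in> A then f \<alpha> * int CARD('p) ^ \<delta> \<alpha> else 0)) U (\<chi> i. of_int (v $ i))) j \<noteq> 0)"
  then have van: "coeff (line_poly (padic_coeffs g) U (\<chi> i. of_int (v $ i))) j = 0" if "j \<le> ?o" for v :: "int ^ 'n" and j
    using that unfolding g_def by blast
  have A': "A \<subseteq> S" "A \<noteq> {}" using A by (auto simp: facial_def)
  have finA: "finite A" using A'(1) finite_gens finite_subset by blast
  have fp: "face_part f ?F = (\<lambda>\<alpha>. if \<alpha> \<in> A then f \<alpha> else 0)" unfolding face_of_gens_def by (rule face_part_facial[OF A])
  have fnz: "face_part f ?F \<alpha> \<noteq> 0 \<longleftrightarrow> \<alpha> \<in> A" for \<alpha> using A' gens_support by (auto simp: fp)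
  define q :: "'p padic ^ 'n" where "q = (\<chi> i. of_nat CARD('p) ^ (k $ i))"
  define x where "x = (\<chi> i. q $ i * U $ i)"
  have q0: "q $ i \<noteq> 0" for i by (simp add: q_def)
  have U0: "U $ i \<noteq> 0" for i using U[of i] by auto
  \<comment> \<open>An integral direction v at U corresponds to the direction
    \<open>q $ i * v $ i\<close> at x, the reason for the scales in
    \<open>derivatives_vanish\<close>.\<close>
  have line_eq: "line_poly (padic_coeffs (face_part f ?F)) x (\<chi> i. q $ i * of_int (v $ i)) =
      smult (of_nat CARD('p) ^ m) (line_poly (padic_coeffs g) U (\<chi> i. of_int (v $ i)))" for v :: "int ^ 'n"
  proof -
    have "line_poly (padic_coeffs (face_part f ?F)) x (\<chi> i. q $ i * of_int (v $ i)) =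
        (\<Sum>\<alpha>\<in>A. smult (padic_coeffs (face_part f ?F) \<alpha>) (\<Prod>i\<in>UNIV. [:x $ i, (\<chi> i. q $ i * of_int (v $ i)) $ i:] ^ (\<alpha> $ i)))"
      by (rule line_poly_superset[OF finA]) (use fnz in \<open>auto simp: padic_coeffs_def\<close>)
    also have "\<dots> = (\<Sum>\<alpha>\<in>A. smult (of_nat CARD('p) ^ m) (smult (padic_coeffs g \<alpha>) (\<Prod>i\<in>UNIV. [:U $ i, (\<chi> i. of_int (v $ i)) $ i:] ^ (\<alpha> $ i))))"
    proof (rule sum.cong[OF refl])
      fix \<alpha> assume \<alpha>: "\<alpha> \<in> A"
      have "(\<Prod>i\<in>UNIV. [:x $ i, (\<chi> i. q $ i * of_int (v $ i)) $ i:] ^ (\<alpha> $ i)) =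
          (\<Prod>i\<in>UNIV. smult ((q $ i) ^ (\<alpha> $ i)) ([:U $ i, of_int (v $ i):] ^ (\<alpha> $ i)))"
      proof (rule prod.cong[OF refl])
        fix i
        have "[:x $ i, (\<chi> i. q $ i * of_int (v $ i)) $ i:] = smult (q $ i) [:U $ i, of_int (v $ i):]" by (simp add: x_def)
        then show "[:x $ i, (\<chi> i. q $ i * of_int (v $ i)) $ i:] ^ (\<alpha> $ i) = smult ((q $ i) ^ (\<alpha> $ i)) ([:U $ i, of_int (v $ i):] ^ (\<alpha> $ i))"
          by (simp only: smult_power)
      qed
      also have "\<dots> = smult (\<Prod>i\<in>UNIV. (q $ i) ^ (\<alpha> $ i)) (\<Prod>i\<in>UNIV. [:U $ i, of_int (v $ i):] ^ (\<alpha> $ i))"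
        by (rule prod_smult)
      also have "(\<Prod>i\<in>UNIV. (q $ i) ^ (\<alpha> $ i)) = of_nat CARD('p) ^ (m + \<delta> \<alpha>)"
        using monomial_at_powers[of "of_nat CARD('p) :: 'p padic" k \<alpha>] \<delta>[OF \<alpha>] by (simp add: monomial_at_def q_def)
      finally show "smult (padic_coeffs (face_part f ?F) \<alpha>) (\<Prod>i\<in>UNIV. [:x $ i, (\<chi> i. q $ i * of_int (v $ i)) $ i:] ^ (\<alpha> $ i)) =
          smult (of_nat CARD('p) ^ m) (smult (padic_coeffs g \<alpha>) (\<Prod>i\<in>UNIV. [:U $ i, (\<chi> i. of_int (v $ i)) $ i:] ^ (\<alpha> $ i)))"
        using \<alpha> by (simp add: padic_coeffs_def g_def fp power_add mult_ac)
    qed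
    also have "\<dots> = smult (of_nat CARD('p) ^ m) (\<Sum>\<alpha>\<in>A. smult (padic_coeffs g \<alpha>) (\<Prod>i\<in>UNIV. [:U $ i, (\<chi> i. of_int (v $ i)) $ i:] ^ (\<alpha> $ i)))"
      by (simp only: smult_sum2)
    also have "(\<Sum>\<alpha>\<in>A. smult (padic_coeffs g \<alpha>) (\<Prod>i\<in>UNIV. [:U $ i, (\<chi> i. of_int (v $ i)) $ i:] ^ (\<alpha> $ i))) =
        line_poly (padic_coeffs g) U (\<chi> i. of_int (v $ i))"
      by (rule line_poly_superset[OF finA, symmetric]) (auto simp: padic_coeffs_def g_def split: if_splits)
    finally show ?thesis .
  qed
  define D where "D = (\<Sum>\<alpha>\<in>A. \<Sum>i\<in>UNIV. \<alpha> $ i)"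
  have D: "(\<Sum>i\<in>UNIV. \<alpha> $ i) \<le> D" if "\<alpha> \<in> A" for \<alpha>
    unfolding D_def using finA that by (intro member_le_sum[of \<alpha> A "\<lambda>\<alpha>. \<Sum>i\<in>UNIV. \<alpha> $ i"]) auto
  have "x $ i \<noteq> 0" for i using q0 U0 by (simp add: x_def)
  then obtain js where js: "length js \<le> ?o"
    "series_at (foldr coeff_pderiv js (padic_coeffs (face_part f ?F))) x \<noteq> 0"
    using face_order_spec(2)[OF finA A'(2) fnz D] by blast
  have "series_at (foldr coeff_pderiv js (padic_coeffs (face_part f ?F))) x = 0"
  proof (rule derivatives_vanish[OF _ q0 _ js(1)])
    show "finite {\<alpha>. (padic_coeffs (face_part f ?F) \<alpha> :: 'p padic) \<noteq> 0}"
      using finA fnz by (simp add: padic_coeffs_def)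
    show "coeff (line_poly (padic_coeffs (face_part f ?F)) x (\<chi> i. q $ i * of_int (v $ i))) j = 0" if "j \<le> ?o" for v :: "int ^ 'n" and j
      unfolding line_eq using van[OF that] by simp
  qed
  then show False using js(2) by simp
qed

text \<open>The condition is \<open>\<gamma> F \<le> 1 / o(F)\<close>, multiplied out so that a face of order \<open>0\<close> imposes nothing.\<close>

definition admissible_rate :: "'p::prime_card itself \<Rightarrow> ((real ^ 'n) set \<Rightarrow> real) \<Rightarrow> bool" where
  "admissible_rate T \<gamma> \<longleftrightarrow> (\<forall>F\<in>compact_newton_faces f. \<gamma> F \<ge> 0 \<and> \<gamma> F * real (face_order T f F) \<le> 1)"

definition unit_box :: "'p::prime_card itself \<Rightarrow> nat \<Rightarrow> (int ^ 'n) set" where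
  "unit_box T L = {u. (\<forall>i. u $ i \<in> {0..<int CARD('p) ^ L}) \<and> (\<forall>i. \<not> int CARD('p) dvd u $ i)}"

text \<open>M is both the precision to which c' must agree with the rescaled face polynomial and the
  constant in the bound; merged into one number, the statement is monotone in M as
  \<open>uniform_nat_bound\<close> needs.\<close>

lemma facial_count:
  assumes \<gamma>: "admissible_rate TYPE('p::prime_card) \<gamma>"
    and A: "facial A" and \<delta>: "\<And>a. a \<in> A \<Longrightarrow> dotn k a = m + \<delta> a"
  shows "\<exists>M::nat. \<forall>c' j L. finite {\<alpha>. c' \<alpha> \<noteq> 0} \<longrightarrow>
      (\<forall>\<alpha>. int CARD('p) ^ M dvd c' \<alpha> - (if \<alpha> \<in> A then f \<alpha> * int CARD('p) ^ \<delta> \<alpha> else 0)) \<longrightarrow> j \<le> L \<longrightarrow>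
      real (card {u \<in> unit_box TYPE('p) L. int CARD('p) ^ j dvd (\<Sum>\<alpha> | c' \<alpha> \<noteq> 0. c' \<alpha> * monomial_at u \<alpha>)})
      \<le> real M * real CARD('p) ^ (L * CARD('n)) * real CARD('p) powr (- \<gamma> (face_of_gens A) * real j)"
proof -
  let ?p = "int CARD('p)"
  let ?o = "face_order TYPE('p) f (face_of_gens A)"
  define g :: "nat ^ 'n \<Rightarrow> int" where "g = (\<lambda>\<alpha>. if \<alpha> \<in> A then f \<alpha> * ?p ^ \<delta> \<alpha> else 0)"
  have "finite A" using A finite_gens finite_subset by (auto simp: facial_def)
  then have fin: "finite {\<alpha>. g \<alpha> \<noteq> 0}" by (rule rev_finite_subset) (auto simp: g_def split: if_splits)
  have "\<exists>R. \<forall>u :: int ^ 'n. (\<forall>i. \<not> ?p dvd u $ i) \<longrightarrow>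
    (\<exists>v. \<exists>j\<le>?o. \<not> ?p ^ R dvd coeff (line_poly g u v) j)"
    unfolding g_def by (rule uniform_nonvanishing, rule facial_nonvanishing[OF A \<delta>])
  then obtain R where R: "\<And>u :: int ^ 'n. (\<And>i. \<not> ?p dvd u $ i) \<Longrightarrow>
    \<exists>v. \<exists>j\<le>?o. \<not> ?p ^ R dvd coeff (line_poly g u v) j" by blast
  have "face_of_gens A \<in> compact_newton_faces f"
    unfolding face_of_gens_def by (rule facial_compact_face[OF A])
  then have \<gamma>': "\<gamma> (face_of_gens A) \<ge> 0" "\<gamma> (face_of_gens A) * real ?o \<le> 1"
    using \<gamma> by (auto simp: admissible_rate_def)
  obtain C where C: "C > 0"
    "\<And>c' j L. finite {\<alpha>. c' \<alpha> \<noteq> 0} \<Longrightarrow> (\<And>\<alpha>. ?p ^ (R * (?o + 1)) dvd c' \<alpha> - g \<alpha>) \<Longrightarrow> j \<le> L \<Longrightarrow>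
      real (card {u. (\<forall>i. u $ i \<in> {0..<?p ^ L}) \<and> (\<forall>i. \<not> ?p dvd u $ i) \<and>
        ?p ^ j dvd (\<Sum>\<alpha> | c' \<alpha> \<noteq> 0. c' \<alpha> * monomial_at u \<alpha>)})
      \<le> C * real CARD('p) ^ (L * CARD('n)) * real CARD('p) powr (- \<gamma> (face_of_gens A) * real j)"
    using card_unit_sublevel[OF fin R \<gamma>'] by blast
  define M where "M = max (R * (?o + 1)) (nat \<lceil>C\<rceil>)"
  have CM: "C \<le> real M" unfolding M_def using real_nat_ceiling_ge[of C] by linarith
  show ?thesis
  proof (intro exI[of _ M] allI impI)
    fix c' :: "nat ^ 'n \<Rightarrow> int" and j L :: nat
    assume c': "finite {\<alpha>. c' \<alpha> \<noteq> 0}" "\<forall>\<alpha>. ?p ^ M dvd c' \<alpha> - (if \<alpha> \<in> A then f \<alpha> * ?p ^ \<delta> \<alpha> else 0)"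
      and j: "j \<le> L"
    have "?p ^ (R * (?o + 1)) dvd c' \<alpha> - g \<alpha>" for \<alpha>
      unfolding g_def by (rule power_le_dvd[OF c'(2)[rule_format]]) (simp add: M_def)
    from C(2)[OF c'(1) this j]
    have "real (card {u \<in> unit_box TYPE('p) L. ?p ^ j dvd (\<Sum>\<alpha> | c' \<alpha> \<noteq> 0. c' \<alpha> * monomial_at u \<alpha>)}) \<le>
      C * (real CARD('p) ^ (L * CARD('n)) * real CARD('p) powr (- \<gamma> (face_of_gens A) * real j))"
      by (simp add: unit_box_def mult.assoc)
    also have "\<dots> \<le> real M * (real CARD('p) ^ (L * CARD('n)) * real CARD('p) powr (- \<gamma> (face_of_gens A) * real j))"
      by (rule mult_right_mono[OF CM]) simp
    finally show "real (card {u \<in> unit_box TYPE('p) L. ?p ^ j dvd (\<Sum>\<alpha> | c' \<alpha> \<noteq> 0. c' \<alpha> * monomial_at u \<alpha>)}) \<le>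
      real M * real CARD('p) ^ (L * CARD('n)) * real CARD('p) powr (- \<gamma> (face_of_gens A) * real j)"
      by (simp only: mult.assoc)
  qed
qed

text \<open>For tolerance B the offsets of the active generators take finitely many values, so one
  precision serves all rescaled face polynomials. B' is at least that precision: after division by
  p^m(k) all inactive terms are congruent to 0 to this precision.\<close>

lemma approx_face_count:
  fixes B :: nat
  assumes \<gamma>: "admissible_rate TYPE('p::prime_card) \<gamma>"
  shows "\<exists>B' :: nat. \<forall>k A. A \<subseteq> S \<longrightarrow> A \<noteq> {} \<longrightarrow> (\<forall>a\<in>A. dotn k a \<le> order_along k + B) \<longrightarrow>
    (\<forall>b\<in>S - A. dotn k b > order_along k + B') \<longrightarrow> (\<forall>i. k $ i > B') \<longrightarrow>
    facial A \<and> (\<forall>l L U. order_along k \<le> l \<longrightarrow> l \<le> L \<longrightarrow> finite U \<longrightarrow> A \<subseteq> U \<longrightarrow>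
      real (card {u \<in> unit_box TYPE('p) L. int CARD('p) ^ l dvd (\<Sum>\<alpha>\<in>U. f \<alpha> * int CARD('p) ^ dotn k \<alpha> * monomial_at u \<alpha>)})
      \<le> real B' * real CARD('p) ^ (L * CARD('n)) * real CARD('p) powr (- \<gamma> (face_of_gens A) * real (l - order_along k)))"
proof -
  let ?p = "int CARD('p)"
  have p0: "?p \<noteq> 0" using prime_gt_0_nat[OF prime_card[where 'a = 'p]] by simp
  have "\<exists>K. \<forall>A\<in>Pow S - {{}}. \<forall>B k. (\<forall>a\<in>A. dotn k a \<le> order_along k + B) \<longrightarrow>
      (\<forall>b\<in>S - A. dotn k b > order_along k + K * B) \<longrightarrow> (\<forall>i. k $ i > K * B) \<longrightarrow> facial A"
  proof (rule uniform_nat_bound)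
    show "finite (Pow S - {{}})" using finite_gens by simp
    show "\<exists>K. \<forall>B k. (\<forall>a\<in>A. dotn k a \<le> order_along k + B) \<longrightarrow>
      (\<forall>b\<in>S - A. dotn k b > order_along k + K * B) \<longrightarrow> (\<forall>i. k $ i > K * B) \<longrightarrow> facial A"
      if "A \<in> Pow S - {{}}" for A
      using active_facial_bound[of A] that by blast
    fix A :: "(nat ^ 'n) set" and K K' :: nat
    assume *: "\<forall>B k. (\<forall>a\<in>A. dotn k a \<le> order_along k + B) \<longrightarrow>
      (\<forall>b\<in>S - A. dotn k b > order_along k + K * B) \<longrightarrow> (\<forall>i. k $ i > K * B) \<longrightarrow> facial A" and "K \<le> K'"
    then have KK: "K * B \<le> K' * B" for B by simp
    show "\<forall>B k. (\<forall>a\<in>A. dotn k a \<le> order_along k + B) \<longrightarrow>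
      (\<forall>b\<in>S - A. dotn k b > order_along k + K' * B) \<longrightarrow> (\<forall>i. k $ i > K' * B) \<longrightarrow> facial A"
    proof (intro allI impI)
      fix B k assume 1: "\<forall>a\<in>A. dotn k a \<le> order_along k + B"
        and 2: "\<forall>b\<in>S - A. dotn k b > order_along k + K' * B" and 3: "\<forall>i. k $ i > K' * B"
      have "\<forall>b\<in>S - A. dotn k b > order_along k + K * B"
      proof
        fix b assume "b \<in> S - A"
        then have "dotn k b > order_along k + K' * B" using 2 by blast
        then show "dotn k b > order_along k + K * B" using KK[of B] by linarith
      qed
      moreover have "\<forall>i. k $ i > K * B"
      proof
        fix i
        have "k $ i > K' * B" using 3 by blast
        then show "k $ i > K * B" using KK[of B] by linarith
      qed
      ultimately show "facial A" using * 1 by blast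
    qed
  qed
  then obtain K where K0: "\<forall>A\<in>Pow S - {{}}. \<forall>B k. (\<forall>a\<in>A. dotn k a \<le> order_along k + B) \<longrightarrow>
      (\<forall>b\<in>S - A. dotn k b > order_along k + K * B) \<longrightarrow> (\<forall>i. k $ i > K * B) \<longrightarrow> facial A" ..
  have K: "facial A" if "A \<subseteq> S" "A \<noteq> {}" "\<forall>a\<in>A. dotn k a \<le> order_along k + B"
    "\<forall>b\<in>S - A. dotn k b > order_along k + K * B" "\<forall>i. k $ i > K * B" for A B k
  proof -
    have "A \<in> Pow S - {{}}" using that by simp
    from bspec[OF K0 this, THEN spec, THEN spec, THEN mp, OF that(3), THEN mp, OF that(4), THEN mp, OF that(5)]
    show ?thesis .
  qed
  \<comment> \<open>The finite set of patterns over which \<open>facial_count\<close> is made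
    uniform.\<close>
  define G where "G = (SIGMA A : Pow S. A \<rightarrow>\<^sub>E {..B})"
  have "finite G" unfolding G_def
    using finite_gens finite_subset by (intro finite_SigmaI finite_PiE) auto
  define P where "P = (\<lambda>x M. case x of (A, \<delta>) \<Rightarrow> facial A \<longrightarrow> (\<exists>k. \<forall>a\<in>A. dotn k a = order_along k + \<delta> a) \<longrightarrow>
      (\<forall>c' j L. finite {\<alpha>. c' \<alpha> \<noteq> 0} \<longrightarrow>
      (\<forall>\<alpha>. ?p ^ M dvd c' \<alpha> - (if \<alpha> \<in> A then f \<alpha> * ?p ^ \<delta> \<alpha> else 0)) \<longrightarrow> j \<le> L \<longrightarrow>
      real (card {u \<in> unit_box TYPE('p) L. ?p ^ j dvd (\<Sum>\<alpha> | c' \<alpha> \<noteq> 0. c' \<alpha> * monomial_at u \<alpha>)})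
      \<le> real M * real CARD('p) ^ (L * CARD('n)) * real CARD('p) powr (- \<gamma> (face_of_gens A) * real j)))"
  have "\<exists>M. \<forall>x\<in>G. P x M"
  proof (rule uniform_nat_bound[OF \<open>finite G\<close>])
    fix x :: "(nat ^ 'n) set \<times> (nat ^ 'n \<Rightarrow> nat)"
    obtain A \<delta> where x: "x = (A, \<delta>)" by (cases x)
    show "\<exists>M. P x M"
    proof (cases "facial A \<and> (\<exists>k. \<forall>a\<in>A. dotn k a = order_along k + \<delta> a)")
      case True
      then obtain k where "\<And>a. a \<in> A \<Longrightarrow> dotn k a = order_along k + \<delta> a" by blast
      from facial_count[OF \<gamma> _ this] show ?thesis using True unfolding P_def x by simp
    next
      case False
      then show ?thesis unfolding P_def x by auto
    qed
  next
    fix x :: "(nat ^ 'n) set \<times> (nat ^ 'n \<Rightarrow> nat)" and M M' :: nat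
    obtain A \<delta> where x: "x = (A, \<delta>)" by (cases x)
    assume P: "P x M" and M: "M \<le> M'"
    show "P x M'"
      unfolding P_def x prod.case
    proof (intro impI allI)
      fix c' :: "nat ^ 'n \<Rightarrow> int" and j L :: nat
      assume A: "facial A" "\<exists>k. \<forall>a\<in>A. dotn k a = order_along k + \<delta> a"
        and c': "finite {\<alpha>. c' \<alpha> \<noteq> 0}" "\<forall>\<alpha>. ?p ^ M' dvd c' \<alpha> - (if \<alpha> \<in> A then f \<alpha> * ?p ^ \<delta> \<alpha> else 0)"
        and j: "j \<le> L"
      have "\<forall>\<alpha>. ?p ^ M dvd c' \<alpha> - (if \<alpha> \<in> A then f \<alpha> * ?p ^ \<delta> \<alpha> else 0)"
        using c'(2) M by (intro allI power_le_dvd[OF c'(2)[rule_format]])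
      then have "real (card {u \<in> unit_box TYPE('p) L. ?p ^ j dvd (\<Sum>\<alpha> | c' \<alpha> \<noteq> 0. c' \<alpha> * monomial_at u \<alpha>)})
        \<le> real M * real CARD('p) ^ (L * CARD('n)) * real CARD('p) powr (- \<gamma> (face_of_gens A) * real j)"
        using P A c'(1) j unfolding P_def x by simp
      also have "\<dots> \<le> real M' * real CARD('p) ^ (L * CARD('n)) * real CARD('p) powr (- \<gamma> (face_of_gens A) * real j)"
        using M by (intro mult_right_mono) auto
      finally show "real (card {u \<in> unit_box TYPE('p) L. ?p ^ j dvd (\<Sum>\<alpha> | c' \<alpha> \<noteq> 0. c' \<alpha> * monomial_at u \<alpha>)})
        \<le> real M' * real CARD('p) ^ (L * CARD('n)) * real CARD('p) powr (- \<gamma> (face_of_gens A) * real j)" .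
    qed
  qed
  then obtain M where M: "\<And>x. x \<in> G \<Longrightarrow> P x M" by blast
  define B' where "B' = max (K * B) M"
  show ?thesis
  proof (intro exI[of _ B'] allI impI conjI)
    fix k A assume A: "A \<subseteq> S" "A \<noteq> {}" and act: "\<forall>a\<in>A. dotn k a \<le> order_along k + B"
      and inact: "\<forall>b\<in>S - A. dotn k b > order_along k + B'" and big: "\<forall>i. k $ i > B'"
    show fac: "facial A"
    proof (rule K[OF A act])
      have KB: "K * B \<le> B'" by (simp add: B'_def)
      show "\<forall>b\<in>S - A. dotn k b > order_along k + K * B"
      proof
        fix b assume "b \<in> S - A"
        then have "dotn k b > order_along k + B'" using inact by blast
        then show "dotn k b > order_along k + K * B" using KB by linarith
      qed
      show "\<forall>i. k $ i > K * B" using big le_less_trans[OF KB] by blast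
    qed
    fix l L :: nat and U assume l: "order_along k \<le> l" "l \<le> L" and U: "finite U" "A \<subseteq> U"
    let ?m = "order_along k"
    define \<delta> where "\<delta> = restrict (\<lambda>a. dotn k a - ?m) A"
    define c where "c = (\<lambda>\<alpha>. if \<alpha> \<in> U \<and> f \<alpha> \<noteq> 0 then f \<alpha> * ?p ^ (dotn k \<alpha> - ?m) else 0)"
    \<comment> \<open>A support point outside \<open>S\<close> exceeds a generator by at least 1 in
      some coordinate i and so gains \<open>k $ i > B'\<close>. The possibly infinitely many
      monomials beyond the generators are disposed of in this way; here large entries of k are
      essential.\<close>
    have ge: "?m \<le> dotn k \<alpha>" "\<alpha> \<notin> A \<Longrightarrow> ?m + B' \<le> dotn k \<alpha>" if \<alpha>: "f \<alpha> \<noteq> 0" for \<alpha>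
    proof -
      obtain s where s: "s \<in> S" "\<And>i. s $ i \<le> \<alpha> $ i" using gens_dominate[OF \<alpha>] by blast
      have le: "dotn k s \<le> dotn k \<alpha>" unfolding dotn_def using s(2) by (intro sum_mono mult_le_mono2)
      then show "?m \<le> dotn k \<alpha>" using order_along_le[OF s(1), of k] by linarith
      assume "\<alpha> \<notin> A"
      show "?m + B' \<le> dotn k \<alpha>"
      proof (cases "s = \<alpha>")
        case True
        then have "?m + B' < dotn k \<alpha>" using inact s(1) \<open>\<alpha> \<notin> A\<close> by blast
        then show ?thesis by simp
      next
        case False
        then have "\<exists>i. s $ i \<noteq> \<alpha> $ i" unfolding vec_eq_iff by simp
        then obtain i where "s $ i \<noteq> \<alpha> $ i" ..
        then have i: "s $ i + 1 \<le> \<alpha> $ i" using s(2)[of i] by simp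
        have "dotn k s + k $ i = (\<Sum>j\<in>UNIV. k $ j * s $ j + (if j = i then k $ i else 0))"
          by (simp add: dotn_def sum.distrib)
        also have "\<dots> \<le> dotn k \<alpha>"
          unfolding dotn_def
        proof (rule sum_mono)
          fix j
          have "s $ j + (if j = i then 1 else 0) \<le> \<alpha> $ j" using s(2)[of j] i by simp
          then have "k $ j * (s $ j + (if j = i then 1 else 0)) \<le> k $ j * \<alpha> $ j" by (rule mult_le_mono2)
          then show "k $ j * s $ j + (if j = i then k $ i else 0) \<le> k $ j * \<alpha> $ j"
            by (cases "j = i") (simp_all add: algebra_simps)
        qed
        finally have "dotn k s + k $ i \<le> dotn k \<alpha>" .
        moreover have "k $ i > B'" using big by blast
        ultimately show ?thesis using order_along_le[OF s(1), of k] by linarith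
      qed
    qed
    have \<delta>: "dotn k a = ?m + \<delta> a" if "a \<in> A" for a
      using order_along_le[of a k] that A by (auto simp: \<delta>_def)
    have "(A, \<delta>) \<in> G" using A(1) act by (auto simp: G_def \<delta>_def)
    from M[OF this] have PM: "\<And>c' j L. finite {\<alpha>. c' \<alpha> \<noteq> 0} \<Longrightarrow>
      (\<forall>\<alpha>. ?p ^ M dvd c' \<alpha> - (if \<alpha> \<in> A then f \<alpha> * ?p ^ \<delta> \<alpha> else 0)) \<Longrightarrow> j \<le> L \<Longrightarrow>
      real (card {u \<in> unit_box TYPE('p) L. ?p ^ j dvd (\<Sum>\<alpha> | c' \<alpha> \<noteq> 0. c' \<alpha> * monomial_at u \<alpha>)})
      \<le> real M * real CARD('p) ^ (L * CARD('n)) * real CARD('p) powr (- \<gamma> (face_of_gens A) * real j)"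
      using fac \<delta> unfolding P_def prod.case by blast
    have supp: "{\<alpha>. c \<alpha> \<noteq> 0} \<subseteq> U" by (auto simp: c_def split: if_splits)
    have finc: "finite {\<alpha>. c \<alpha> \<noteq> 0}" using supp U(1) by (rule finite_subset)
    have cdiff: "?p ^ M dvd c \<alpha> - (if \<alpha> \<in> A then f \<alpha> * ?p ^ \<delta> \<alpha> else 0)" for \<alpha>
    proof (cases "\<alpha> \<in> A")
      case True
      then have "c \<alpha> = f \<alpha> * ?p ^ \<delta> \<alpha>" using A U gens_support by (auto simp: c_def \<delta>_def)
      then show ?thesis using True by simp
    next
      case False
      have "?p ^ M dvd c \<alpha>"
      proof (cases "\<alpha> \<in> U \<and> f \<alpha> \<noteq> 0")
        case True
        have "M \<le> dotn k \<alpha> - ?m" using ge(2)[of \<alpha>] True False by (simp add: B'_def)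
        then have "?p ^ M dvd ?p ^ (dotn k \<alpha> - ?m)" by (rule le_imp_power_dvd)
        then show ?thesis using True by (simp add: c_def)
      qed (auto simp: c_def)
      then show ?thesis using False by simp
    qed
    have ev: "(\<Sum>\<alpha>\<in>U. f \<alpha> * ?p ^ dotn k \<alpha> * monomial_at u \<alpha>) = ?p ^ ?m * (\<Sum>\<alpha> | c \<alpha> \<noteq> 0. c \<alpha> * monomial_at u \<alpha>)" for u
    proof -
      have e1: "(\<Sum>\<alpha> | c \<alpha> \<noteq> 0. c \<alpha> * monomial_at u \<alpha>) = (\<Sum>\<alpha>\<in>U. c \<alpha> * monomial_at u \<alpha>)"
        using U(1) supp by (intro sum.mono_neutral_left) auto
      have e2: "f \<alpha> * ?p ^ dotn k \<alpha> * monomial_at u \<alpha> = ?p ^ ?m * (c \<alpha> * monomial_at u \<alpha>)" if "\<alpha> \<in> U" for \<alpha>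
      proof (cases "f \<alpha> = 0")
        case False
        then have "?m + (dotn k \<alpha> - ?m) = dotn k \<alpha>" using ge(1)[of \<alpha>] by simp
        then have "?p ^ dotn k \<alpha> = ?p ^ ?m * ?p ^ (dotn k \<alpha> - ?m)"
          using power_add[of ?p ?m "dotn k \<alpha> - ?m"] by (simp only:)
        then show ?thesis using that False by (simp add: c_def)
      qed (simp add: c_def)
      show ?thesis unfolding e1 sum_distrib_left by (rule sum.cong[OF refl e2])
    qed
    have dv: "?p ^ l dvd (\<Sum>\<alpha>\<in>U. f \<alpha> * ?p ^ dotn k \<alpha> * monomial_at u \<alpha>) \<longleftrightarrow>
        ?p ^ (l - ?m) dvd (\<Sum>\<alpha> | c \<alpha> \<noteq> 0. c \<alpha> * monomial_at u \<alpha>)" for u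
    proof -
      have "?p ^ l = ?p ^ ?m * ?p ^ (l - ?m)" using l(1) by (simp flip: power_add)
      then show ?thesis unfolding ev using p0 by simp
    qed
    have "l - ?m \<le> L" using l(2) by simp
    have "real (card {u \<in> unit_box TYPE('p) L. ?p ^ (l - ?m) dvd (\<Sum>\<alpha> | c \<alpha> \<noteq> 0. c \<alpha> * monomial_at u \<alpha>)})
      \<le> real M * real CARD('p) ^ (L * CARD('n)) * real CARD('p) powr (- \<gamma> (face_of_gens A) * real (l - ?m))"
      by (rule PM[OF finc _ \<open>l - ?m \<le> L\<close>]) (use cdiff in blast)
    also have "\<dots> \<le> real B' * real CARD('p) ^ (L * CARD('n)) * real CARD('p) powr (- \<gamma> (face_of_gens A) * real (l - ?m))"
      by (intro mult_right_mono) (auto simp: B'_def)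
    finally show "real (card {u \<in> unit_box TYPE('p) L. ?p ^ l dvd (\<Sum>\<alpha>\<in>U. f \<alpha> * ?p ^ dotn k \<alpha> * monomial_at u \<alpha>)})
      \<le> real B' * real CARD('p) ^ (L * CARD('n)) * real CARD('p) powr (- \<gamma> (face_of_gens A) * real (l - ?m))"
      unfolding dv .
  qed
qed

text \<open>
  The sets of generators that are within \<open>b j\<close> of being minimal along \<open>k\<close> increase with \<open>j\<close>,
  so they are stationary for some \<open>j \<le> card S\<close>.
\<close>

lemma face_decomposition:
  assumes \<gamma>: "admissible_rate TYPE('p::prime_card) \<gamma>"
  shows "\<exists>M::nat. \<forall>k. (\<forall>i. k $ i > M) \<longrightarrow> (\<exists>A. facial A \<and> (\<forall>a\<in>A. dotn k a \<le> order_along k + M) \<and>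
    (\<forall>l L U. order_along k \<le> l \<longrightarrow> l \<le> L \<longrightarrow> finite U \<longrightarrow> S \<subseteq> U \<longrightarrow>
      real (card {u \<in> unit_box TYPE('p) L. int CARD('p) ^ l dvd (\<Sum>\<alpha>\<in>U. f \<alpha> * int CARD('p) ^ dotn k \<alpha> * monomial_at u \<alpha>)})
      \<le> real M * real CARD('p) ^ (L * CARD('n)) * real CARD('p) powr (- \<gamma> (face_of_gens A) * real (l - order_along k))))"
proof -
  define Q where "Q = (\<lambda>k A B' l L U. real (card {u \<in> unit_box TYPE('p) L. int CARD('p) ^ l dvd (\<Sum>\<alpha>\<in>U. f \<alpha> * int CARD('p) ^ dotn k \<alpha> * monomial_at u \<alpha>)})
      \<le> real (B'::nat) * real CARD('p) ^ (L * CARD('n)) * real CARD('p) powr (- \<gamma> (face_of_gens A) * real (l - order_along k)))"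
  have "\<forall>B::nat. \<exists>B' :: nat. \<forall>k A. A \<subseteq> S \<longrightarrow> A \<noteq> {} \<longrightarrow> (\<forall>a\<in>A. dotn k a \<le> order_along k + B) \<longrightarrow>
    (\<forall>b\<in>S - A. dotn k b > order_along k + B') \<longrightarrow> (\<forall>i. k $ i > B') \<longrightarrow>
    facial A \<and> (\<forall>l L U. order_along k \<le> l \<longrightarrow> l \<le> L \<longrightarrow> finite U \<longrightarrow> A \<subseteq> U \<longrightarrow> Q k A B' l L U)"
    unfolding Q_def by (rule allI, rule approx_face_count[OF \<gamma>])
  from choice[OF this] obtain \<Phi> :: "nat \<Rightarrow> nat" where \<Phi>0: "\<forall>B. \<forall>k A. A \<subseteq> S \<longrightarrow> A \<noteq> {} \<longrightarrow> (\<forall>a\<in>A. dotn k a \<le> order_along k + B) \<longrightarrow>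
    (\<forall>b\<in>S - A. dotn k b > order_along k + \<Phi> B) \<longrightarrow> (\<forall>i. k $ i > \<Phi> B) \<longrightarrow>
    facial A \<and> (\<forall>l L U. order_along k \<le> l \<longrightarrow> l \<le> L \<longrightarrow> finite U \<longrightarrow> A \<subseteq> U \<longrightarrow> Q k A (\<Phi> B) l L U)" ..
  \<comment> \<open>Each threshold is the gap demanded by its predecessor, so A (j + 1) = A j says
    that every generator is either within b j of the minimum or beyond the required gap. The maximum
    keeps the sequence nondecreasing.\<close>
  define b where "b = rec_nat 0 (\<lambda>_ x. max (\<Phi> x) x)"
  have b0: "b 0 = 0" and bS: "b (Suc j) = max (\<Phi> (b j)) (b j)" for j by (simp_all add: b_def)
  have "mono b" by (rule incseq_SucI) (simp add: bS)
  then have bm: "b i \<le> b j" if "i \<le> j" for i j using that by (rule monoD)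
  define M where "M = b (Suc (card S))"
  show ?thesis
  proof (intro exI[of _ M] allI impI)
    fix k :: "nat ^ 'n" assume k: "\<forall>i. k $ i > M"
    let ?m = "order_along k"
    define A where "A j = {s\<in>S. dotn k s \<le> ?m + b j}" for j :: nat
    have finA: "finite (A j)" for j using finite_gens by (simp add: A_def)
    have subA: "A j \<subseteq> A (Suc j)" for j using bm[of j "Suc j"] by (auto simp: A_def)
    have "\<exists>j\<le>card S. A (Suc j) = A j"
    proof (rule ccontr)
      assume *: "\<not> (\<exists>j\<le>card S. A (Suc j) = A j)"
      have "j \<le> card (A j)" if "j \<le> Suc (card S)" for j
        using that
      proof (induction j)
        case (Suc j)
        then have "A j \<subset> A (Suc j)" using * subA[of j] by auto
        then have "card (A j) < card (A (Suc j))" using finA by (rule psubset_card_mono[rotated])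
        then show ?case using Suc by simp
      qed simp
      then have "Suc (card S) \<le> card (A (Suc (card S)))" by simp
      moreover have "card (A (Suc (card S))) \<le> card S" using finite_gens by (intro card_mono) (auto simp: A_def)
      ultimately show False by simp
    qed
    then obtain j where j: "j \<le> card S" "A (Suc j) = A j" by blast
    have bj: "\<Phi> (b j) \<le> M" "b j \<le> M"
      using bm[of "Suc j" "Suc (card S)"] j(1) bS[of j] by (auto simp: M_def)
    obtain s where s: "s \<in> S" "dotn k s = ?m" using order_along_attained by blast
    have h1: "A j \<subseteq> S" by (auto simp: A_def)
    have h2: "A j \<noteq> {}" using s by (auto simp: A_def)
    have h3: "\<forall>a\<in>A j. dotn k a \<le> ?m + b j" by (auto simp: A_def)
    have h4: "\<forall>c\<in>S - A j. dotn k c > ?m + \<Phi> (b j)"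
    proof
      fix c assume c: "c \<in> S - A j"
      then have "c \<notin> A (Suc j)" using j(2) by simp
      then have "dotn k c > ?m + b (Suc j)" using c by (simp add: A_def)
      then show "dotn k c > ?m + \<Phi> (b j)" using bS[of j] by linarith
    qed
    have h5: "\<forall>i. k $ i > \<Phi> (b j)" using k le_less_trans[OF bj(1)] by blast
    note res = \<Phi>0[THEN spec, THEN spec, THEN spec, THEN mp, OF h1, THEN mp, OF h2, THEN mp, OF h3, THEN mp, OF h4, THEN mp, OF h5]
    show "\<exists>A. facial A \<and> (\<forall>a\<in>A. dotn k a \<le> ?m + M) \<and>
      (\<forall>l L U. ?m \<le> l \<longrightarrow> l \<le> L \<longrightarrow> finite U \<longrightarrow> S \<subseteq> U \<longrightarrow>
        real (card {u \<in> unit_box TYPE('p) L. int CARD('p) ^ l dvd (\<Sum>\<alpha>\<in>U. f \<alpha> * int CARD('p) ^ dotn k \<alpha> * monomial_at u \<alpha>)})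
        \<le> real M * real CARD('p) ^ (L * CARD('n)) * real CARD('p) powr (- \<gamma> (face_of_gens A) * real (l - ?m)))"
    proof (intro exI[of _ "A j"] conjI allI impI)
      show "facial (A j)" using res by (rule conjunct1)
      show "\<forall>a\<in>A j. dotn k a \<le> ?m + M"
      proof
        fix a assume "a \<in> A j"
        then have "dotn k a \<le> ?m + b j" using h3 by blast
        then show "dotn k a \<le> ?m + M" using bj(2) by linarith
      qed
      fix l L :: nat and U assume l: "?m \<le> l" "l \<le> L" and U: "finite U" "S \<subseteq> U"
      have "A j \<subseteq> U" using h1 U(2) by (rule subset_trans)
      from res[THEN conjunct2, THEN spec, THEN spec, THEN spec, THEN mp, OF l(1), THEN mp, OF l(2), THEN mp, OF U(1), THEN mp, OF this]
      have "Q k (A j) (\<Phi> (b j)) l L U" .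
      then have "Q k (A j) M l L U"
        unfolding Q_def by (rule order_trans) (use bj(1) in \<open>auto intro!: mult_right_mono\<close>)
      then show "real (card {u \<in> unit_box TYPE('p) L. int CARD('p) ^ l dvd (\<Sum>\<alpha>\<in>U. f \<alpha> * int CARD('p) ^ dotn k \<alpha> * monomial_at u \<alpha>)})
        \<le> real M * real CARD('p) ^ (L * CARD('n)) * real CARD('p) powr (- \<gamma> (face_of_gens (A j)) * real (l - ?m))"
        unfolding Q_def .
    qed
  qed
qed

end

section \<open>Strata of fixed valuations\<close>

lemma card_int_box_prod: "card {u :: int ^ 'n. \<forall>i. u $ i \<in> {0..<int (N i)}} = (\<Prod>i\<in>UNIV. N i)"
proof -
  have "bij_betw vec_lambda (Pi\<^sub>E (UNIV :: 'n set) (\<lambda>i. {0..<int (N i)})) {u. \<forall>i. u $ i \<in> {0..<int (N i)}}"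
    by (rule bij_betwI[of _ _ _ vec_nth]) auto
  then have "card {u :: int ^ 'n. \<forall>i. u $ i \<in> {0..<int (N i)}} = card (Pi\<^sub>E (UNIV :: 'n set) (\<lambda>i. {0..<int (N i)}))"
    by (rule bij_betw_same_card[symmetric])
  then show ?thesis by (simp add: card_PiE)
qed

definition int_box :: "nat \<Rightarrow> (int ^ 'n) set" where
  "int_box N = {x. \<forall>i. x $ i \<in> {0..<int N}}"

lemma finite_int_box' [simp]: "finite (int_box N)"
  unfolding int_box_def by (rule finite_int_box)

lemma card_int_box' [simp]: "card (int_box N :: (int ^ 'n) set) = N ^ CARD('n)"
  unfolding int_box_def by (rule card_int_box)

text \<open>In the expansion x = x' + a y, with x' below a and y below b, a property of period a
  depends on x' alone.\<close>

lemma card_periodic_refine: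
  fixes Pr :: "int ^ 'n \<Rightarrow> bool"
  assumes a: "a > 0" and b: "b > 0" and per: "\<And>x y. (\<And>i. int a dvd x $ i - y $ i) \<Longrightarrow> Pr x = Pr y"
  shows "card {x \<in> int_box (a * b). Pr x} = card {x \<in> int_box a. Pr x} * b ^ CARD('n)"
proof -
  have ap: "int a > 0" and bp: "int b > 0" using a b by auto
  let ?g = "\<lambda>(x, y). (\<chi> i. x $ i + int a * y $ i) :: int ^ 'n"
  let ?h = "\<lambda>z :: int ^ 'n. (\<chi> i. z $ i mod int a, \<chi> i. z $ i div int a)"
  have "bij_betw ?g ({x \<in> int_box a. Pr x} \<times> int_box b) {x \<in> int_box (a * b). Pr x}"
  proof (rule bij_betwI[of _ _ _ ?h])
    show "?g \<in> {x \<in> int_box a. Pr x} \<times> int_box b \<rightarrow> {x \<in> int_box (a * b). Pr x}"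
    proof (intro funcsetI, clarify, intro CollectI conjI)
      fix x y :: "int ^ 'n" assume x: "x \<in> int_box a" "Pr x" and y: "y \<in> int_box b"
      have "0 \<le> x $ i + int a * y $ i \<and> x $ i + int a * y $ i < int (a * b)" for i
      proof -
        have xy: "0 \<le> x $ i" "x $ i < int a" "0 \<le> y $ i" "y $ i + 1 \<le> int b"
          using x(1)[unfolded int_box_def, THEN CollectD, THEN spec, of i]
            y[unfolded int_box_def, THEN CollectD, THEN spec, of i] by auto
        then have "int a * (y $ i + 1) \<le> int a * int b" using ap by (intro mult_left_mono) auto
        moreover have "0 \<le> int a * y $ i" using xy ap by simp
        ultimately show ?thesis using xy by (simp add: algebra_simps)
      qed
      then show "(\<chi> i. x $ i + int a * y $ i) \<in> int_box (a * b)" by (simp add: int_box_def)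
      show "Pr (\<chi> i. x $ i + int a * y $ i)" using per[of "\<chi> i. x $ i + int a * y $ i" x] x(2) by simp
    qed
    show "?h \<in> {x \<in> int_box (a * b). Pr x} \<rightarrow> {x \<in> int_box a. Pr x} \<times> int_box b"
    proof (intro funcsetI SigmaI CollectI conjI)
      fix z :: "int ^ 'n" assume z: "z \<in> {x \<in> int_box (a * b). Pr x}"
      show "(\<chi> i. z $ i mod int a) \<in> int_box a" using ap by (simp add: int_box_def)
      show "Pr (\<chi> i. z $ i mod int a)"
        using per[of z "\<chi> i. z $ i mod int a"] z by (simp add: minus_mod_eq_mult_div)
      have "0 \<le> z $ i div int a \<and> z $ i div int a < int b" for i
      proof -
        have "0 \<le> z $ i" "z $ i < int b * int a" using z by (auto simp: int_box_def mult.commute)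
        moreover have "z $ i div int a * int a \<le> z $ i"
          using pos_mod_sign[OF ap, of "z $ i"] div_mult_mod_eq[of "z $ i" "int a"] by linarith
        ultimately have "z $ i div int a * int a < int b * int a" by linarith
        then have "z $ i div int a < int b" using ap by (rule mult_right_less_imp_less[OF _ less_imp_le])
        then show ?thesis using \<open>0 \<le> z $ i\<close> ap by (simp add: pos_imp_zdiv_nonneg_iff)
      qed
      then show "(\<chi> i. z $ i div int a) \<in> int_box b" by (simp add: int_box_def)
    qed
    show "?h (?g x) = x" if "x \<in> {x \<in> int_box a. Pr x} \<times> int_box b" for x
    proof -
      obtain u v where x: "x = (u, v)" by (cases x)
      have "(u $ i + int a * v $ i) mod int a = u $ i \<and> (u $ i + int a * v $ i) div int a = v $ i" for i
      proof -
        have "0 \<le> u $ i" "u $ i < int a" using that by (auto simp: x int_box_def)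
        then show ?thesis using ap by simp
      qed
      then show ?thesis by (simp add: x vec_eq_iff)
    qed
    show "?g (?h y) = y" for y :: "int ^ 'n" by (simp add: vec_eq_iff)
  qed
  then have "card {x \<in> int_box (a * b). Pr x} = card ({x \<in> int_box a. Pr x} \<times> (int_box b :: (int ^ 'n) set))"
    by (rule bij_betw_same_card[symmetric])
  then show ?thesis by (simp add: card_cartesian_product)
qed

text \<open>Vanishing of x_i is weakened to divisibility by N, a periodic condition which a line
  along the i-th axis meets at most once.\<close>

lemma card_zero_coordinate:
  assumes "N > 0"
  shows "N * card {x :: int ^ 'n. x \<in> int_box N \<and> x $ i = 0} \<le> N ^ CARD('n)"
proof -
  have "real N * real (card {u :: int ^ 'n. (\<forall>i. u $ i \<in> {0..<int N}) \<and> int N dvd u $ i}) \<le> real N ^ CARD('n) * 1"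
  proof (rule card_le_line_sections[OF assms, where w = "axis i 1"])
    show "int N dvd x $ i \<longleftrightarrow> int N dvd y $ i" if "\<And>i. int N dvd x $ i - y $ i" for x y :: "int ^ 'n"
      using that[of i] dvd_add_right_iff[of "int N" "x $ i - y $ i" "y $ i"] by simp
    fix u :: "int ^ 'n"
    have "{t \<in> {0..<int N}. int N dvd (u + t *s axis i 1) $ i} \<subseteq> {(- (u $ i)) mod int N}"
    proof clarify
      fix t assume t: "t \<in> {0..<int N}" "int N dvd (u + t *s axis i 1) $ i"
      then have "int N dvd t - (- (u $ i))" by (simp add: axis_def add.commute)
      then have "t mod int N = (- (u $ i)) mod int N" by (simp only: mod_eq_dvd_iff)
      then show "t = (- (u $ i)) mod int N" using t by simp
    qed
    then have "card {t \<in> {0..<int N}. int N dvd (u + t *s axis i 1) $ i} \<le> card {(- (u $ i)) mod int N}"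
      by (intro card_mono) auto
    then show "real (card {t \<in> {0..<int N}. int N dvd (u + t *s axis i 1) $ i}) \<le> 1" by simp
  qed
  moreover have "{x :: int ^ 'n. x \<in> int_box N \<and> x $ i = 0} \<subseteq> {u. (\<forall>i. u $ i \<in> {0..<int N}) \<and> int N dvd u $ i}"
    by (auto simp: int_box_def)
  then have "card {x :: int ^ 'n. x \<in> int_box N \<and> x $ i = 0} \<le> card {u :: int ^ 'n. (\<forall>i. u $ i \<in> {0..<int N}) \<and> int N dvd u $ i}"
    by (rule card_mono[rotated]) (rule finite_subset[OF _ finite_int_box[of "int N"]], auto)
  then have "real N * real (card {x :: int ^ 'n. x \<in> int_box N \<and> x $ i = 0}) \<le>
      real N * real (card {u :: int ^ 'n. (\<forall>i. u $ i \<in> {0..<int N}) \<and> int N dvd u $ i})"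
    by (intro mult_left_mono) auto
  ultimately have "real (N * card {x :: int ^ 'n. x \<in> int_box N \<and> x $ i = 0}) \<le> real (N ^ CARD('n))" by simp
  then show ?thesis by (simp only: of_nat_le_iff)
qed

text \<open>The unit parts x_i / p^(e_i) are only known below p^(L - e_i). Adding p^(L - e_i) s_i,
  with s_i below p^(e_i), lifts them injectively to the full box and changes p^(e_i) u_i only modulo
  p^L. This produces the weight p^(-|e|) of the stratum.\<close>

lemma card_stratum_le:
  fixes Pr :: "int ^ 'n \<Rightarrow> bool" and e :: "nat ^ 'n" and p :: nat
  assumes p: "prime p" and e: "\<And>i. e $ i < L"
    and per: "\<And>x y. (\<And>i. int p ^ L dvd x $ i - y $ i) \<Longrightarrow> Pr x = Pr y"
  shows "card {x \<in> int_box (p ^ L). (\<forall>i. x $ i \<noteq> 0 \<and> multiplicity (int p) (x $ i) = e $ i) \<and> Pr x} * (\<Prod>i\<in>UNIV. p ^ (e $ i))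
    \<le> card {u. (\<forall>i. u $ i \<in> {0..<int p ^ L}) \<and> (\<forall>i. \<not> int p dvd u $ i) \<and> Pr (\<chi> i. int p ^ (e $ i) * u $ i)}"
proof -
  let ?V = "{x \<in> int_box (p ^ L). (\<forall>i. x $ i \<noteq> 0 \<and> multiplicity (int p) (x $ i) = e $ i) \<and> Pr x}"
  let ?T = "{s :: int ^ 'n. \<forall>i. s $ i \<in> {0..<int (p ^ (e $ i))}}"
  let ?W = "{u. (\<forall>i. u $ i \<in> {0..<int p ^ L}) \<and> (\<forall>i. \<not> int p dvd u $ i) \<and> Pr (\<chi> i. int p ^ (e $ i) * u $ i)}"
  let ?g = "\<lambda>(x, s). (\<chi> i. x $ i div int p ^ (e $ i) + int p ^ (L - e $ i) * s $ i) :: int ^ 'n"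
  have p0: "int p > 0" using p prime_gt_0_nat by simp
  have nu: "\<not> is_unit (int p)" using prime_gt_1_nat[OF p] by simp
  have LL: "int p ^ (e $ i) * int p ^ (L - e $ i) = int p ^ L" for i
    using e[of i] by (simp flip: power_add)
  have x: "\<exists>y. x $ i = int p ^ (e $ i) * y \<and> 0 \<le> y \<and> y < int p ^ (L - e $ i) \<and> \<not> int p dvd y" if "x \<in> ?V" for x i
  proof -
    have xi: "x $ i \<noteq> 0" "multiplicity (int p) (x $ i) = e $ i" "0 \<le> x $ i" "x $ i < int p ^ L"
      using that by (auto simp: int_box_def)
    obtain y where y: "x $ i = int p ^ (e $ i) * y" "\<not> int p dvd y"
      using multiplicity_decompose'[OF xi(1) nu] xi(2) by metis
    have pos: "int p ^ (e $ i) > 0" using p0 by simp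
    have "0 \<le> y" using xi(3) mult_le_cancel_left_pos[OF pos, of 0 y] unfolding y(1) by simp
    moreover have "int p ^ (e $ i) * y < int p ^ (e $ i) * int p ^ (L - e $ i)" using xi(4) y(1) LL by simp
    then have "y < int p ^ (L - e $ i)" using p0 by (simp add: mult_less_cancel_left_pos)
    ultimately show ?thesis using y by blast
  qed
  have "card (?V \<times> ?T) \<le> card ?W"
  proof (rule card_inj_on_le[of ?g])
    show "inj_on ?g (?V \<times> ?T)"
    proof (rule inj_onI, clarify)
      fix x s x' s'
      assume *: "x \<in> int_box (p ^ L)" "\<forall>i. x $ i \<noteq> 0 \<and> multiplicity (int p) (x $ i) = e $ i" "Pr x"
        "x' \<in> int_box (p ^ L)" "\<forall>i. x' $ i \<noteq> 0 \<and> multiplicity (int p) (x' $ i) = e $ i" "Pr x'"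
        and eq: "(\<chi> i. x $ i div int p ^ (e $ i) + int p ^ (L - e $ i) * s $ i) =
          (\<chi> i. x' $ i div int p ^ (e $ i) + int p ^ (L - e $ i) * s' $ i)"
      have "x $ i = x' $ i \<and> s $ i = s' $ i" for i
      proof -
        obtain y where y: "x $ i = int p ^ (e $ i) * y" "0 \<le> y" "y < int p ^ (L - e $ i)" using x[of x i] * by blast
        obtain y' where y': "x' $ i = int p ^ (e $ i) * y'" "0 \<le> y'" "y' < int p ^ (L - e $ i)" using x[of x' i] * by blast
        have eqi: "y + int p ^ (L - e $ i) * s $ i = y' + int p ^ (L - e $ i) * s' $ i"
          using arg_cong[OF eq, of "\<lambda>v. v $ i"] y y' p0 by simp
        have "(y + int p ^ (L - e $ i) * s $ i) mod int p ^ (L - e $ i) = y"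
          "(y' + int p ^ (L - e $ i) * s' $ i) mod int p ^ (L - e $ i) = y'" using y y' by simp_all
        then have "y = y'" using eqi by simp
        then show ?thesis using eqi y y' p0 by simp
      qed
      then show "x = x' \<and> s = s'" by (simp add: vec_eq_iff)
    qed
    show "?g ` (?V \<times> ?T) \<subseteq> ?W"
    proof (intro subsetI, elim imageE SigmaE)
      fix w z x' s assume w: "w = ?g z" and z: "z = (x', s)" and V: "x' \<in> ?V" and T: "s \<in> ?T"
      have wi: "w $ i \<in> {0..<int p ^ L} \<and> \<not> int p dvd w $ i \<and> int p ^ L dvd int p ^ (e $ i) * w $ i - x' $ i" for i
      proof -
        obtain y where y: "x' $ i = int p ^ (e $ i) * y" "0 \<le> y" "y < int p ^ (L - e $ i)" "\<not> int p dvd y" using x[OF V] by blast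
        have s: "0 \<le> s $ i" "s $ i + 1 \<le> int p ^ (e $ i)" using T[THEN CollectD, THEN spec, of i] by auto
        have wi: "w $ i = y + int p ^ (L - e $ i) * s $ i" using y p0 by (simp add: w z)
        have "int p ^ (L - e $ i) * (s $ i + 1) \<le> int p ^ (L - e $ i) * int p ^ (e $ i)"
          using s p0 by (intro mult_left_mono) auto
        then have "w $ i < int p ^ L" using y(3) LL[of i] by (simp add: wi algebra_simps)
        moreover have "0 \<le> w $ i" using y s p0 by (simp add: wi)
        moreover have "int p dvd int p ^ (L - e $ i)" using e[of i] by (simp add: dvd_power)
        then have "\<not> int p dvd w $ i" using y(4) unfolding wi by (simp add: dvd_add_left_iff)
        moreover have "int p ^ (e $ i) * w $ i - x' $ i = int p ^ L * s $ i"
          unfolding wi y(1) LL[of i, symmetric] by (simp add: algebra_simps)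
        ultimately show ?thesis by simp
      qed
      have "Pr (\<chi> i. int p ^ (e $ i) * w $ i) = Pr x'" by (rule per) (use wi in simp)
      then show "w \<in> ?W" using wi V by simp
    qed
    show "finite ?W" by (rule finite_subset[OF _ finite_int_box[of "int p ^ L"]]) auto
  qed
  then show ?thesis by (simp only: card_cartesian_product card_int_box_prod)
qed

text \<open>The unit parts congruent to 1 modulo p already give enough points; restricting to them
  costs the factor p^n.\<close>

lemma card_stratum_ge:
  fixes e :: "nat ^ 'n" and p :: nat
  assumes p: "prime p" and e: "\<And>i. e $ i < L"
  shows "p ^ (L * CARD('n)) \<le> card {x :: int ^ 'n. x \<in> int_box (p ^ L) \<and> (\<forall>i. x $ i \<noteq> 0 \<and> multiplicity (int p) (x $ i) = e $ i)} *
    (p ^ CARD('n) * (\<Prod>i\<in>UNIV. p ^ (e $ i)))"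
proof -
  let ?V = "{x :: int ^ 'n. x \<in> int_box (p ^ L) \<and> (\<forall>i. x $ i \<noteq> 0 \<and> multiplicity (int p) (x $ i) = e $ i)}"
  let ?T = "{s :: int ^ 'n. \<forall>i. s $ i \<in> {0..<int (p ^ (L - e $ i - 1))}}"
  let ?g = "\<lambda>s :: int ^ 'n. \<chi> i. int p ^ (e $ i) * (1 + int p * s $ i)"
  have p1: "int p > 1" using p prime_gt_1_nat by simp
  have "card ?T \<le> card ?V"
  proof (rule card_inj_on_le[of ?g])
    show "inj_on ?g ?T" using p1 by (auto simp: inj_on_def vec_eq_iff)
    show "?g ` ?T \<subseteq> ?V"
    proof (intro image_subsetI CollectI conjI allI)
      fix s :: "int ^ 'n" and i assume "s \<in> ?T"
      then have s: "0 \<le> s $ i" "s $ i + 1 \<le> int p ^ (L - e $ i - 1)" for i by (auto dest: spec[of _ i])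
      have nd: "\<not> int p dvd 1 + int p * s $ i" for i
        using p1 by (simp add: dvd_add_left_iff)
      have pos: "1 + int p * s $ i > 0" for i using s(1)[of i] p1 by (simp add: add_pos_nonneg)
      show "?g s $ i \<noteq> 0" using pos[of i] p1 by simp
      have "prime_elem (int p)" using p by (simp add: prime_imp_prime_elem)
      then show "multiplicity (int p) (?g s $ i) = e $ i"
        using pos[of i] p1 not_dvd_imp_multiplicity_0[OF nd[of i]]
        by (simp add: prime_elem_multiplicity_mult_distrib multiplicity_same_power)
      show "?g s \<in> int_box (p ^ L)"
        unfolding int_box_def
      proof (intro CollectI allI)
        fix i
        have "1 + int p * s $ i < int p * (s $ i + 1)" using p1 by (simp add: algebra_simps)
        also have "\<dots> \<le> int p * int p ^ (L - e $ i - 1)" using s(2)[of i] p1 by (intro mult_left_mono) auto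
        also have "\<dots> = int p ^ Suc (L - e $ i - 1)" by simp
        also have "Suc (L - e $ i - 1) = L - e $ i" using e[of i] by simp
        finally have "int p ^ (e $ i) * (1 + int p * s $ i) < int p ^ (e $ i) * int p ^ (L - e $ i)"
          using p1 by (intro mult_strict_left_mono) auto
        also have "\<dots> = int p ^ L" using e[of i] by (simp flip: power_add)
        finally show "?g s $ i \<in> {0..<int (p ^ L)}" using pos[of i] p1 by simp
      qed
    qed
    show "finite ?V" by simp
  qed
  then have "card ?T * (p ^ CARD('n) * (\<Prod>i\<in>UNIV. p ^ (e $ i))) \<le> card ?V * (p ^ CARD('n) * (\<Prod>i\<in>UNIV. p ^ (e $ i)))"
    by (rule mult_le_mono1)
  also have "card ?T * (p ^ CARD('n) * (\<Prod>i\<in>UNIV. p ^ (e $ i))) =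
      (\<Prod>i\<in>UNIV. p ^ (L - e $ i - 1) * (p * p ^ (e $ i)))"
    by (simp only: card_int_box_prod prod.distrib prod_constant)
  also have "\<dots> = (\<Prod>i\<in>(UNIV :: 'n set). p ^ L)"
  proof (rule prod.cong[OF refl])
    fix i
    have "L - e $ i - 1 + Suc (e $ i) = L" using e[of i] by simp
    then show "p ^ (L - e $ i - 1) * (p * p ^ (e $ i)) = p ^ L"
      using power_add[of p "L - e $ i - 1" "Suc (e $ i)"] by (simp only: power_Suc)
  qed
  also have "\<dots> = p ^ (L * CARD('n))" by (simp add: power_mult)
  finally show ?thesis .
qed

section \<open>Lattice point sums\<close>

text \<open>With 1 / x = (1 + \<delta>)^(2 (n + 1)), half of this growth dominates the polynomial
  factor by Bernoulli's inequality, and the other half leaves a geometric series whose ratio z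
  satisfies z^2 = x.\<close>

lemma poly_geometric_summable:
  fixes x :: real
  assumes "0 < x" "x < 1"
  shows "summable (\<lambda>y. (2 + real y) ^ n * x ^ y)"
proof -
  have "root (2 * Suc n) (1 / x) > 1" using assms by (subst real_root_gt_1_iff) auto
  define \<delta> where "\<delta> = root (2 * Suc n) (1 / x) - 1"
  have \<delta>: "\<delta> > 0" using \<open>root _ _ > 1\<close> by (simp add: \<delta>_def)
  have \<delta>p: "(1 + \<delta>) ^ (2 * Suc n) = 1 / x" using assms by (simp add: \<delta>_def real_root_pow_pos2 del: power_Suc)
  have s1: "((1 + \<delta>) ^ Suc n * x) ^ 2 = x"
  proof -
    have "((1 + \<delta>) ^ Suc n * x) ^ 2 = (1 + \<delta>) ^ (2 * Suc n) * x ^ 2"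
      by (simp only: power_mult_distrib power_mult[symmetric] mult.commute)
    also have "\<dots> = x" unfolding \<delta>p using assms by (simp add: power2_eq_square)
    finally show ?thesis .
  qed
  define z where "z = (1 + \<delta>) ^ Suc n * x"
  have z: "0 < z" using \<delta> assms by (simp add: z_def)
  have "z < 1"
  proof (rule ccontr)
    assume "\<not> z < 1"
    then have "1 \<le> z ^ 2" by (intro one_le_power) simp
    then show False using s1 assms unfolding z_def[symmetric] by simp
  qed
  have "summable (\<lambda>y. (2 + 1 / \<delta>) ^ Suc n * z ^ y)"
    using z \<open>z < 1\<close> by (intro summable_mult summable_geometric) simp
  then show ?thesis
  proof (rule summable_comparison_test'[where N = 0])
    fix y :: nat
    have "2 + real y \<le> (2 + 1 / \<delta>) * (1 + real y * \<delta>)"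
      using \<delta> by (simp add: algebra_simps)
    also have "\<dots> \<le> (2 + 1 / \<delta>) * (1 + \<delta>) ^ y"
      using Bernoulli_inequality[of \<delta> y] \<delta> by (intro mult_left_mono) auto
    finally have b: "2 + real y \<le> (2 + 1 / \<delta>) * (1 + \<delta>) ^ y" .
    have "(2 + real y) ^ n \<le> (2 + real y) ^ Suc n" by (intro power_increasing) auto
    also have "\<dots> \<le> ((2 + 1 / \<delta>) * (1 + \<delta>) ^ y) ^ Suc n" by (rule power_mono[OF b]) simp
    finally have "(2 + real y) ^ n * x ^ y \<le> ((2 + 1 / \<delta>) * (1 + \<delta>) ^ y) ^ Suc n * x ^ y"
      using assms by (intro mult_right_mono) auto
    also have "\<dots> = (2 + 1 / \<delta>) ^ Suc n * z ^ y"
      by (simp only: z_def power_mult_distrib power_mult[symmetric] mult.commute mult.left_commute mult.assoc)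
    finally show "norm ((2 + real y) ^ n * x ^ y) \<le> (2 + 1 / \<delta>) ^ Suc n * z ^ y"
      using assms by simp
  qed
qed

text \<open>Coordinates are fixed linear combinations of the forms in \<open>B\<close>, and
  \<epsilon> is 1 / (A + 1), where A is the sum of the absolute values of all coefficients. Integer
  vectors whose forms differ by less than \<epsilon> therefore coincide.\<close>

lemma basis_separates_lattice:
  fixes B :: "(real ^ 'n) set"
  assumes "finite B" "span B = UNIV"
  shows "\<exists>\<epsilon>>0. \<forall>x. (\<forall>b\<in>B. \<bar>x \<bullet> b\<bar> < \<epsilon>) \<longrightarrow> (\<forall>i. \<bar>x $ i\<bar> < 1)"
proof -
  have "\<forall>i. \<exists>u. (\<Sum>b\<in>B. u b *\<^sub>R b) = axis i (1::real)"
  proof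
    fix i
    have "axis i (1::real) \<in> span B" using assms(2) by simp
    then show "\<exists>u. (\<Sum>b\<in>B. u b *\<^sub>R b) = axis i (1::real)"
      unfolding span_finite[OF assms(1)] by force
  qed
  from choice[OF this] obtain u where u: "\<forall>i. (\<Sum>b\<in>B. u i b *\<^sub>R b) = axis i (1::real)" ..
  define A where "A = (\<Sum>i\<in>UNIV. \<Sum>b\<in>B. \<bar>u i b\<bar>)"
  have A: "(\<Sum>b\<in>B. \<bar>u i b\<bar>) \<le> A" for i
    unfolding A_def by (rule member_le_sum[of i UNIV "\<lambda>i. \<Sum>b\<in>B. \<bar>u i b\<bar>"]) (auto intro: sum_nonneg)
  have A0: "A \<ge> 0" unfolding A_def by (intro sum_nonneg) auto
  show ?thesis
  proof (intro exI[of _ "1 / (A + 1)"] conjI allI impI)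
    show "1 / (A + 1) > 0" using A0 by simp
    fix x :: "real ^ 'n" and i assume x: "\<forall>b\<in>B. \<bar>x \<bullet> b\<bar> < 1 / (A + 1)"
    have "x $ i = x \<bullet> (\<Sum>b\<in>B. u i b *\<^sub>R b)" using u by (simp add: inner_axis)
    also have "\<dots> = (\<Sum>b\<in>B. u i b * (x \<bullet> b))" by (simp add: inner_sum_right)
    finally have "\<bar>x $ i\<bar> \<le> (\<Sum>b\<in>B. \<bar>u i b * (x \<bullet> b)\<bar>)" by simp
    also have "\<dots> \<le> (\<Sum>b\<in>B. \<bar>u i b\<bar> * (1 / (A + 1)))"
      unfolding abs_mult by (intro sum_mono mult_left_mono) (use x less_imp_le in auto)
    also have "\<dots> = (\<Sum>b\<in>B. \<bar>u i b\<bar>) * (1 / (A + 1))" by (simp only: sum_distrib_right)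
    also have "\<dots> \<le> A * (1 / (A + 1))" using A A0 by (intro mult_right_mono) auto
    also have "\<dots> < 1" using A0 by simp
    finally show "\<bar>x $ i\<bar> < 1" .
  qed
qed

lemma floor_in_window:
  fixes v V :: real
  assumes "\<bar>v\<bar> \<le> V" shows "\<lfloor>v\<rfloor> \<in> {- \<lceil>V\<rceil>..\<lceil>V\<rceil>}"
  using assms by (simp add: le_floor_iff) linarith

lemma card_int_window: "V \<ge> 0 \<Longrightarrow> real (card {- \<lceil>V\<rceil>..\<lceil>V\<rceil>}) \<le> 2 * V + 3"
  using ceiling_correct[of V] by (simp add: of_nat_nat)

definition vec_sum :: "nat ^ 'n \<Rightarrow> nat" where
  "vec_sum k = (\<Sum>i\<in>UNIV. k $ i)"

text \<open>
  Complete \<open>B\<close> to a basis: the integer parts of the \<open>n\<close> linear forms determine \<open>k\<close> up to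
  boundedly many choices, the forms in \<open>B\<close> range over windows of size \<open>1 + Y k\<close> and the others over
  windows of size \<open>l + Y k\<close>.
\<close>

lemma lattice_sum_bound:
  fixes B :: "(real ^ 'n) set" and q \<eta> C\<^sub>0 :: real
  assumes B: "independent B" and q: "q > 1" and \<eta>: "\<eta> > 0" and C0: "C\<^sub>0 \<ge> 0"
  shows "\<exists>C>0. \<forall>(K :: (nat ^ 'n) set) Y c (l::nat). finite K \<longrightarrow> l \<ge> 1 \<longrightarrow>
    (\<forall>k\<in>K. Y k \<ge> 0 \<and> (\<forall>b\<in>B. \<bar>real_vec k \<bullet> b - c b\<bar> \<le> C\<^sub>0 * (1 + Y k)) \<and> real (vec_sum k) \<le> C\<^sub>0 * (real l + Y k)) \<longrightarrow>
    (\<Sum>k\<in>K. q powr (- \<eta> * Y k)) \<le> C * real l ^ (CARD('n) - card B)"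
proof -
  let ?n = "CARD('n)"
  obtain B' where B0: "B \<subseteq> B'" "B' \<subseteq> UNIV" "independent B'" "UNIV \<subseteq> span B'"
    by (rule maximal_independent_subset_extend[OF subset_UNIV B])
  have B': "B \<subseteq> B'" "independent B'" "span B' = UNIV"
    using B0 by (simp_all add: top.extremum_uniqueI)
  have finB': "finite B'" using B'(2) independent_imp_finite by blast
  have finB: "finite B" using B'(1) finB' by (rule finite_subset)
  have cB': "card B' = ?n"
    using basis_card_eq_dim[of B' UNIV] B' by simp
  have cB: "card B \<le> ?n" using card_mono[OF finB' B'(1)] cB' by simp
  obtain \<epsilon> where \<epsilon>: "\<epsilon> > 0" "\<And>x :: real ^ 'n. \<forall>b\<in>B'. \<bar>x \<bullet> b\<bar> < \<epsilon> \<Longrightarrow> \<forall>i. \<bar>x $ i\<bar> < 1"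
    using basis_separates_lattice[OF finB' B'(3)] by blast
  define b1 where "b1 = (\<Sum>b\<in>B'. \<Sum>i\<in>UNIV. \<bar>b $ i\<bar>)"
  have b1: "\<bar>b $ i\<bar> \<le> b1" if "b \<in> B'" for b i
  proof -
    have "\<bar>b $ i\<bar> \<le> (\<Sum>i\<in>UNIV. \<bar>b $ i\<bar>)" by (rule member_le_sum) auto
    also have "\<dots> \<le> b1" unfolding b1_def using that finB'
      by (intro member_le_sum[of b B' "\<lambda>b. \<Sum>i\<in>UNIV. \<bar>b $ i\<bar>"]) (auto intro: sum_nonneg)
    finally show ?thesis .
  qed
  have b10: "b1 \<ge> 0" unfolding b1_def by (intro sum_nonneg) auto
  \<comment> \<open>At most 2 V + 3 integers lie between the negative and the positive ceiling of V,
    and V will be (1 + b1) C0 / \<epsilon> times the size of the window.\<close>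
  define D where "D = 2 * ((1 + b1) * C\<^sub>0 / \<epsilon>) + 3"
  have D: "D \<ge> 3" using b10 C0 \<epsilon>(1) by (simp add: D_def)
  define x where "x = q powr (- \<eta>)"
  have x: "0 < x" "x < 1" using q \<eta> by (simp_all add: x_def powr_less_one)
  define \<Sigma> where "\<Sigma> = (\<Sum>y. (2 + real y) ^ ?n * x ^ y)"
  have sm: "summable (\<lambda>y. (2 + real y) ^ ?n * x ^ y)" by (rule poly_geometric_summable[OF x])
  have \<Sigma>0: "\<Sigma> \<ge> 0" unfolding \<Sigma>_def using x by (intro suminf_nonneg sm) auto
  show ?thesis
  proof (intro exI[of _ "D ^ ?n * \<Sigma> + 1"] conjI allI impI)
    show "D ^ ?n * \<Sigma> + 1 > 0" using D \<Sigma>0 by (intro add_nonneg_pos mult_nonneg_nonneg) auto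
    fix K :: "(nat ^ 'n) set" and Y :: "nat ^ 'n \<Rightarrow> real" and c :: "real ^ 'n \<Rightarrow> real" and l :: nat
    assume K: "finite K" and l: "l \<ge> 1"
      and H: "\<forall>k\<in>K. Y k \<ge> 0 \<and> (\<forall>b\<in>B. \<bar>real_vec k \<bullet> b - c b\<bar> \<le> C\<^sub>0 * (1 + Y k)) \<and> real (vec_sum k) \<le> C\<^sub>0 * (real l + Y k)"
    define c' where "c' b = (if b \<in> B then c b else 0)" for b
    \<comment> \<open>Measuring the forms in units of \<epsilon> makes their integer parts determine
      k uniquely.\<close>
    define \<phi> where "\<phi> k = (\<lambda>b\<in>B'. \<lfloor>(real_vec k \<bullet> b - c' b) / \<epsilon>\<rfloor>)" for k
    have inj: "inj_on \<phi> K"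
    proof (rule inj_onI)
      fix k k' assume eq: "\<phi> k = \<phi> k'"
      have fl: "\<lfloor>(real_vec k \<bullet> b - c' b) / \<epsilon>\<rfloor> = \<lfloor>(real_vec k' \<bullet> b - c' b) / \<epsilon>\<rfloor>" if "b \<in> B'" for b
        using fun_cong[OF eq, of b] that by (simp add: \<phi>_def)
      have "\<bar>(real_vec k - real_vec k') \<bullet> b\<bar> < \<epsilon>" if "b \<in> B'" for b
      proof -
        have "\<bar>(real_vec k \<bullet> b - c' b) / \<epsilon> - (real_vec k' \<bullet> b - c' b) / \<epsilon>\<bar> < 1" using fl[OF that] by linarith
        moreover have "(real_vec k \<bullet> b - c' b) / \<epsilon> - (real_vec k' \<bullet> b - c' b) / \<epsilon> = (real_vec k - real_vec k') \<bullet> b / \<epsilon>"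
          by (simp add: diff_divide_distrib[symmetric] inner_diff_left)
        ultimately show ?thesis using \<epsilon>(1) by (simp add: abs_divide)
      qed
      then have lt1: "\<bar>(real_vec k - real_vec k') $ i\<bar> < 1" for i using \<epsilon>(2) by blast
      have "k $ i = k' $ i" for i using lt1[of i] by simp
      then show "k = k'" by (simp add: vec_eq_iff)
    qed
    \<comment> \<open>On the layer with integer part y the cardinality is polynomial in y and the
      weight decays like x^y; the power of l factors out of the convergent sum over y.\<close>
    define Ky where "Ky y = {k\<in>K. nat \<lfloor>Y k\<rfloor> = y}" for y
    have finKy: "finite (Ky y)" for y using K by (simp add: Ky_def)
    have cardKy: "real (card (Ky y)) \<le> D ^ ?n * (2 + real y) ^ ?n * real l ^ (?n - card B)" for y
    proof -
      define V where "V b = (if b \<in> B then (1 + b1) * C\<^sub>0 / \<epsilon> * (2 + real y) else (1 + b1) * C\<^sub>0 / \<epsilon> * ((2 + real y) * real l))" for b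
      \<comment> \<open>Turns the additive bound l + 1 + y into a product, so that the power of l
        can be split off.\<close>
      have ly: "real l + 1 + real y \<le> (2 + real y) * real l"
      proof -
        have "(1 + real y) * 1 \<le> (1 + real y) * real l" using l by (intro mult_left_mono) auto
        then show ?thesis by (simp add: algebra_simps)
      qed
      have win: "\<bar>(real_vec k \<bullet> b - c' b) / \<epsilon>\<bar> \<le> V b" if k: "k \<in> Ky y" and b: "b \<in> B'" for k b
      proof -
        have kK: "k \<in> K" and Yk: "Y k \<le> 1 + real y" "Y k \<ge> 0"
          using k H by (auto simp: Ky_def) linarith
        show ?thesis
        proof (cases "b \<in> B")
          case True
          have "\<bar>real_vec k \<bullet> b - c' b\<bar> \<le> C\<^sub>0 * (1 + Y k)" using H kK True by (simp add: c'_def)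
          also have "\<dots> \<le> C\<^sub>0 * (2 + real y)" using Yk C0 by (intro mult_left_mono) auto
          also have "\<dots> \<le> (1 + b1) * (C\<^sub>0 * (2 + real y))"
            using mult_right_mono[of 1 "1 + b1" "C\<^sub>0 * (2 + real y)"] b10 C0 by simp
          finally have "\<bar>real_vec k \<bullet> b - c' b\<bar> / \<epsilon> \<le> (1 + b1) * (C\<^sub>0 * (2 + real y)) / \<epsilon>"
            using \<epsilon>(1) by (intro divide_right_mono) auto
          then show ?thesis using True \<epsilon>(1) by (simp add: V_def abs_divide mult.assoc)
        next
          case False
          have "\<bar>real_vec k \<bullet> b\<bar> \<le> (\<Sum>i\<in>UNIV. \<bar>real (k $ i) * b $ i\<bar>)"
            by (simp add: inner_vec_def)
          also have "\<dots> \<le> (\<Sum>i\<in>UNIV. real (k $ i) * b1)"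
            unfolding abs_mult by (intro sum_mono) (use b1[OF b] in \<open>simp add: mult_left_mono\<close>)
          also have "\<dots> = real (vec_sum k) * b1" by (simp add: vec_sum_def sum_distrib_right)
          also have "\<dots> \<le> real (vec_sum k) * (1 + b1)" by (intro mult_left_mono) auto
          also have "\<dots> \<le> (C\<^sub>0 * (real l + Y k)) * (1 + b1)" using H kK b10 by (intro mult_right_mono) auto
          also have "\<dots> \<le> (C\<^sub>0 * ((2 + real y) * real l)) * (1 + b1)"
            using ly Yk C0 b10 by (intro mult_right_mono mult_left_mono) auto
          finally have "\<bar>real_vec k \<bullet> b\<bar> / \<epsilon> \<le> (C\<^sub>0 * ((2 + real y) * real l)) * (1 + b1) / \<epsilon>"
            using \<epsilon>(1) by (intro divide_right_mono) auto
          then show ?thesis using False \<epsilon>(1) by (simp add: V_def c'_def abs_divide mult_ac)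
        qed
      qed
      have V0: "V b \<ge> 0" for b using b10 C0 \<epsilon>(1) by (auto simp: V_def)
      have "\<phi> ` Ky y \<subseteq> Pi\<^sub>E B' (\<lambda>b. {- \<lceil>V b\<rceil>..\<lceil>V b\<rceil>})"
        using floor_in_window[OF win] by (auto simp: \<phi>_def)
      then have "card (\<phi> ` Ky y) \<le> card (Pi\<^sub>E B' (\<lambda>b. {- \<lceil>V b\<rceil>..\<lceil>V b\<rceil>}))"
        by (intro card_mono finite_PiE finB') auto
      moreover have "card (\<phi> ` Ky y) = card (Ky y)"
        by (intro card_image inj_on_subset[OF inj]) (auto simp: Ky_def)
      ultimately have "real (card (Ky y)) \<le> real (card (Pi\<^sub>E B' (\<lambda>b. {- \<lceil>V b\<rceil>..\<lceil>V b\<rceil>})))" by simp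
      also have "\<dots> = (\<Prod>b\<in>B'. real (card {- \<lceil>V b\<rceil>..\<lceil>V b\<rceil>}))" using finB' by (simp only: card_PiE of_nat_prod)
      also have "\<dots> \<le> (\<Prod>b\<in>B'. D * (2 + real y) * (if b \<in> B then 1 else real l))"
      proof (intro prod_mono conjI)
        fix b
        have "real (card {- \<lceil>V b\<rceil>..\<lceil>V b\<rceil>}) \<le> 2 * V b + 3" by (rule card_int_window[OF V0])
        also have "\<dots> \<le> D * ((2 + real y) * (if b \<in> B then 1 else real l))"
        proof -
          let ?w = "(2 + real y) * (if b \<in> B then 1 else real l)"
          have "?w \<ge> 1 * 1" using l by (intro mult_mono) auto
          have gen: "2 * (A * w) + 3 \<le> (2 * A + 3) * w" if "w \<ge> 1" for A w :: real
            using that by (simp add: algebra_simps)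
          have "V b = (1 + b1) * C\<^sub>0 / \<epsilon> * ?w" by (simp add: V_def)
          then show ?thesis using gen[of ?w "(1 + b1) * C\<^sub>0 / \<epsilon>"] \<open>?w \<ge> 1 * 1\<close> by (simp only: D_def mult_1)
        qed
        finally show "real (card {- \<lceil>V b\<rceil>..\<lceil>V b\<rceil>}) \<le> D * (2 + real y) * (if b \<in> B then 1 else real l)"
          by (simp only: mult.assoc)
      qed simp
      also have "\<dots> = (D * (2 + real y)) ^ ?n * (\<Prod>b\<in>B'. if b \<in> B then 1 else real l)"
        by (simp only: prod.distrib prod_constant cB' power_mult_distrib)
      also have "(\<Prod>b\<in>B'. if b \<in> B then 1 else real l) = real l ^ (?n - card B)"
      proof -
        have "(\<Prod>b\<in>B'. if b \<in> B then 1 else real l) = (\<Prod>b\<in>B' - B. real l)"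
          using finB' by (subst prod.If_cases) (auto simp: Diff_eq)
        then show ?thesis using card_Diff_subset[OF finB B'(1)] cB' by simp
      qed
      finally show ?thesis by (simp only: power_mult_distrib)
    qed
    have "(\<Sum>k\<in>K. q powr (- \<eta> * Y k)) \<le> (\<Sum>k\<in>K. x ^ nat \<lfloor>Y k\<rfloor>)"
    proof (rule sum_mono)
      fix k assume "k \<in> K"
      then have "real (nat \<lfloor>Y k\<rfloor>) \<le> Y k" using H by simp
      then have "\<eta> * real (nat \<lfloor>Y k\<rfloor>) \<le> \<eta> * Y k" using \<eta> by (intro mult_left_mono) auto
      then have "q powr (- \<eta> * Y k) \<le> q powr (- \<eta> * real (nat \<lfloor>Y k\<rfloor>))" using q by (intro powr_mono) auto
      also have "\<dots> = x ^ nat \<lfloor>Y k\<rfloor>" using q unfolding x_def by (subst powr_realpow[symmetric]) (simp_all add: powr_powr)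
      finally show "q powr (- \<eta> * Y k) \<le> x ^ nat \<lfloor>Y k\<rfloor>" .
    qed
    also have "\<dots> = (\<Sum>y\<in>(\<lambda>k. nat \<lfloor>Y k\<rfloor>) ` K. \<Sum>k\<in>Ky y. x ^ nat \<lfloor>Y k\<rfloor>)"
      unfolding Ky_def by (rule sum.image_gen[OF K])
    also have "\<dots> = (\<Sum>y\<in>(\<lambda>k. nat \<lfloor>Y k\<rfloor>) ` K. real (card (Ky y)) * x ^ y)"
      by (intro sum.cong refl) (simp add: Ky_def)
    also have "\<dots> \<le> (\<Sum>y\<in>(\<lambda>k. nat \<lfloor>Y k\<rfloor>) ` K. (D ^ ?n * (2 + real y) ^ ?n * real l ^ (?n - card B)) * x ^ y)"
      using x by (intro sum_mono mult_right_mono cardKy) auto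
    also have "\<dots> = D ^ ?n * real l ^ (?n - card B) * (\<Sum>y\<in>(\<lambda>k. nat \<lfloor>Y k\<rfloor>) ` K. (2 + real y) ^ ?n * x ^ y)"
      by (simp add: sum_distrib_left mult_ac)
    also have "\<dots> \<le> D ^ ?n * real l ^ (?n - card B) * \<Sigma>"
      unfolding \<Sigma>_def using K D x by (intro mult_left_mono sum_le_suminf sm) auto
    also have "\<dots> \<le> (D ^ ?n * \<Sigma> + 1) * real l ^ (?n - card B)" by (simp add: algebra_simps)
    finally show "(\<Sum>k\<in>K. q powr (- \<eta> * Y k)) \<le> (D ^ ?n * \<Sigma> + 1) * real l ^ (?n - card B)" .
  qed
qed

section \<open>The diagonal and the central face\<close>

context newton_series
begin

abbreviation "dist\<^sub>N \<equiv> newton_distance f"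

definition diag_pt :: "real ^ 'n" where
  "diag_pt = (\<chi> i. dist\<^sub>N)"

lemma inner_diag_pt: "\<kappa> \<bullet> diag_pt = dist\<^sub>N * (\<Sum>i\<in>UNIV. \<kappa> $ i)"
  by (simp add: inner_vec_def diag_pt_def sum_distrib_left mult.commute)

text \<open>Because 0 is not a generator, the sum of the coordinates is at least 1 on all of
  N.\<close>

lemma diag_in_N_ge: "(\<chi> i. t) \<in> N \<Longrightarrow> t \<ge> 1 / real CARD('n)"
proof -
  assume t: "(\<chi> i. t) \<in> N"
  have "1 \<le> (\<chi> i. 1) \<bullet> (\<chi> i. t :: real ^ 'n)"
  proof (rule N_subset_halfspace[OF _ _ t])
    fix s assume s: "s \<in> S"
    then have "s \<noteq> 0" using zero_notin_gens by blast
    then have "\<exists>i. s $ i \<noteq> 0" unfolding vec_eq_iff by simp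
    then obtain i where "s $ i \<noteq> 0" ..
    then have "1 \<le> s $ i" by simp
    also have "\<dots> \<le> (\<Sum>i\<in>UNIV. s $ i)" by (rule member_le_sum) auto
    finally have "real 1 \<le> real (\<Sum>i\<in>UNIV. s $ i)" by (simp only: of_nat_le_iff)
    then show "1 \<le> (\<chi> i. 1) \<bullet> real_vec s" by (simp add: inner_vec_def)
  qed simp
  then have "1 \<le> real CARD('n) * t" by (simp add: inner_vec_def)
  then show ?thesis by (simp add: field_simps)
qed

lemma newton_distance_le: "(\<chi> i. t) \<in> N \<Longrightarrow> dist\<^sub>N \<le> t"
  unfolding newton_distance_def using diag_in_N_ge by (intro cInf_lower bdd_belowI) auto

text \<open>Closedness of N makes the infimum in \<open>newton_distance\<close> attained.\<close>

lemma diag_pt_in_N: "diag_pt \<in> N"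
proof -
  let ?T = "{t. (\<chi> i. t) \<in> N}"
  have "continuous_on UNIV (\<lambda>t::real. (\<chi> i. t) :: real ^ 'n)" by (intro continuous_intros)
  then have "closed ?T" using continuous_closed_vimage[OF closed_N, of "\<lambda>t::real. (\<chi> i. t) :: real ^ 'n"]
    by (simp add: vimage_def continuous_on_eq_continuous_at)
  moreover have "?T \<noteq> {}"
  proof -
    obtain s where s: "s \<in> S" using gens_ne by blast
    have "real_vec s $ i \<le> (\<chi> i. real (\<Sum>i\<in>UNIV. s $ i)) $ i" for i
      using member_le_sum[of i UNIV "\<lambda>i. s $ i"] by (simp del: of_nat_sum)
    then have "(\<chi> i. real (\<Sum>i\<in>UNIV. s $ i)) \<in> N" by (rule N_up[OF gens_in_N[OF s]])
    then show ?thesis by blast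
  qed
  moreover have "bdd_below ?T" using diag_in_N_ge by (intro bdd_belowI) auto
  ultimately have "Inf ?T \<in> ?T" by (intro closed_contains_Inf)
  then show ?thesis by (simp add: diag_pt_def newton_distance_def)
qed

lemma newton_distance_pos: "dist\<^sub>N > 0"
proof -
  have "1 / real CARD('n) \<le> dist\<^sub>N" using diag_in_N_ge diag_pt_in_N unfolding diag_pt_def by blast
  moreover have "1 / real CARD('n) > 0" by simp
  ultimately show ?thesis by linarith
qed

definition defect :: "nat ^ 'n \<Rightarrow> real" where
  "defect k = dist\<^sub>N * real (vec_sum k) - real (order_along k)"

lemma inner_diag_real_vec: "real_vec k \<bullet> diag_pt = dist\<^sub>N * real (vec_sum k)"
  by (simp add: inner_diag_pt vec_sum_def)

lemma defect_nonneg: "defect k \<ge> 0"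
  unfolding defect_def using order_along_le_inner[OF diag_pt_in_N, of k] by (simp add: inner_diag_real_vec)

text \<open>The linear space parallel to the affine hull of the central face.\<close>

definition central_directions :: "(real ^ 'n) set" where
  "central_directions = {v. \<exists>e>0. diag_pt + e *\<^sub>R v \<in> N \<and> diag_pt - e *\<^sub>R v \<in> N}"

lemma central_directions_shrink:
  assumes "diag_pt + e *\<^sub>R v \<in> N" "diag_pt - e *\<^sub>R v \<in> N" "0 \<le> e'" "e' \<le> e"
  shows "diag_pt + e' *\<^sub>R v \<in> N" "diag_pt - e' *\<^sub>R v \<in> N"
  using minface_mono_e[OF convex_N diag_pt_in_N, of e "- v" e'] minface_mono_e[OF convex_N diag_pt_in_N, of e v e'] assms
  by auto

lemma subspace_central_directions: "subspace central_directions"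
  unfolding subspace_def
proof (intro conjI ballI allI)
  show "0 \<in> central_directions" using diag_pt_in_N by (auto simp: central_directions_def intro: exI[of _ 1])
  fix x assume x: "x \<in> central_directions"
  then obtain e1 where e1: "e1 > 0" "diag_pt + e1 *\<^sub>R x \<in> N" "diag_pt - e1 *\<^sub>R x \<in> N"
    by (auto simp: central_directions_def)
  {
    fix c :: real
    show "c *\<^sub>R x \<in> central_directions"
    proof (cases "c = 0")
      case True
      then show ?thesis using diag_pt_in_N by (auto simp: central_directions_def intro: exI[of _ 1])
    next
      case False
      have eq: "(e1 / \<bar>c\<bar>) *\<^sub>R (c *\<^sub>R x) = e1 *\<^sub>R x \<or> (e1 / \<bar>c\<bar>) *\<^sub>R (c *\<^sub>R x) = - (e1 *\<^sub>R x)"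
        using False by (cases "c > 0") auto
      have "diag_pt + (e1 / \<bar>c\<bar>) *\<^sub>R (c *\<^sub>R x) \<in> N \<and> diag_pt - (e1 / \<bar>c\<bar>) *\<^sub>R (c *\<^sub>R x) \<in> N"
        using eq
      proof
        assume *: "(e1 / \<bar>c\<bar>) *\<^sub>R (c *\<^sub>R x) = e1 *\<^sub>R x"
        show ?thesis unfolding * using e1 by simp
      next
        assume *: "(e1 / \<bar>c\<bar>) *\<^sub>R (c *\<^sub>R x) = - (e1 *\<^sub>R x)"
        show ?thesis unfolding * using e1 by simp
      qed
      moreover have "e1 / \<bar>c\<bar> > 0" using e1 False by simp
      ultimately show ?thesis unfolding central_directions_def by blast
    qed
  }
  fix y assume "y \<in> central_directions"
  then obtain e2 where e2: "e2 > 0" "diag_pt + e2 *\<^sub>R y \<in> N" "diag_pt - e2 *\<^sub>R y \<in> N"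
    by (auto simp: central_directions_def)
  let ?e = "min e1 e2"
  have e: "?e > 0" using e1 e2 by simp
  have x': "diag_pt + ?e *\<^sub>R x \<in> N" "diag_pt - ?e *\<^sub>R x \<in> N"
    using central_directions_shrink[OF e1(2,3)] e by auto
  have y': "diag_pt + ?e *\<^sub>R y \<in> N" "diag_pt - ?e *\<^sub>R y \<in> N"
    using central_directions_shrink[OF e2(2,3)] e by auto
  have "(1/2) *\<^sub>R (diag_pt + ?e *\<^sub>R x) + (1/2) *\<^sub>R (diag_pt + ?e *\<^sub>R y) \<in> N"
    using x' y' by (intro convexD[OF convex_N]) auto
  moreover have "(1/2) *\<^sub>R (diag_pt + ?e *\<^sub>R x) + (1/2) *\<^sub>R (diag_pt + ?e *\<^sub>R y) = (1/2 + 1/2) *\<^sub>R diag_pt + (?e / 2) *\<^sub>R (x + y)"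
    unfolding scaleR_add_left by (simp add: scaleR_add_right)
  moreover have "(1/2) *\<^sub>R (diag_pt - ?e *\<^sub>R x) + (1/2) *\<^sub>R (diag_pt - ?e *\<^sub>R y) \<in> N"
    using x' y' by (intro convexD[OF convex_N]) auto
  moreover have "(1/2) *\<^sub>R (diag_pt - ?e *\<^sub>R x) + (1/2) *\<^sub>R (diag_pt - ?e *\<^sub>R y) = (1/2 + 1/2) *\<^sub>R diag_pt - (?e / 2) *\<^sub>R (x + y)"
    unfolding scaleR_add_left by (simp add: scaleR_diff_right scaleR_add_right)
  ultimately have "diag_pt + (?e / 2) *\<^sub>R (x + y) \<in> N \<and> diag_pt - (?e / 2) *\<^sub>R (x + y) \<in> N" by simp
  moreover have "?e / 2 > 0" using e by simp
  ultimately show "x + y \<in> central_directions" unfolding central_directions_def by blast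
qed

lemma ones_notin_central_directions: "(\<chi> i. 1) \<notin> central_directions"
proof
  assume "(\<chi> i. 1) \<in> central_directions"
  then obtain e where e: "e > 0" "diag_pt - e *\<^sub>R (\<chi> i. 1) \<in> N" by (auto simp: central_directions_def)
  have "diag_pt - e *\<^sub>R (\<chi> i. 1) = (\<chi> i. dist\<^sub>N - e)" by (simp add: vec_eq_iff diag_pt_def)
  then have "dist\<^sub>N \<le> dist\<^sub>N - e" using e(2) newton_distance_le by simp
  then show False using e(1) by simp
qed

lemma minface_eq_central_directions: "t \<in> minface N diag_pt \<longleftrightarrow> t \<in> N \<and> t - diag_pt \<in> central_directions"
proof
  assume "t \<in> minface N diag_pt"
  then obtain e where e: "e > 0" "diag_pt - e *\<^sub>R (t - diag_pt) \<in> N" and t: "t \<in> N" by (auto simp: minface_def)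
  let ?e = "min e 1"
  have "diag_pt - ?e *\<^sub>R (t - diag_pt) \<in> N" by (rule minface_mono_e[OF convex_N diag_pt_in_N e(2)]) (use e(1) in auto)
  moreover have "diag_pt + ?e *\<^sub>R (t - diag_pt) \<in> N"
  proof -
    have "(1 - ?e) *\<^sub>R diag_pt + ?e *\<^sub>R t \<in> N" using e(1) t diag_pt_in_N by (intro convexD[OF convex_N]) auto
    moreover have "(1 - ?e) *\<^sub>R diag_pt + ?e *\<^sub>R t = diag_pt + ?e *\<^sub>R (t - diag_pt)" by (simp add: algebra_simps)
    ultimately show ?thesis by simp
  qed
  moreover have "?e > 0" using e(1) by simp
  ultimately show "t \<in> N \<and> t - diag_pt \<in> central_directions" unfolding central_directions_def using t by blast
next
  assume "t \<in> N \<and> t - diag_pt \<in> central_directions"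
  then show "t \<in> minface N diag_pt" unfolding minface_def central_directions_def by blast
qed

lemma aff_dim_minface_diag: "aff_dim (minface N diag_pt) = int (dim central_directions)"
proof -
  let ?F = "minface N diag_pt"
  have dF: "diag_pt \<in> ?F" by (rule minface_self[OF diag_pt_in_N])
  have "aff_dim ?F = int (dim ((+) (- diag_pt) ` ?F))" by (rule aff_dim_eq_dim[OF hull_inc[OF dF]])
  also have "dim ((+) (- diag_pt) ` ?F) = dim central_directions"
  proof (rule span_eq_dim, rule subset_antisym)
    show "span ((+) (- diag_pt) ` ?F) \<subseteq> span central_directions"
      by (rule span_mono) (auto simp: minface_eq_central_directions)
    have "central_directions \<subseteq> span ((+) (- diag_pt) ` ?F)"
    proof
      fix v assume "v \<in> central_directions"
      then obtain e where e: "e > 0" "diag_pt + e *\<^sub>R v \<in> N" "diag_pt - e *\<^sub>R v \<in> N"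
        by (auto simp: central_directions_def)
      have "diag_pt + e *\<^sub>R v \<in> ?F" unfolding minface_def using e by (auto intro!: exI[of _ 1])
      then have "- diag_pt + (diag_pt + e *\<^sub>R v) \<in> span ((+) (- diag_pt) ` ?F)" by (intro span_base imageI)
      then have "(1 / e) *\<^sub>R (- diag_pt + (diag_pt + e *\<^sub>R v)) \<in> span ((+) (- diag_pt) ` ?F)" by (rule span_scale)
      moreover have "(1 / e) *\<^sub>R (- diag_pt + (diag_pt + e *\<^sub>R v)) = v" using e(1) by simp
      ultimately show "v \<in> span ((+) (- diag_pt) ` ?F)" by (simp only:)
    qed
    then show "span central_directions \<subseteq> span ((+) (- diag_pt) ` ?F)" by (rule span_minimal[OF _ subspace_span])
  qed
  finally show ?thesis .
qed

text \<open>Upwards from \<open>diag_pt\<close> the diagonal stays in N, so a face meeting the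
  diagonal anywhere also contains \<open>diag_pt\<close>, and with it the smallest face at
  \<open>diag_pt\<close>. Minimality of the dimension excludes a strictly larger face.\<close>

lemma central_face_eq:
  assumes "central_face f F"
  shows "F = minface N diag_pt"
proof -
  let ?F = "minface N diag_pt"
  have face: "?F face_of N" by (rule minface_face_of[OF convex_N diag_pt_in_N])
  have dF: "diag_pt \<in> ?F" by (rule minface_self[OF diag_pt_in_N])
  have dd: "diag_pt \<in> diagonal" by (simp add: diagonal_def diag_pt_def)
  have F: "F face_of N" "F \<inter> diagonal \<noteq> {}" using assms by (auto simp: central_face_def newton_face_def)
  have "newton_face f ?F" using face dF by (auto simp: newton_face_def)
  moreover have "?F \<inter> diagonal \<noteq> {}" using dF dd by blast
  ultimately have le: "aff_dim F \<le> aff_dim ?F" using assms by (simp add: central_face_def)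
  obtain t where t: "(\<chi> i. t) \<in> F" using F(2) by (auto simp: diagonal_def)
  have tN: "(\<chi> i. t) \<in> N" using t F(1) face_of_imp_subset by blast
  have td: "dist\<^sub>N \<le> t" by (rule newton_distance_le[OF tN])
  have convF: "convex F" using F(1) by (rule face_of_imp_convex)
  have "diag_pt \<in> F"
  proof (cases "t = dist\<^sub>N")
    case True
    then show ?thesis using t by (simp add: diag_pt_def)
  next
    case False
    then have t': "t > dist\<^sub>N" using td by simp
    let ?t = "(\<chi> i. t) :: real ^ 'n"
    have "diag_pt \<in> minface N ?t"
    proof -
      have "?t - 1 *\<^sub>R (diag_pt - ?t) \<in> N"
        by (rule N_up[OF tN]) (use t' in \<open>simp add: diag_pt_def\<close>)
      then show ?thesis unfolding minface_def using diag_pt_in_N zero_less_one by blast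
    qed
    then show ?thesis using minface_subset_face[OF F(1) t] by blast
  qed
  then have sub: "?F \<subseteq> F" by (rule minface_subset_face[OF F(1)])
  have "?F face_of F" by (rule face_of_subset[OF face sub face_of_imp_subset[OF F(1)]])
  then show ?thesis using face_of_aff_dim_lt[OF convF, of ?F] le by (metis not_less)
qed

text \<open>N contains a segment centred at \<open>diag_pt\<close> in direction v. The form k is at
  least \<open>order_along k\<close> at both of its ends, which squeezes the slope of k along v
  between multiples of the defect.\<close>

lemma inner_central_direction_bound:
  assumes "v \<in> central_directions"
  shows "\<exists>C\<ge>0. \<forall>k. \<bar>real_vec k \<bullet> v\<bar> \<le> C * defect k"
proof -
  obtain e where e: "e > 0" "diag_pt + e *\<^sub>R v \<in> N" "diag_pt - e *\<^sub>R v \<in> N"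
    using assms by (auto simp: central_directions_def)
  have "\<bar>real_vec k \<bullet> v\<bar> \<le> (1 / e) * defect k" for k
  proof -
    have "real (order_along k) \<le> real_vec k \<bullet> (diag_pt + e *\<^sub>R v)" by (rule order_along_le_inner[OF e(2)])
    moreover have "real (order_along k) \<le> real_vec k \<bullet> (diag_pt - e *\<^sub>R v)" by (rule order_along_le_inner[OF e(3)])
    ultimately have "e * \<bar>real_vec k \<bullet> v\<bar> \<le> defect k"
      using e(1) by (simp add: inner_add_right inner_diff_right inner_diag_real_vec defect_def abs_if)
    then show ?thesis using e(1) by (simp add: field_simps)
  qed
  then show ?thesis using e(1) by (intro exI[of _ "1 / e"]) auto
qed

lemma central_basis:
  obtains B C where "finite B" "independent B" "B \<subseteq> central_directions" "card B = dim central_directions"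
    "C \<ge> 0" "\<And>k b. b \<in> B \<Longrightarrow> \<bar>real_vec k \<bullet> b\<bar> \<le> C * defect k"
proof -
  obtain B where B: "B \<subseteq> central_directions" "independent B" "central_directions \<subseteq> span B" "card B = dim central_directions"
    by (rule basis_exists)
  have fin: "finite B" using B(2) by (rule independent_imp_finite)
  have "\<exists>C::nat. \<forall>b\<in>B. \<forall>k. \<bar>real_vec k \<bullet> b\<bar> \<le> real C * defect k"
  proof (rule uniform_nat_bound[OF fin])
    fix b assume "b \<in> B"
    then obtain C where C: "C \<ge> 0" "\<forall>k. \<bar>real_vec k \<bullet> b\<bar> \<le> C * defect k"
      using inner_central_direction_bound B(1) by blast
    obtain m :: nat where m: "C \<le> real m" using real_arch_simple by blast
    show "\<exists>C::nat. \<forall>k. \<bar>real_vec k \<bullet> b\<bar> \<le> real C * defect k"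
    proof (intro exI[of _ m] allI)
      fix k
      have "\<bar>real_vec k \<bullet> b\<bar> \<le> C * defect k" using C(2) by blast
      also have "\<dots> \<le> real m * defect k" by (rule mult_right_mono[OF m defect_nonneg])
      finally show "\<bar>real_vec k \<bullet> b\<bar> \<le> real m * defect k" .
    qed
  next
    fix b and m m' :: nat assume *: "\<forall>k. \<bar>real_vec k \<bullet> b\<bar> \<le> real m * defect k" and "m \<le> m'"
    then have mm: "real m \<le> real m'" by simp
    show "\<forall>k. \<bar>real_vec k \<bullet> b\<bar> \<le> real m' * defect k"
    proof
      fix k
      have "\<bar>real_vec k \<bullet> b\<bar> \<le> real m * defect k" using * by blast
      also have "\<dots> \<le> real m' * defect k" by (rule mult_right_mono[OF mm defect_nonneg])
      finally show "\<bar>real_vec k \<bullet> b\<bar> \<le> real m' * defect k" .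
    qed
  qed
  then obtain C :: nat where "\<forall>b\<in>B. \<forall>k. \<bar>real_vec k \<bullet> b\<bar> \<le> real C * defect k" ..
  then show ?thesis using that[of B "real C"] B fin by simp
qed

section \<open>Weighted sums over valuation vectors\<close>

lemma independent_insert_central:
  assumes "independent B" "B \<subseteq> central_directions" "v \<notin> central_directions"
  shows "independent (insert v B)" "v \<notin> B"
proof -
  have "span B \<subseteq> central_directions" by (rule span_minimal[OF assms(2) subspace_central_directions])
  then have "v \<notin> span B" using assms(3) by blast
  then show "independent (insert v B)" using assms(1) by (rule independent_insertI)
  show "v \<notin> B" using assms(2,3) by blast
qed

lemma dim_central_directions_less: "dim central_directions < CARD('n)"
proof -
  have "dim central_directions < dim (UNIV :: (real ^ 'n) set)"
    by (rule dim_psubset) (use ones_notin_central_directions subspace_central_directions in \<open>auto simp: span_eq_iff[THEN iffD2]\<close>)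
  then show ?thesis by simp
qed

text \<open>Substitute d |k| = defect + m and, for truncated subtraction, m + (l - m) = l + (m - l).
  Once l / d is split off, the exponent decays in the defect and in the excess of m(k) over l, and
  for g > 1 / d also in its shortfall.\<close>

lemma weight_exponent:
  assumes "g \<ge> 1 / dist\<^sub>N"
  shows "- real (vec_sum k) - g * real (l - order_along k) \<le>
    - (real l / dist\<^sub>N) - 1 / dist\<^sub>N * (defect k + real (order_along k - l)) - (g - 1 / dist\<^sub>N) * real (l - order_along k)"
proof -
  let ?d = "dist\<^sub>N" and ?m = "order_along k"
  have d: "?d > 0" by (rule newton_distance_pos)
  have v: "real (vec_sum k) = (defect k + real ?m) / ?d" using d by (simp add: defect_def)
  have "real ?m + real (l - ?m) = real l + real (?m - l)" by linarith
  then have "1 / ?d * (real ?m + real (l - ?m)) = 1 / ?d * (real l + real (?m - l))" by simp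
  then show ?thesis unfolding v by (simp add: algebra_simps add_divide_distrib)
qed

lemma vec_sum_le: "real (vec_sum k) \<le> 1 / dist\<^sub>N * (real l + (defect k + real (order_along k - l)))"
proof -
  have d: "dist\<^sub>N > 0" by (rule newton_distance_pos)
  have "real (vec_sum k) = 1 / dist\<^sub>N * (real (order_along k) + defect k)" using d by (simp add: defect_def)
  also have "\<dots> \<le> 1 / dist\<^sub>N * (real l + (defect k + real (order_along k - l)))"
    using d by (intro mult_left_mono) auto
  finally show ?thesis .
qed

text \<open>Only the h forms along the central face are confined, by the defect. Nothing penalises a
  shortfall of m(k) below l, which leaves of the order of l^(n - h) vectors of full weight.\<close>

lemma weight_sum_central:
  fixes q :: real
  assumes q: "q > 1" and g: "g \<ge> 1 / dist\<^sub>N"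
  shows "\<exists>C>0. \<forall>K (l::nat). finite K \<longrightarrow> l \<ge> 1 \<longrightarrow>
    (\<Sum>k\<in>K. q powr (- real (vec_sum k) - g * real (l - order_along k))) \<le>
      C * real l ^ (CARD('n) - dim central_directions) * q powr (- (real l / dist\<^sub>N))"
proof -
  let ?d = "dist\<^sub>N"
  have d: "?d > 0" by (rule newton_distance_pos)
  obtain B C where B: "finite B" "independent B" "B \<subseteq> central_directions" "card B = dim central_directions"
    "C \<ge> 0" "\<And>k b. b \<in> B \<Longrightarrow> \<bar>real_vec k \<bullet> b\<bar> \<le> C * defect k"
    by (rule central_basis) blast
  have "1 / ?d > 0" "max C (1 / ?d) \<ge> 0" using d B(5) by auto
  from lattice_sum_bound[OF B(2) q this]
  obtain C1 where C1: "C1 > 0" "\<forall>(K :: (nat ^ 'n) set) Y c (l::nat). finite K \<longrightarrow> l \<ge> 1 \<longrightarrow>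
    (\<forall>k\<in>K. Y k \<ge> 0 \<and> (\<forall>b\<in>B. \<bar>real_vec k \<bullet> b - c b\<bar> \<le> max C (1 / ?d) * (1 + Y k)) \<and> real (vec_sum k) \<le> max C (1 / ?d) * (real l + Y k)) \<longrightarrow>
    (\<Sum>k\<in>K. q powr (- (1 / ?d) * Y k)) \<le> C1 * real l ^ (CARD('n) - card B)" by blast
  show ?thesis
  proof (intro exI[of _ C1] conjI allI impI C1(1))
    fix K :: "(nat ^ 'n) set" and l :: nat assume K: "finite K" and l: "l \<ge> 1"
    define Y where "Y k = defect k + real (order_along k - l)" for k
    have H: "\<forall>k\<in>K. Y k \<ge> 0 \<and> (\<forall>b\<in>B. \<bar>real_vec k \<bullet> b - 0\<bar> \<le> max C (1 / ?d) * (1 + Y k)) \<and> real (vec_sum k) \<le> max C (1 / ?d) * (real l + Y k)"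
    proof (intro ballI conjI)
      fix k
      show Y0: "Y k \<ge> 0" using defect_nonneg[of k] by (simp add: Y_def)
      show "\<bar>real_vec k \<bullet> b - 0\<bar> \<le> max C (1 / ?d) * (1 + Y k)" if "b \<in> B" for b
      proof -
        have "\<bar>real_vec k \<bullet> b - 0\<bar> \<le> C * defect k" using B(6)[OF that] by simp
        also have "\<dots> \<le> max C (1 / ?d) * (1 + Y k)"
          using B(5) defect_nonneg[of k] by (intro mult_mono) (auto simp: Y_def)
        finally show ?thesis .
      qed
      have "real (vec_sum k) \<le> 1 / ?d * (real l + Y k)" unfolding Y_def by (rule vec_sum_le)
      also have "\<dots> \<le> max C (1 / ?d) * (real l + Y k)" using Y0 by (intro mult_right_mono) auto
      finally show "real (vec_sum k) \<le> max C (1 / ?d) * (real l + Y k)" .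
    qed
    have "(\<Sum>k\<in>K. q powr (- real (vec_sum k) - g * real (l - order_along k))) \<le>
        (\<Sum>k\<in>K. q powr (- (real l / ?d)) * q powr (- (1 / ?d) * Y k))"
    proof (rule sum_mono)
      fix k
      have "(g - 1 / ?d) * real (l - order_along k) \<ge> 0" using g by simp
      then have "- real (vec_sum k) - g * real (l - order_along k) \<le> - (real l / ?d) + - (1 / ?d) * Y k"
        using weight_exponent[OF g, of k l] by (simp add: Y_def)
      then show "q powr (- real (vec_sum k) - g * real (l - order_along k)) \<le> q powr (- (real l / ?d)) * q powr (- (1 / ?d) * Y k)"
        unfolding powr_add[symmetric] using q by (intro powr_mono) auto
    qed
    also have "\<dots> = q powr (- (real l / ?d)) * (\<Sum>k\<in>K. q powr (- (1 / ?d) * Y k))" by (simp only: sum_distrib_left)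
    also have "\<dots> \<le> q powr (- (real l / ?d)) * (C1 * real l ^ (CARD('n) - card B))"
      using C1(2)[THEN spec, THEN spec, THEN spec, THEN spec, THEN mp, OF K, THEN mp, OF l, of Y "\<lambda>_. 0", THEN mp, OF H]
      by (intro mult_left_mono) auto
    finally show "(\<Sum>k\<in>K. q powr (- real (vec_sum k) - g * real (l - order_along k))) \<le>
      C1 * real l ^ (CARD('n) - dim central_directions) * q powr (- (real l / dist\<^sub>N))"
      by (simp add: B(4) mult_ac)
  qed
qed

text \<open>A form outside \<open>central_directions\<close> is independent of the h forms already
  confined, so keeping it near a constant saves one power of l.\<close>

lemma weight_sum_extra_form:
  fixes q :: real
  assumes q: "q > 1" and \<eta>: "\<eta> > 0" and v: "v \<notin> central_directions" and C0: "C\<^sub>0 \<ge> 0"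
  shows "\<exists>C>0. \<forall>(K :: (nat ^ 'n) set) Y c (l::nat). finite K \<longrightarrow> l \<ge> 1 \<longrightarrow>
    (\<forall>k\<in>K. defect k \<le> Y k \<and> \<bar>real_vec k \<bullet> v - c\<bar> \<le> C\<^sub>0 * (1 + Y k) \<and> real (vec_sum k) \<le> 1 / dist\<^sub>N * (real l + Y k)) \<longrightarrow>
    (\<Sum>k\<in>K. q powr (- \<eta> * Y k)) \<le> C * real l ^ (CARD('n) - dim central_directions - 1)"
proof -
  let ?d = "dist\<^sub>N"
  have d: "?d > 0" by (rule newton_distance_pos)
  obtain B C where B: "finite B" "independent B" "B \<subseteq> central_directions" "card B = dim central_directions"
    "C \<ge> 0" "\<And>k b. b \<in> B \<Longrightarrow> \<bar>real_vec k \<bullet> b\<bar> \<le> C * defect k"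
    by (rule central_basis) blast
  note ins = independent_insert_central[OF B(2,3) v]
  define D where "D = C + C\<^sub>0 + 1 / ?d"
  have D: "D \<ge> 0" "C \<le> D" "C\<^sub>0 \<le> D" "1 / ?d \<le> D" using d B(5) C0 by (auto simp: D_def)
  from lattice_sum_bound[OF ins(1) q \<eta> D(1)]
  obtain C1 where C1: "C1 > 0" "\<forall>(K :: (nat ^ 'n) set) Y c (l::nat). finite K \<longrightarrow> l \<ge> 1 \<longrightarrow>
    (\<forall>k\<in>K. Y k \<ge> 0 \<and> (\<forall>b\<in>insert v B. \<bar>real_vec k \<bullet> b - c b\<bar> \<le> D * (1 + Y k)) \<and> real (vec_sum k) \<le> D * (real l + Y k)) \<longrightarrow>
    (\<Sum>k\<in>K. q powr (- \<eta> * Y k)) \<le> C1 * real l ^ (CARD('n) - card (insert v B))" by blast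
  have card: "CARD('n) - card (insert v B) = CARD('n) - dim central_directions - 1"
    using B(1,4) ins(2) by simp
  show ?thesis
  proof (intro exI[of _ C1] conjI allI impI C1(1))
    fix K :: "(nat ^ 'n) set" and Y :: "nat ^ 'n \<Rightarrow> real" and c :: real and l :: nat
    assume K: "finite K" and l: "l \<ge> 1"
      and H: "\<forall>k\<in>K. defect k \<le> Y k \<and> \<bar>real_vec k \<bullet> v - c\<bar> \<le> C\<^sub>0 * (1 + Y k) \<and> real (vec_sum k) \<le> 1 / ?d * (real l + Y k)"
    define c' where "c' b = (if b = v then c else 0)" for b
    have H': "\<forall>k\<in>K. Y k \<ge> 0 \<and> (\<forall>b\<in>insert v B. \<bar>real_vec k \<bullet> b - c' b\<bar> \<le> D * (1 + Y k)) \<and> real (vec_sum k) \<le> D * (real l + Y k)"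
    proof (intro ballI conjI)
      fix k assume k: "k \<in> K"
      have h: "defect k \<le> Y k" "\<bar>real_vec k \<bullet> v - c\<bar> \<le> C\<^sub>0 * (1 + Y k)" "real (vec_sum k) \<le> 1 / ?d * (real l + Y k)"
        using H k by auto
      show Y0: "Y k \<ge> 0" using defect_nonneg[of k] h(1) by linarith
      show "\<bar>real_vec k \<bullet> b - c' b\<bar> \<le> D * (1 + Y k)" if b: "b \<in> insert v B" for b
      proof (cases "b = v")
        case True
        have "\<bar>real_vec k \<bullet> v - c\<bar> \<le> D * (1 + Y k)"
          using h(2) mult_right_mono[OF D(3), of "1 + Y k"] Y0 by linarith
        then show ?thesis using True by (simp add: c'_def)
      next
        case False
        have "\<bar>real_vec k \<bullet> b\<bar> \<le> C * defect k" using B(6) b False by blast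
        also have "\<dots> \<le> D * (1 + Y k)"
          using D(1,2) B(5) h(1) defect_nonneg[of k] by (intro mult_mono) auto
        finally show ?thesis using False by (simp add: c'_def)
      qed
      have "1 / ?d * (real l + Y k) \<le> D * (real l + Y k)" using D(4) Y0 by (intro mult_right_mono) auto
      then show "real (vec_sum k) \<le> D * (real l + Y k)" using h(3) by linarith
    qed
    show "(\<Sum>k\<in>K. q powr (- \<eta> * Y k)) \<le> C1 * real l ^ (CARD('n) - dim central_directions - 1)"
      unfolding card[symmetric]
      using C1(2)[THEN spec, THEN spec, THEN spec, THEN spec, THEN mp, OF K, THEN mp, OF l, of Y c', THEN mp, OF H'] .
  qed
qed

text \<open>A rate above 1 / d penalises a shortfall of m(k) below l, so |k| stays near l / d. The
  extra form is thus given by the vector of ones, which is not a central direction since no diagonal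
  point below \<open>diag_pt\<close> lies in N.\<close>

lemma weight_sum_steep:
  fixes q :: real
  assumes q: "q > 1" and g: "g > 1 / dist\<^sub>N"
  shows "\<exists>C>0. \<forall>K (l::nat). finite K \<longrightarrow> l \<ge> 1 \<longrightarrow>
    (\<Sum>k\<in>K. q powr (- real (vec_sum k) - g * real (l - order_along k))) \<le>
      C * real l ^ (CARD('n) - dim central_directions - 1) * q powr (- (real l / dist\<^sub>N))"
proof -
  let ?d = "dist\<^sub>N"
  have d: "?d > 0" by (rule newton_distance_pos)
  \<comment> \<open>A common decay rate for the defect, the excess and the shortfall.\<close>
  define \<eta> where "\<eta> = min (1 / ?d) (g - 1 / ?d)"
  have \<eta>: "\<eta> > 0" "\<eta> \<le> 1 / ?d" "\<eta> \<le> g - 1 / ?d" using d g by (auto simp: \<eta>_def)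
  have "1 / ?d \<ge> 0" using d by simp
  from weight_sum_extra_form[OF q \<eta>(1) ones_notin_central_directions this]
  obtain C1 where C1: "C1 > 0" "\<forall>(K :: (nat ^ 'n) set) Y c (l::nat). finite K \<longrightarrow> l \<ge> 1 \<longrightarrow>
    (\<forall>k\<in>K. defect k \<le> Y k \<and> \<bar>real_vec k \<bullet> (\<chi> i. 1) - c\<bar> \<le> 1 / ?d * (1 + Y k) \<and> real (vec_sum k) \<le> 1 / ?d * (real l + Y k)) \<longrightarrow>
    (\<Sum>k\<in>K. q powr (- \<eta> * Y k)) \<le> C1 * real l ^ (CARD('n) - dim central_directions - 1)" by blast
  show ?thesis
  proof (intro exI[of _ C1] conjI allI impI C1(1))
    fix K :: "(nat ^ 'n) set" and l :: nat assume K: "finite K" and l: "l \<ge> 1"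
    define Y where "Y k = defect k + real (order_along k - l) + real (l - order_along k)" for k
    have H: "\<forall>k\<in>K. defect k \<le> Y k \<and> \<bar>real_vec k \<bullet> (\<chi> i. 1) - real l / ?d\<bar> \<le> 1 / ?d * (1 + Y k) \<and> real (vec_sum k) \<le> 1 / ?d * (real l + Y k)"
    proof (intro ballI conjI)
      fix k
      show "defect k \<le> Y k" by (simp add: Y_def)
      have "real_vec k \<bullet> (\<chi> i. 1) = real (vec_sum k)" by (simp add: inner_vec_def vec_sum_def)
      also have "\<dots> = 1 / ?d * (defect k + real (order_along k))" using d by (simp add: defect_def)
      finally have "real_vec k \<bullet> (\<chi> i. 1) - real l / ?d = 1 / ?d * (defect k + (real (order_along k) - real l))"
        by (simp add: algebra_simps)
      also have "\<bar>\<dots>\<bar> = 1 / ?d * \<bar>defect k + (real (order_along k) - real l)\<bar>" using d by (simp add: abs_mult)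
      also have "\<dots> \<le> 1 / ?d * (1 + Y k)"
      proof (rule mult_left_mono)
        show "\<bar>defect k + (real (order_along k) - real l)\<bar> \<le> 1 + Y k"
          using defect_nonneg[of k] unfolding Y_def by linarith
      qed (use d in simp)
      finally show "\<bar>real_vec k \<bullet> (\<chi> i. 1) - real l / ?d\<bar> \<le> 1 / ?d * (1 + Y k)" .
      have "1 / ?d * (real l + (defect k + real (order_along k - l))) \<le> 1 / ?d * (real l + Y k)"
        unfolding Y_def using d by (intro mult_left_mono) auto
      then show "real (vec_sum k) \<le> 1 / ?d * (real l + Y k)" using vec_sum_le[of k l] by linarith
    qed
    have "(\<Sum>k\<in>K. q powr (- real (vec_sum k) - g * real (l - order_along k))) \<le>
        (\<Sum>k\<in>K. q powr (- (real l / ?d)) * q powr (- \<eta> * Y k))"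
    proof (rule sum_mono)
      fix k
      have "\<eta> * (defect k + real (order_along k - l)) \<le> 1 / ?d * (defect k + real (order_along k - l))"
        using \<eta>(2) defect_nonneg[of k] by (intro mult_right_mono) auto
      moreover have "\<eta> * real (l - order_along k) \<le> (g - 1 / ?d) * real (l - order_along k)"
        using \<eta>(3) by (intro mult_right_mono) auto
      moreover have "\<eta> * Y k = \<eta> * (defect k + real (order_along k - l)) + \<eta> * real (l - order_along k)"
        by (simp add: Y_def algebra_simps)
      moreover have "g \<ge> 1 / ?d" using g by simp
      ultimately have "- real (vec_sum k) - g * real (l - order_along k) \<le> - (real l / ?d) + - (\<eta> * Y k)"
        using weight_exponent[of g k l] by linarith
      then show "q powr (- real (vec_sum k) - g * real (l - order_along k)) \<le> q powr (- (real l / ?d)) * q powr (- \<eta> * Y k)"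
        unfolding powr_add[symmetric] using q by (intro powr_mono) auto
    qed
    also have "\<dots> = q powr (- (real l / ?d)) * (\<Sum>k\<in>K. q powr (- \<eta> * Y k))" by (simp only: sum_distrib_left)
    also have "\<dots> \<le> q powr (- (real l / ?d)) * (C1 * real l ^ (CARD('n) - dim central_directions - 1))"
      using C1(2)[THEN spec, THEN spec, THEN spec, THEN spec, THEN mp, OF K, THEN mp, OF l, of Y "real l / ?d", THEN mp, OF H]
      by (intro mult_left_mono) auto
    finally show "(\<Sum>k\<in>K. q powr (- real (vec_sum k) - g * real (l - order_along k))) \<le>
      C1 * real l ^ (CARD('n) - dim central_directions - 1) * q powr (- (real l / dist\<^sub>N))"
      by (simp only: mult_ac)
  qed
qed

text \<open>An exponent off the central face that is nearly minimal along k supplies the extra form: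
  k . (alpha - diag_pt) equals k . alpha - m(k) minus the defect, hence is close to 0.\<close>

lemma weight_sum_off_center:
  fixes q :: real
  assumes q: "q > 1" and g: "g \<ge> 1 / dist\<^sub>N" and \<alpha>: "real_vec \<alpha> - diag_pt \<notin> central_directions"
  shows "\<exists>C>0. \<forall>K (l::nat). finite K \<longrightarrow> l \<ge> 1 \<longrightarrow> (\<forall>k\<in>K. order_along k \<le> dotn k \<alpha> \<and> dotn k \<alpha> \<le> order_along k + M) \<longrightarrow>
    (\<Sum>k\<in>K. q powr (- real (vec_sum k) - g * real (l - order_along k))) \<le>
      C * real l ^ (CARD('n) - dim central_directions - 1) * q powr (- (real l / dist\<^sub>N))"
proof -
  let ?d = "dist\<^sub>N"
  have d: "?d > 0" by (rule newton_distance_pos)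
  have "1 / ?d > 0" "real M + 1 \<ge> 0" using d by auto
  from weight_sum_extra_form[OF q this(1) \<alpha> this(2)]
  obtain C1 where C1: "C1 > 0" "\<forall>(K :: (nat ^ 'n) set) Y c (l::nat). finite K \<longrightarrow> l \<ge> 1 \<longrightarrow>
    (\<forall>k\<in>K. defect k \<le> Y k \<and> \<bar>real_vec k \<bullet> (real_vec \<alpha> - diag_pt) - c\<bar> \<le> (real M + 1) * (1 + Y k) \<and> real (vec_sum k) \<le> 1 / ?d * (real l + Y k)) \<longrightarrow>
    (\<Sum>k\<in>K. q powr (- (1 / ?d) * Y k)) \<le> C1 * real l ^ (CARD('n) - dim central_directions - 1)" by blast
  show ?thesis
  proof (intro exI[of _ C1] conjI allI impI C1(1))
    fix K :: "(nat ^ 'n) set" and l :: nat assume K: "finite K" and l: "l \<ge> 1"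
      and near: "\<forall>k\<in>K. order_along k \<le> dotn k \<alpha> \<and> dotn k \<alpha> \<le> order_along k + M"
    define Y where "Y k = defect k + real (order_along k - l)" for k
    have H: "\<forall>k\<in>K. defect k \<le> Y k \<and> \<bar>real_vec k \<bullet> (real_vec \<alpha> - diag_pt) - 0\<bar> \<le> (real M + 1) * (1 + Y k) \<and> real (vec_sum k) \<le> 1 / ?d * (real l + Y k)"
    proof (intro ballI conjI)
      fix k assume k: "k \<in> K"
      show "defect k \<le> Y k" by (simp add: Y_def)
      have Y0: "Y k \<ge> 0" "defect k \<le> Y k" using defect_nonneg[of k] by (auto simp: Y_def)
      have "real_vec k \<bullet> (real_vec \<alpha> - diag_pt) = real (dotn k \<alpha>) - real (order_along k) - defect k"
        by (simp add: inner_diff_right inner_real_vec inner_diag_real_vec defect_def)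
      moreover have "order_along k \<le> dotn k \<alpha>" "dotn k \<alpha> \<le> order_along k + M" using near k by auto
      ultimately have "\<bar>real_vec k \<bullet> (real_vec \<alpha> - diag_pt) - 0\<bar> \<le> real M + Y k"
        using defect_nonneg[of k] Y0 by linarith
      also have "\<dots> \<le> (real M + 1) * (1 + Y k)" using Y0(1) by (simp add: algebra_simps)
      finally show "\<bar>real_vec k \<bullet> (real_vec \<alpha> - diag_pt) - 0\<bar> \<le> (real M + 1) * (1 + Y k)" .
      show "real (vec_sum k) \<le> 1 / ?d * (real l + Y k)" unfolding Y_def by (rule vec_sum_le)
    qed
    have "(\<Sum>k\<in>K. q powr (- real (vec_sum k) - g * real (l - order_along k))) \<le>
        (\<Sum>k\<in>K. q powr (- (real l / ?d)) * q powr (- (1 / ?d) * Y k))"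
    proof (rule sum_mono)
      fix k
      have "(g - 1 / ?d) * real (l - order_along k) \<ge> 0" using g by simp
      then have "- real (vec_sum k) - g * real (l - order_along k) \<le> - (real l / ?d) + - (1 / ?d) * Y k"
        using weight_exponent[OF g, of k l] by (simp add: Y_def)
      then show "q powr (- real (vec_sum k) - g * real (l - order_along k)) \<le> q powr (- (real l / ?d)) * q powr (- (1 / ?d) * Y k)"
        unfolding powr_add[symmetric] using q by (intro powr_mono) auto
    qed
    also have "\<dots> = q powr (- (real l / ?d)) * (\<Sum>k\<in>K. q powr (- (1 / ?d) * Y k))" by (simp only: sum_distrib_left)
    also have "\<dots> \<le> q powr (- (real l / ?d)) * (C1 * real l ^ (CARD('n) - dim central_directions - 1))"
      using C1(2)[THEN spec, THEN spec, THEN spec, THEN spec, THEN mp, OF K, THEN mp, OF l, of Y "0", THEN mp, OF H]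
      by (intro mult_left_mono) auto
    finally show "(\<Sum>k\<in>K. q powr (- real (vec_sum k) - g * real (l - order_along k))) \<le>
      C1 * real l ^ (CARD('n) - dim central_directions - 1) * q powr (- (real l / dist\<^sub>N))"
      by (simp only: mult_ac)
  qed
qed

text \<open>From m(k) \<le> d |k| the weight is at most q powr (- l / s) times an exponential decay
  in |k| with rate 1 - d / s > 0. All n coordinate forms are controlled by |k|, so no power of l
  remains.\<close>

lemma weight_sum_shallow:
  fixes q s :: real
  assumes q: "q > 1" and s: "s > dist\<^sub>N"
  shows "\<exists>C>0. \<forall>K (l::nat). finite K \<longrightarrow> l \<ge> 1 \<longrightarrow>
    (\<Sum>k\<in>K. q powr (- real (vec_sum k) - 1 / s * real (l - order_along k))) \<le> C * q powr (- (real l / s))"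
proof -
  let ?d = "dist\<^sub>N"
  have d: "?d > 0" by (rule newton_distance_pos)
  define \<eta> where "\<eta> = 1 - ?d / s"
  have \<eta>: "\<eta> > 0" using s d by (simp add: \<eta>_def)
  from lattice_sum_bound[OF independent_Basis q \<eta> zero_le_one]
  obtain C1 where C1: "C1 > 0" "\<forall>(K :: (nat ^ 'n) set) Y c (l::nat). finite K \<longrightarrow> l \<ge> 1 \<longrightarrow>
    (\<forall>k\<in>K. Y k \<ge> 0 \<and> (\<forall>b\<in>Basis. \<bar>real_vec k \<bullet> b - c b\<bar> \<le> 1 * (1 + Y k)) \<and> real (vec_sum k) \<le> 1 * (real l + Y k)) \<longrightarrow>
    (\<Sum>k\<in>K. q powr (- \<eta> * Y k)) \<le> C1 * real l ^ (CARD('n) - card (Basis :: (real ^ 'n) set))" by blast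
  show ?thesis
  proof (intro exI[of _ C1] conjI allI impI C1(1))
    fix K :: "(nat ^ 'n) set" and l :: nat assume K: "finite K" and l: "l \<ge> 1"
    define Y where "Y k = real (vec_sum k)" for k :: "nat ^ 'n"
    have H: "\<forall>k\<in>K. Y k \<ge> 0 \<and> (\<forall>b\<in>Basis. \<bar>real_vec k \<bullet> b - 0\<bar> \<le> 1 * (1 + Y k)) \<and> real (vec_sum k) \<le> 1 * (real l + Y k)"
    proof (intro ballI conjI)
      fix k and b :: "real ^ 'n" assume "b \<in> Basis"
      then obtain i where b: "b = axis i 1" by (auto simp: Basis_vec_def)
      have "k $ i \<le> vec_sum k" unfolding vec_sum_def by (rule member_le_sum) auto
      then show "\<bar>real_vec k \<bullet> b - 0\<bar> \<le> 1 * (1 + Y k)" by (simp add: b inner_axis Y_def)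
    qed (auto simp: Y_def)
    have "(\<Sum>k\<in>K. q powr (- real (vec_sum k) - 1 / s * real (l - order_along k))) \<le>
        (\<Sum>k\<in>K. q powr (- (real l / s)) * q powr (- \<eta> * Y k))"
    proof (rule sum_mono)
      fix k
      have "real (order_along k) \<le> ?d * real (vec_sum k)" using defect_nonneg[of k] by (simp add: defect_def)
      then have "real l \<le> ?d * real (vec_sum k) + real (l - order_along k)" by linarith
      then have "1 / s * real l \<le> 1 / s * (?d * real (vec_sum k) + real (l - order_along k))"
        using s d by (intro mult_left_mono) auto
      then have "- real (vec_sum k) - 1 / s * real (l - order_along k) \<le> - (real l / s) + - \<eta> * Y k"
        by (simp add: \<eta>_def Y_def algebra_simps add_divide_distrib)
      then show "q powr (- real (vec_sum k) - 1 / s * real (l - order_along k)) \<le> q powr (- (real l / s)) * q powr (- \<eta> * Y k)"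
        unfolding powr_add[symmetric] using q by (intro powr_mono) auto
    qed
    also have "\<dots> = q powr (- (real l / s)) * (\<Sum>k\<in>K. q powr (- \<eta> * Y k))" by (simp only: sum_distrib_left)
    also have "\<dots> \<le> q powr (- (real l / s)) * C1"
      using C1(2)[THEN spec, THEN spec, THEN spec, THEN spec, THEN mp, OF K, THEN mp, OF l, of Y "\<lambda>_. 0", THEN mp, OF H]
      by (intro mult_left_mono) auto
    finally show "(\<Sum>k\<in>K. q powr (- real (vec_sum k) - 1 / s * real (l - order_along k))) \<le> C1 * q powr (- (real l / s))"
      by (simp only: mult_ac)
  qed
qed

section \<open>The normal cone of the central face and the lower bound\<close>

text \<open>Generators of the cone of feasible directions of N at \<open>diag_pt\<close>: towards
  the generators of N, and along the axes. A finite set makes the duality below polyhedral.\<close>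

definition tangent_gens :: "(real ^ 'n) set" where
  "tangent_gens = (\<lambda>s. real_vec s - diag_pt) ` S \<union> range (\<lambda>i. axis i 1)"

definition normal_cone :: "(real ^ 'n) set" where
  "normal_cone = {\<kappa>. \<forall>t\<in>tangent_gens. 0 \<le> \<kappa> \<bullet> t}"

lemma finite_tangent_gens: "finite tangent_gens"
  unfolding tangent_gens_def using finite_gens by simp

definition feasible_directions :: "(real ^ 'n) set" where
  "feasible_directions = {v. \<exists>e>0. diag_pt + e *\<^sub>R v \<in> N}"

lemma feasible_add:
  assumes "x \<in> feasible_directions" "y \<in> feasible_directions"
  shows "x + y \<in> feasible_directions"
proof -
  obtain e1 where e1: "e1 > 0" "diag_pt + e1 *\<^sub>R x \<in> N" using assms by (auto simp: feasible_directions_def)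
  obtain e2 where e2: "e2 > 0" "diag_pt + e2 *\<^sub>R y \<in> N" using assms by (auto simp: feasible_directions_def)
  let ?e = "min e1 e2"
  have 1: "diag_pt + ?e *\<^sub>R x \<in> N"
    using minface_mono_e[OF convex_N diag_pt_in_N, of e1 "- x" ?e] e1 e2 by auto
  have 2: "diag_pt + ?e *\<^sub>R y \<in> N"
    using minface_mono_e[OF convex_N diag_pt_in_N, of e2 "- y" ?e] e1 e2 by auto
  have "(1/2) *\<^sub>R (diag_pt + ?e *\<^sub>R x) + (1/2) *\<^sub>R (diag_pt + ?e *\<^sub>R y) \<in> N"
    using 1 2 by (intro convexD[OF convex_N]) auto
  moreover have "(1/2) *\<^sub>R (diag_pt + ?e *\<^sub>R x) + (1/2) *\<^sub>R (diag_pt + ?e *\<^sub>R y) = (1/2 + 1/2) *\<^sub>R diag_pt + (?e / 2) *\<^sub>R (x + y)"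
    unfolding scaleR_add_left by (simp add: scaleR_add_right)
  ultimately have "diag_pt + (?e / 2) *\<^sub>R (x + y) \<in> N" by simp
  moreover have "?e / 2 > 0" using e1 e2 by simp
  ultimately show ?thesis unfolding feasible_directions_def by blast
qed

lemma feasible_scale:
  assumes "x \<in> feasible_directions" "c \<ge> 0"
  shows "c *\<^sub>R x \<in> feasible_directions"
proof (cases "c = 0")
  case True
  then show ?thesis using diag_pt_in_N by (auto simp: feasible_directions_def intro: exI[of _ 1])
next
  case False
  obtain e where e: "e > 0" "diag_pt + e *\<^sub>R x \<in> N" using assms by (auto simp: feasible_directions_def)
  have "diag_pt + (e / c) *\<^sub>R (c *\<^sub>R x) \<in> N" using e False by simp
  moreover have "e / c > 0" using e False assms(2) by simp
  ultimately show ?thesis unfolding feasible_directions_def by blast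
qed

lemma tangent_gens_feasible: "t \<in> tangent_gens \<Longrightarrow> t \<in> feasible_directions"
proof -
  assume "t \<in> tangent_gens"
  then consider s where "s \<in> S" "t = real_vec s - diag_pt" | i where "t = axis i 1"
    by (auto simp: tangent_gens_def)
  then show ?thesis
  proof cases
    case 1
    then have "diag_pt + 1 *\<^sub>R t \<in> N" using gens_in_N by simp
    then show ?thesis unfolding feasible_directions_def using zero_less_one by blast
  next
    case 2
    have "diag_pt + 1 *\<^sub>R t \<in> N" by (rule N_up[OF diag_pt_in_N]) (simp add: 2 axis_def)
    then show ?thesis unfolding feasible_directions_def using zero_less_one by blast
  qed
qed

lemma feasible_sum:
  assumes "finite T" "\<And>t. t \<in> T \<Longrightarrow> t \<in> feasible_directions" "\<And>t. t \<in> T \<Longrightarrow> c t \<ge> (0::real)"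
  shows "(\<Sum>t\<in>T. c t *\<^sub>R t) \<in> feasible_directions"
  using assms
proof (induction T rule: finite_induct)
  case empty
  then show ?case using diag_pt_in_N by (auto simp: feasible_directions_def intro: exI[of _ 1])
next
  case (insert t T)
  then show ?case by (simp add: feasible_add feasible_scale)
qed

lemma feasible_both_central:
  assumes "v \<in> feasible_directions" "- v \<in> feasible_directions"
  shows "v \<in> central_directions"
proof -
  obtain e1 where e1: "e1 > 0" "diag_pt + e1 *\<^sub>R v \<in> N" using assms by (auto simp: feasible_directions_def)
  obtain e2 where e2: "e2 > 0" "diag_pt + e2 *\<^sub>R (- v) \<in> N" using assms unfolding feasible_directions_def by blast
  let ?e = "min e1 e2"
  have 1: "diag_pt + ?e *\<^sub>R v \<in> N"
    using minface_mono_e[OF convex_N diag_pt_in_N, of e1 "- v" ?e] e1 e2 by auto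
  have 2: "diag_pt - ?e *\<^sub>R v \<in> N"
    using minface_mono_e[OF convex_N diag_pt_in_N, of e2 "v" ?e] e1 e2 by auto
  have "?e > 0" using e1 e2 by simp
  then show ?thesis unfolding central_directions_def using 1 2 by blast
qed

text \<open>
  Duality: the generators on which the whole normal cone vanishes span central directions.
  Otherwise a functional separating \<open>0\<close> from the cone they generate, corrected by a multiple of
  an element \<open>\<kappa>\<^sub>0\<close> of the normal cone that is positive on the other generators, would lie in the
  normal cone.
\<close>

lemma dim_normal_cone: "CARD('n) \<le> dim normal_cone + dim central_directions"
proof -
  define T0 where "T0 = {t\<in>tangent_gens. \<forall>\<kappa>\<in>normal_cone. \<kappa> \<bullet> t = 0}"
  define T1 where "T1 = tangent_gens - T0"
  have finT: "finite T0" "finite T1" using finite_tangent_gens by (auto simp: T0_def T1_def)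
  have "\<forall>t\<in>T1. \<exists>\<kappa>. \<kappa> \<in> normal_cone \<and> \<kappa> \<bullet> t > 0"
  proof
    fix t assume t: "t \<in> T1"
    then have tT: "t \<in> tangent_gens" by (simp add: T1_def)
    obtain \<kappa> where \<kappa>: "\<kappa> \<in> normal_cone" "\<kappa> \<bullet> t \<noteq> 0" using t by (auto simp: T1_def T0_def)
    have "\<kappa> \<bullet> t \<ge> 0" using \<kappa>(1) tT by (simp add: normal_cone_def)
    then show "\<exists>\<kappa>. \<kappa> \<in> normal_cone \<and> \<kappa> \<bullet> t > 0" using \<kappa> by (intro exI[of _ \<kappa>]) simp
  qed
  from bchoice[OF this] obtain \<kappa>t where \<kappa>t: "\<forall>t\<in>T1. \<kappa>t t \<in> normal_cone \<and> \<kappa>t t \<bullet> t > 0" ..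
  \<comment> \<open>Summing one functional positive on each member of \<open>T1\<close> gives a
    single element of the cone that is positive on all of them.\<close>
  define \<kappa>0 where "\<kappa>0 = (\<Sum>t\<in>T1. \<kappa>t t)"
  have \<kappa>0_nonneg: "\<kappa>0 \<bullet> t \<ge> 0" if "t \<in> tangent_gens" for t
    unfolding \<kappa>0_def inner_sum_left using \<kappa>t that by (intro sum_nonneg) (auto simp: normal_cone_def)
  have \<kappa>0: "\<kappa>0 \<in> normal_cone" using \<kappa>0_nonneg by (simp add: normal_cone_def)
  have \<kappa>0_pos: "\<kappa>0 \<bullet> t > 0" if t: "t \<in> T1" for t
  proof -
    have "\<kappa>t t \<bullet> t \<le> \<kappa>0 \<bullet> t"
      unfolding \<kappa>0_def inner_sum_left
      by (rule member_le_sum[OF t, of "\<lambda>t'. \<kappa>t t' \<bullet> t"]) (use \<kappa>t t finT in \<open>auto simp: normal_cone_def T1_def\<close>)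
    moreover have "\<kappa>t t \<bullet> t > 0" using \<kappa>t t by blast
    ultimately show ?thesis by linarith
  qed
  \<comment> \<open>On \<open>T0\<close> the correction is invisible because
    \<open>\<kappa>0\<close> vanishes there; on \<open>T1\<close> a large multiple of
    \<open>\<kappa>0\<close> outweighs w.\<close>
  have corr: "\<exists>b. b *\<^sub>R \<kappa>0 + w \<in> normal_cone" if w: "\<And>t. t \<in> T0 \<Longrightarrow> w \<bullet> t \<ge> 0" for w
  proof -
    define b where "b = (\<Sum>t\<in>T1. \<bar>w \<bullet> t\<bar> / (\<kappa>0 \<bullet> t))"
    have "(b *\<^sub>R \<kappa>0 + w) \<bullet> t \<ge> 0" if t: "t \<in> tangent_gens" for t
    proof (cases "t \<in> T0")
      case True
      then have "\<kappa>0 \<bullet> t = 0" using \<kappa>0 by (simp add: T0_def)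
      then show ?thesis using w[OF True] by (simp add: inner_add_left)
    next
      case False
      then have t1: "t \<in> T1" using t by (simp add: T1_def)
      have "\<bar>w \<bullet> t\<bar> / (\<kappa>0 \<bullet> t) \<le> b"
        unfolding b_def using finT \<kappa>0_pos less_imp_le
        by (intro member_le_sum[OF t1, of "\<lambda>t. \<bar>w \<bullet> t\<bar> / (\<kappa>0 \<bullet> t)"]) (auto intro!: divide_nonneg_pos)
      then have "\<bar>w \<bullet> t\<bar> \<le> b * (\<kappa>0 \<bullet> t)" using \<kappa>0_pos[OF t1] by (simp add: pos_divide_le_eq)
      then show ?thesis by (simp add: inner_add_left)
    qed
    then show ?thesis by (auto simp: normal_cone_def)
  qed
  define Cc where "Cc = {y. \<exists>c. (\<forall>t. c t \<ge> 0) \<and> y = (\<Sum>t\<in>T0. c t *\<^sub>R t)}"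
  have T0Cc: "t \<in> Cc" if "t \<in> T0" for t
  proof -
    have "t = (\<Sum>t'\<in>T0. (if t' = t then 1 else 0) *\<^sub>R t')"
    proof -
      have "(\<Sum>t'\<in>T0. (if t' = t then 1 else 0) *\<^sub>R t') = (\<Sum>t'\<in>T0. if t' = t then t' else 0)"
        by (rule sum.cong) auto
      then show ?thesis using that finT by simp
    qed
    then show ?thesis unfolding Cc_def by (intro CollectI exI[of _ "\<lambda>t'. if t' = t then 1 else 0"]) auto
  qed
  have zero: "0 \<in> Cc" unfolding Cc_def by (intro CollectI exI[of _ "\<lambda>_. 0"]) simp
  have convC: "convex Cc"
    unfolding convex_def
  proof (intro ballI allI impI)
    fix x y and u v :: real assume "x \<in> Cc" "y \<in> Cc" and uv: "0 \<le> u" "0 \<le> v" "u + v = 1"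
    then obtain cx cy where cx: "\<forall>t. cx t \<ge> 0" "x = (\<Sum>t\<in>T0. cx t *\<^sub>R t)"
      and cy: "\<forall>t. cy t \<ge> 0" "y = (\<Sum>t\<in>T0. cy t *\<^sub>R t)"
      unfolding Cc_def by blast
    show "u *\<^sub>R x + v *\<^sub>R y \<in> Cc"
      unfolding Cc_def
    proof (intro CollectI exI[of _ "\<lambda>t. u * cx t + v * cy t"] conjI allI)
      show "0 \<le> u * cx t + v * cy t" for t using uv cx(1) cy(1) by simp
      show "u *\<^sub>R x + v *\<^sub>R y = (\<Sum>t\<in>T0. (u * cx t + v * cy t) *\<^sub>R t)"
        unfolding cx(2) cy(2) by (simp add: scaleR_sum_right scaleR_add_left sum.distrib)
    qed
  qed
  \<comment> \<open>Equivalently, the cone generated by \<open>T0\<close> is a linear subspace; this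
    is what yields the negatives of its generators as feasible directions.\<close>
  have "0 \<in> rel_interior Cc"
  proof (rule ccontr)
    assume "0 \<notin> rel_interior Cc"
    obtain a where a0: "a \<noteq> 0" and a: "\<And>y. y \<in> Cc \<Longrightarrow> a \<bullet> 0 \<le> a \<bullet> y" "\<And>y. y \<in> rel_interior Cc \<Longrightarrow> a \<bullet> 0 < a \<bullet> y"
      by (rule supporting_hyperplane_rel_boundary[OF convC zero \<open>0 \<notin> rel_interior Cc\<close>]) (rule that)
    have "rel_interior Cc \<noteq> {}" using rel_interior_eq_empty[OF convC] zero by blast
    then obtain y where y: "y \<in> rel_interior Cc" by blast
    have y0: "a \<bullet> y > 0" using a(2)[OF y] by simp
    have "y \<in> Cc" using y by (rule subsetD[OF rel_interior_subset])
    then obtain c where c: "\<forall>t. c t \<ge> 0" "y = (\<Sum>t\<in>T0. c t *\<^sub>R t)"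
      unfolding Cc_def by blast
    have "\<exists>t\<in>T0. a \<bullet> t > 0"
    proof (rule ccontr)
      assume "\<not> (\<exists>t\<in>T0. a \<bullet> t > 0)"
      then have "a \<bullet> y \<le> 0" unfolding c(2) inner_sum_right
        using c(1) by (intro sum_nonpos) (auto simp: mult_nonneg_nonpos not_less)
      then show False using y0 by simp
    qed
    then obtain t where t: "t \<in> T0" "a \<bullet> t > 0" by blast
    obtain b where b: "b *\<^sub>R \<kappa>0 + a \<in> normal_cone" using corr[of a] a(1)[OF T0Cc] by auto
    have "\<kappa>0 \<bullet> t = 0" "(b *\<^sub>R \<kappa>0 + a) \<bullet> t = 0" using t(1) \<kappa>0 b by (auto simp: T0_def)
    then show False using t(2) by (simp add: inner_add_left)
  qed
  then have T0L: "T0 \<subseteq> central_directions"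
  proof (intro subsetI)
    fix t assume t: "t \<in> T0"
    have "Cc \<noteq> {}" using zero by blast
    then have "\<forall>x\<in>Cc. \<exists>e>1. (1 - e) *\<^sub>R x + e *\<^sub>R 0 \<in> Cc"
      using convex_rel_interior_iff[OF convC, of 0] \<open>0 \<in> rel_interior Cc\<close> by blast
    from bspec[OF this T0Cc[OF t]]
    obtain e where e: "e > 1" "(1 - e) *\<^sub>R t + e *\<^sub>R 0 \<in> Cc" by (elim exE conjE)
    then have "(1 - e) *\<^sub>R t \<in> Cc" by simp
    then obtain c where c: "\<forall>t. c t \<ge> 0" "(1 - e) *\<^sub>R t = (\<Sum>t\<in>T0. c t *\<^sub>R t)" by (auto simp: Cc_def)
    have feas: "x \<in> feasible_directions" if "x \<in> T0" for x
      using that tangent_gens_feasible by (simp add: T0_def)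
    have "(1 - e) *\<^sub>R t \<in> feasible_directions" unfolding c(2) using c(1) feas finT by (intro feasible_sum) auto
    then have "(1 / (e - 1)) *\<^sub>R ((1 - e) *\<^sub>R t) \<in> feasible_directions" by (rule feasible_scale) (use e(1) in simp)
    moreover have "(1 / (e - 1)) *\<^sub>R ((1 - e) *\<^sub>R t) = - t"
    proof -
      have "(1 / (e - 1)) * (1 - e) = - 1" using e(1) by (simp add: field_simps)
      then show ?thesis by (simp only: scaleR_scaleR) simp
    qed
    ultimately have "- t \<in> feasible_directions" by (simp only:)
    then show "t \<in> central_directions" using feas[OF t] by (intro feasible_both_central)
  qed
  \<comment> \<open>The orthogonal complement of \<open>T0\<close> lies in the span of the normal
    cone by \<open>corr\<close>, so that span has dimension at least n - dim (span T0).\<close>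
  let ?W = "{y \<in> UNIV. \<forall>x\<in>span T0. orthogonal x y}"
  have "?W \<subseteq> span normal_cone"
  proof
    fix w assume w: "w \<in> ?W"
    have "w \<bullet> t \<ge> 0" if "t \<in> T0" for t
    proof -
      have "orthogonal t w" using w span_base[OF that] by blast
      then show ?thesis by (simp add: orthogonal_def inner_commute)
    qed
    then obtain b where b: "b *\<^sub>R \<kappa>0 + w \<in> normal_cone" using corr by blast
    have "(b *\<^sub>R \<kappa>0 + w) - b *\<^sub>R \<kappa>0 \<in> span normal_cone"
      by (intro span_diff span_scale span_base b \<kappa>0)
    then show "w \<in> span normal_cone" by simp
  qed
  then have "dim ?W \<le> dim (span normal_cone)" by (rule dim_subset)
  moreover have "dim ?W + dim (span T0) = dim (UNIV :: (real ^ 'n) set)"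
    by (rule dim_subspace_orthogonal_to_vectors) auto
  moreover have "dim (span T0) \<le> dim central_directions" using dim_subset[OF T0L] by simp
  ultimately show ?thesis by simp
qed

lemma normal_cone_nonneg: "\<kappa> \<in> normal_cone \<Longrightarrow> \<kappa> $ i \<ge> 0"
proof -
  assume "\<kappa> \<in> normal_cone"
  moreover have "axis i 1 \<in> tangent_gens" by (auto simp: tangent_gens_def)
  ultimately have "0 \<le> \<kappa> \<bullet> axis i 1" by (auto simp: normal_cone_def)
  then show ?thesis by (simp add: inner_axis)
qed

lemma normal_cone_gens:
  assumes "\<kappa> \<in> normal_cone" "s \<in> S"
  shows "dist\<^sub>N * (\<Sum>i\<in>UNIV. \<kappa> $ i) \<le> \<kappa> \<bullet> real_vec s"
proof -
  have "real_vec s - diag_pt \<in> tangent_gens" using assms(2) by (auto simp: tangent_gens_def)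
  then have "0 \<le> \<kappa> \<bullet> (real_vec s - diag_pt)" using assms(1) unfolding normal_cone_def by blast
  then show ?thesis by (simp add: inner_diff_right inner_diag_pt)
qed

text \<open>Dual functionals extended to the whole space bound the coefficients by the coordinates.
  Coefficients spaced by Q thus remain distinguishable after rounding the coordinates.\<close>

lemma independent_coordinates_bound:
  fixes B :: "(real ^ 'n) set"
  assumes B: "independent B"
  shows "\<exists>Q>0. \<forall>a x. (\<forall>i. \<bar>(\<Sum>b\<in>B. a b *\<^sub>R b) $ i\<bar> < 1) \<longrightarrow> x \<in> B \<longrightarrow> \<bar>a x\<bar> < Q"
proof -
  have fin: "finite B" using B by (rule independent_imp_finite)
  have "\<forall>b\<in>B. \<exists>g :: real ^ 'n \<Rightarrow> real. linear g \<and> (\<forall>x\<in>B. g x = (if x = b then 1 else 0))"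
    by (intro ballI linear_independent_extend[OF B])
  from bchoice[OF this] obtain g :: "real ^ 'n \<Rightarrow> real ^ 'n \<Rightarrow> real"
    where g: "\<forall>b\<in>B. linear (g b) \<and> (\<forall>x\<in>B. g b x = (if x = b then 1 else 0))" ..
  define Q where "Q = 1 + (\<Sum>b\<in>B. \<Sum>i\<in>UNIV. \<bar>g b (axis i 1)\<bar>)"
  have S0: "(\<Sum>b\<in>B. \<Sum>i\<in>UNIV. \<bar>g b (axis i 1)\<bar>) \<ge> 0" by (intro sum_nonneg) auto
  show ?thesis
  proof (intro exI[of _ Q] conjI allI impI)
    show "Q > 0" using S0 by (simp add: Q_def)
    fix a and x :: "real ^ 'n" assume small: "\<forall>i. \<bar>(\<Sum>b\<in>B. a b *\<^sub>R b) $ i\<bar> < 1" and x: "x \<in> B"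
    let ?y = "\<Sum>b\<in>B. a b *\<^sub>R b"
    have lin: "linear (g x)" and val: "g x b = (if b = x then 1 else 0)" if "b \<in> B" for b using g x that by auto
    have "g x ?y = (\<Sum>b\<in>B. a b *\<^sub>R g x b)"
      using lin[OF x] by (simp add: linear_sum linear_scale)
    also have "\<dots> = (\<Sum>b\<in>B. if b = x then a b else 0)" using val by (intro sum.cong) auto
    also have "\<dots> = a x" using fin x by simp
    finally have ax: "a x = g x ?y" by simp
    have "?y = (\<Sum>i\<in>UNIV. (?y $ i) *\<^sub>R axis i 1)"
      using basis_expansion[of ?y] by (simp only: scalar_mult_eq_scaleR)
    then have "g x ?y = g x (\<Sum>i\<in>UNIV. (?y $ i) *\<^sub>R axis i 1)" by (rule arg_cong)
    also have "\<dots> = (\<Sum>i\<in>UNIV. (?y $ i) * g x (axis i 1))"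
      using lin[OF x] by (simp only: linear_sum linear_scale real_scaleR_def)
    finally have "a x = (\<Sum>i\<in>UNIV. (?y $ i) * g x (axis i 1))" using ax by simp
    also have "\<bar>\<dots>\<bar> \<le> (\<Sum>i\<in>UNIV. \<bar>(?y $ i) * g x (axis i 1)\<bar>)" by (rule sum_abs)
    also have "\<dots> \<le> (\<Sum>i\<in>UNIV. 1 * \<bar>g x (axis i 1)\<bar>)"
      unfolding abs_mult by (intro sum_mono mult_right_mono) (use small less_imp_le in blast, simp)
    also have "\<dots> \<le> (\<Sum>b\<in>B. \<Sum>i\<in>UNIV. \<bar>g b (axis i 1)\<bar>)"
      using member_le_sum[OF x, of "\<lambda>b. \<Sum>i\<in>UNIV. \<bar>g b (axis i 1)\<bar>"] fin by (simp add: sum_nonneg)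
    also have "\<dots> < Q" by (simp add: Q_def)
    finally show "\<bar>a x\<bar> < Q" .
  qed
qed

text \<open>Nonnegative combinations x of n - h independent vectors of the normal cone with |x| = l
  / d satisfy x . s \<ge> d |x| = l for every generator s. All coefficients but one run freely
  through multiples of Q up to the order of l, the last one adjusts |x|, and rounding up keeps the
  inequality at a cost of at most n in |x|.\<close>

lemma lower_vectors:
  "\<exists>c>0. \<forall>l::nat. l \<ge> 1 \<longrightarrow> (\<exists>E. finite E \<and> c * real l ^ (CARD('n) - dim central_directions - 1) \<le> real (card E) \<and>
    (\<forall>e\<in>E. real (vec_sum e) \<le> real l / dist\<^sub>N + real CARD('n) \<and> (\<forall>s\<in>S. l \<le> dotn e s)))"
proof -
  let ?d = "dist\<^sub>N"
  have d: "?d > 0" by (rule newton_distance_pos)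
  define r where "r = CARD('n) - dim central_directions"
  have r: "r > 0" using dim_central_directions_less by (simp add: r_def)
  obtain B0 where B0: "B0 \<subseteq> normal_cone" "independent B0" "normal_cone \<subseteq> span B0" "card B0 = dim normal_cone"
    by (rule basis_exists)
  have "r \<le> card B0" using dim_normal_cone B0(4) by (simp add: r_def)
  then obtain B where B: "B \<subseteq> B0" "card B = r" "finite B" by (rule obtain_subset_with_card_n)
  have indB: "independent B" using B0(2) B(1) by (rule independent_mono)
  have BK: "B \<subseteq> normal_cone" using B(1) B0(1) by (rule subset_trans)
  have "B \<noteq> {}" using B r by auto
  then obtain \<kappa>0 where \<kappa>0: "\<kappa>0 \<in> B" by blast
  define R where "R = B - {\<kappa>0}"
  have R: "finite R" "card R = r - 1" "B = insert \<kappa>0 R" "\<kappa>0 \<notin> R" using B \<kappa>0 by (auto simp: R_def)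
  define wt where "wt \<kappa> = (\<Sum>i\<in>UNIV. \<kappa> $ i)" for \<kappa> :: "real ^ 'n"
  have wt0: "wt \<kappa> \<ge> 0" if "\<kappa> \<in> B" for \<kappa>
    unfolding wt_def using BK that normal_cone_nonneg by (intro sum_nonneg) auto
  have wt_pos: "wt \<kappa>0 > 0"
  proof (rule ccontr)
    assume "\<not> wt \<kappa>0 > 0"
    then have "wt \<kappa>0 = 0" using wt0[OF \<kappa>0] by simp
    moreover have nn: "\<kappa>0 $ i \<ge> 0" for i using BK \<kappa>0 normal_cone_nonneg by blast
    ultimately have "\<forall>i\<in>UNIV. \<kappa>0 $ i = 0" unfolding wt_def by (subst (asm) sum_nonneg_eq_0_iff) auto
    then have "\<kappa>0 = 0" by (simp add: vec_eq_iff)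
    then show False using indB \<kappa>0 dependent_zero by blast
  qed
  obtain Q where Q: "Q > 0" "\<And>a x. (\<forall>i. \<bar>(\<Sum>b\<in>B. a b *\<^sub>R b) $ i\<bar> < 1) \<Longrightarrow> x \<in> B \<Longrightarrow> \<bar>a x\<bar> < Q"
    using independent_coordinates_bound[OF indB] by blast
  \<comment> \<open>\<open>W\<close> bounds the total weight of the vectors in \<open>R\<close>, and
    J will be chosen such that even with all free coefficients maximal the remaining one, for
    \<open>\<kappa>0\<close>, is nonnegative. The summand 1 avoids division by 0.\<close>
  define W where "W = 1 + (\<Sum>\<kappa>\<in>R. wt \<kappa>)"
  have W: "W \<ge> 1" unfolding W_def using wt0 R by (simp add: sum_nonneg)
  define c where "c = (1 / (?d * Q * W)) ^ (r - 1)"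
  have dQW: "?d * Q * W > 0" using d Q W by simp
  have "c > 0" using dQW by (simp add: c_def)
  moreover have "\<exists>E. finite E \<and> c * real l ^ (CARD('n) - dim central_directions - 1) \<le> real (card E) \<and>
    (\<forall>e\<in>E. real (vec_sum e) \<le> real l / ?d + real CARD('n) \<and> (\<forall>s\<in>S. l \<le> dotn e s))" if l: "l \<ge> 1" for l :: nat
  proof -
    define J where "J = nat \<lfloor>real l / (?d * Q * W)\<rfloor>"
    have J: "real J \<le> real l / (?d * Q * W)" "real l / (?d * Q * W) \<le> real J + 1"
      using dQW by (simp_all add: J_def)
    define co where "co j = (\<lambda>\<kappa>. if \<kappa> = \<kappa>0 then (real l / ?d - (\<Sum>\<kappa>\<in>R. Q * real (j \<kappa>) * wt \<kappa>)) / wt \<kappa>0 else Q * real (j \<kappa>))" for j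
    define x where "x j = (\<Sum>\<kappa>\<in>B. co j \<kappa> *\<^sub>R \<kappa>)" for j
    define e where "e j = (\<chi> i. nat \<lceil>x j $ i\<rceil>)" for j
    define P where "P = Pi\<^sub>E R (\<lambda>_. {..J})"
    have co0: "co j \<kappa> \<ge> 0" if j: "j \<in> P" and \<kappa>: "\<kappa> \<in> B" for j \<kappa>
    proof (cases "\<kappa> = \<kappa>0")
      case True
      have "(\<Sum>\<kappa>\<in>R. Q * real (j \<kappa>) * wt \<kappa>) \<le> (\<Sum>\<kappa>\<in>R. Q * real J * wt \<kappa>)"
      proof (intro sum_mono mult_right_mono mult_left_mono)
        fix \<kappa> assume "\<kappa> \<in> R"
        then show "real (j \<kappa>) \<le> real J" "0 \<le> wt \<kappa>" using j wt0 R(3) by (auto simp: P_def)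
      qed (use Q in auto)
      also have "\<dots> = Q * real J * (\<Sum>\<kappa>\<in>R. wt \<kappa>)" by (simp only: sum_distrib_left)
      also have "\<dots> \<le> Q * real J * W" using Q by (intro mult_left_mono) (auto simp: W_def)
      also have "\<dots> \<le> Q * (real l / (?d * Q * W)) * W"
        using J(1) Q W by (intro mult_right_mono mult_left_mono) auto
      also have "\<dots> = real l / ?d" using Q W by simp
      finally show ?thesis using True wt_pos by (simp add: co_def)
    next
      case False
      then show ?thesis using Q by (simp add: co_def)
    qed
    have total: "(\<Sum>\<kappa>\<in>B. co j \<kappa> * wt \<kappa>) = real l / ?d" for j
    proof -
      have "(\<Sum>\<kappa>\<in>B. co j \<kappa> * wt \<kappa>) = co j \<kappa>0 * wt \<kappa>0 + (\<Sum>\<kappa>\<in>R. co j \<kappa> * wt \<kappa>)"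
        unfolding R(3) using R(1,4) by simp
      also have "co j \<kappa>0 * wt \<kappa>0 = real l / ?d - (\<Sum>\<kappa>\<in>R. Q * real (j \<kappa>) * wt \<kappa>)"
        using wt_pos by (simp add: co_def)
      also have "(\<Sum>\<kappa>\<in>R. co j \<kappa> * wt \<kappa>) = (\<Sum>\<kappa>\<in>R. Q * real (j \<kappa>) * wt \<kappa>)"
        using R(4) by (intro sum.cong) (auto simp: co_def)
      finally show ?thesis by simp
    qed
    have x0: "x j $ i \<ge> 0" if "j \<in> P" for j i
      unfolding x_def using co0[OF that] BK normal_cone_nonneg
      by (auto intro!: sum_nonneg mult_nonneg_nonneg)
    have xsum: "(\<Sum>i\<in>UNIV. x j $ i) = real l / ?d" for j
    proof -
      have "(\<Sum>i\<in>UNIV. x j $ i) = (\<Sum>i\<in>UNIV. \<Sum>\<kappa>\<in>B. co j \<kappa> * \<kappa> $ i)" by (simp add: x_def)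
      also have "\<dots> = (\<Sum>\<kappa>\<in>B. \<Sum>i\<in>UNIV. co j \<kappa> * \<kappa> $ i)" by (rule sum.swap)
      also have "\<dots> = (\<Sum>\<kappa>\<in>B. co j \<kappa> * wt \<kappa>)" by (simp add: wt_def sum_distrib_left)
      finally show ?thesis using total by simp
    qed
    \<comment> \<open>Equal roundings bring the points within 1 of each other in each coordinate,
      hence the coefficients strictly within Q, while distinct multiples of Q differ by at least
      Q.\<close>
    have inj: "inj_on e P"
    proof (rule inj_onI)
      fix j j' assume j: "j \<in> P" "j' \<in> P" and eq: "e j = e j'"
      have small: "\<forall>i. \<bar>(\<Sum>b\<in>B. (co j b - co j' b) *\<^sub>R b) $ i\<bar> < 1"
      proof
        fix i
        have "nat \<lceil>x j $ i\<rceil> = nat \<lceil>x j' $ i\<rceil>" using arg_cong[OF eq, of "\<lambda>v. v $ i"] by (simp add: e_def)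
        moreover have "\<lceil>x j $ i\<rceil> \<ge> 0" "\<lceil>x j' $ i\<rceil> \<ge> 0" using x0[OF j(1), of i] x0[OF j(2), of i] by linarith+
        ultimately have "\<lceil>x j $ i\<rceil> = \<lceil>x j' $ i\<rceil>" by (simp add: eq_nat_nat_iff)
        then have "\<bar>x j $ i - x j' $ i\<bar> < 1" by linarith
        moreover have "(\<Sum>b\<in>B. (co j b - co j' b) *\<^sub>R b) = x j - x j'"
          unfolding x_def scaleR_diff_left sum_subtractf ..
        ultimately show "\<bar>(\<Sum>b\<in>B. (co j b - co j' b) *\<^sub>R b) $ i\<bar> < 1" by simp
      qed
      have "j \<kappa> = j' \<kappa>" if \<kappa>: "\<kappa> \<in> R" for \<kappa>
      proof (rule ccontr)
        assume ne: "j \<kappa> \<noteq> j' \<kappa>"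
        have "\<kappa> \<in> B" "\<kappa> \<noteq> \<kappa>0" using \<kappa> R by auto
        then have "\<bar>Q * real (j \<kappa>) - Q * real (j' \<kappa>)\<bar> < Q" using Q(2)[OF small, of \<kappa>] by (simp add: co_def)
        moreover have "\<bar>Q * real (j \<kappa>) - Q * real (j' \<kappa>)\<bar> = Q * \<bar>real (j \<kappa>) - real (j' \<kappa>)\<bar>"
          using Q(1) by (simp add: abs_mult flip: right_diff_distrib)
        moreover have "Q * 1 \<le> Q * \<bar>real (j \<kappa>) - real (j' \<kappa>)\<bar>" using ne Q(1) by (intro mult_left_mono) auto
        ultimately show False by simp
      qed
      then show "j = j'" using j unfolding P_def by (intro PiE_ext) auto
    qed
    have finP: "finite P" unfolding P_def using R(1) by (intro finite_PiE) auto
    have cardP: "card P = (J + 1) ^ (r - 1)" unfolding P_def using R(1,2) by (simp add: card_PiE)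
    show ?thesis
    proof (intro exI[of _ "e ` P"] conjI ballI)
      show "finite (e ` P)" using finP by simp
      have "c * real l ^ (r - 1) = (real l / (?d * Q * W)) ^ (r - 1)"
        by (simp add: c_def power_divide)
      also have "\<dots> \<le> (real J + 1) ^ (r - 1)" using J(2) dQW by (intro power_mono) auto
      also have "\<dots> = real (card (e ` P))" using card_image[OF inj] cardP by (simp add: add.commute)
      finally show "c * real l ^ (CARD('n) - dim central_directions - 1) \<le> real (card (e ` P))" by (simp add: r_def)
    next
      fix v assume "v \<in> e ` P"
      then obtain j where j: "j \<in> P" and v: "v = e j" by blast
      have vi: "x j $ i \<le> real (v $ i)" "real (v $ i) \<le> x j $ i + 1" for i
        using x0[OF j, of i] by (simp_all add: v e_def)
      have "real (vec_sum v) = (\<Sum>i\<in>UNIV. real (v $ i))" by (simp add: vec_sum_def)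
      also have "\<dots> \<le> (\<Sum>i\<in>UNIV. x j $ i + 1)" by (intro sum_mono vi)
      also have "\<dots> = real l / ?d + real CARD('n)" using xsum[of j] by (simp add: sum.distrib)
      finally show "real (vec_sum v) \<le> real l / ?d + real CARD('n)" .
      fix s assume s: "s \<in> S"
      have "real l = ?d * (\<Sum>\<kappa>\<in>B. co j \<kappa> * wt \<kappa>)" using total[of j] d by simp
      also have "\<dots> = (\<Sum>\<kappa>\<in>B. co j \<kappa> * (?d * wt \<kappa>))" by (simp add: sum_distrib_left mult_ac)
      also have "\<dots> \<le> (\<Sum>\<kappa>\<in>B. co j \<kappa> * (\<kappa> \<bullet> real_vec s))"
        using BK normal_cone_gens[OF _ s] co0[OF j] unfolding wt_def
        by (intro sum_mono mult_left_mono) auto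
      also have "\<dots> = x j \<bullet> real_vec s" by (simp add: x_def inner_sum_left)
      also have "\<dots> \<le> real_vec v \<bullet> real_vec s"
        unfolding inner_vec_def using vi(1) by (intro sum_mono) (simp add: mult_right_mono)
      also have "\<dots> = real (dotn v s)" by (rule inner_real_vec)
      finally show "l \<le> dotn v s" by (simp only: of_nat_le_iff)
    qed
  qed
  ultimately show ?thesis by blast
qed

section \<open>Lower bound from strata consisting of solutions\<close>

lemma dotn_mono: "(\<And>i. s $ i \<le> \<alpha> $ i) \<Longrightarrow> dotn k s \<le> dotn k \<alpha>"
  unfolding dotn_def by (intro sum_mono mult_le_mono2)

lemma dotn_add_left: "dotn (k + e) \<alpha> = dotn k \<alpha> + dotn e \<alpha>"
  by (simp add: dotn_def distrib_right sum.distrib)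

definition truncation :: "nat \<Rightarrow> nat ^ 'n \<Rightarrow> (nat ^ 'n) set \<Rightarrow> int ^ 'n \<Rightarrow> int" where
  "truncation p k U x = (\<Sum>\<alpha>\<in>U. f \<alpha> * int p ^ dotn k \<alpha> * monomial_at x \<alpha>)"

text \<open>The condition has period p^l, so the density may be computed in the larger box of side
  p^L. The strata require this, because nonzero entries of a box of side p^l have valuation below
  l.\<close>

lemma solutions_refine:
  fixes a :: "int ^ 'n" and k :: "nat ^ 'n"
  assumes a: "\<And>i. a $ i = int (k $ i)" and k: "\<And>i. k $ i \<ge> 1"
    and U: "finite U" "\<And>\<alpha>. f \<alpha> \<noteq> 0 \<Longrightarrow> dotn k \<alpha> < l \<Longrightarrow> \<alpha> \<in> U" and L: "l \<le> L"
  shows "1 / real CARD('p) ^ (l * CARD('n)) * real (card (solutions TYPE('p::prime_card) f a l)) =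
    real (card {x \<in> int_box (CARD('p) ^ L). int CARD('p) ^ l dvd truncation CARD('p) k U x}) / real CARD('p) ^ (L * CARD('n))"
proof -
  let ?p = "CARD('p)"
  have p0: "?p > 0" by (rule prime_gt_0_nat[OF prime_card[where 'a = 'p]])
  have sol: "solutions TYPE('p) f a l = {x \<in> int_box (?p ^ l). int ?p ^ l dvd truncation ?p k U x}"
    using solutions_eq[where 'p = 'p, OF a k U] by (simp add: int_box_def truncation_def)
  have "card {x \<in> int_box (?p ^ l * ?p ^ (L - l)). int ?p ^ l dvd truncation ?p k U x} =
      card {x \<in> int_box (?p ^ l). int ?p ^ l dvd truncation ?p k U x} * (?p ^ (L - l)) ^ CARD('n)"
  proof (rule card_periodic_refine)
    fix x y :: "int ^ 'n" assume "\<And>i. int (?p ^ l) dvd x $ i - y $ i"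
    then have "int ?p ^ l dvd truncation ?p k U x - truncation ?p k U y"
      unfolding truncation_def by (intro eval_diff_dvd) simp
    then show "int ?p ^ l dvd truncation ?p k U x \<longleftrightarrow> int ?p ^ l dvd truncation ?p k U y"
      using dvd_add_right_iff[of "int ?p ^ l" "truncation ?p k U x - truncation ?p k U y" "truncation ?p k U y"] by simp
  qed (use p0 in auto)
  moreover have "?p ^ l * ?p ^ (L - l) = ?p ^ L" using L by (simp flip: power_add)
  ultimately have eq: "card {x \<in> int_box (?p ^ L). int ?p ^ l dvd truncation ?p k U x} =
      card (solutions TYPE('p) f a l) * ?p ^ ((L - l) * CARD('n))" by (simp add: sol power_mult)
  have "l * CARD('n) + (L - l) * CARD('n) = L * CARD('n)" using L by (simp flip: distrib_right)
  then have "real ?p ^ (L * CARD('n)) = real ?p ^ (l * CARD('n)) * real ?p ^ ((L - l) * CARD('n))"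
    by (simp flip: power_add)
  then show ?thesis unfolding eq using p0 by simp
qed

lemma power_sum_vec: "(\<Prod>i\<in>UNIV. q ^ (e $ i)) = (q :: 'b :: comm_semiring_1) ^ vec_sum e"
  by (simp add: vec_sum_def power_sum)

text \<open>On the strata from \<open>lower_vectors\<close>, p^l divides each monomial of the
  support separately, so the bound holds for every positive a, in all three cases alike.\<close>

lemma density_lower:
  fixes a :: "int ^ 'n"
  assumes a: "\<And>i. a $ i \<ge> 1"
  shows "\<exists>C>0. \<forall>l::nat. l > 0 \<longrightarrow> C * real l ^ (CARD('n) - dim central_directions - 1) * real CARD('p) powr (- (real l / dist\<^sub>N)) \<le>
    1 / real CARD('p) ^ (l * CARD('n)) * real (card (solutions TYPE('p::prime_card) f a l))"
proof -
  let ?p = "CARD('p)"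
  have pp: "prime ?p" by (rule prime_card)
  have p1: "real ?p > 1" by (rule card_prime_gt_1)
  obtain c where c: "c > 0" "\<And>l::nat. l \<ge> 1 \<Longrightarrow> (\<exists>E. finite E \<and> c * real l ^ (CARD('n) - dim central_directions - 1) \<le> real (card E) \<and>
    (\<forall>e\<in>E. real (vec_sum e) \<le> real l / dist\<^sub>N + real CARD('n) \<and> (\<forall>s\<in>S. l \<le> dotn e s)))"
    using lower_vectors by blast
  define k where "k = (\<chi> i. nat (a $ i))"
  have ak: "a $ i = int (k $ i)" and k1: "k $ i \<ge> 1" for i using a[of i] by (auto simp: k_def)
  \<comment> \<open>One n in the exponent comes from rounding in \<open>lower_vectors\<close>, the
    other from \<open>card_stratum_ge\<close>.\<close>
  define q where "q = real ?p powr (- 2 * real CARD('n))"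
  have q: "q > 0" using p1 by (simp add: q_def)
  show ?thesis
  proof (intro exI[of _ "c * q"] conjI allI impI)
    show "c * q > 0" using c(1) q by simp
    fix l :: nat assume l: "l > 0"
    obtain E where E: "finite E" "c * real l ^ (CARD('n) - dim central_directions - 1) \<le> real (card E)"
      "\<And>e. e \<in> E \<Longrightarrow> real (vec_sum e) \<le> real l / dist\<^sub>N + real CARD('n)" "\<And>e s. e \<in> E \<Longrightarrow> s \<in> S \<Longrightarrow> l \<le> dotn e s"
      using c(2)[of l] l by auto
    define L where "L = l + 1 + (\<Sum>e\<in>E. vec_sum e)"
    have eL: "e $ i < L" if "e \<in> E" for e i
    proof -
      have "e $ i \<le> vec_sum e" unfolding vec_sum_def by (rule member_le_sum) auto
      also have "\<dots> \<le> (\<Sum>e\<in>E. vec_sum e)" using E(1) that by (intro member_le_sum) auto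
      finally show ?thesis by (simp add: L_def)
    qed
    define U where "U = {\<alpha>. f \<alpha> \<noteq> 0 \<and> dotn k \<alpha> < l}"
    have U: "finite U" unfolding U_def using finite_dotn_less[of k l] k1 by (auto intro: rev_finite_subset)
    define V where "V e = {x :: int ^ 'n. x \<in> int_box (?p ^ L) \<and> (\<forall>i. x $ i \<noteq> 0 \<and> multiplicity (int ?p) (x $ i) = e $ i)}" for e
    define X where "X = {x \<in> int_box (?p ^ L). int ?p ^ l dvd truncation ?p k U x}"
    have finX: "finite X" unfolding X_def by (rule finite_subset[OF _ finite_int_box']) auto
    have finV: "finite (V e)" for e unfolding V_def by (rule finite_subset[OF _ finite_int_box']) auto
    have "V e \<subseteq> X" if e: "e \<in> E" for e
    proof
      fix x assume x: "x \<in> V e"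
      have "int ?p ^ l dvd f \<alpha> * int ?p ^ dotn k \<alpha> * monomial_at x \<alpha>" if \<alpha>: "\<alpha> \<in> U" for \<alpha>
      proof -
        obtain s where s: "s \<in> S" "\<And>i. s $ i \<le> \<alpha> $ i" using gens_dominate[of \<alpha>] \<alpha> by (auto simp: U_def)
        have "l \<le> dotn e \<alpha>" using E(4)[OF e s(1)] dotn_mono[OF s(2), of e] by (rule order_trans)
        then have "int ?p ^ l dvd int ?p ^ dotn e \<alpha>" by (rule le_imp_power_dvd)
        also have "int ?p ^ dotn e \<alpha> = (\<Prod>i\<in>UNIV. (int ?p ^ (e $ i)) ^ (\<alpha> $ i))"
          by (simp add: dotn_def power_sum power_mult)
        also have "\<dots> dvd monomial_at x \<alpha>"
          unfolding monomial_at_def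
        proof (rule prod_dvd_prod)
          fix i
          have "int ?p ^ (e $ i) dvd x $ i" using x multiplicity_dvd[of "int ?p" "x $ i"] by (simp add: V_def)
          then show "(int ?p ^ (e $ i)) ^ (\<alpha> $ i) dvd (x $ i) ^ (\<alpha> $ i)" by (rule dvd_power_same)
        qed
        finally show ?thesis by (rule dvd_mult)
      qed
      then have "int ?p ^ l dvd truncation ?p k U x" unfolding truncation_def by (rule dvd_sum)
      then show "x \<in> X" using x by (simp add: X_def V_def)
    qed
    then have "card (\<Union>e\<in>E. V e) \<le> card X" using finX by (intro card_mono) auto
    moreover have "card (\<Union>e\<in>E. V e) = (\<Sum>e\<in>E. card (V e))"
    proof (rule card_UN_disjoint[OF E(1)])
      show "\<forall>e\<in>E. finite (V e)" using finV by blast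
      show "\<forall>e\<in>E. \<forall>e'\<in>E. e \<noteq> e' \<longrightarrow> V e \<inter> V e' = {}"
      proof (intro ballI impI, rule ccontr)
        fix e e' :: "nat ^ 'n" assume "e \<noteq> e'" "V e \<inter> V e' \<noteq> {}"
        then obtain x where "x \<in> V e" "x \<in> V e'" by blast
        then have "e $ i = e' $ i" for i by (simp add: V_def)
        then show False using \<open>e \<noteq> e'\<close> by (simp add: vec_eq_iff)
      qed
    qed
    ultimately have "(\<Sum>e\<in>E. card (V e)) \<le> card X" by simp
    then have "real (\<Sum>e\<in>E. card (V e)) \<le> real (card X)" by (simp only: of_nat_le_iff)
    then have "(\<Sum>e\<in>E. real (card (V e))) \<le> real (card X)" by (simp only: of_nat_sum)
    then have cX: "(\<Sum>e\<in>E. real (card (V e))) / real ?p ^ (L * CARD('n)) \<le> real (card X) / real ?p ^ (L * CARD('n))"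
      by (rule divide_right_mono) simp
    have cV: "q * real ?p powr (- (real l / dist\<^sub>N)) \<le> real (card (V e)) / real ?p ^ (L * CARD('n))" if e: "e \<in> E" for e
    proof -
      have "?p ^ (L * CARD('n)) \<le> card (V e) * (?p ^ CARD('n) * ?p ^ vec_sum e)"
        using card_stratum_ge[OF pp, of e L] eL[OF e] unfolding V_def power_sum_vec by blast
      then have "real (?p ^ (L * CARD('n))) \<le> real (card (V e) * (?p ^ CARD('n) * ?p ^ vec_sum e))"
        by (simp only: of_nat_le_iff)
      then have 1: "real ?p ^ (L * CARD('n)) \<le> real (card (V e)) * (real ?p powr (real CARD('n) + real (vec_sum e)))"
        using p1 by (simp add: powr_add powr_realpow)
      have "q * real ?p powr (- (real l / dist\<^sub>N)) = real ?p powr (- 2 * real CARD('n) - real l / dist\<^sub>N)"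
        unfolding q_def powr_add[symmetric] by simp
      also have "\<dots> \<le> real ?p powr (- (real CARD('n) + real (vec_sum e)))"
        using E(3)[OF e] p1 by (intro powr_mono) auto
      also have "\<dots> = 1 / real ?p powr (real CARD('n) + real (vec_sum e))" by (simp only: powr_minus_divide)
      also have "\<dots> \<le> real (card (V e)) / real ?p ^ (L * CARD('n))"
        using 1 p1 by (simp add: field_simps)
      finally show ?thesis .
    qed
    have "c * q * real l ^ (CARD('n) - dim central_directions - 1) * real ?p powr (- (real l / dist\<^sub>N)) =
        (c * real l ^ (CARD('n) - dim central_directions - 1)) * (q * real ?p powr (- (real l / dist\<^sub>N)))" by (simp only: mult_ac)
    also have "\<dots> \<le> real (card E) * (q * real ?p powr (- (real l / dist\<^sub>N)))"
      using E(2) q by (intro mult_right_mono) auto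
    also have "\<dots> = (\<Sum>e\<in>E. q * real ?p powr (- (real l / dist\<^sub>N)))" by simp
    also have "\<dots> \<le> (\<Sum>e\<in>E. real (card (V e)) / real ?p ^ (L * CARD('n)))" by (intro sum_mono cV)
    also have "\<dots> \<le> real (card X) / real ?p ^ (L * CARD('n))" using cX by (simp only: sum_divide_distrib)
    also have "\<dots> = 1 / real ?p ^ (l * CARD('n)) * real (card (solutions TYPE('p) f a l))"
      unfolding X_def by (rule solutions_refine[OF ak k1 U, symmetric]) (auto simp: U_def L_def)
    finally show "c * q * real l ^ (CARD('n) - dim central_directions - 1) * real ?p powr (- (real l / dist\<^sub>N)) \<le>
      1 / real ?p ^ (l * CARD('n)) * real (card (solutions TYPE('p) f a l))" .
  qed
qed

section \<open>The upper bounds\<close>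

text \<open>The common part of the three upper bounds: r and \<rho> are the targeted exponents, and
  \<open>weights\<close> is the lattice sum that has to be supplied. It is quantified over
  \<open>\<A>\<close> since the face that \<open>face_decomposition\<close> assigns to k is not
  under control.\<close>

lemma density_upper:
  fixes \<gamma> :: "(real ^ 'n) set \<Rightarrow> real"
  assumes \<gamma>: "admissible_rate TYPE('p::prime_card) \<gamma>" and \<rho>: "\<rho> > 0"
    and weights: "\<And>M::nat. \<exists>C>0. \<forall>\<A> K (l::nat). finite K \<longrightarrow> l \<ge> 1 \<longrightarrow>
      (\<forall>k\<in>K. facial (\<A> k) \<and> (\<forall>a\<in>\<A> k. dotn k a \<le> order_along k + M)) \<longrightarrow>
      (\<Sum>k\<in>K. real CARD('p) powr (- real (vec_sum k) - \<gamma> (face_of_gens (\<A> k)) * real (l - order_along k))) \<le>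
        C * real l ^ r * real CARD('p) powr (- (real l / \<rho>))"
  shows "\<exists>M::nat. \<forall>a :: int ^ 'n. (\<forall>i. a $ i > int M) \<longrightarrow> (\<exists>C>0. \<forall>l::nat. l > 0 \<longrightarrow>
    1 / real CARD('p) ^ (l * CARD('n)) * real (card (solutions TYPE('p) f a l)) \<le>
      C * real l ^ r * real CARD('p) powr (- (real l / \<rho>)))"
proof -
  let ?p = "CARD('p)"
  have pp: "prime ?p" by (rule prime_card)
  have p1: "real ?p > 1" by (rule card_prime_gt_1)
  have p0: "?p > 0" by (rule prime_gt_0_nat[OF pp])
  from face_decomposition[OF \<gamma>] obtain M :: nat where M: "\<forall>k. (\<forall>i. k $ i > M) \<longrightarrow> (\<exists>A. facial A \<and> (\<forall>a\<in>A. dotn k a \<le> order_along k + M) \<and>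
    (\<forall>l L U. order_along k \<le> l \<longrightarrow> l \<le> L \<longrightarrow> finite U \<longrightarrow> S \<subseteq> U \<longrightarrow>
      real (card {u \<in> unit_box TYPE('p) L. int ?p ^ l dvd (\<Sum>\<alpha>\<in>U. f \<alpha> * int ?p ^ dotn k \<alpha> * monomial_at u \<alpha>)})
      \<le> real M * real ?p ^ (L * CARD('n)) * real ?p powr (- \<gamma> (face_of_gens A) * real (l - order_along k))))" ..
  have "\<forall>k. \<exists>A. (\<forall>i. k $ i > M) \<longrightarrow> (facial A \<and> (\<forall>a\<in>A. dotn k a \<le> order_along k + M) \<and>
    (\<forall>l L U. order_along k \<le> l \<longrightarrow> l \<le> L \<longrightarrow> finite U \<longrightarrow> S \<subseteq> U \<longrightarrow>
      real (card {u \<in> unit_box TYPE('p) L. int ?p ^ l dvd (\<Sum>\<alpha>\<in>U. f \<alpha> * int ?p ^ dotn k \<alpha> * monomial_at u \<alpha>)})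
      \<le> real M * real ?p ^ (L * CARD('n)) * real ?p powr (- \<gamma> (face_of_gens A) * real (l - order_along k))))"
  proof
    fix k
    from M[THEN spec, of k]
    show "\<exists>A. (\<forall>i. k $ i > M) \<longrightarrow> (facial A \<and> (\<forall>a\<in>A. dotn k a \<le> order_along k + M) \<and>
      (\<forall>l L U. order_along k \<le> l \<longrightarrow> l \<le> L \<longrightarrow> finite U \<longrightarrow> S \<subseteq> U \<longrightarrow>
        real (card {u \<in> unit_box TYPE('p) L. int ?p ^ l dvd (\<Sum>\<alpha>\<in>U. f \<alpha> * int ?p ^ dotn k \<alpha> * monomial_at u \<alpha>)})
        \<le> real M * real ?p ^ (L * CARD('n)) * real ?p powr (- \<gamma> (face_of_gens A) * real (l - order_along k))))"
      by (simp only: ex_simps(6))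
  qed
  from choice[OF this] obtain \<A> where \<A>: "\<forall>k. (\<forall>i. k $ i > M) \<longrightarrow> (facial (\<A> k) \<and> (\<forall>a\<in>\<A> k. dotn k a \<le> order_along k + M) \<and>
    (\<forall>l L U. order_along k \<le> l \<longrightarrow> l \<le> L \<longrightarrow> finite U \<longrightarrow> S \<subseteq> U \<longrightarrow>
      real (card {u \<in> unit_box TYPE('p) L. int ?p ^ l dvd (\<Sum>\<alpha>\<in>U. f \<alpha> * int ?p ^ dotn k \<alpha> * monomial_at u \<alpha>)})
      \<le> real M * real ?p ^ (L * CARD('n)) * real ?p powr (- \<gamma> (face_of_gens (\<A> k)) * real (l - order_along k))))" ..
  from weights[of M] obtain C where C: "C > 0" "\<forall>\<A> K (l::nat). finite K \<longrightarrow> l \<ge> 1 \<longrightarrow>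
      (\<forall>k\<in>K. facial (\<A> k) \<and> (\<forall>a\<in>\<A> k. dotn k a \<le> order_along k + M)) \<longrightarrow>
      (\<Sum>k\<in>K. real ?p powr (- real (vec_sum k) - \<gamma> (face_of_gens (\<A> k)) * real (l - order_along k))) \<le>
        C * real l ^ r * real ?p powr (- (real l / \<rho>))" by (elim exE conjE)
  show ?thesis
  proof (intro exI[of _ M] allI impI)
    fix a :: "int ^ 'n" assume a: "\<forall>i. a $ i > int M"
    define k0 where "k0 = (\<chi> i. nat (a $ i))"
    have a': "a $ i > int M" for i using a by blast
    have ak: "a $ i = int (k0 $ i)" and k0M: "k0 $ i > M" and k01: "k0 $ i \<ge> 1" for i
      using a'[of i] by (auto simp: k0_def)
    \<comment> \<open>The first summand pays for points with a zero coordinate. The factor p powr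
      |k0| arises because a stratum has weight p^(-|e|) whereas the lattice sum is in terms of k =
      k0 + e; it makes the constant depend on a.\<close>
    define C' where "C' = real CARD('n) + real (M + 1) * real ?p powr real (vec_sum k0) * C"
    have C': "C' > 0" using C(1) p1 by (simp add: C'_def add_pos_nonneg)
    show "\<exists>C>0. \<forall>l::nat. l > 0 \<longrightarrow> 1 / real ?p ^ (l * CARD('n)) * real (card (solutions TYPE('p) f a l)) \<le>
      C * real l ^ r * real ?p powr (- (real l / \<rho>))"
    proof (intro exI[of _ C'] conjI C' allI impI)
      fix l :: nat assume l: "l > 0"
      \<comment> \<open>With L \<ge> l / \<rho> the points with a zero coordinate, of density at
        most n p^(-L), stay below the target.\<close>
      define L where "L = l + nat \<lceil>real l / \<rho>\<rceil>"
      have L: "l \<le> L" "real l / \<rho> \<le> real L" "L > 0"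
        using l real_nat_ceiling_ge[of "real l / \<rho>"] by (auto simp: L_def)
      \<comment> \<open>\<open>S\<close> is included because \<open>face_decomposition\<close>
        counts with polynomials containing all generators.\<close>
      define U where "U = S \<union> {\<alpha>. dotn k0 \<alpha> < l}"
      have U: "finite U" "S \<subseteq> U" unfolding U_def using finite_gens finite_dotn_less[of k0 l] k01 by auto
      define X where "X = {x \<in> int_box (?p ^ L). int ?p ^ l dvd truncation ?p k0 U x}"
      define Z where "Z i = {x :: int ^ 'n. x \<in> int_box (?p ^ L) \<and> x $ i = 0}" for i
      define V where "V e = {x \<in> int_box (?p ^ L). (\<forall>i. x $ i \<noteq> 0 \<and> multiplicity (int ?p) (x $ i) = e $ i) \<and>
        int ?p ^ l dvd truncation ?p k0 U x}" for e :: "nat ^ 'n"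
      define E where "E = {e :: nat ^ 'n. \<forall>i. e $ i < L}"
      have finE: "finite E" unfolding E_def
        by (rule finite_subset[OF _ finite_bounded_vec[of L]]) (auto intro: less_imp_le)
      have finV: "finite (V e)" for e unfolding V_def by (rule finite_subset[OF _ finite_int_box']) auto
      have finZ: "finite (Z i)" for i unfolding Z_def by (rule finite_subset[OF _ finite_int_box']) auto
      have nu: "\<not> is_unit (int ?p)" using p1 by simp
      have "X \<subseteq> (\<Union>i\<in>UNIV. Z i) \<union> (\<Union>e\<in>E. V e)"
      proof
        fix x assume x: "x \<in> X"
        show "x \<in> (\<Union>i\<in>UNIV. Z i) \<union> (\<Union>e\<in>E. V e)"
        proof (cases "\<exists>i. x $ i = 0")
          case True
          then show ?thesis using x by (auto simp: X_def Z_def)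
        next
          case False
          let ?e = "\<chi> i. multiplicity (int ?p) (x $ i)"
          have "multiplicity (int ?p) (x $ i) < L" for i
          proof (rule ccontr)
            assume "\<not> multiplicity (int ?p) (x $ i) < L"
            then have "int ?p ^ L dvd x $ i" by (intro multiplicity_dvd') simp
            moreover have "x $ i > 0"
            proof -
              have "x $ i \<ge> 0" using x by (auto simp: X_def int_box_def)
              then show ?thesis using False by (simp add: order_less_le)
            qed
            ultimately have "int ?p ^ L \<le> x $ i" by (rule zdvd_imp_le)
            moreover have "x $ i < int ?p ^ L" using x by (auto simp: X_def int_box_def)
            ultimately show False by simp
          qed
          then have "?e \<in> E" by (simp add: E_def)
          moreover have "x \<in> V ?e" using x False by (simp add: X_def V_def)
          ultimately show ?thesis by blast
        qed
      qed
      then have "card X \<le> card ((\<Union>i\<in>UNIV. Z i) \<union> (\<Union>e\<in>E. V e))"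
        using finE finV finZ by (intro card_mono) auto
      also have "\<dots> \<le> card (\<Union>i\<in>UNIV. Z i) + card (\<Union>e\<in>E. V e)" by (rule card_Un_le)
      also have "\<dots> \<le> (\<Sum>i\<in>UNIV. card (Z i)) + (\<Sum>e\<in>E. card (V e))"
        using finE by (intro add_mono card_UN_le) auto
      finally have "real (card X) \<le> real ((\<Sum>i\<in>UNIV. card (Z i)) + (\<Sum>e\<in>E. card (V e)))" by (simp only: of_nat_le_iff)
      then have cX: "real (card X) / real ?p ^ (L * CARD('n)) \<le>
          (\<Sum>i\<in>UNIV. real (card (Z i)) / real ?p ^ (L * CARD('n))) + (\<Sum>e\<in>E. real (card (V e)) / real ?p ^ (L * CARD('n)))"
        unfolding of_nat_add of_nat_sum sum_divide_distrib[symmetric] add_divide_distrib[symmetric]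
        by (rule divide_right_mono) simp
      have cZ: "real (card (Z i)) / real ?p ^ (L * CARD('n)) \<le> real ?p powr (- (real l / \<rho>))" for i
      proof -
        have "?p ^ L * card (Z i) \<le> (?p ^ L) ^ CARD('n)"
          unfolding Z_def by (rule card_zero_coordinate) (use p0 in simp)
        then have "real (?p ^ L * card (Z i)) \<le> real ((?p ^ L) ^ CARD('n))" by (simp only: of_nat_le_iff)
        then have "real ?p ^ L * real (card (Z i)) \<le> real ?p ^ (L * CARD('n))" by (simp add: power_mult)
        then have "real (card (Z i)) / real ?p ^ (L * CARD('n)) \<le> 1 / real ?p ^ L"
          using p0 by (simp add: field_simps)
        also have "\<dots> = real ?p powr (- real L)" using p1 by (simp add: powr_minus_divide powr_realpow)
        also have "\<dots> \<le> real ?p powr (- (real l / \<rho>))" using L(2) p1 by (intro powr_mono) auto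
        finally show ?thesis .
      qed
      have cV: "real (card (V e)) / real ?p ^ (L * CARD('n)) \<le> real (M + 1) * real ?p powr real (vec_sum k0) *
          real ?p powr (- real (vec_sum (k0 + e)) - \<gamma> (face_of_gens (\<A> (k0 + e))) * real (l - order_along (k0 + e)))"
        if e: "e \<in> E" for e
      proof -
        let ?k = "k0 + e"
        let ?g = "\<gamma> (face_of_gens (\<A> ?k))"
        let ?ev = "\<lambda>u. \<Sum>\<alpha>\<in>U. f \<alpha> * int ?p ^ dotn ?k \<alpha> * monomial_at u \<alpha>"
        have kM: "\<forall>i. ?k $ i > M" using k0M by (simp add: trans_less_add1)
        note AA = \<A>[THEN spec, THEN mp, OF kM]
        have "card (V e) * (\<Prod>i\<in>UNIV. ?p ^ (e $ i)) \<le>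
            card {u. (\<forall>i. u $ i \<in> {0..<int ?p ^ L}) \<and> (\<forall>i. \<not> int ?p dvd u $ i) \<and>
              int ?p ^ l dvd truncation ?p k0 U (\<chi> i. int ?p ^ (e $ i) * u $ i)}"
          unfolding V_def
        proof (rule card_stratum_le[OF pp])
          show "e $ i < L" for i using e by (simp add: E_def)
          fix x y :: "int ^ 'n" assume xy: "\<And>i. int ?p ^ L dvd x $ i - y $ i"
          have "int ?p ^ l dvd x $ i - y $ i" for i using xy[of i] L(1) by (rule power_le_dvd)
          then have "int ?p ^ l dvd truncation ?p k0 U x - truncation ?p k0 U y"
            unfolding truncation_def by (rule eval_diff_dvd)
          then show "int ?p ^ l dvd truncation ?p k0 U x \<longleftrightarrow> int ?p ^ l dvd truncation ?p k0 U y"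
            using dvd_add_right_iff[of "int ?p ^ l" "truncation ?p k0 U x - truncation ?p k0 U y" "truncation ?p k0 U y"] by simp
        qed
        also have "{u. (\<forall>i. u $ i \<in> {0..<int ?p ^ L}) \<and> (\<forall>i. \<not> int ?p dvd u $ i) \<and>
              int ?p ^ l dvd truncation ?p k0 U (\<chi> i. int ?p ^ (e $ i) * u $ i)} =
            {u \<in> unit_box TYPE('p) L. int ?p ^ l dvd ?ev u}"
        proof -
          have "truncation ?p k0 U (\<chi> i. int ?p ^ (e $ i) * u $ i) = ?ev u" for u
          proof -
            have "monomial_at (\<chi> i. int ?p ^ (e $ i) * u $ i) \<alpha> = int ?p ^ dotn e \<alpha> * monomial_at u \<alpha>" for \<alpha>
              using monomial_at_mult[of "\<chi> i. int ?p ^ (e $ i)" u \<alpha>] by (simp add: monomial_at_powers)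
            then show ?thesis by (simp add: truncation_def dotn_add_left power_add mult.assoc)
          qed
          then show ?thesis by (simp add: unit_box_def)
        qed
        finally have c1: "card (V e) * ?p ^ vec_sum e \<le> card {u \<in> unit_box TYPE('p) L. int ?p ^ l dvd ?ev u}"
          by (simp only: power_sum_vec)
        have c2: "real (card {u \<in> unit_box TYPE('p) L. int ?p ^ l dvd ?ev u}) \<le>
            real (M + 1) * (real ?p ^ (L * CARD('n)) * real ?p powr (- ?g * real (l - order_along ?k)))"
        proof (cases "order_along ?k \<le> l")
          case True
          have "real (card {u \<in> unit_box TYPE('p) L. int ?p ^ l dvd ?ev u}) \<le>
              real M * real ?p ^ (L * CARD('n)) * real ?p powr (- ?g * real (l - order_along ?k))"
            using AA[THEN conjunct2, THEN conjunct2, THEN spec, THEN spec, THEN spec, THEN mp, OF True, THEN mp, OF L(1), THEN mp, OF U(1), THEN mp, OF U(2)] .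
          also have "\<dots> \<le> real (M + 1) * (real ?p ^ (L * CARD('n)) * real ?p powr (- ?g * real (l - order_along ?k)))"
            unfolding mult.assoc by (intro mult_right_mono) auto
          finally show ?thesis .
        next
          \<comment> \<open>Truncated subtraction gives exponent 0 here, so the trivial bound
            suffices; M + 1 in place of M keeps the constant at least 1.\<close>
          case False
          have "card {u \<in> unit_box TYPE('p) L. int ?p ^ l dvd ?ev u} \<le> card (int_box (?p ^ L) :: (int ^ 'n) set)"
            by (rule card_mono[OF finite_int_box']) (auto simp: unit_box_def int_box_def)
          also have "\<dots> = ?p ^ (L * CARD('n))" by (simp add: power_mult)
          finally have "real (card {u \<in> unit_box TYPE('p) L. int ?p ^ l dvd ?ev u}) \<le> real (?p ^ (L * CARD('n)))"
            by (simp only: of_nat_le_iff)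
          also have "\<dots> \<le> real (M + 1) * (real ?p ^ (L * CARD('n)) * real ?p powr (- ?g * real (l - order_along ?k)))"
            using False p0 by simp
          finally show ?thesis .
        qed
        have "real (card (V e)) * real ?p powr real (vec_sum e) \<le>
            real (M + 1) * (real ?p ^ (L * CARD('n)) * real ?p powr (- ?g * real (l - order_along ?k)))"
        proof -
          have "real (card (V e) * ?p ^ vec_sum e) \<le> real (card {u \<in> unit_box TYPE('p) L. int ?p ^ l dvd ?ev u})"
            using c1 by (simp only: of_nat_le_iff)
          then show ?thesis using c2 p0 by (simp add: powr_realpow)
        qed
        then have "real (card (V e)) \<le> real (M + 1) * (real ?p ^ (L * CARD('n)) * real ?p powr (- ?g * real (l - order_along ?k))) * real ?p powr (- real (vec_sum e))"
          using p0 by (simp add: powr_minus field_simps)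
        also have "\<dots> = (real (M + 1) * (real ?p powr (- ?g * real (l - order_along ?k)) * real ?p powr (- real (vec_sum e)))) * real ?p ^ (L * CARD('n))"
          by (simp only: mult_ac)
        finally have "real (card (V e)) / real ?p ^ (L * CARD('n)) \<le>
            real (M + 1) * (real ?p powr (- ?g * real (l - order_along ?k)) * real ?p powr (- real (vec_sum e)))"
          using p0 by (simp add: pos_divide_le_eq)
        also have "real ?p powr (- ?g * real (l - order_along ?k)) * real ?p powr (- real (vec_sum e)) =
            real ?p powr real (vec_sum k0) * real ?p powr (- real (vec_sum ?k) - ?g * real (l - order_along ?k))"
          unfolding powr_add[symmetric]
          by (rule arg_cong[where f = "\<lambda>z. real ?p powr z"]) (simp add: vec_sum_def sum.distrib)
        finally show ?thesis by (simp only: mult.assoc)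
      qed
      have K: "finite ((\<lambda>e. k0 + e) ` E)" using finE by simp
      have H: "\<forall>k\<in>(\<lambda>e. k0 + e) ` E. facial (\<A> k) \<and> (\<forall>a\<in>\<A> k. dotn k a \<le> order_along k + M)"
      proof
        fix k assume "k \<in> (\<lambda>e. k0 + e) ` E"
        then obtain e where "k = k0 + e" by blast
        then have kM: "\<forall>i. k $ i > M" using k0M by (simp add: trans_less_add1)
        show "facial (\<A> k) \<and> (\<forall>a\<in>\<A> k. dotn k a \<le> order_along k + M)"
          using \<A>[THEN spec, THEN mp, OF kM] by blast
      qed
      have l1: "l \<ge> 1" using l by simp
      have "(\<Sum>e\<in>E. real ?p powr (- real (vec_sum (k0 + e)) - \<gamma> (face_of_gens (\<A> (k0 + e))) * real (l - order_along (k0 + e)))) =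
          (\<Sum>k\<in>(\<lambda>e. k0 + e) ` E. real ?p powr (- real (vec_sum k) - \<gamma> (face_of_gens (\<A> k)) * real (l - order_along k)))"
        by (subst sum.reindex) (auto simp: inj_on_def)
      also have "\<dots> \<le> C * real l ^ r * real ?p powr (- (real l / \<rho>))"
        using C(2)[THEN spec, THEN spec, THEN spec, THEN mp, OF K, THEN mp, OF l1, of \<A>, THEN mp, OF H] .
      finally have sumE: "(\<Sum>e\<in>E. real ?p powr (- real (vec_sum (k0 + e)) - \<gamma> (face_of_gens (\<A> (k0 + e))) * real (l - order_along (k0 + e))))
          \<le> C * real l ^ r * real ?p powr (- (real l / \<rho>))" .
      have "1 / real ?p ^ (l * CARD('n)) * real (card (solutions TYPE('p) f a l)) = real (card X) / real ?p ^ (L * CARD('n))"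
        unfolding X_def by (rule solutions_refine[OF ak k01 U(1) _ L(1)]) (auto simp: U_def)
      also have "\<dots> \<le> (\<Sum>i\<in>(UNIV :: 'n set). real ?p powr (- (real l / \<rho>))) +
          (\<Sum>e\<in>E. real (M + 1) * real ?p powr real (vec_sum k0) * real ?p powr (- real (vec_sum (k0 + e)) - \<gamma> (face_of_gens (\<A> (k0 + e))) * real (l - order_along (k0 + e))))"
        by (rule order_trans[OF cX], intro add_mono sum_mono cZ cV)
      also have "\<dots> = real CARD('n) * real ?p powr (- (real l / \<rho>)) +
          real (M + 1) * real ?p powr real (vec_sum k0) * (\<Sum>e\<in>E. real ?p powr (- real (vec_sum (k0 + e)) - \<gamma> (face_of_gens (\<A> (k0 + e))) * real (l - order_along (k0 + e))))"
        by (simp only: sum_constant sum_distrib_left)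
      also have "\<dots> \<le> real CARD('n) * (real l ^ r * real ?p powr (- (real l / \<rho>))) +
          real (M + 1) * real ?p powr real (vec_sum k0) * (C * real l ^ r * real ?p powr (- (real l / \<rho>)))"
      proof (rule add_mono)
        have "1 * real ?p powr (- (real l / \<rho>)) \<le> real l ^ r * real ?p powr (- (real l / \<rho>))"
          using l by (intro mult_right_mono one_le_power) auto
        then show "real CARD('n) * real ?p powr (- (real l / \<rho>)) \<le> real CARD('n) * (real l ^ r * real ?p powr (- (real l / \<rho>)))"
          by (intro mult_left_mono) auto
        show "real (M + 1) * real ?p powr real (vec_sum k0) * (\<Sum>e\<in>E. real ?p powr (- real (vec_sum (k0 + e)) - \<gamma> (face_of_gens (\<A> (k0 + e))) * real (l - order_along (k0 + e)))) \<le>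
          real (M + 1) * real ?p powr real (vec_sum k0) * (C * real l ^ r * real ?p powr (- (real l / \<rho>)))"
          using sumE by (rule mult_left_mono) simp
      qed
      also have "\<dots> = C' * real l ^ r * real ?p powr (- (real l / \<rho>))"
        unfolding C'_def distrib_right by (simp only: mult.assoc)
      finally show "1 / real ?p ^ (l * CARD('n)) * real (card (solutions TYPE('p) f a l)) \<le>
        C' * real l ^ r * real ?p powr (- (real l / \<rho>))" .
    qed
  qed
qed

text \<open>A \<open>SUP\<close> over natural numbers is meaningful only for bounded sets. A compact
  face contains support points only from \<open>S\<close>, so there are finitely many polynomials
  f_F and hence finitely many orders.\<close>

lemma bdd_above_face_orders: "bdd_above (face_order TYPE('p::prime_card) f ` compact_newton_faces f)"
proof -
  define G where "G g = (let Z = (torus_zeros g :: ('p padic ^ 'n) set)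
      in if Z = {} then 0 else Max (zero_order (padic_coeffs g) ` Z))" for g :: "nat ^ 'n \<Rightarrow> int"
  have "face_order TYPE('p) f F \<in> (\<lambda>A. G (\<lambda>\<alpha>. if \<alpha> \<in> A then f \<alpha> else 0)) ` Pow S" if F: "F \<in> compact_newton_faces f" for F
  proof -
    have face: "F face_of N" and comp: "compact F" using F by (auto simp: compact_newton_faces_def newton_face_def)
    have supp: "\<alpha> \<in> S" if \<alpha>: "f \<alpha> \<noteq> 0" "real_vec \<alpha> \<in> F" for \<alpha>
    proof -
      obtain s where s: "s \<in> S" "\<And>i. s $ i \<le> \<alpha> $ i" using gens_dominate[OF \<alpha>(1)] by blast
      define v where "v = real_vec \<alpha> - real_vec s"
      have sN: "real_vec s \<in> N" by (rule gens_in_N[OF s(1)])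
      \<comment> \<open>If a support point on the face differed from the generator s below it, the
        ray from s through it would stay in the face beyond it, against compactness.\<close>
      have inF: "real_vec \<alpha> + c *\<^sub>R v \<in> F" if c: "c > 0" for c
      proof -
        have zN: "real_vec \<alpha> + c *\<^sub>R v \<in> N"
        proof (rule support_in_N[OF \<alpha>(1)])
          fix i
          have "v $ i \<ge> 0" using s(2)[of i] by (simp add: v_def)
          then show "real (\<alpha> $ i) \<le> (real_vec \<alpha> + c *\<^sub>R v) $ i" using c by simp
        qed
        have "real_vec \<alpha> - c *\<^sub>R (real_vec s - real_vec \<alpha>) \<in> N" using zN by (simp add: v_def algebra_simps)
        moreover have "real_vec \<alpha> - (1 / c) *\<^sub>R ((real_vec \<alpha> + c *\<^sub>R v) - real_vec \<alpha>) = real_vec s"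
          using c by (simp add: v_def)
        ultimately have "real_vec \<alpha> + c *\<^sub>R v \<in> minface N (real_vec \<alpha>)"
          unfolding minface_def using zN sN c by (intro CollectI conjI exI[of _ "1 / c"]) auto
        then show ?thesis using minface_subset_face[OF face \<alpha>(2)] by blast
      qed
      obtain b where b: "\<And>x. x \<in> F \<Longrightarrow> norm x \<le> b" using compact_imp_bounded[OF comp] by (auto simp: bounded_iff)
      have "v = 0"
      proof (rule ccontr)
        assume "v \<noteq> 0"
        then have nv: "norm v > 0" by simp
        define c where "c = (b + norm (real_vec \<alpha>) + 1) / norm v"
        have b0: "b \<ge> 0" using b[OF \<alpha>(2)] norm_ge_zero[of "real_vec \<alpha>"] by linarith
        have c: "c > 0" using nv b0 by (simp add: c_def add_nonneg_pos)
        have "norm (c *\<^sub>R v) \<le> norm (real_vec \<alpha> + c *\<^sub>R v) + norm (real_vec \<alpha>)"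
          using norm_triangle_ineq4[of "real_vec \<alpha> + c *\<^sub>R v" "real_vec \<alpha>"] by simp
        also have "\<dots> \<le> b + norm (real_vec \<alpha>)" using b[OF inF[OF c]] by simp
        finally have "c * norm v \<le> b + norm (real_vec \<alpha>)" using c by simp
        then show False using nv by (simp add: c_def)
      qed
      then have "real_vec \<alpha> $ i = real_vec s $ i" for i by (simp add: v_def)
      then have "\<alpha> $ i = s $ i" for i by simp
      then have "\<alpha> = s" by (simp add: vec_eq_iff)
      then show ?thesis using s(1) by simp
    qed
    define A where "A = {\<alpha>. f \<alpha> \<noteq> 0 \<and> real_vec \<alpha> \<in> F}"
    have "A \<subseteq> S" using supp by (auto simp: A_def)
    moreover have "face_part f F = (\<lambda>\<alpha>. if \<alpha> \<in> A then f \<alpha> else 0)"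
      by (rule ext) (simp add: face_part_def A_def real_vec_def)
    then have "face_order TYPE('p) f F = G (\<lambda>\<alpha>. if \<alpha> \<in> A then f \<alpha> else 0)"
      by (simp only: face_order_def G_def)
    ultimately show ?thesis by blast
  qed
  then have "face_order TYPE('p) f ` compact_newton_faces f \<subseteq> (\<lambda>A. G (\<lambda>\<alpha>. if \<alpha> \<in> A then f \<alpha> else 0)) ` Pow S" by blast
  moreover have "finite ((\<lambda>A. G (\<lambda>\<alpha>. if \<alpha> \<in> A then f \<alpha> else 0)) ` Pow S)" using finite_gens by simp
  ultimately have "finite (face_order TYPE('p) f ` compact_newton_faces f)" by (rule finite_subset)
  then show ?thesis by (rule bdd_above_finite)
qed

section \<open>The three upper bounds\<close>

lemma face_of_gens_subset:
  assumes A: "facial A" and F: "F face_of N" and sub: "\<And>\<alpha>. \<alpha> \<in> A \<Longrightarrow> real_vec \<alpha> \<in> F"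
  shows "face_of_gens A \<subseteq> F"
proof -
  have fin: "finite A" and ne: "A \<noteq> {}" using A finite_gens finite_subset by (auto simp: facial_def)
  have n: "real (card A) > 0" using fin ne by (simp add: card_gt_0_iff)
  have "(\<Sum>a\<in>A. (1 / real (card A)) *\<^sub>R real_vec a) \<in> F"
    by (rule convex_sum[OF fin face_of_imp_convex[OF F]]) (use n sub in auto)
  then have "barycenter A \<in> F" by (simp add: barycenter_def scaleR_sum_right)
  then show ?thesis unfolding face_of_gens_def by (rule minface_subset_face[OF F])
qed

text \<open>Vectors k are split by the face assigned to them. Inside the central face the rate
  exceeds 1 / d and \<open>weight_sum_steep\<close> applies. Otherwise some active generator lies
  off the central face and \<open>weight_sum_off_center\<close> applies, once for each of the
  finitely many such generators.\<close>

lemma upper_small_orders: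
  fixes F\<^sub>0 :: "(real ^ 'n) set"
  assumes F0: "central_face f F\<^sub>0"
    and le: "\<forall>F\<in>compact_newton_faces f. real (face_order TYPE('p::prime_card) f F) \<le> dist\<^sub>N"
    and less: "\<forall>F\<in>compact_newton_faces f. F \<subseteq> F\<^sub>0 \<longrightarrow> real (face_order TYPE('p) f F) < dist\<^sub>N"
  shows "\<exists>M::nat. \<forall>a :: int ^ 'n. (\<forall>i. a $ i > int M) \<longrightarrow> (\<exists>C>0. \<forall>l::nat. l > 0 \<longrightarrow>
    1 / real CARD('p) ^ (l * CARD('n)) * real (card (solutions TYPE('p) f a l)) \<le>
      C * real l ^ (CARD('n) - dim central_directions - 1) * real CARD('p) powr (- (real l / dist\<^sub>N)))"
proof -
  let ?d = "dist\<^sub>N" and ?q = "real CARD('p)" and ?r = "CARD('n) - dim central_directions - 1"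
  have d: "?d > 0" by (rule newton_distance_pos)
  have q: "?q > 1" by (rule card_prime_gt_1)
  have F0eq: "F\<^sub>0 = minface N diag_pt" by (rule central_face_eq[OF F0])
  have face0: "F\<^sub>0 face_of N" unfolding F0eq by (rule minface_face_of[OF convex_N diag_pt_in_N])
  \<comment> \<open>Orders are integers, so those below d are at most the ceiling of d minus 1,
    which is strictly below d; d / 2 keeps b positive when that number is 0.\<close>
  define b where "b = max (?d / 2) (real (nat (\<lceil>?d\<rceil> - 1)))"
  have b: "b > 0" "b < ?d" using d by (auto simp: b_def) linarith
  have ord_b: "real m \<le> b" if "real m < ?d" for m
  proof -
    have "int m < \<lceil>?d\<rceil>" using that by linarith
    then have "m \<le> nat (\<lceil>?d\<rceil> - 1)" by linarith
    then show ?thesis by (simp add: b_def)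
  qed
  define \<gamma> where "\<gamma> F = (if F \<subseteq> F\<^sub>0 then 1 / b else 1 / ?d)" for F
  have "admissible_rate TYPE('p) \<gamma>"
    unfolding admissible_rate_def
  proof (intro ballI conjI)
    fix F assume F: "F \<in> compact_newton_faces f"
    show "0 \<le> \<gamma> F" using b d by (simp add: \<gamma>_def)
    show "\<gamma> F * real (face_order TYPE('p) f F) \<le> 1"
    proof (cases "F \<subseteq> F\<^sub>0")
      case True
      then have "real (face_order TYPE('p) f F) \<le> b" using less F by (intro ord_b) blast
      then show ?thesis using True b by (simp add: \<gamma>_def)
    next
      case False
      have "real (face_order TYPE('p) f F) \<le> ?d" using le F by blast
      then show ?thesis using False d by (simp add: \<gamma>_def)
    qed
  qed
  moreover have "\<exists>C>0. \<forall>\<A> K (l::nat). finite K \<longrightarrow> l \<ge> 1 \<longrightarrow>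
      (\<forall>k\<in>K. facial (\<A> k) \<and> (\<forall>a\<in>\<A> k. dotn k a \<le> order_along k + M)) \<longrightarrow>
      (\<Sum>k\<in>K. ?q powr (- real (vec_sum k) - \<gamma> (face_of_gens (\<A> k)) * real (l - order_along k))) \<le>
        C * real l ^ ?r * ?q powr (- (real l / ?d))" for M :: nat
  proof -
    have "1 / b > 1 / ?d" using b by (simp add: frac_less2)
    from weight_sum_steep[OF q this] obtain C1 where C1: "C1 > 0" "\<forall>K (l::nat). finite K \<longrightarrow> l \<ge> 1 \<longrightarrow>
      (\<Sum>k\<in>K. ?q powr (- real (vec_sum k) - 1 / b * real (l - order_along k))) \<le> C1 * real l ^ ?r * ?q powr (- (real l / ?d))"
      by (elim exE conjE)
    define S' where "S' = {\<alpha>\<in>S. real_vec \<alpha> \<notin> F\<^sub>0}"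
    have finS': "finite S'" using finite_gens by (simp add: S'_def)
    have "\<forall>\<alpha>\<in>S'. \<exists>C. C > 0 \<and> (\<forall>K (l::nat). finite K \<longrightarrow> l \<ge> 1 \<longrightarrow> (\<forall>k\<in>K. order_along k \<le> dotn k \<alpha> \<and> dotn k \<alpha> \<le> order_along k + M) \<longrightarrow>
      (\<Sum>k\<in>K. ?q powr (- real (vec_sum k) - 1 / ?d * real (l - order_along k))) \<le> C * real l ^ ?r * ?q powr (- (real l / ?d)))"
    proof
      fix \<alpha> assume \<alpha>: "\<alpha> \<in> S'"
      then have "real_vec \<alpha> - diag_pt \<notin> central_directions"
        using gens_in_N by (auto simp: S'_def F0eq minface_eq_central_directions)
      from weight_sum_off_center[OF q order_refl this]
      show "\<exists>C. C > 0 \<and> (\<forall>K (l::nat). finite K \<longrightarrow> l \<ge> 1 \<longrightarrow> (\<forall>k\<in>K. order_along k \<le> dotn k \<alpha> \<and> dotn k \<alpha> \<le> order_along k + M) \<longrightarrow>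
        (\<Sum>k\<in>K. ?q powr (- real (vec_sum k) - 1 / ?d * real (l - order_along k))) \<le> C * real l ^ ?r * ?q powr (- (real l / ?d)))" .
    qed
    from bchoice[OF this] obtain C2 where C2: "\<forall>\<alpha>\<in>S'. C2 \<alpha> > 0 \<and> (\<forall>K (l::nat). finite K \<longrightarrow> l \<ge> 1 \<longrightarrow> (\<forall>k\<in>K. order_along k \<le> dotn k \<alpha> \<and> dotn k \<alpha> \<le> order_along k + M) \<longrightarrow>
      (\<Sum>k\<in>K. ?q powr (- real (vec_sum k) - 1 / ?d * real (l - order_along k))) \<le> C2 \<alpha> * real l ^ ?r * ?q powr (- (real l / ?d)))" ..
    define C where "C = C1 + (\<Sum>\<alpha>\<in>S'. C2 \<alpha>)"
    have "C > 0" unfolding C_def using C1(1) C2 by (intro add_pos_nonneg sum_nonneg) (auto intro: less_imp_le)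
    show ?thesis
    proof (intro exI[of _ C] conjI allI impI \<open>C > 0\<close>)
      fix \<A> and K :: "(nat ^ 'n) set" and l :: nat assume K: "finite K" and l: "l \<ge> 1"
        and H: "\<forall>k\<in>K. facial (\<A> k) \<and> (\<forall>a\<in>\<A> k. dotn k a \<le> order_along k + M)"
      define K1 where "K1 = {k\<in>K. face_of_gens (\<A> k) \<subseteq> F\<^sub>0}"
      define K2 where "K2 \<alpha> = {k\<in>K. \<alpha> \<in> \<A> k}" for \<alpha>
      let ?w = "\<lambda>g k. ?q powr (- real (vec_sum k) - g * real (l - order_along k))"
      let ?B = "real l ^ ?r * ?q powr (- (real l / ?d))"
      have "(\<Sum>k\<in>K. ?w (\<gamma> (face_of_gens (\<A> k))) k) = (\<Sum>k\<in>K1. ?w (\<gamma> (face_of_gens (\<A> k))) k) + (\<Sum>k\<in>K - K1. ?w (\<gamma> (face_of_gens (\<A> k))) k)"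
        by (subst sum.subset_diff[of K1 K]) (use K in \<open>auto simp: K1_def\<close>)
      also have "(\<Sum>k\<in>K1. ?w (\<gamma> (face_of_gens (\<A> k))) k) = (\<Sum>k\<in>K1. ?w (1 / b) k)"
        by (rule sum.cong) (auto simp: K1_def \<gamma>_def)
      also have "\<dots> \<le> C1 * real l ^ ?r * ?q powr (- (real l / ?d))"
      proof -
        have "finite K1" using K by (simp add: K1_def)
        from C1(2)[THEN spec, THEN spec, THEN mp, OF this, THEN mp, OF l] show ?thesis .
      qed
      also have "(\<Sum>k\<in>K - K1. ?w (\<gamma> (face_of_gens (\<A> k))) k) = (\<Sum>k\<in>K - K1. ?w (1 / ?d) k)"
        by (rule sum.cong) (auto simp: K1_def \<gamma>_def)
      \<comment> \<open>A vector k with several active generators off the central face is counted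
        once for each, which only enlarges the sum.\<close>
      also have "\<dots> \<le> (\<Sum>z\<in>(SIGMA \<alpha> : S'. K2 \<alpha>). ?w (1 / ?d) (snd z))"
      proof (rule sum_le_included[where i = snd])
        show "finite (K - K1)" using K by simp
        show "finite (SIGMA \<alpha> : S'. K2 \<alpha>)" using finS' K by (simp add: K2_def)
        show "\<forall>k\<in>K - K1. \<exists>z\<in>(SIGMA \<alpha> : S'. K2 \<alpha>). snd z = k \<and> ?w (1 / ?d) k \<le> ?w (1 / ?d) (snd z)"
        proof
          fix k assume k: "k \<in> K - K1"
          then have kK: "k \<in> K" and nsub: "\<not> face_of_gens (\<A> k) \<subseteq> F\<^sub>0" by (auto simp: K1_def)
          have fac: "facial (\<A> k)" using H kK by blast
          have "\<exists>\<alpha>\<in>\<A> k. real_vec \<alpha> \<notin> F\<^sub>0" using face_of_gens_subset[OF fac face0] nsub by blast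
          then obtain \<alpha> where \<alpha>: "\<alpha> \<in> \<A> k" "real_vec \<alpha> \<notin> F\<^sub>0" ..
          have "\<alpha> \<in> S'" using \<alpha> fac by (auto simp: S'_def facial_def)
          then have "(\<alpha>, k) \<in> (SIGMA \<alpha> : S'. K2 \<alpha>)" using \<alpha>(1) kK by (auto simp: K2_def)
          then show "\<exists>z\<in>(SIGMA \<alpha> : S'. K2 \<alpha>). snd z = k \<and> ?w (1 / ?d) k \<le> ?w (1 / ?d) (snd z)"
            by (rule rev_bexI) simp
        qed
      qed simp
      also have "\<dots> = (\<Sum>\<alpha>\<in>S'. \<Sum>k\<in>K2 \<alpha>. ?w (1 / ?d) k)"
        using sum.Sigma[of S' K2 "\<lambda>_ k. ?w (1 / ?d) k"] finS' K by (simp add: K2_def case_prod_unfold)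
      also have "\<dots> \<le> (\<Sum>\<alpha>\<in>S'. C2 \<alpha> * real l ^ ?r * ?q powr (- (real l / ?d)))"
      proof (rule sum_mono)
        fix \<alpha> assume \<alpha>: "\<alpha> \<in> S'"
        have fK2: "finite (K2 \<alpha>)" using K by (simp add: K2_def)
        have near: "\<forall>k\<in>K2 \<alpha>. order_along k \<le> dotn k \<alpha> \<and> dotn k \<alpha> \<le> order_along k + M"
          using H \<alpha> order_along_le by (auto simp: K2_def S'_def)
        show "(\<Sum>k\<in>K2 \<alpha>. ?w (1 / ?d) k) \<le> C2 \<alpha> * real l ^ ?r * ?q powr (- (real l / ?d))"
          using bspec[OF C2 \<alpha>, THEN conjunct2, THEN spec, THEN spec, THEN mp, OF fK2, THEN mp, OF l, THEN mp, OF near] .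
      qed
      also have "C1 * real l ^ ?r * ?q powr (- (real l / ?d)) + (\<Sum>\<alpha>\<in>S'. C2 \<alpha> * real l ^ ?r * ?q powr (- (real l / ?d))) =
          C * real l ^ ?r * ?q powr (- (real l / ?d))"
        by (simp add: C_def sum_distrib_right distrib_right)
      finally show "(\<Sum>k\<in>K. ?w (\<gamma> (face_of_gens (\<A> k))) k) \<le> C * real l ^ ?r * ?q powr (- (real l / ?d))"
        by simp
    qed
  qed
  ultimately show ?thesis by (rule density_upper[OF _ d])
qed

text \<open>The constant rate 1 / d is admissible. Without a steeper rate on the central face m(k)
  is not pinned to l, whence the additional power of l.\<close>

lemma upper_equal_orders:
  assumes le: "\<forall>F\<in>compact_newton_faces f. real (face_order TYPE('p::prime_card) f F) \<le> dist\<^sub>N"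
  shows "\<exists>M::nat. \<forall>a :: int ^ 'n. (\<forall>i. a $ i > int M) \<longrightarrow> (\<exists>C>0. \<forall>l::nat. l > 0 \<longrightarrow>
    1 / real CARD('p) ^ (l * CARD('n)) * real (card (solutions TYPE('p) f a l)) \<le>
      C * real l ^ (CARD('n) - dim central_directions) * real CARD('p) powr (- (real l / dist\<^sub>N)))"
proof -
  have d: "dist\<^sub>N > 0" by (rule newton_distance_pos)
  have "admissible_rate TYPE('p) (\<lambda>_. 1 / dist\<^sub>N)"
    unfolding admissible_rate_def using d le by simp
  then show ?thesis
  proof (rule density_upper[OF _ d])
    fix M :: nat
    from weight_sum_central[OF card_prime_gt_1[where 'p = 'p] order_refl]
    obtain C where C: "C > 0" "\<forall>K (l::nat). finite K \<longrightarrow> l \<ge> 1 \<longrightarrow>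
      (\<Sum>k\<in>K. real CARD('p) powr (- real (vec_sum k) - 1 / dist\<^sub>N * real (l - order_along k))) \<le>
        C * real l ^ (CARD('n) - dim central_directions) * real CARD('p) powr (- (real l / dist\<^sub>N))"
      by (elim exE conjE)
    show "\<exists>C>0. \<forall>\<A> K (l::nat). finite K \<longrightarrow> l \<ge> 1 \<longrightarrow>
      (\<forall>k\<in>K. facial (\<A> k) \<and> (\<forall>a\<in>\<A> k. dotn k a \<le> order_along k + M)) \<longrightarrow>
      (\<Sum>k\<in>K. real CARD('p) powr (- real (vec_sum k) - 1 / dist\<^sub>N * real (l - order_along k))) \<le>
        C * real l ^ (CARD('n) - dim central_directions) * real CARD('p) powr (- (real l / dist\<^sub>N))"
      using C(2) by (intro exI[of _ C] conjI C(1) allI impI) (elim allE impE, assumption+)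
  qed
qed

lemma upper_large_order:
  assumes s: "s > dist\<^sub>N" "\<forall>F\<in>compact_newton_faces f. real (face_order TYPE('p::prime_card) f F) \<le> s"
  shows "\<exists>M::nat. \<forall>a :: int ^ 'n. (\<forall>i. a $ i > int M) \<longrightarrow> (\<exists>C>0. \<forall>l::nat. l > 0 \<longrightarrow>
    1 / real CARD('p) ^ (l * CARD('n)) * real (card (solutions TYPE('p) f a l)) \<le>
      C * real CARD('p) powr (- (real l / s)))"
proof -
  have s0: "s > 0" using s(1) newton_distance_pos by linarith
  have "admissible_rate TYPE('p) (\<lambda>_. 1 / s)"
    unfolding admissible_rate_def using s0 s(2) by simp
  then have "\<exists>M::nat. \<forall>a :: int ^ 'n. (\<forall>i. a $ i > int M) \<longrightarrow> (\<exists>C>0. \<forall>l::nat. l > 0 \<longrightarrow>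
    1 / real CARD('p) ^ (l * CARD('n)) * real (card (solutions TYPE('p) f a l)) \<le>
      C * real l ^ 0 * real CARD('p) powr (- (real l / s)))"
  proof (rule density_upper[OF _ s0])
    fix M :: nat
    from weight_sum_shallow[OF card_prime_gt_1[where 'p = 'p] s(1)]
    obtain C where C: "C > 0" "\<forall>K (l::nat). finite K \<longrightarrow> l \<ge> 1 \<longrightarrow>
      (\<Sum>k\<in>K. real CARD('p) powr (- real (vec_sum k) - 1 / s * real (l - order_along k))) \<le> C * real CARD('p) powr (- (real l / s))"
      by (elim exE conjE)
    show "\<exists>C>0. \<forall>\<A> K (l::nat). finite K \<longrightarrow> l \<ge> 1 \<longrightarrow>
      (\<forall>k\<in>K. facial (\<A> k) \<and> (\<forall>a\<in>\<A> k. dotn k a \<le> order_along k + M)) \<longrightarrow>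
      (\<Sum>k\<in>K. real CARD('p) powr (- real (vec_sum k) - 1 / s * real (l - order_along k))) \<le>
        C * real l ^ 0 * real CARD('p) powr (- (real l / s))"
      unfolding power_0 mult_1_right
      using C(2) by (intro exI[of _ C] conjI C(1) allI impI) (elim allE impE, assumption+)
  qed
  then show ?thesis by (simp only: power_0 mult_1_right)
qed

end

theorem theorem1p3:
  fixes p :: nat and f :: "nat ^ 'n \<Rightarrow> int" and F\<^sub>0 :: "(real ^ 'n) set" and h :: int
  assumes "p = CARD('p::prime_card)"
    and "\<exists>\<alpha>. f \<alpha> \<noteq> 0"
    and "converges_near_0 (padic_coeffs f :: nat ^ 'n \<Rightarrow> 'p padic)"
    and "series_at (padic_coeffs f :: nat ^ 'n \<Rightarrow> 'p padic) 0 = 0"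
    and "central_face f F\<^sub>0"
    and "h = aff_dim F\<^sub>0"
  shows "\<exists>M::real. M > 0 \<and> (\<forall>a :: int ^ 'n. (\<forall>i. real_of_int (a $ i) > M) \<longrightarrow>
    (\<exists>C C' :: real. C > 0 \<and> C' > 0 \<and> (\<forall>l::nat. l > 0 \<longrightarrow>
      (let n = int CARD('n);
           d = newton_distance f;
           faces = compact_newton_faces f;
           ord = face_order TYPE('p) f;
           s = (SUP F\<in>faces. ord F);
           density = 1 / real p ^ (l * CARD('n)) * real (card (solutions TYPE('p) f a l));
           lower = C * real l powi (n - h - 1) * real p powr (- (real l / d))
       in
         ((\<forall>F\<in>faces. real (ord F) \<le> d) \<and> (\<forall>F\<in>faces. F \<subseteq> F\<^sub>0 \<longrightarrow> real (ord F) < d) \<longrightarrow>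
            lower \<le> density \<and>
            density \<le> C' * real l powi (n - h - 1) * real p powr (- (real l / d))) \<and>
         ((\<forall>F\<in>faces. real (ord F) \<le> d) \<and> (\<exists>F\<in>faces. F \<subseteq> F\<^sub>0 \<and> real (ord F) = d) \<longrightarrow>
            lower \<le> density \<and>
            density \<le> C' * real l powi (n - h) * real p powr (- (real l / d))) \<and>
         ((\<exists>F\<in>faces. real (ord F) > d) \<longrightarrow>
            lower \<le> density \<and>
            density \<le> C' * real p powr (- (real l / real s)))))))"
proof -
  obtain S where S: "finite S" "S \<subseteq> {\<alpha>. f \<alpha> \<noteq> 0}" "\<forall>x\<in>{\<alpha>. f \<alpha> \<noteq> 0}. \<exists>s\<in>S. \<forall>i. s $ i \<le> x $ i"
    using finite_dominating_subset[of "{\<alpha>. f \<alpha> \<noteq> 0}"] by (elim exE conjE)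
  \<comment> \<open>At the origin only the monomial with exponent 0 survives, so f(0) = 0 says that
    this coefficient vanishes.\<close>
  have f0: "f 0 = 0"
  proof -
    have m0: "monomial_at 0 \<alpha> = (0 :: 'p padic)" if "\<alpha> \<noteq> (0 :: nat ^ 'n)" for \<alpha>
    proof -
      have "\<exists>i. \<alpha> $ i \<noteq> 0" using that unfolding vec_eq_iff by simp
      then obtain i where "\<alpha> $ i \<noteq> 0" ..
      then show ?thesis unfolding monomial_at_def by (intro prod_zero) (auto intro: exI[of _ i])
    qed
    have "series_at (padic_coeffs f :: nat ^ 'n \<Rightarrow> 'p padic) 0 = infsum (\<lambda>\<alpha>. padic_coeffs f \<alpha> * monomial_at 0 \<alpha>) {0}"
      unfolding series_at_def by (rule infsum_cong_neutral) (simp_all add: m0)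
    also have "\<dots> = padic_coeffs f 0" by (simp add: monomial_at_def)
    finally show ?thesis using assms(4) by (simp add: padic_coeffs_def)
  qed
  interpret newton_series f S
  proof
    show "finite S" by (rule S(1))
    show "S \<noteq> {}" using S(3) assms(2) by blast
    show "f s \<noteq> 0" if "s \<in> S" for s using S(2) that by blast
    show "\<exists>s\<in>S. \<forall>i. s $ i \<le> \<alpha> $ i" if "f \<alpha> \<noteq> 0" for \<alpha> using S(3) that by simp
    show "0 \<notin> S" using S(2) f0 by blast
  qed
  let ?d = "newton_distance f" and ?faces = "compact_newton_faces f" and ?ord = "face_order TYPE('p) f"
  let ?\<delta> = "dim central_directions"
  let ?dens = "\<lambda>a l. 1 / real p ^ (l * CARD('n)) * real (card (solutions TYPE('p) f a l))"
  let ?s = "SUP F\<in>?faces. ?ord F"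
  define HA where "HA \<longleftrightarrow> (\<forall>F\<in>?faces. real (?ord F) \<le> ?d) \<and> (\<forall>F\<in>?faces. F \<subseteq> F\<^sub>0 \<longrightarrow> real (?ord F) < ?d)"
  define HB where "HB \<longleftrightarrow> (\<forall>F\<in>?faces. real (?ord F) \<le> ?d) \<and> (\<exists>F\<in>?faces. F \<subseteq> F\<^sub>0 \<and> real (?ord F) = ?d)"
  define HC where "HC \<longleftrightarrow> (\<exists>F\<in>?faces. real (?ord F) > ?d)"
  have h: "h = int ?\<delta>" using assms(6) central_face_eq[OF assms(5)] aff_dim_minface_diag by simp
  \<comment> \<open>The central face has dimension less than n, so the integer exponents agree with
    truncated natural subtraction.\<close>
  have e1: "int CARD('n) - h - 1 = int (CARD('n) - ?\<delta> - 1)" and e0: "int CARD('n) - h = int (CARD('n) - ?\<delta>)"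
    using dim_central_directions_less unfolding h by linarith+
  \<comment> \<open>The case hypothesis is placed behind the quantifiers for M and C; where it fails
    any constants do. Thus one M and one pair of constants can serve all cases.\<close>
  have uA: "\<exists>M::nat. \<forall>a :: int ^ 'n. (\<forall>i. a $ i > int M) \<longrightarrow> (\<exists>C>0. \<forall>l::nat. l > 0 \<longrightarrow> HA \<longrightarrow>
      ?dens a l \<le> C * real l powi (int CARD('n) - h - 1) * real p powr (- (real l / ?d)))"
  proof (cases HA)
    case True
    from upper_small_orders[where 'p = 'p, OF assms(5) conjunct1[OF True[unfolded HA_def]] conjunct2[OF True[unfolded HA_def]]]
    show ?thesis unfolding e1 power_int_of_nat assms(1) by (simp only: True simp_thms)
  next
    case False
    then show ?thesis by (intro exI[of _ "0 :: nat"] exI[of _ "1 :: real"] allI impI conjI) simp_all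
  qed
  have uB: "\<exists>M::nat. \<forall>a :: int ^ 'n. (\<forall>i. a $ i > int M) \<longrightarrow> (\<exists>C>0. \<forall>l::nat. l > 0 \<longrightarrow> HB \<longrightarrow>
      ?dens a l \<le> C * real l powi (int CARD('n) - h) * real p powr (- (real l / ?d)))"
  proof (cases HB)
    case True
    from upper_equal_orders[where 'p = 'p, OF conjunct1[OF True[unfolded HB_def]]]
    show ?thesis unfolding e0 power_int_of_nat assms(1) by (simp only: True simp_thms)
  next
    case False
    then show ?thesis by (intro exI[of _ "0 :: nat"] exI[of _ "1 :: real"] allI impI conjI) simp_all
  qed
  have uC: "\<exists>M::nat. \<forall>a :: int ^ 'n. (\<forall>i. a $ i > int M) \<longrightarrow> (\<exists>C>0. \<forall>l::nat. l > 0 \<longrightarrow> HC \<longrightarrow>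
      ?dens a l \<le> C * real p powr (- (real l / real ?s)))"
  proof (cases HC)
    case True
    have ord_s: "real (?ord F) \<le> real ?s" if "F \<in> ?faces" for F
      using cSUP_upper[OF that bdd_above_face_orders[where 'p = 'p]] by (simp only: of_nat_le_iff)
    obtain F where F: "F \<in> ?faces" "real (?ord F) > ?d" using True unfolding HC_def ..
    have "real ?s > ?d" using ord_s[OF F(1)] F(2) by linarith
    moreover have "\<forall>F\<in>?faces. real (?ord F) \<le> real ?s" using ord_s by blast
    ultimately have "\<exists>M::nat. \<forall>a :: int ^ 'n. (\<forall>i. a $ i > int M) \<longrightarrow> (\<exists>C>0. \<forall>l::nat. l > 0 \<longrightarrow>
        1 / real CARD('p) ^ (l * CARD('n)) * real (card (solutions TYPE('p) f a l)) \<le>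
        C * real CARD('p) powr (- (real l / real ?s)))"
      by (rule upper_large_order)
    then show ?thesis unfolding assms(1) by (simp only: True simp_thms)
  next
    case False
    then show ?thesis by (intro exI[of _ "0 :: nat"] exI[of _ "1 :: real"] allI impI conjI) simp_all
  qed
  obtain MA :: nat where MA: "\<forall>a :: int ^ 'n. (\<forall>i. a $ i > int MA) \<longrightarrow> (\<exists>C>0. \<forall>l::nat. l > 0 \<longrightarrow> HA \<longrightarrow>
      ?dens a l \<le> C * real l powi (int CARD('n) - h - 1) * real p powr (- (real l / ?d)))" using uA ..
  obtain MB :: nat where MB: "\<forall>a :: int ^ 'n. (\<forall>i. a $ i > int MB) \<longrightarrow> (\<exists>C>0. \<forall>l::nat. l > 0 \<longrightarrow> HB \<longrightarrow>
      ?dens a l \<le> C * real l powi (int CARD('n) - h) * real p powr (- (real l / ?d)))" using uB ..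
  obtain MC :: nat where MC: "\<forall>a :: int ^ 'n. (\<forall>i. a $ i > int MC) \<longrightarrow> (\<exists>C>0. \<forall>l::nat. l > 0 \<longrightarrow> HC \<longrightarrow>
      ?dens a l \<le> C * real p powr (- (real l / real ?s)))" using uC ..
  define M where "M = real (MA + MB + MC + 1)"
  have "M > 0" by (simp add: M_def)
  then show ?thesis
    unfolding Let_def HA_def[symmetric] HB_def[symmetric] HC_def[symmetric]
  proof (intro exI[of _ M] conjI, assumption, intro allI impI)
    fix a :: "int ^ 'n" assume a: "\<forall>i. real_of_int (a $ i) > M"
    have ai: "a $ i > int (MA + MB + MC + 1)" for i
    proof -
      have "real_of_int (a $ i) > real (MA + MB + MC + 1)" using a unfolding M_def by blast
      then show ?thesis by linarith
    qed
    have aA: "\<forall>i. a $ i > int MA" and aB: "\<forall>i. a $ i > int MB" and aC: "\<forall>i. a $ i > int MC"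
      using ai by (force intro: le_less_trans[OF _ ai])+
    have a1: "a $ i \<ge> 1" for i
      using ai[of i] by linarith
    obtain CA where CA: "CA > 0" "\<forall>l::nat. l > 0 \<longrightarrow> HA \<longrightarrow>
      ?dens a l \<le> CA * real l powi (int CARD('n) - h - 1) * real p powr (- (real l / ?d))"
      using MA[THEN spec, THEN mp, OF aA] by (elim exE conjE)
    obtain CB where CB: "CB > 0" "\<forall>l::nat. l > 0 \<longrightarrow> HB \<longrightarrow>
      ?dens a l \<le> CB * real l powi (int CARD('n) - h) * real p powr (- (real l / ?d))"
      using MB[THEN spec, THEN mp, OF aB] by (elim exE conjE)
    obtain CC where CC: "CC > 0" "\<forall>l::nat. l > 0 \<longrightarrow> HC \<longrightarrow>
      ?dens a l \<le> CC * real p powr (- (real l / real ?s))"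
      using MC[THEN spec, THEN mp, OF aC] by (elim exE conjE)
    obtain C where C: "C > 0" "\<forall>l::nat. l > 0 \<longrightarrow> C * real l ^ (CARD('n) - ?\<delta> - 1) * real CARD('p) powr (- (real l / ?d)) \<le>
      1 / real CARD('p) ^ (l * CARD('n)) * real (card (solutions TYPE('p) f a l))"
      using density_lower[where 'p = 'p and a = a, OF a1] by (elim exE conjE)
    have lower: "C * real l powi (int CARD('n) - h - 1) * real p powr (- (real l / ?d)) \<le> ?dens a l" if "l > 0" for l
      unfolding e1 power_int_of_nat assms(1) using C(2) that by blast
    define C' where "C' = CA + CB + CC"
    have C': "CA \<le> C'" "CB \<le> C'" "CC \<le> C'" "C' > 0" using CA(1) CB(1) CC(1) by (simp_all add: C'_def)
    have upA: "?dens a l \<le> C' * real l powi (int CARD('n) - h - 1) * real p powr (- (real l / ?d))" if "l > 0" HA for l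
    proof -
      have "?dens a l \<le> CA * real l powi (int CARD('n) - h - 1) * real p powr (- (real l / ?d))" using CA(2) that by blast
      also have "\<dots> \<le> C' * real l powi (int CARD('n) - h - 1) * real p powr (- (real l / ?d))"
        using C'(1) by (intro mult_right_mono) auto
      finally show ?thesis .
    qed
    have upB: "?dens a l \<le> C' * real l powi (int CARD('n) - h) * real p powr (- (real l / ?d))" if "l > 0" HB for l
    proof -
      have "?dens a l \<le> CB * real l powi (int CARD('n) - h) * real p powr (- (real l / ?d))" using CB(2) that by blast
      also have "\<dots> \<le> C' * real l powi (int CARD('n) - h) * real p powr (- (real l / ?d))"
        using C'(2) by (intro mult_right_mono) auto
      finally show ?thesis .
    qed
    have upC: "?dens a l \<le> C' * real p powr (- (real l / real ?s))" if "l > 0" HC for l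
    proof -
      have "?dens a l \<le> CC * real p powr (- (real l / real ?s))" using CC(2) that by blast
      also have "\<dots> \<le> C' * real p powr (- (real l / real ?s))"
        using C'(3) by (intro mult_right_mono) auto
      finally show ?thesis .
    qed
    show "\<exists>C C' :: real. C > 0 \<and> C' > 0 \<and> (\<forall>l::nat. l > 0 \<longrightarrow>
      (HA \<longrightarrow> C * real l powi (int CARD('n) - h - 1) * real p powr (- (real l / ?d)) \<le> ?dens a l \<and>
        ?dens a l \<le> C' * real l powi (int CARD('n) - h - 1) * real p powr (- (real l / ?d))) \<and>
      (HB \<longrightarrow> C * real l powi (int CARD('n) - h - 1) * real p powr (- (real l / ?d)) \<le> ?dens a l \<and>
        ?dens a l \<le> C' * real l powi (int CARD('n) - h) * real p powr (- (real l / ?d))) \<and>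
      (HC \<longrightarrow> C * real l powi (int CARD('n) - h - 1) * real p powr (- (real l / ?d)) \<le> ?dens a l \<and>
        ?dens a l \<le> C' * real p powr (- (real l / real ?s))))"
      by (rule exI[of _ C], rule exI[of _ C']) (intro conjI C(1) C'(4) allI impI lower upA upB upC)
  qed
qed

end
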